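(* If $\exists$Equality-OMv can be solved in time $O(n^{3-\varepsilon})$ for some $\varepsilon>0$, then Bounded Monotone Min-Plus-OMv can be solved in time $O(n^{3-\varepsilon/3}\log n)$ by a randomized algorithm that succeeds with probability at least $1-1/n$.
   Context: Both problems are online: an $n\times n$ matrix $M$ is given for preprocessing, then $n$ query column vectors $v_1,\dots,v_n$ arrive one at a time and the answer to query $j$ must be output before $v_{j+1}$ is received; running time counts preprocessing and all queries. $\exists$Equality-OMv: $M\in\mathbb{Z}^{n\times n}$, $v_j\in\mathbb{Z}^n$, output $u\in\{0,1\}^n$ with $u[i]=1$ iff $\exists k\in[n]$: $M[i,k]=v_j[k]$. Bounded Monotone Min-Plus-OMv: $M\in[n]^{n\times n}$, $v_j\in[n]^n$ (where $[n]=\{1,\dots,n\}$), output $u\in\mathbb{Z}^n$ with $u[i]=\min_{k\in[n]}(M[i,k]+v_j[k])$, under the guarantee that at least one of the following holds: (a) each row of $M$ is nondecreasing; (b) each column of $M$ is nondecreasing; (c) each $v_j$ is nondecreasing ($v_j[k]\le v_j[k+1]$); (d) for every $k$, $v_j[k]\le v_{j+1}[k]$ for all $j$. *)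

theory Defs
  imports
    "HOL-Probability.Probability_Mass_Function"
    "HOL-Library.Landau_Symbols"
    "Jordan_Normal_Form.Matrix"
begin

no_notation Finite_Cartesian_Product.vec_nth (infixl "$" 90)

section \<open>A randomised word RAM\<close>

text \<open>
  The machine model is the usual word RAM, with programs written in a structured language.
  A machine has integer registers and finitely many arrays (the ones named in the program), all
  initially zero. Words are integers \<open>x\<close> with \<open>\<bar>x\<bar> \<le> W\<close>; a computation producing any other
  value faults, and so does an access at a negative index. Every elementary command and every
  test takes one step; expressions have constant size, since a program is a fixed finite object
  that does not depend on the input.
\<close>

datatype binop = Add | Sub | Mul | Div | Mod | And | Or | Xor | Shl | Shr

datatype aexp =
    N int
  | R nat                  (* register *)
  | Rd nat aexp            (* array cell *)
  | Bin binop aexp aexp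

datatype bexp = Less aexp aexp | Equal aexp aexp | Neg bexp | Conj bexp bexp

datatype com =
    SKIP
  | Assign nat aexp
  | Store nat aexp aexp
  | Rand nat aexp          (* uniformly random element of {0..<m}, m the value of the expression *)
  | Seq com com
  | If bexp com com
  | While bexp com

record state =
  regs :: "nat \<Rightarrow> int"
  arrs :: "nat \<Rightarrow> nat \<Rightarrow> int"

fun binop_val :: "binop \<Rightarrow> int \<Rightarrow> int \<Rightarrow> int" where
  "binop_val Add x y = x + y"
| "binop_val Sub x y = x - y"
| "binop_val Mul x y = x * y"
| "binop_val Div x y = x div y"
| "binop_val Mod x y = x mod y"
| "binop_val And x y = Bit_Operations.and x y"
| "binop_val Or x y = Bit_Operations.or x y"
| "binop_val Xor x y = Bit_Operations.xor x y"
| "binop_val Shl x y = push_bit (nat y) x"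
| "binop_val Shr x y = drop_bit (nat y) x"

definition word :: "int \<Rightarrow> int \<Rightarrow> int option" where
  "word W x = (if \<bar>x\<bar> \<le> W then Some x else None)"

fun aval :: "int \<Rightarrow> state \<Rightarrow> aexp \<Rightarrow> int option" where
  "aval W s (N x) = word W x"
| "aval W s (R x) = word W (regs s x)"
| "aval W s (Rd a e) =
     (case aval W s e of None \<Rightarrow> None
      | Some i \<Rightarrow> if i < 0 then None else word W (arrs s a (nat i)))"
| "aval W s (Bin f e1 e2) =
     (case (aval W s e1, aval W s e2) of
        (Some x, Some y) \<Rightarrow> word W (binop_val f x y)
      | _ \<Rightarrow> None)"

fun bval :: "int \<Rightarrow> state \<Rightarrow> bexp \<Rightarrow> bool option" where
  "bval W s (Less e1 e2) =
     (case (aval W s e1, aval W s e2) of (Some x, Some y) \<Rightarrow> Some (x < y) | _ \<Rightarrow> None)"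
| "bval W s (Equal e1 e2) =
     (case (aval W s e1, aval W s e2) of (Some x, Some y) \<Rightarrow> Some (x = y) | _ \<Rightarrow> None)"
| "bval W s (Neg b) = map_option HOL.Not (bval W s b)"
| "bval W s (Conj b1 b2) =
     (case (bval W s b1, bval W s b2) of (Some p, Some q) \<Rightarrow> Some (p \<and> q) | _ \<Rightarrow> None)"

text \<open>
  One step on the command \<open>c\<close> with the commands \<open>cs\<close> still to be executed after it; the outcome
  \<open>None\<close> is a fault.
\<close>

fun step :: "int \<Rightarrow> com \<Rightarrow> com list \<Rightarrow> state \<Rightarrow> (com list \<times> state) option pmf" where
  "step W SKIP cs s = return_pmf (Some (cs, s))"
| "step W (Assign x e) cs s = return_pmf
     (case aval W s e of None \<Rightarrow> None
      | Some y \<Rightarrow> Some (cs, s\<lparr>regs := (regs s)(x := y)\<rparr>))"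
| "step W (Store a e1 e2) cs s = return_pmf
     (case (aval W s e1, aval W s e2) of
        (Some i, Some y) \<Rightarrow>
          if i < 0 then None
          else Some (cs, s\<lparr>arrs := (arrs s)(a := (arrs s a)(nat i := y))\<rparr>)
      | _ \<Rightarrow> None)"
| "step W (Rand x e) cs s =
     (case aval W s e of None \<Rightarrow> return_pmf None
      | Some m \<Rightarrow>
          if m \<le> 0 then return_pmf None
          else map_pmf (\<lambda>y. Some (cs, s\<lparr>regs := (regs s)(x := y)\<rparr>)) (pmf_of_set {0..<m}))"
| "step W (Seq c1 c2) cs s = return_pmf (Some (c1 # c2 # cs, s))"
| "step W (If b c1 c2) cs s = return_pmf
     (case bval W s b of None \<Rightarrow> None
      | Some p \<Rightarrow> Some ((if p then c1 else c2) # cs, s))"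
| "step W (While b c) cs s = return_pmf
     (case bval W s b of None \<Rightarrow> None
      | Some p \<Rightarrow> Some (if p then c # While b c # cs else cs, s))"

text \<open>
  Run with a budget of \<open>t\<close> steps: the outcome is the final state together with the unused part of
  the budget, or \<open>None\<close> if the machine faults or does not halt within the budget.
\<close>

fun exec :: "int \<Rightarrow> nat \<Rightarrow> com list \<Rightarrow> state \<Rightarrow> (state \<times> nat) option pmf" where
  "exec W t [] s = return_pmf (Some (s, t))"
| "exec W 0 (c # cs) s = return_pmf None"
| "exec W (Suc t) (c # cs) s = bind_pmf (step W c cs s)
     (\<lambda>r. case r of None \<Rightarrow> return_pmf None | Some (cs', s') \<Rightarrow> exec W t cs' s')"

fun deterministic :: "com \<Rightarrow> bool" where
  "deterministic (Rand x e) = False"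
| "deterministic (Seq c1 c2) = (deterministic c1 \<and> deterministic c2)"
| "deterministic (If b c1 c2) = (deterministic c1 \<and> deterministic c2)"
| "deterministic (While b c) = deterministic c"
| "deterministic _ = True"


section \<open>Online matrix-vector problems\<close>

text \<open>
  An online algorithm consists of a preprocessing program and a query program, sharing one memory.
  Before preprocessing, register 0 holds \<open>n\<close> and array 0 the matrix in row-major order. Then, for
  each query in turn, the query vector is placed in array 1, the query program is run, and the
  answer is taken from array 2; only after that is the next query vector supplied.
\<close>

record online_alg =
  prep :: com
  query :: com

definition init_state :: "nat \<Rightarrow> int mat \<Rightarrow> state" where
  "init_state n M =
     \<lparr>regs = (\<lambda>_. 0)(0 := int n),
      arrs = (\<lambda>_ _. 0)(0 := (\<lambda>p. if p < n * n then M $$ (p div n, p mod n) else 0))\<rparr>"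

definition put_query :: "nat \<Rightarrow> int vec \<Rightarrow> state \<Rightarrow> state" where
  "put_query n v s =
     s\<lparr>arrs := (arrs s)(1 := (\<lambda>p. if p < n then v $ p else arrs s 1 p))\<rparr>"

definition get_answer :: "nat \<Rightarrow> state \<Rightarrow> int vec" where
  "get_answer n s = vec n (arrs s 2)"

fun serve :: "int \<Rightarrow> com \<Rightarrow> nat \<Rightarrow> nat \<Rightarrow> state \<Rightarrow> int vec list \<Rightarrow> int vec list option pmf" where
  "serve W q n t s [] = return_pmf (Some [])"
| "serve W q n t s (v # vs) = bind_pmf (exec W t [q] (put_query n v s))
     (\<lambda>r. case r of None \<Rightarrow> return_pmf None
       | Some (s', t') \<Rightarrow> map_pmf (map_option ((#) (get_answer n s'))) (serve W q n t' s' vs))"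

text \<open>
  The answers given to the queries \<open>vs\<close>, or \<open>None\<close> if the machine faults or if preprocessing and
  all queries together take more than \<open>t\<close> steps.
\<close>

definition run_online ::
  "int \<Rightarrow> online_alg \<Rightarrow> nat \<Rightarrow> nat \<Rightarrow> int mat \<Rightarrow> int vec list \<Rightarrow> int vec list option pmf" where
  "run_online W A n t M vs = bind_pmf (exec W t [prep A] (init_state n M))
     (\<lambda>r. case r of None \<Rightarrow> return_pmf None
       | Some (s, t') \<Rightarrow> serve W (query A) n t' s vs)"

text \<open>
  The word length is \<open>\<Theta>(log N)\<close>, where \<open>N\<close> bounds \<open>n\<close> and the absolute values of all input numbers,
  so that each input number fits into a word.
\<close>

definition word_bound :: "nat \<Rightarrow> nat \<Rightarrow> int mat \<Rightarrow> int vec list \<Rightarrow> int" where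
  "word_bound c n M vs =
     (Max ({int n} \<union> {\<bar>M $$ (i, k)\<bar> | i k. i < n \<and> k < n}
                   \<union> {\<bar>vs ! j $ k\<bar> | j k. j < length vs \<and> k < n}) + 2) ^ c"

record online_problem =
  instances :: "nat \<Rightarrow> int mat \<Rightarrow> int vec list \<Rightarrow> bool"
  answer :: "nat \<Rightarrow> int mat \<Rightarrow> int vec \<Rightarrow> int vec"

definition solvable_in_time :: "online_problem \<Rightarrow> (nat \<Rightarrow> real) \<Rightarrow> bool" where
  "solvable_in_time P f \<longleftrightarrow>
     (\<exists>A c t. deterministic (prep A) \<and> deterministic (query A) \<and>
        (\<lambda>n. real (t n)) \<in> O(f) \<and>
        (\<forall>n>0. \<forall>M vs. instances P n M vs \<longrightarrow>
           run_online (word_bound c n M vs) A n (t n) M vs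
             = return_pmf (Some (map (answer P n M) vs))))"

text \<open>
  Monte Carlo algorithms: the time bound holds for all random choices, and all answers are correct
  with probability at least \<open>p n\<close>.
\<close>

definition solvable_in_time_with_prob ::
  "online_problem \<Rightarrow> (nat \<Rightarrow> real) \<Rightarrow> (nat \<Rightarrow> real) \<Rightarrow> bool" where
  "solvable_in_time_with_prob P f p \<longleftrightarrow>
     (\<exists>A c t. (\<lambda>n. real (t n)) \<in> O(f) \<and>
        (\<forall>n>0. \<forall>M vs. instances P n M vs \<longrightarrow>
           (let D = run_online (word_bound c n M vs) A n (t n) M vs
            in None \<notin> set_pmf D \<and>
               measure_pmf.prob D {Some (map (answer P n M) vs)} \<ge> p n)))"


section \<open>The two problems\<close>

text \<open>Rows, columns and queries are numbered from 0, so the index set \<open>[n]\<close> becomes \<open>{0..<n}\<close>.\<close>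

definition omv_instance :: "nat \<Rightarrow> int mat \<Rightarrow> int vec list \<Rightarrow> bool" where
  "omv_instance n M vs \<longleftrightarrow>
     M \<in> carrier_mat n n \<and> length vs = n \<and> set vs \<subseteq> carrier_vec n"

definition ex_equality_OMv :: online_problem where
  "ex_equality_OMv =
     \<lparr>instances = omv_instance,
      answer = (\<lambda>n M v. vec n (\<lambda>i. if \<exists>k<n. M $$ (i, k) = v $ k then 1 else 0))\<rparr>"

definition rows_nondecreasing :: "nat \<Rightarrow> int mat \<Rightarrow> bool" where
  "rows_nondecreasing n M \<longleftrightarrow> (\<forall>i<n. \<forall>k. k + 1 < n \<longrightarrow> M $$ (i, k) \<le> M $$ (i, k + 1))"

definition cols_nondecreasing :: "nat \<Rightarrow> int mat \<Rightarrow> bool" where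
  "cols_nondecreasing n M \<longleftrightarrow> (\<forall>k<n. \<forall>i. i + 1 < n \<longrightarrow> M $$ (i, k) \<le> M $$ (i + 1, k))"

definition queries_nondecreasing :: "nat \<Rightarrow> int vec list \<Rightarrow> bool" where
  "queries_nondecreasing n vs \<longleftrightarrow>
     (\<forall>j<n. \<forall>k. k + 1 < n \<longrightarrow> vs ! j $ k \<le> vs ! j $ (k + 1))"

definition queries_nondecreasing_in_time :: "nat \<Rightarrow> int vec list \<Rightarrow> bool" where
  "queries_nondecreasing_in_time n vs \<longleftrightarrow>
     (\<forall>k<n. \<forall>j. j + 1 < n \<longrightarrow> vs ! j $ k \<le> vs ! (j + 1) $ k)"

definition bounded_monotone_instance :: "nat \<Rightarrow> int mat \<Rightarrow> int vec list \<Rightarrow> bool" where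
  "bounded_monotone_instance n M vs \<longleftrightarrow>
     omv_instance n M vs \<and>
     (\<forall>i<n. \<forall>k<n. M $$ (i, k) \<in> {1..int n}) \<and>
     (\<forall>j<n. \<forall>k<n. vs ! j $ k \<in> {1..int n}) \<and>
     (rows_nondecreasing n M \<or> cols_nondecreasing n M \<or>
      queries_nondecreasing n vs \<or> queries_nondecreasing_in_time n vs)"

definition bounded_monotone_min_plus_OMv :: online_problem where
  "bounded_monotone_min_plus_OMv =
     \<lparr>instances = bounded_monotone_instance,
      answer = (\<lambda>n M v. vec n (\<lambda>i. Min {M $$ (i, k) + v $ k | k. k < n}))\<rparr>"

end

theory Submission
 imports Defs "HOL-Real_Asymp.Real_Asymp"
begin

text \<open>
  Pad the columns to a power of two \<open>N\<close> and fix a radius \<open>D\<close>. Call \<open>k\<close> near-optimal for row \<open>i\<close> and query \<open>v\<close> if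
  \<open>M[i,k] + v[k]\<close> exceeds the minimum \<open>u\<close> by at most \<open>2D\<close>. If more than \<open>N / D\<close> columns are near-optimal, then one of
  \<open>O(D log n)\<close> random columns \<open>c\<close> is, with high probability, and \<open>u = M[i,c] + v[c] - d\<close> for some \<open>d \<le> 2D\<close>. This is
  detected by the equality instance with matrix \<open>M[i,k] - M[i,c]\<close> and query \<open>v[c] - v[k] - d\<close>. Otherwise a capped
  branch and bound search over a binary tree of columns lists the near-optimal columns; its lower bounds are
  accurate up to \<open>D\<close> at all but \<open>O(N / D)\<close> nodes by monotonicity, or because they come from an outdated copy of the
  sums that is refreshed only when an entry has moved by more than \<open>D\<close>.

  The best radius depends on \<open>\<epsilon>\<close>, which the program cannot know: it starts from \<open>D\<close> near the cube root of \<open>n\<close> and halves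
  \<open>D\<close> whenever the simulated equality algorithms have used up their share of the time. Writing the answers
  takes time \<open>n\<^sup>2 - n\<close>, so \<open>\<epsilon> \<le> 1\<close> and the starting radius is large enough.
\<close>

section \<open>Big-step semantics with exact step counts\<close>

text \<open>With radius \<open>D\<close> there are about \<open>D^2 * log n\<close> copies (samples
  times offsets), each running for \<open>n^(3 - \<epsilon>)\<close> steps, while a search visits
  about \<open>(n / D) * log n\<close> nodes for each of the \<open>n^2\<close> pairs of row and
  query. The two costs balance at \<open>D = n^(\<epsilon>/3)\<close>, which gives the exponent
  \<open>3 - \<epsilon>/3\<close>; with \<open>\<epsilon> <= 1\<close> this radius is at most the
  cube root of \<open>n\<close>. Halving \<open>D\<close> in the middle of a run is harmless: the
  copies active at the smaller radius are among those already running, so none has to be restarted.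
  The obstacle is that neither the simulated phases nor the refreshes of outdated sums have a useful
  bound per query; only their totals are small. Both are therefore charged to potentials,
  \<open>pot\<close> and \<open>vpot\<close>, which never decrease during the run and are bounded at
  its end. All samples are drawn in preprocessing. For each fixed sample the rest is a deterministic
  run whose time bound does not depend on the sample; only the values of the answers do, through the
  single event \<open>good\<close>.\<close>

abbreviation setr :: "state => nat => int => state" where
 "setr s x v \<equiv> s\<lparr>regs := (regs s)(x := v)\<rparr>"

abbreviation seta :: "state => nat => nat => int => state" where
 "seta s a p v \<equiv> s\<lparr>arrs := (arrs s)(a := (arrs s a)(p := v))\<rparr>"

text \<open>There is no rule for \<open>Rand\<close> or for faults, so a derivation certifies a
  fault-free run without randomness. The count is exactly the number of \<open>exec\<close> steps,
  which lets runs be chained by subtracting from the budget.\<close>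

inductive bs :: "int => com => state => state => nat => bool" for W where
 bs_Skip: "bs W SKIP s s 1"
| bs_Assign: "aval W s e = Some y ==> bs W (Assign x e) s (setr s x y) 1"
| bs_Store: "aval W s e1 = Some i ==> aval W s e2 = Some y ==> 0 <= i ==>
  bs W (Store a e1 e2) s (seta s a (nat i) y) 1"
| bs_Seq: "bs W c1 s s1 t1 ==> bs W c2 s1 s2 t2 ==> bs W (Seq c1 c2) s s2 (Suc (t1+t2))"
| bs_IfT: "bval W s b = Some True ==> bs W c1 s s' t ==> bs W (If b c1 c2) s s' (Suc t)"
| bs_IfF: "bval W s b = Some False ==> bs W c2 s s' t ==> bs W (If b c1 c2) s s' (Suc t)"
| bs_WhileF: "bval W s b = Some False ==> bs W (While b c) s s 1"
| bs_WhileT: "bval W s b = Some True ==> bs W c s s1 t1 ==> bs W (While b c) s1 s2 t2 ==>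
  bs W (While b c) s s2 (Suc (t1+t2))"

lemma exec_bs: "bs W c s s' t ==> exec W (t+r) (c # cs) s = exec W r cs s'"
proof (induction arbitrary: r cs rule: bs.induct)
 case (bs_Seq c1 s s1 t1 c2 s2 t2)
 have "exec W (Suc (t1+t2)+r) (Seq c1 c2 # cs) s = exec W (t1+(t2+r)) (c1 # c2 # cs) s"
  by (simp add: bind_return_pmf add.assoc)
 then show ?case using bs_Seq.IH by simp
next
 case (bs_WhileT s b c s1 t1 s2 t2)
 have "exec W (Suc (t1+t2)+r) (While b c # cs) s = exec W (t1+(t2+r)) (c # While b c # cs) s"
  using bs_WhileT.hyps by (simp add: bind_return_pmf add.assoc)
 then show ?case using bs_WhileT.IH by simp
qed (simp_all add: bind_return_pmf)

lemma exec_bs_le: "bs W c s s' t ==> t <= T ==> exec W T (c # cs) s = exec W (T - t) cs s'"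
 using exec_bs[of W c s s' t "T - t" cs] by simp

text \<open>Induction on the budget rather than on the command: unfolding a loop makes the command
  list grow, but every step lowers the budget.\<close>

lemma bs_of_exec:
 assumes "deterministic c" "None \<notin> set_pmf (exec W T (c # cs) s)"
 shows "\<exists>s' t. bs W c s s' t & t <= T"
 using assms
proof (induction T arbitrary: c cs s rule: less_induct)
 case (less T)
 obtain T' where T: "T = Suc T'" using less.prems(2) by (cases T) auto
 have two: "\<exists>s2 t1 t2 s1. bs W c1 s s1 t1 & bs W c2 s1 s2 t2 & t1+t2 <= T'"
  if det: "deterministic c1" "deterministic c2"
   and ex: "None \<notin> set_pmf (exec W T' (c1 # c2 # cs) s)" for c1 c2
 proof -
  obtain s1 t1 where 1: "bs W c1 s s1 t1" "t1 <= T'"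
   using less.IH[of T' c1 "c2 # cs" s] det ex T by auto
  have "None \<notin> set_pmf (exec W (T' - t1) (c2 # cs) s1)"
   using ex exec_bs_le[OF 1] by simp
  then obtain s2 t2 where "bs W c2 s1 s2 t2" "t2 <= T' - t1"
   using less.IH[of "T' - t1" c2 cs s1] det T by (auto simp: less_Suc_eq_le)
  then show ?thesis using 1 by (metis add.commute le_diff_conv2)
 qed
 show ?case
 proof (cases c)
  case SKIP
  then show ?thesis using T bs_Skip by fastforce
 next
  case (Assign x e)
  then show ?thesis using T less.prems
   by (cases "aval W s e") (auto simp: bind_return_pmf intro!: exI bs_Assign)
 next
  case (Store a e1 e2)
  then show ?thesis using T less.prems
   by (cases "aval W s e1"; cases "aval W s e2")
    (auto simp: bind_return_pmf split: if_splits intro!: exI bs_Store)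
 next
  case (Rand x e)
  then show ?thesis using less.prems by simp
 next
  case (Seq c1 c2)
  then have "None \<notin> set_pmf (exec W T' (c1 # c2 # cs) s)"
   using less.prems T by (simp add: bind_return_pmf)
  from two[OF _ _ this] less.prems Seq obtain s2 t1 t2 s1 where
   "bs W c1 s s1 t1" "bs W c2 s1 s2 t2" "t1+t2 <= T'" by auto
  then show ?thesis using bs_Seq Seq T by (meson Suc_le_mono)
 next
  case (If b c1 c2)
  obtain p where p: "bval W s b = Some p"
   using If less.prems T by (cases "bval W s b") (auto simp: bind_return_pmf)
  have d: "deterministic (if p then c1 else c2)" using less.prems If by simp
  have "None \<notin> set_pmf (exec W T' ((if p then c1 else c2) # cs) s)"
   using If less.prems T p by (simp add: bind_return_pmf)
  from less.IH[OF _ d this] T obtain s' t where "bs W (if p then c1 else c2) s s' t" "t <= T'"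
   by auto
  then have "bs W c s s' (Suc t)" using If p by (cases p) (auto intro: bs_IfT bs_IfF)
  then show ?thesis using \<open>t <= T'\<close> T by (intro exI[of _ s'] exI[of _ "Suc t"]) simp
 next
  case (While b d)
  obtain p where p: "bval W s b = Some p"
   using While less.prems T by (cases "bval W s b") (auto simp: bind_return_pmf)
  show ?thesis
  proof (cases p)
   case False
   then show ?thesis using p While T bs_WhileF by fastforce
  next
   case True
   then have "None \<notin> set_pmf (exec W T' (d # While b d # cs) s)"
    using While less.prems p T by (simp add: bind_return_pmf)
   from two[OF _ _ this] less.prems While obtain s2 t1 t2 s1 where
    "bs W d s s1 t1" "bs W (While b d) s1 s2 t2" "t1+t2 <= T'" by auto
   then show ?thesis using bs_WhileT[of W s b d s1 t1 s2 t2] p True While T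
    by (auto intro!: exI[of _ s2] exI[of _ "Suc (t1+t2)"])
  qed
 qed
qed

section \<open>Execution traces of deterministic online runs\<close>

lemma serve_trace:
 assumes "deterministic q" "serve W q n T s vs = return_pmf (Some as)"
 shows "\<exists>st \<tau>. st 0 = s & length as = length vs &
  (\<forall>j<length vs. bs W q (put_query n (vs ! j) (st j)) (st (Suc j)) (\<tau> j) &
    get_answer n (st (Suc j)) = as ! j) & (\<Sum>j<length vs. \<tau> j) <= T"
 using assms(2)
proof (induction vs arbitrary: T s as)
 case Nil
 then show ?case by (auto simp: return_pmf_inj intro!: exI[of _ "%_. s"])
next
 case (Cons v vs)
 have N: "None \<notin> set_pmf (serve W q n T s (v # vs))" using Cons.prems by simp
 have "None \<notin> set_pmf (exec W T [q] (put_query n v s))"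
 proof
  assume "None \<in> set_pmf (exec W T [q] (put_query n v s))"
  then have "None \<in> set_pmf (serve W q n T s (v # vs))" by force
  then show False using N by simp
 qed
 then obtain s' t where b: "bs W q (put_query n v s) s' t" "t <= T"
  using bs_of_exec assms(1) by blast
 have sv: "map_pmf (map_option ((#) (get_answer n s'))) (serve W q n (T - t) s' vs)
   = return_pmf (Some as)"
  using Cons.prems exec_bs_le[OF b] by (simp add: bind_return_pmf)
 have *: "map_option ((#) (get_answer n s')) x = Some as"
  if "x \<in> set_pmf (serve W q n (T - t) s' vs)" for x
 proof -
  have "map_option ((#) (get_answer n s')) x \<in> set_pmf (return_pmf (Some as))"
   unfolding sv[symmetric] using that by simp
  then show ?thesis by simp
 qed
 obtain as' where as': "as = get_answer n s' # as'"
 proof -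
  obtain x where "x \<in> set_pmf (serve W q n (T - t) s' vs)"
   using set_pmf_not_empty[of "serve W q n (T - t) s' vs"] by blast
  from *[OF this] show ?thesis using that by (cases x) auto
 qed
 have "set_pmf (serve W q n (T - t) s' vs) \<subseteq> {Some as'}"
  using * as' by (auto dest!: *)
 then have "serve W q n (T - t) s' vs = return_pmf (Some as')"
  by (simp add: set_pmf_subset_singleton)
 from Cons.IH[OF this] obtain st \<tau> where I: "st 0 = s'" "length as' = length vs"
  "\<forall>j<length vs. bs W q (put_query n (vs ! j) (st j)) (st (Suc j)) (\<tau> j) &
    get_answer n (st (Suc j)) = as' ! j" "(\<Sum>j<length vs. \<tau> j) <= T - t" by blast
 have "(\<Sum>j<length (v # vs). case_nat t \<tau> j) = t+(\<Sum>j<length vs. \<tau> j)"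
  by (simp only: length_Cons sum.lessThan_Suc_shift) simp
 then show ?case
  using I b as' by (intro exI[of _ "case_nat s st"] exI[of _ "case_nat t \<tau>"])
   (auto simp: less_Suc_eq_0_disj)
qed

text \<open>Intermediate states and step counts are exposed because the simulation advances many
  copies of the algorithm in lockstep, one phase at a time, and must know what each phase
  does.\<close>

lemma run_online_trace:
 assumes "deterministic (prep A)" "deterministic (query A)"
  and run: "run_online W A n T M vs = return_pmf (Some as)"
 shows "\<exists>st \<tau> \<tau>0. bs W (prep A) (init_state n M) (st 0) \<tau>0 & length as = length vs &
  (\<forall>j<length vs. bs W (query A) (put_query n (vs ! j) (st j)) (st (Suc j)) (\<tau> j) &
    get_answer n (st (Suc j)) = as ! j) & \<tau>0+(\<Sum>j<length vs. \<tau> j) <= T"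
proof -
 have "None \<notin> set_pmf (exec W T [prep A] (init_state n M))"
 proof
  assume "None \<in> set_pmf (exec W T [prep A] (init_state n M))"
  then have "None \<in> set_pmf (run_online W A n T M vs)" unfolding run_online_def by force
  then show False using run by simp
 qed
 then obtain s t where b: "bs W (prep A) (init_state n M) s t" "t <= T"
  using bs_of_exec assms(1) by blast
 have "serve W (query A) n (T - t) s vs = return_pmf (Some as)"
  using run exec_bs_le[OF b] by (simp add: run_online_def bind_return_pmf)
 from serve_trace[OF assms(2) this] obtain st \<tau> where I: "st 0 = s" "length as = length vs"
  "\<forall>j<length vs. bs W (query A) (put_query n (vs ! j) (st j)) (st (Suc j)) (\<tau> j) &
    get_answer n (st (Suc j)) = as ! j" "(\<Sum>j<length vs. \<tau> j) <= T - t" by blast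
 have "t+(\<Sum>j<length vs. \<tau> j) <= T" using I(4) b(2) by simp
 then show ?thesis using I b by blast
qed

text \<open>Each elementary step writes at most one cell. This is how a required change of output
  turns into a lower bound on time.\<close>

lemma card_changed_cells:
 "bs W c s s' t ==>
   finite {p. arrs s' a p \<noteq> arrs s a p} & card {p. arrs s' a p \<noteq> arrs s a p} <= t"
proof (induction rule: bs.induct)
 have comp: "finite {p. arrs s2 a p \<noteq> arrs s a p} &
   card {p. arrs s2 a p \<noteq> arrs s a p} <= t1+t2"
  if "finite {p. arrs s1 a p \<noteq> arrs s a p} & card {p. arrs s1 a p \<noteq> arrs s a p} <= t1"
   "finite {p. arrs s2 a p \<noteq> arrs s1 a p} & card {p. arrs s2 a p \<noteq> arrs s1 a p} <= t2"
  for s s1 s2 t1 t2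
 proof -
  have sub: "{p. arrs s2 a p \<noteq> arrs s a p} \<subseteq>
    {p. arrs s1 a p \<noteq> arrs s a p} \<union> {p. arrs s2 a p \<noteq> arrs s1 a p}" by auto
  have "card {p. arrs s2 a p \<noteq> arrs s a p} <=
    card {p. arrs s1 a p \<noteq> arrs s a p} + card {p. arrs s2 a p \<noteq> arrs s1 a p}"
   using sub that by (meson card_Un_le card_mono finite_UnI le_trans)
  then show ?thesis using that sub finite_subset by fastforce
 qed
 {
  case (bs_Seq c1 s s1 t1 c2 s2 t2)
  then show ?case using comp[of s1 s t1 s2 t2] by auto
 next
  case (bs_WhileT s b c s1 t1 s2 t2)
  then show ?case using comp[of s1 s t1 s2 t2] by auto
 next
  case (bs_Store s e1 i e2 y b)
  have "{p. arrs (seta s b (nat i) y) a p \<noteq> arrs s a p} \<subseteq> {nat i}"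
   by (auto split: if_splits)
  from finite_subset[OF this] card_mono[OF _ this] show ?case by simp
 }
qed auto

section \<open>Total-correctness triples for bounded states\<close>

fun av :: "state => aexp => int" where
 "av s (N x) = x"
| "av s (R x) = regs s x"
| "av s (Rd a e) = arrs s a (nat (av s e))"
| "av s (Bin f e1 e2) = binop_val f (av s e1) (av s e2)"

text \<open>Exponent of a size bound: over stored values of size at most \<open>B >= 2\<close>, an
  expression has size at most \<open>B ^ leaves e\<close>. A read contributes only the leaves of its
  index, since the value read is a stored value again.\<close>

fun leaves :: "aexp => nat" where
 "leaves (N x) = 1"
| "leaves (R x) = 1"
| "leaves (Rd a e) = leaves e"
| "leaves (Bin f e1 e2) = leaves e1+leaves e2"

fun aok :: "int => state => aexp => bool" where
 "aok B s (N x) = (\<bar>x\<bar> <= B)"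
| "aok B s (R x) = True"
| "aok B s (Rd a e) = (aok B s e & 0 <= av s e)"
| "aok B s (Bin f e1 e2) = ((f \<in> {Add, Sub, Mul} \<or> f \<in> {Div, Mod} & 0 < av s e2) & aok B s e1 & aok B s e2)"

fun bv :: "state => bexp => bool" where
 "bv s (Less e1 e2) = (av s e1 < av s e2)"
| "bv s (Equal e1 e2) = (av s e1 = av s e2)"
| "bv s (Neg b) = (\<not> bv s b)"
| "bv s (Conj b1 b2) = (bv s b1 & bv s b2)"

fun bok :: "int => state => bexp => bool" where
 "bok B s (Less e1 e2) = (aok B s e1 & aok B s e2 & leaves e1 <= 16 & leaves e2 <= 16)"
| "bok B s (Equal e1 e2) = (aok B s e1 & aok B s e2 & leaves e1 <= 16 & leaves e2 <= 16)"
| "bok B s (Neg b) = bok B s b"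
| "bok B s (Conj b1 b2) = (bok B s b1 & bok B s b2)"

definition bnd :: "int => state => bool" where
 "bnd B s \<longleftrightarrow> (\<forall>r. \<bar>regs s r\<bar> <= B) & (\<forall>a p. \<bar>arrs s a p\<bar> <= B)"

lemma bnd_regs: "bnd B s ==> \<bar>regs s r\<bar> <= B"
 and bnd_arrs: "bnd B s ==> \<bar>arrs s a p\<bar> <= B"
 by (auto simp: bnd_def)

lemma bnd_assign: "bnd B s ==> \<bar>y\<bar> <= B ==> bnd B (setr s x y)"
 by (auto simp: bnd_def)

lemma bnd_store: "bnd B s ==> \<bar>y\<bar> <= B ==> bnd B (seta s a p y)"
 by (auto simp: bnd_def)

lemma leaves_pos: "1 <= leaves e"
 by (induction e) auto

text \<open>Expand \<open>1 <= (B^a - 1) * (B^b - 1)\<close>. It makes sums obey the same size bound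
  as products.\<close>

lemma power_add_bound:
 fixes B :: int
 assumes "2 <= B" "1 <= a" "1 <= b"
 shows "B^a+B^b <= B^(a+b)"
proof -
 have "B^1 <= B^a" by (rule power_increasing) (use assms in auto)
 moreover have "B^1 <= B^b" by (rule power_increasing) (use assms in auto)
 ultimately have *: "1 <= B^a - 1" "1 <= B^b - 1" using assms by auto
 have "1*1 <= (B^a - 1)*(B^b - 1)" using * by (intro mult_mono) auto
 then show ?thesis unfolding power_add by (simp add: left_diff_distrib right_diff_distrib)
qed

lemma abs_div_le: "0 < y ==> \<bar>x div y\<bar> <= \<bar>x :: int\<bar>"
 using zdiv_mono2[of x 1 y] zdiv_mono2_neg[of x 1 y] pos_imp_zdiv_nonneg_iff[of y x]
 by (cases "0 <= x") auto

lemma abs_mod_le: "0 < y ==> \<bar>x mod y\<bar> <= \<bar>x\<bar> + \<bar>y :: int\<bar>"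
 using pos_mod_bound[of y x] pos_mod_sign[of y x] by linarith

lemma aval_bnd:
 assumes "bnd B s" "2 <= B"
 shows "aok B s e ==> B^leaves e <= W ==>
  aval W s e = Some (av s e) & \<bar>av s e\<bar> <= B^leaves e"
proof (induction e)
 case (Rd a e)
 have "B^1 <= B^leaves e" using leaves_pos[of e] assms by (intro power_increasing) auto
 then show ?case using Rd bnd_arrs[OF assms(1), of a "nat (av s e)"] by (auto simp: word_def)
next
 case (Bin f e1 e2)
 let ?b1 = "B^leaves e1" and ?b2 = "B^leaves e2"
 have sum: "?b1+?b2 <= B^(leaves e1+leaves e2)"
  using power_add_bound assms leaves_pos by blast
 have pos: "1 <= ?b1" "1 <= ?b2" using assms by auto
 have IH: "aval W s e1 = Some (av s e1)" "\<bar>av s e1\<bar> <= ?b1"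
  "aval W s e2 = Some (av s e2)" "\<bar>av s e2\<bar> <= ?b2"
  using Bin sum pos by auto
 have "\<bar>binop_val f (av s e1) (av s e2)\<bar> <= B^(leaves e1+leaves e2)"
 proof -
  have mul: "\<bar>av s e1*av s e2\<bar> <= B^(leaves e1+leaves e2)"
   unfolding power_add abs_mult using IH pos by (intro mult_mono) auto
  from Bin.prems consider "f = Add \<or> f = Sub" | "f = Mul" | "f = Div" "0 < av s e2"
   | "f = Mod" "0 < av s e2" by auto
  then show ?thesis
  proof cases
   case 1
   then have "\<bar>binop_val f (av s e1) (av s e2)\<bar> <= \<bar>av s e1\<bar> + \<bar>av s e2\<bar>" by auto
   then show ?thesis using IH sum by linarith
  next
   case 2
   then show ?thesis using mul by simp
  next
   case 3
   then show ?thesis using IH sum pos abs_div_le[OF 3(2), of "av s e1"] by simp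
  next
   case 4
   then show ?thesis using IH sum abs_mod_le[OF 4(2), of "av s e1"] by simp
  qed
 qed
 then show ?case using IH Bin.prems by (simp add: word_def)
next
 case (R x)
 then show ?case using bnd_regs[OF assms(1), of x] by (simp add: word_def)
qed (use assms in \<open>auto simp: word_def\<close>)

lemma bval_bnd:
 assumes "bnd B s" "2 <= B" "B^16 <= W"
 shows "bok B s b ==> bval W s b = Some (bv s b)"
proof (induction b)
 have "aval W s e = Some (av s e)" if "aok B s e" "leaves e <= 16" for e
 proof -
  have "B^leaves e <= B^16" using that assms by (intro power_increasing) auto
  then show ?thesis using aval_bnd[OF assms(1,2) that(1)] assms(3) by simp
 qed
 note * = this
 {
  case (Less e1 e2)
  then show ?case using * by simp
 next
  case (Equal e1 e2)
  then show ?case using * by simp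
 }
qed auto

definition same :: "nat set => nat set => state => state => bool" where
 "same X Y s s' \<longleftrightarrow> (\<forall>r. r \<notin> X --> regs s' r = regs s r) & (\<forall>a. a \<notin> Y --> arrs s' a = arrs s a)"

lemma same_refl [simp]: "same X Y s s" by (simp add: same_def)

lemma same_trans: "same X Y s s1 ==> same X' Y' s1 s2 ==> X' \<subseteq> X ==> Y' \<subseteq> Y ==> same X Y s s2"
 by (auto simp: same_def)

lemma same_mono: "same X Y s s1 ==> X \<subseteq> X' ==> Y \<subseteq> Y' ==> same X' Y' s s1"
 by (auto simp: same_def)

lemma same_assign [simp]: "x \<in> X ==> same X Y s (setr s' x y) = same X Y s s'"
 by (auto simp: same_def)

lemma same_store [simp]: "a \<in> Y ==> same X Y s (s'\<lparr>arrs := (arrs s')(a := f)\<rparr>) = same X Y s s'"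
 by (auto simp: same_def)

lemma same_regs: "same X Y s s' ==> r \<notin> X ==> regs s' r = regs s r"
 and same_arrs: "same X Y s s' ==> a \<notin> Y ==> arrs s' a = arrs s a"
 by (auto simp: same_def)

fun wregs :: "com => nat set" where
 "wregs (Assign x e) = {x}"
| "wregs (Rand x e) = {x}"
| "wregs (Seq c1 c2) = wregs c1 \<union> wregs c2"
| "wregs (If b c1 c2) = wregs c1 \<union> wregs c2"
| "wregs (While b c) = wregs c"
| "wregs _ = {}"

fun warrs :: "com => nat set" where
 "warrs (Store a e1 e2) = {a}"
| "warrs (Seq c1 c2) = warrs c1 \<union> warrs c2"
| "warrs (If b c1 c2) = warrs c1 \<union> warrs c2"
| "warrs (While b c) = warrs c"
| "warrs _ = {}"

lemma bs_same: "bs W c s s' t ==> same (wregs c) (warrs c) s s'"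
proof (induction rule: bs.induct)
 case (bs_Seq c1 s s1 t1 c2 s2 t2)
 then show ?case by (auto simp: same_def)
next
 case (bs_WhileT s b c s1 t1 s2 t2)
 then show ?case by (auto simp: same_def)
qed (simp_all add: same_def)

text \<open>Stored values are kept within \<open>B\<close>, while intermediate values of an
  expression may grow up to the word bound \<open>W\<close>; the exponent 16 is the number of leaves
  allowed per expression.\<close>

locale mach =
 fixes W B :: int
 assumes B2: "2 <= B" and BW: "B^16 <= W"
begin

text \<open>A triple for a single start state. The size bound is assumed before and guaranteed
  after, so each rule checks only the values newly written; \<open>Q\<close> sees the step count as
  well, so correctness and time are proved together.\<close>

definition T :: "com => state => (state => nat => bool) => bool" where
 "T c s Q \<longleftrightarrow> (bnd B s --> (\<exists>s' t. bs W c s s' t & bnd B s' & Q s' t))"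

lemma T_bnd: "(bnd B s ==> T c s Q) ==> T c s Q"
 by (auto simp: T_def)

text \<open>Besides weakening, this hands over the size bound and the frame given by the syntactic
  write sets, so specifications need not list the memory they leave alone.\<close>

lemma T_conseq: "T c s Q ==>
  (\<And>s' t. Q s' t ==> same (wregs c) (warrs c) s s' ==> bnd B s' ==> Q' s' t) ==> T c s Q'"
 unfolding T_def using bs_same by blast

lemma T_Skip: "Q s 1 ==> T SKIP s Q"
 unfolding T_def using bs_Skip by blast

lemma leaves16: "leaves e <= 16 ==> B^leaves e <= W"
 using power_increasing[of "leaves e" 16 B] B2 BW by linarith

lemma T_Assign:
 assumes "aok B s e" "leaves e <= 16" "\<bar>av s e\<bar> <= B" "Q (setr s x (av s e)) 1"
 shows "T (Assign x e) s Q"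
proof -
 have "bnd B s ==> aval W s e = Some (av s e)"
  using aval_bnd[OF _ B2 assms(1)] leaves16[OF assms(2)] by blast
 then show ?thesis unfolding T_def using bs_Assign bnd_assign assms(3,4) by blast
qed

lemma T_Store:
 assumes "aok B s e1" "leaves e1 <= 16" "0 <= av s e1" "aok B s e2" "leaves e2 <= 16" "\<bar>av s e2\<bar> <= B"
  "Q (seta s a (nat (av s e1)) (av s e2)) 1"
 shows "T (Store a e1 e2) s Q"
proof -
 have "bnd B s ==> aval W s e1 = Some (av s e1)" "bnd B s ==> aval W s e2 = Some (av s e2)"
  using aval_bnd[OF _ B2 assms(1)] leaves16[OF assms(2)] aval_bnd[OF _ B2 assms(4)]
   leaves16[OF assms(5)] by blast+
 then show ?thesis unfolding T_def using bs_Store bnd_store assms(3,6,7) by blast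
qed

lemma T_Seq: "T c1 s (%s1 t1. T c2 s1 (%s2 t2. Q s2 (Suc (t1+t2)))) ==> T (Seq c1 c2) s Q"
 unfolding T_def using bs_Seq by blast

lemma T_AssignV: "av s e = v ==> aok B s e ==> leaves e <= 16 ==> \<bar>v\<bar> <= B ==>
  Q (setr s x v) 1 ==> T (Assign x e) s Q"
 by (rule T_Assign) auto

lemma T_AssignS: "av s e = v ==> aok B s e ==> leaves e <= 16 ==> \<bar>v\<bar> <= B ==>
  T c (setr s x v) (%s' t. Q s' (Suc (Suc t))) ==> T (Seq (Assign x e) c) s Q"
 by (rule T_Seq, rule T_Assign) auto

lemma T_StoreV: "av s e1 = int p ==> av s e2 = v ==> aok B s e1 ==> leaves e1 <= 16 ==>
  aok B s e2 ==> leaves e2 <= 16 ==> \<bar>v\<bar> <= B ==>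
  Q (seta s a p v) 1 ==> T (Store a e1 e2) s Q"
 by (rule T_Store) auto

lemma T_StoreS: "av s e1 = int p ==> av s e2 = v ==> aok B s e1 ==> leaves e1 <= 16 ==>
  aok B s e2 ==> leaves e2 <= 16 ==> \<bar>v\<bar> <= B ==>
  T c (seta s a p v) (%s' t. Q s' (Suc (Suc t))) ==>
  T (Seq (Store a e1 e2) c) s Q"
 by (rule T_Seq, rule T_Store) auto

lemma T_If:
 assumes "bok B s b" "bv s b ==> T c1 s (%s' t. Q s' (Suc t))" "\<not> bv s b ==> T c2 s (%s' t. Q s' (Suc t))"
 shows "T (If b c1 c2) s Q"
proof (rule T_bnd)
 assume "bnd B s"
 then have b: "bval W s b = Some (bv s b)" using bval_bnd[OF _ B2 BW assms(1)] by blast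
 show ?thesis
 proof (cases "bv s b")
  case True
  then show ?thesis using assms(2) bs_IfT b unfolding T_def by metis
 next
  case False
  then show ?thesis using assms(3) bs_IfF b unfolding T_def by metis
 qed
qed

text \<open>The invariant includes the number \<open>kp\<close> of steps spent so far. This permits
  amortised bounds, where cheap iterations pay for expensive ones; termination has its own
  measure.\<close>

lemma T_While:
 fixes \<mu> :: "state => nat"
 assumes init: "I s 0"
  and bok: "\<And>s kp. I s kp ==> bnd B s ==> bok B s b"
  and body: "\<And>s kp. I s kp ==> bnd B s ==> bv s b ==> T c s (%s' t. I s' (Suc (kp + t)) & \<mu> s' < \<mu> s)"
  and fin: "\<And>s kp. I s kp ==> bnd B s ==> \<not> bv s b ==> Q s (Suc kp)"
 shows "T (While b c) s Q"
proof -
 have "\<exists>s' t. bs W (While b c) s s' t & bnd B s' & Q s' (kp + t)" if "I s kp" "bnd B s" for s kp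
  using that
 proof (induction "\<mu> s" arbitrary: s kp rule: less_induct)
  case less
  have b: "bval W s b = Some (bv s b)" using bval_bnd[OF less.prems(2) B2 BW bok] less.prems by blast
  show ?case
  proof (cases "bv s b")
   case True
   then obtain s1 t1 where 1: "bs W c s s1 t1" "bnd B s1" "I s1 (Suc (kp + t1))" "\<mu> s1 < \<mu> s"
    using body less.prems unfolding T_def by blast
   then obtain s' t where "bs W (While b c) s1 s' t" "bnd B s'" "Q s' (Suc (kp + t1)+t)"
    using less.hyps by blast
   moreover from this(1) have "bs W (While b c) s s' (Suc (t1+t))"
    using bs_WhileT[OF _ 1(1)] b True by simp
   ultimately show ?thesis by (intro exI[of _ s'] exI[of _ "Suc (t1+t)"]) (auto simp: add_ac)
  next
   case False
   then show ?thesis using b fin[OF less.prems] less.prems(2)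
    by (intro exI[of _ s] exI[of _ 1]) (auto intro: bs_WhileF[simplified])
  qed
 qed
 from this[OF init] show ?thesis unfolding T_def by simp
qed

end

abbreviation plus_e (infixl "\<boxplus>" 65) where "e1\<boxplus>e2 \<equiv> Bin Add e1 e2"
abbreviation minus_e (infixl "\<boxminus>" 65) where "e1\<boxminus>e2 \<equiv> Bin Sub e1 e2"
abbreviation mult_e (infixl "\<boxtimes>" 70) where "e1\<boxtimes>e2 \<equiv> Bin Mul e1 e2"
abbreviation seq_c (infixr ";;" 60) where "c1 ;; c2 \<equiv> Seq c1 c2"

definition for_loop :: "nat => aexp => com => com" where
 "for_loop x e c = Assign x (N 0) ;; While (Less (R x) e) (c ;; Assign x (R x\<boxplus>N 1))"

lemma wregs_for [simp]: "wregs (for_loop x e c) = insert x (wregs c)"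
 and warrs_for [simp]: "warrs (for_loop x e c) = warrs c"
 by (auto simp: for_loop_def)

context mach
begin

text \<open>An iteration costs three steps besides its body (test, sequencing, increment);
  initialisation and the final test cost three more. The bound \<open>e\<close> is evaluated anew at
  each test, hence the condition on all states of the invariant.\<close>

lemma T_for:
 assumes x: "x \<notin> wregs c" and e: "leaves e <= 16"
  and mB: "int m <= B"
  and ub: "\<And>i s kp. i <= m ==> I i s kp ==> regs s x = int i ==> bnd B s ==> aok B s e & av s e = int m"
  and init: "I 0 (setr s x 0) 0"
  and step: "\<And>i s kp. i < m ==> I i s kp ==> regs s x = int i ==> bnd B s ==>
    T c s (%s' t. I (Suc i) (setr s' x (int (Suc i))) (kp + t+3))"
  and fin: "\<And>s kp. I m s kp ==> regs s x = int m ==> bnd B s ==> Q s (kp + 3)"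
 shows "T (for_loop x e c) s Q"
 unfolding for_loop_def
proof (intro T_Seq T_Assign)
 show "\<bar>av s (N 0)\<bar> <= B" "aok B s (N 0)" using B2 by auto
 let ?J = "%s kp. \<exists>i\<le>m. I i s kp & regs s x = int i"
 show "T (While (Less (R x) e) (c ;; Assign x (R x\<boxplus>N 1))) (setr s x (av s (N 0)))
   (%s2 t2. Q s2 (Suc (1+t2)))"
 proof (rule T_While[where I = ?J and \<mu> = "%s. m - nat (regs s x)"])
  show "?J (setr s x (av s (N 0))) 0"
   using init by (intro exI[of _ 0]) simp
 next
  fix s kp assume "?J s kp" "bnd B s"
  then show "bok B s (Less (R x) e)" using ub e by auto
 next
  fix s kp assume J: "?J s kp" and b: "bnd B s" and "bv s (Less (R x) e)"
  then obtain i where "i <= m" and i': "I i s kp" "regs s x = int i" and "int i < av s e" by auto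
  moreover have "av s e = int m" using ub[of i s kp] calculation b by simp
  ultimately have i: "i < m" "I i s kp" "regs s x = int i" by auto
  show "T (c ;; Assign x (R x\<boxplus>N 1)) s (%s' t. ?J s' (Suc (kp + t)) &
      m - nat (regs s' x) < m - nat (regs s x))"
  proof (rule T_Seq, rule T_conseq[OF step[OF i b]])
   fix s' t
   assume I: "I (Suc i) (setr s' x (int (Suc i))) (kp + t+3)"
    and sm: "same (wregs c) (warrs c) s s'"
   have r: "regs s' x = int i" using same_regs[OF sm x] i by simp
   have k: "kp + t+3 = Suc (kp + Suc (t+1))" by simp
   show "T (Assign x (R x\<boxplus>N 1)) s' (%s2 t2. ?J s2 (Suc (kp + Suc (t+t2))) &
      m - nat (regs s2 x) < m - nat (regs s x))"
    using r i mB B2 I k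
    by (intro T_Assign) (auto intro!: exI[of _ "Suc i"] simp: add.commute nat_add_distrib)
  qed
 next
  fix s kp assume J: "?J s kp" and b: "bnd B s" and "\<not> bv s (Less (R x) e)"
  then obtain i where i: "i <= m" "I i s kp" "regs s x = int i" "\<not> int i < av s e" by auto
  moreover have "av s e = int m" using ub[of i s kp] i b by simp
  ultimately have "Q s (kp + 3)" using fin[of s kp] b by simp
  then show "Q s (Suc (1+Suc kp))" by (simp add: eval_nat_numeral)
 qed
qed (auto simp: B2)

lemma T_for_const:
 assumes x: "x \<notin> wregs c" and e: "leaves e <= 16"
  and mB: "int m <= B"
  and ub: "\<And>i s. i <= m ==> I i s ==> regs s x = int i ==> bnd B s ==> aok B s e & av s e = int m"
  and init: "I 0 (setr s x 0)"
  and step: "\<And>i s. i < m ==> I i s ==> regs s x = int i ==> bnd B s ==>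
    T c s (%s' t. t <= K & I (Suc i) (setr s' x (int (Suc i))))"
  and fin: "\<And>s kp. I m s ==> regs s x = int m ==> bnd B s ==> kp <= m*(K+3)+3 ==> Q s kp"
 shows "T (for_loop x e c) s Q"
proof (rule T_for[where I = "%i s kp. I i s & kp <= i*(K+3)", OF x e mB])
 fix i s kp assume "i < m" "I i s & kp <= i*(K+3)" "regs s x = int i" "bnd B s"
 then have "T c s (%s' t. t <= K & I (Suc i) (setr s' x (int (Suc i))))"
  and k: "kp <= i*(K+3)" using step by blast+
 then show "T c s (%s' t. I (Suc i) (setr s' x (int (Suc i))) &
   kp + t+3 <= Suc i*(K+3))"
  by (elim T_conseq) simp
next
 fix s kp assume "I m s & kp <= m*(K+3)" "regs s x = int m" "bnd B s"
 then show "Q s (kp + 3)" using fin by simp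
next
 fix i s kp assume "i <= m" "I i s & kp <= i*(K+3)" "regs s x = int i" "bnd B s"
 then show "aok B s e & av s e = int m" using ub by blast
qed (use init in simp)

end

section \<open>Simulating many copies of a program in interleaved memory\<close>

text \<open>
 Copy \<open>i\<close> of \<open>K\<close> copies keeps its register \<open>x\<close> in cell \<open>x * K + i\<close> of array 12 and cell \<open>p\<close> of its
 array \<open>a\<close> in cell \<open>p * K + i\<close> of array \<open>a + 13\<close>; register 5 holds \<open>K\<close>, register 6 holds \<open>i\<close>, and
 register 4 counts the simulated steps.
\<close>

definition view :: "nat => nat => state => state" where
 "view K i s = \<lparr>regs = (%x. arrs s 12 (x*K+i)), arrs = (%a p. arrs s (a+13) (p*K+i))\<rparr>"

fun cexp :: "aexp => aexp" where
 "cexp (N x) = N x"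
| "cexp (R x) = Rd 12 (N (int x)\<boxtimes>R 5\<boxplus>R 6)"
| "cexp (Rd a e) = Rd (a+13) (cexp e\<boxtimes>R 5\<boxplus>R 6)"
| "cexp (Bin f e1 e2) = Bin f (cexp e1) (cexp e2)"

fun cbexp :: "bexp => bexp" where
 "cbexp (Less e1 e2) = Less (cexp e1) (cexp e2)"
| "cbexp (Equal e1 e2) = Equal (cexp e1) (cexp e2)"
| "cbexp (Neg b) = Neg (cbexp b)"
| "cbexp (Conj b1 b2) = Conj (cbexp b1) (cbexp b2)"

abbreviation tick :: com where "tick \<equiv> Assign 4 (R 4\<boxplus>N 1)"

text \<open>Every simulated step has its \<open>tick\<close>. A loop makes one test more than it has
  iterations: the first test is counted before the compiled loop and each later one at the end of
  the body. \<open>Rand\<close> is mapped to \<open>SKIP\<close> as only deterministic commands are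
  simulated.\<close>

fun ccom :: "com => com" where
 "ccom SKIP = tick ;; SKIP"
| "ccom (Assign x e) = tick ;; Store 12 (N (int x)\<boxtimes>R 5\<boxplus>R 6) (cexp e)"
| "ccom (Store a e1 e2) = tick ;; Store (a+13) (cexp e1\<boxtimes>R 5\<boxplus>R 6) (cexp e2)"
| "ccom (Rand x e) = SKIP"
| "ccom (Seq c1 c2) = tick ;; (ccom c1 ;; ccom c2)"
| "ccom (If b c1 c2) = tick ;; If (cbexp b) (ccom c1) (ccom c2)"
| "ccom (While b c) = tick ;; While (cbexp b) (ccom c ;; tick)"

text \<open>A sum, hence a crude upper bound on each register number that occurs. Compilation turns
  register numbers into numeric constants, which must fit into \<open>B\<close>.\<close>

fun amax :: "aexp => nat" where
 "amax (N x) = 0"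
| "amax (R x) = x"
| "amax (Rd a e) = amax e"
| "amax (Bin f e1 e2) = (amax e1)+(amax e2)"

fun bmax :: "bexp => nat" where
 "bmax (Less e1 e2) = (amax e1)+(amax e2)"
| "bmax (Equal e1 e2) = (amax e1)+(amax e2)"
| "bmax (Neg b) = bmax b"
| "bmax (Conj b1 b2) = (bmax b1)+(bmax b2)"

fun cmax :: "com => nat" where
 "cmax SKIP = 0"
| "cmax (Assign x e) = x+(amax e)"
| "cmax (Store a e1 e2) = (amax e1)+(amax e2)"
| "cmax (Rand x e) = 0"
| "cmax (Seq c1 c2) = (cmax c1)+(cmax c2)"
| "cmax (If b c1 c2) = bmax b + cmax c1 + cmax c2"
| "cmax (While b c) = (bmax b)+(cmax c)"

lemma wregs_ccom: "wregs (ccom c) \<subseteq> {4}"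
 by (induction c) auto

lemma warrs_ccom: "warrs (ccom c) \<subseteq> {12..}"
 by (induction c) auto

lemma interleave_inj:
 fixes K :: nat
 assumes "i < K" "i' < K"
 shows "(x*K+i = y*K+i') = (x = y & i = i')"
proof
 assume eq: "x*K+i = y*K+i'"
 have "(x*K+i) div K = x" "(y*K+i') div K = y" using assms by auto
 then have "x = y" using eq by simp
 then show "x = y & i = i'" using eq by simp
qed simp

lemma aval_le: "aval W s e = Some x ==> \<bar>x\<bar> <= W"
 by (cases e) (auto simp: word_def split: option.splits if_splits)

context mach
begin

lemma index_bound: "\<bar>x\<bar> <= B ==> \<bar>y\<bar> <= B ==> \<bar>z\<bar> <= B ==> \<bar>x*y\<bar> <= W & \<bar>x*y+z\<bar> <= W & B <= W"
proof -
 assume a: "\<bar>x\<bar> <= B" "\<bar>y\<bar> <= B" "\<bar>z\<bar> <= B"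
 have "\<bar>x*y\<bar> <= B*B" unfolding abs_mult using a B2 by (intro mult_mono) auto
 moreover have "B^2+B^1 <= B^(2+1)" using B2 by (intro power_add_bound) auto
 moreover have "B^3 <= B^16" using B2 by (intro power_increasing) auto
 moreover have "0 <= B*B" using B2 by simp
 ultimately show ?thesis using a BW by (auto simp: power2_eq_square)
qed

definition simc :: "nat => nat => state => bool" where
 "simc K i s \<longleftrightarrow> bnd B s & regs s 5 = int K & regs s 6 = int i & i < K & int K <= B"

text \<open>A simulated address \<open>j\<close> is a word of the simulated machine, so at most
  \<open>WA <= B\<close>; the real address \<open>j * K + i\<close> is then at most
  \<open>B^2 + B\<close> and still a word.\<close>

lemma aval_cexp:
 assumes c: "simc K i s" and WA: "WA <= B"
 shows "aval WA (view K i s) e = Some x ==> int (amax e) <= B ==> aval W s (cexp e) = Some x"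
proof (induction e arbitrary: x)
 case (N y)
 then show ?case using index_bound[of 0 0 0] WA B2 by (auto simp: word_def split: if_splits)
next
 case (R y)
 have "nat (int y*int K+int i) = y*K+i"
  by (simp add: nat_add_distrib nat_mult_distrib)
 moreover have "\<bar>int y\<bar> <= W" "\<bar>int y*int K\<bar> <= W" "\<bar>int y*int K+int i\<bar> <= W" "int K <= W" "int i <= W" "B <= W"
  using index_bound[of "int y" "int K" "int i"] c R.prems unfolding simc_def by auto
 ultimately show ?case using c R.prems WA
  by (auto simp: simc_def word_def view_def split: if_splits)
next
 case (Rd a e)
 then obtain j where j: "aval WA (view K i s) e = Some j" "0 <= j"
  and x: "x = arrs s (a+13) (nat j*K+i)" "\<bar>x\<bar> <= WA"
  by (auto simp: view_def word_def split: option.splits if_splits)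
 have IH: "aval W s (cexp e) = Some j" using Rd.IH[OF j(1)] Rd.prems by simp
 have "nat (j*int K+int i) = nat j*K+i"
  using j(2) by (simp add: nat_add_distrib nat_mult_distrib)
 moreover have "\<bar>j*int K\<bar> <= W" "\<bar>j*int K+int i\<bar> <= W" "int K <= W" "int i <= W" "B <= W"
  using index_bound[of j "int K" "int i"] c aval_le[OF j(1)] WA unfolding simc_def by auto
 moreover have "0 <= j*int K+int i" using j(2) by simp
 ultimately show ?case using c IH x WA by (auto simp: simc_def word_def)
next
 case (Bin f e1 e2)
 then obtain y z where "aval WA (view K i s) e1 = Some y" "aval WA (view K i s) e2 = Some z"
  "x = binop_val f y z" "\<bar>x\<bar> <= WA"
  by (auto simp: word_def split: option.splits if_splits)
 moreover have "B <= W" using index_bound[of 0 0 0] B2 by simp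
 ultimately show ?case using Bin WA by (simp add: word_def)
qed

lemma bval_cbexp:
 assumes c: "simc K i s" and WA: "WA <= B"
 shows "bval WA (view K i s) b = Some p ==> int (bmax b) <= B ==> bval W s (cbexp b) = Some p"
proof (induction b arbitrary: p)
 case (Less e1 e2)
 then obtain x y where "aval WA (view K i s) e1 = Some x" "aval WA (view K i s) e2 = Some y"
  by (auto split: option.splits)
 then show ?case using Less aval_cexp[OF c WA] by simp
next
 case (Equal e1 e2)
 then obtain x y where "aval WA (view K i s) e1 = Some x" "aval WA (view K i s) e2 = Some y"
  by (auto split: option.splits)
 then show ?case using Equal aval_cexp[OF c WA] by simp
next
 case (Neg b)
 then obtain q where "bval WA (view K i s) b = Some q" by auto
 then show ?case using Neg by simp
next
 case (Conj b1 b2)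
 then obtain q r where "bval WA (view K i s) b1 = Some q" "bval WA (view K i s) b2 = Some r"
  by (auto split: option.splits)
 then show ?case using Conj by simp
qed

definition simpost :: "nat => nat => state => state => nat => state => bool" where
 "simpost K i s s' t v \<longleftrightarrow> view K i s' = v & regs s' = (regs s)(4 := regs s 4+int t) &
   (\<forall>a<12. arrs s' a = arrs s a) & (\<forall>j<K. j \<noteq> i --> view K j s' = view K j s) & bnd B s'"

lemma bs_tick:
 assumes "bnd B s" "0 <= regs s 4" "regs s 4 < B"
 shows "bs W tick s (setr s 4 (regs s 4+1)) 1"
  "bnd B (setr s 4 (regs s 4+1))"
proof -
 have "B <= W" using index_bound[of 0 0 0] B2 by simp
 then show "bs W tick s (setr s 4 (regs s 4+1)) 1"
  using assms B2 by (intro bs_Assign) (auto simp: word_def)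
 show "bnd B (setr s 4 (regs s 4+1))"
  using assms by (intro bnd_assign) auto
qed

lemma view_regs [simp]: "view K i (s\<lparr>regs := f\<rparr>) = view K i s" by (simp add: view_def)

inductive_cases bs_SeqE: "bs W (Seq c1 c2) s s' t"
inductive_cases bs_AssignE: "bs W (Assign x e) s s' t"

text \<open>Each simulated step expands into a constant number of real ones, for its tick, the
  sequencing and the access itself; address arithmetic costs nothing extra, being part of an
  expression.\<close>

lemma bs_ccom:
 assumes "bs WA c v v' t" "WA <= B" "deterministic c"
  and "view K i s = v" "simc K i s" "int (cmax c) <= B" "0 <= regs s 4" "regs s 4+int t <= B"
 shows "\<exists>s' t'. bs W (ccom c) s s' t' & t' <= 5*t & simpost K i s s' t v'"
 using assms
proof (induction arbitrary: s rule: bs.induct)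
 case (bs_Skip v)
 let ?s = "setr s 4 (regs s 4+1)"
 have "bs W (ccom SKIP) s ?s 3"
  using bs_Seq[OF bs_tick(1) bs.bs_Skip, of s] bs_Skip by (simp add: simc_def eval_nat_numeral)
 moreover have "simpost K i s ?s 1 v" using bs_Skip bs_tick(2)[of s] by (simp add: simpost_def simc_def)
 ultimately show ?case by (intro exI[of _ ?s] exI[of _ 3]) simp
next
 case (bs_Assign v e y x)
 let ?s = "setr s 4 (regs s 4+1)"
 have c: "simc K i ?s" using bs_Assign bs_tick(2)[of s] by (simp add: simc_def)
 let ?s' = "seta ?s 12 (x*K+i) y"
 have y: "aval W ?s (cexp e) = Some y" using aval_cexp[OF c] bs_Assign by simp
 have "aval W ?s (N (int x)\<boxtimes>R 5\<boxplus>R 6) = Some (int (x*K+i))"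
  using index_bound[of "int x" "int K" "int i"] c bs_Assign.prems unfolding simc_def
  by (auto simp: word_def)
 moreover have "nat (int (x*K+i)) = x*K+i" by (simp only: nat_int)
 ultimately have "bs W (Store 12 (N (int x)\<boxtimes>R 5\<boxplus>R 6) (cexp e)) ?s ?s' 1"
  using bs_Store[OF _ y, of "N (int x)\<boxtimes>R 5\<boxplus>R 6" "int (x*K+i)" 12] by (metis of_nat_0_le_iff)
 from bs_Seq[OF bs_tick(1) this] have "bs W (ccom (Assign x e)) s ?s' 3"
  using bs_Assign by (simp add: simc_def eval_nat_numeral)
 moreover have "simpost K i s ?s' 1 (setr v x y)"
 proof -
  have "bnd B ?s'" using c aval_le[OF bs_Assign.hyps] bs_Assign.prems(1)
   by (intro bnd_store) (auto simp: simc_def)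
  moreover have "view K j ?s' = view K j s" if "j < K" "j \<noteq> i" for j
   using that c by (auto simp: view_def simc_def interleave_inj)
  moreover have "view K i ?s' = setr v x y"
   using c bs_Assign.prems(3) by (auto simp: view_def simc_def interleave_inj fun_eq_iff)
  ultimately show ?thesis by (simp add: simpost_def)
 qed
 ultimately show ?case by (intro exI[of _ ?s'] exI[of _ 3]) simp
next
 case (bs_Store v e1 p e2 y a)
 let ?s = "setr s 4 (regs s 4+1)"
 have c: "simc K i ?s" using bs_Store bs_tick(2)[of s] by (simp add: simc_def)
 let ?s' = "?s\<lparr>arrs := (arrs ?s)(a+13 := (arrs ?s (a+13))(nat p*K+i := y))\<rparr>"
 have y: "aval W ?s (cexp e2) = Some y" using aval_cexp[OF c] bs_Store by simp
 have p: "aval W ?s (cexp e1) = Some p" using aval_cexp[OF c] bs_Store by simp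
 have pB: "\<bar>p\<bar> <= B" using aval_le[OF bs_Store.hyps(1)] bs_Store.prems(1) by simp
 have "aval W ?s (cexp e1\<boxtimes>R 5\<boxplus>R 6) = Some (p*int K+int i)"
  using index_bound[of p "int K" "int i"] c p pB bs_Store.prems unfolding simc_def
  by (auto simp: word_def)
 moreover have "nat (p*int K+int i) = nat p*K+i"
  using bs_Store.hyps(3) by (simp add: nat_add_distrib nat_mult_distrib)
 ultimately have "bs W (Store (a+13) (cexp e1\<boxtimes>R 5\<boxplus>R 6) (cexp e2)) ?s ?s' 1"
  using bs.bs_Store[OF _ y, of "cexp e1\<boxtimes>R 5\<boxplus>R 6" "p*int K+int i" "a+13"] bs_Store.hyps(3) by simp
 from bs_Seq[OF bs_tick(1) this] have "bs W (ccom (Store a e1 e2)) s ?s' 3"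
  using bs_Store by (simp add: simc_def eval_nat_numeral)
 moreover have "simpost K i s ?s' 1 (seta v a (nat p) y)"
 proof -
  have "bnd B ?s'" using c aval_le[OF bs_Store.hyps(2)] bs_Store.prems(1)
   by (intro bnd_store) (auto simp: simc_def)
  moreover have "view K j ?s' = view K j s" if "j < K" "j \<noteq> i" for j
   using that c by (auto simp: view_def simc_def interleave_inj fun_eq_iff)
  moreover have "view K i ?s' = seta v a (nat p) y"
   using c bs_Store.prems(3) by (auto simp: view_def simc_def interleave_inj fun_eq_iff)
  ultimately show ?thesis by (simp add: simpost_def)
 qed
 ultimately show ?case by (intro exI[of _ ?s'] exI[of _ 3]) simp
next
 case (bs_Seq c1 v v1 t1 c2 v2 t2)
 let ?s = "setr s 4 (regs s 4+1)"
 have c: "simc K i ?s" using bs_Seq bs_tick(2)[of s] by (simp add: simc_def)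
 obtain s1 t1' where 1: "bs W (ccom c1) ?s s1 t1'" "t1' <= 5*t1" "simpost K i ?s s1 t1 v1"
  using bs_Seq.IH(1)[of ?s] bs_Seq.prems c by auto
 have c1: "simc K i s1" using 1(3) c by (simp add: simc_def simpost_def)
 obtain s2 t2' where 2: "bs W (ccom c2) s1 s2 t2'" "t2' <= 5*t2" "simpost K i s1 s2 t2 v2"
  using bs_Seq.IH(2)[of s1] bs_Seq.prems c1 1(3) by (auto simp: simpost_def)
 have "bs W (ccom (Seq c1 c2)) s s2 (Suc (1+Suc (t1'+t2')))"
  unfolding ccom.simps using bs_Seq.prems
  by (intro bs.bs_Seq[OF _ bs.bs_Seq[OF 1(1) 2(1)]] bs_tick) (auto simp: simc_def)
 moreover have "simpost K i s s2 (Suc (t1+t2)) v2"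
  using 1(3) 2(3) by (simp add: simpost_def fun_eq_iff)
 ultimately show ?case using 1(2) 2(2) by (intro exI[of _ s2] exI[of _ "Suc (1+Suc (t1'+t2'))"]) simp
next
 case (bs_IfT v b c1 v' t c2)
 let ?s = "setr s 4 (regs s 4+1)"
 have c: "simc K i ?s" using bs_IfT bs_tick(2)[of s] by (simp add: simc_def)
 obtain s1 t1 where 1: "bs W (ccom c1) ?s s1 t1" "t1 <= 5*t" "simpost K i ?s s1 t v'"
  using bs_IfT.IH[of ?s] bs_IfT.prems c by auto
 have b: "bval W ?s (cbexp b) = Some True" using bval_cbexp[OF c] bs_IfT by simp
 have "bs W (ccom (If b c1 c2)) s s1 (Suc (1+Suc t1))"
  unfolding ccom.simps using bs_IfT.prems
  by (intro bs.bs_Seq[OF _ bs.bs_IfT[OF b 1(1)]] bs_tick) (auto simp: simc_def)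
 moreover have "simpost K i s s1 (Suc t) v'"
  using 1(3) by (simp add: simpost_def fun_eq_iff)
 ultimately show ?case using 1(2) by (intro exI[of _ s1] exI[of _ "Suc (1+Suc t1)"]) simp
next
 case (bs_IfF v b c2 v' t c1)
 let ?s = "setr s 4 (regs s 4+1)"
 have c: "simc K i ?s" using bs_IfF bs_tick(2)[of s] by (simp add: simc_def)
 obtain s1 t1 where 1: "bs W (ccom c2) ?s s1 t1" "t1 <= 5*t" "simpost K i ?s s1 t v'"
  using bs_IfF.IH[of ?s] bs_IfF.prems c by auto
 have b: "bval W ?s (cbexp b) = Some False" using bval_cbexp[OF c] bs_IfF by simp
 have "bs W (ccom (If b c1 c2)) s s1 (Suc (1+Suc t1))"
  unfolding ccom.simps using bs_IfF.prems
  by (intro bs.bs_Seq[OF _ bs.bs_IfF[OF b 1(1)]] bs_tick) (auto simp: simc_def)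
 moreover have "simpost K i s s1 (Suc t) v'"
  using 1(3) by (simp add: simpost_def fun_eq_iff)
 ultimately show ?case using 1(2) by (intro exI[of _ s1] exI[of _ "Suc (1+Suc t1)"]) simp
next
 case (bs_WhileF v b d)
 let ?s = "setr s 4 (regs s 4+1)"
 have c: "simc K i ?s" using bs_WhileF bs_tick(2)[of s] by (simp add: simc_def)
 have b: "bval W ?s (cbexp b) = Some False" using bval_cbexp[OF c] bs_WhileF by simp
 have "bs W (ccom (While b d)) s ?s (Suc (1+1))"
  unfolding ccom.simps using bs_WhileF.prems
  by (intro bs.bs_Seq[OF _ bs.bs_WhileF[OF b]] bs_tick) (auto simp: simc_def)
 moreover have "simpost K i s ?s 1 v"
  using bs_WhileF c by (simp add: simpost_def simc_def)
 ultimately show ?case by (intro exI[of _ ?s] exI[of _ "Suc (1+1)"]) simp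
next
 case (bs_WhileT v b d v1 t1 v2 t2)
 let ?s = "setr s 4 (regs s 4+1)"
 have c: "simc K i ?s" using bs_WhileT bs_tick(2)[of s] by (simp add: simc_def)
 have b: "bval W ?s (cbexp b) = Some True" using bval_cbexp[OF c] bs_WhileT by simp
 obtain s1 t1' where 1: "bs W (ccom d) ?s s1 t1'" "t1' <= 5*t1" "simpost K i ?s s1 t1 v1"
  using bs_WhileT.IH(1)[of ?s] bs_WhileT.prems c by auto
 have c1: "simc K i s1" using 1(3) c by (simp add: simc_def simpost_def)
 obtain s2 t2' where 2: "bs W (ccom (While b d)) s1 s2 t2'" "t2' <= 5*t2" "simpost K i s1 s2 t2 v2"
  using bs_WhileT.IH(2)[of s1] bs_WhileT.prems c1 1(3) by (auto simp: simpost_def)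
 \<comment> \<open>The induction hypothesis is about \<open>tick ;; While ...\<close>. Its leading
   tick is the one that ends the current iteration of the compiled loop, so it is split off and
   moved into the body.\<close>
 from 2(1) obtain s1a ta t3 where 3: "bs W tick s1 s1a ta"
  "bs W (While (cbexp b) (ccom d ;; tick)) s1a s2 t3" "t2' = Suc (ta+t3)"
  unfolding ccom.simps by (elim bs_SeqE)
 have ta: "ta = 1" using 3(1) by (elim bs_AssignE) simp
 have "bs W (While (cbexp b) (ccom d ;; tick)) ?s s2 (Suc (Suc (t1'+ta)+t3))"
  by (rule bs.bs_WhileT[OF b bs.bs_Seq[OF 1(1) 3(1)] 3(2)])
 from bs.bs_Seq[OF bs_tick(1) this] have "bs W (ccom (While b d)) s s2 (Suc (1+Suc (Suc (t1'+1)+t3)))"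
  using bs_WhileT.prems ta by (simp add: simc_def)
 moreover have "simpost K i s s2 (Suc (t1+t2)) v2"
  using 1(3) 2(3) by (simp add: simpost_def fun_eq_iff)
 ultimately show ?case using 1(2) 2(2) 3(3) ta
  by (intro exI[of _ s2] exI[of _ "Suc (1+Suc (Suc (t1'+1)+t3))"]) simp
qed

lemma T_ccom:
 assumes "bs WA c (view K i s) v' t" "WA <= B" "deterministic c" "int (cmax c) <= B"
  and "regs s 5 = int K" "regs s 6 = int i" "i < K" "int K <= B" "0 <= regs s 4" "regs s 4+int t <= B"
 shows "T (ccom c) s (%s' t'. t' <= 5*t & simpost K i s s' t v')"
proof (rule T_bnd)
 assume "bnd B s"
 then have "simc K i s" using assms by (simp add: simc_def)
 from bs_ccom[OF assms(1-3) refl this assms(4,9,10)]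
 show ?thesis unfolding T_def by (auto simp: simpost_def)
qed

end

section \<open>Tournament trees\<close>

text \<open>
 Register 1 holds the number \<open>2 ^ L\<close> of (padded) columns. Array 5 holds a family of binary trees in
 heap order: node \<open>h\<close> of tree \<open>r\<close> is cell \<open>r * 2 ^ (L + 1) + h\<close>, the root is node 1, and each inner
 node carries the minimum of its two children. Array 3 holds the matrix with rows of length \<open>2 ^ L\<close>.
\<close>

definition TRi :: "aexp => aexp => aexp" where
 "TRi r h = r\<boxtimes>(R 1\<boxplus>R 1)\<boxplus>h"

abbreviation TRe :: "aexp => aexp => aexp" where
 "TRe r h \<equiv> Rd 5 (TRi r h)"

definition MMi :: "aexp => aexp => aexp" where
 "MMi i k = i\<boxtimes>R 1\<boxplus>k"

abbreviation MMe :: "aexp => aexp => aexp" where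
 "MMe i k \<equiv> Rd 3 (MMi i k)"

lemma leaves_idx [simp]: "leaves (TRi r h) = leaves r+2+leaves h" "leaves (MMi i k) = leaves i+1+leaves k"
 by (simp_all add: TRi_def MMi_def)

definition halve :: "nat => com" where "halve x = Assign x (Bin Div (R x) (N 2))"

text \<open>Set leaf \<open>R 16\<close> of tree \<open>R 15\<close> to \<open>R 17\<close>.\<close>

definition upd :: com where
 "upd = Assign 18 (R 1\<boxplus>R 16) ;; Store 5 (TRi (R 15) (R 18)) (R 17) ;; halve 18 ;;
  While (Less (N 0) (R 18))
   (If (Less (TRe (R 15) (R 18\<boxplus>R 18)) (TRe (R 15) (R 18\<boxplus>R 18\<boxplus>N 1)))
     (Store 5 (TRi (R 15) (R 18)) (TRe (R 15) (R 18\<boxplus>R 18)))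
     (Store 5 (TRi (R 15) (R 18)) (TRe (R 15) (R 18\<boxplus>R 18\<boxplus>N 1))) ;; halve 18)"

lemma wr_upd [simp]: "wregs upd = {18}" "warrs upd = {5}"
 by (auto simp: upd_def halve_def)

text \<open>
 Breadth-first search from the root: array 6 is the queue, registers 19 and 20 its ends, register 21
 the current node, and at most \<open>R 33\<close> nodes are processed.
\<close>

definition bfs :: "bexp => com => com" where
 "bfs tst els = Store 6 (N 0) (N 1) ;; Assign 19 (N 0) ;; Assign 20 (N 1) ;;
  While (Conj (Less (R 19) (R 20)) (Less (R 19) (R 33)))
   (Assign 21 (Rd 6 (R 19)) ;; Assign 19 (R 19\<boxplus>N 1) ;;
    If tst (Store 6 (R 20) (R 21\<boxplus>R 21) ;; Store 6 (R 20\<boxplus>N 1) (R 21\<boxplus>R 21\<boxplus>N 1) ;;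
        Assign 20 (R 20\<boxplus>N 2))
     els)"

text \<open>What an uncapped search from the root reaches if it expands exactly the nodes satisfying
  \<open>P\<close>.\<close>

inductive_set vis :: "(nat => bool) => nat set" for P where
 vis_root: "1 \<in> vis P"
| vis_left: "h \<in> vis P ==> P h ==> 2*h \<in> vis P"
| vis_right: "h \<in> vis P ==> P h ==> Suc (2*h) \<in> vis P"

lemma vis_bounds:
 assumes "\<And>h. P h ==> h < K"
 shows "h \<in> vis P ==> 1 <= h & h < 2*K \<or> h = 1"
 by (induction rule: vis.induct) (use assms in force)+

lemma sorted_wrt_snoc2:
 "sorted_wrt (<) xs ==> (\<And>x. x \<in> set xs ==> x < y) ==> y < z ==> sorted_wrt (<) (xs @ [y, z :: nat])"
 by (fastforce simp: sorted_wrt_append)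

text \<open>\<open>2^L\<close> is the padded number of columns. The quartic lower bound on
  \<open>B\<close> is generous room for the addresses and list positions of the program; the step
  counter of the simulation is bounded separately.\<close>

locale par = mach W B for W B +
 fixes n L :: nat
 assumes n0: "0 < n" and nN: "n <= 2^L" and Nn: "2^L < 2*n"
  and big: "int (1000*(n+2)^4) <= B"
begin

definition NN :: nat where "NN = 2^L"
definition LG :: nat where "LG = Suc L"

lemma NN0: "0 < NN" by (simp add: NN_def)
lemma n_le_NN: "n <= NN" and NN_less: "NN < 2*n" using nN Nn by (simp_all add: NN_def)

lemma L_le: "L <= n"
proof -
 have "L < 2^L" by simp
 moreover have "L <= n" if "2^L < 2*n" "0 < n" for L n :: nat
 proof (cases L)
  case (Suc m)
  then have "2^m < n" using that by simp
  moreover have "m < 2^m" by (rule less_exp)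
  ultimately show ?thesis using Suc by linarith
 qed simp
 ultimately show ?thesis using Nn n0 by blast
qed

lemma B_ge: "m <= 1000*(n+2)^4 ==> int m <= B"
 using big by linarith

lemma pow_le: "n+2 <= (n+2)^2" "(n+2)^2 <= (n+2)^3" "(n+2)^3 <= (n+2)^4"
proof -
 have "(n+2)^1 <= (n+2)^2" "(n+2)^2 <= (n+2)^3" "(n+2)^3 <= (n+2)^4"
  by (rule power_increasing; simp)+
 then show "n+2 <= (n+2)^2" "(n+2)^2 <= (n+2)^3" "(n+2)^3 <= (n+2)^4" by simp_all
qed

lemma B_lin: "m <= 1000*(n+2) ==> int m <= B"
 by (rule B_ge, erule order_trans, rule mult_le_mono2) (rule order_trans[OF pow_le(1) order_trans[OF pow_le(2,3)]])

lemma B_quad: "m <= 1000*(n+2)^2 ==> int m <= B"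
 by (rule B_ge, erule order_trans, rule mult_le_mono2) (rule order_trans[OF pow_le(2,3)])

lemma B_facts: "int n+2 <= B" "4*int NN+4 <= B" "2000 <= B" "16*int NN+16 <= B"
 using B_lin[of "n+2"] B_lin[of "16*NN+16"] B_lin[of 2000] NN_less n0 by auto

definition tr :: "state => nat => nat => int" where "tr s r h = arrs s 5 (r*(2*NN)+h)"
definition mm :: "state => nat => nat => int" where "mm s i k = arrs s 3 (i*NN + k)"

lemma av_TRi: "av s r = int r' ==> av s h = int h' ==> regs s 1 = int NN ==> av s (TRi r h) = int (r'*(2*NN)+h')"
 by (simp add: TRi_def algebra_simps)

lemma av_MMi: "av s r = int r' ==> av s h = int h' ==> regs s 1 = int NN ==> av s (MMi r h) = int (r'*NN+h')"
 by (simp add: MMi_def algebra_simps)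

lemma av_TRe: "av s r = int r' ==> av s h = int h' ==> regs s 1 = int NN ==> av s (TRe r h) = tr s r' h'"
 by (simp only: av.simps av_TRi nat_int tr_def)

lemma av_MMe: "av s r = int r' ==> av s h = int h' ==> regs s 1 = int NN ==> av s (MMe r h) = mm s r' h'"
 by (simp only: av.simps av_MMi nat_int mm_def)

lemma aok_TRi [simp]: "aok B s (TRi r h) = (aok B s r & aok B s h)"
 and aok_MMi [simp]: "aok B s (MMi r h) = (aok B s r & aok B s h)"
 by (simp_all add: TRi_def MMi_def)

definition tvalid :: "state => nat => bool" where
 "tvalid s r \<longleftrightarrow> (\<forall>h. 1 <= h & h < NN --> tr s r h = min (tr s r (2*h)) (tr s r (2*h+1)))"

definition trep :: "state => nat => (nat => int) => bool" where
 "trep s r f \<longleftrightarrow> tvalid s r & (\<forall>k<NN. tr s r (NN + k) = f k)"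

lemma trep_cong: "trep s r f ==> (\<And>h. h < 2*NN ==> tr s' r h = tr s r h) ==> trep s' r f"
 by (auto simp: trep_def tvalid_def)

lemma trep_fun_cong: "trep s r f ==> (\<And>k. k < NN ==> f k = g k) ==> trep s r g"
 by (auto simp: trep_def)

lemma tr_store:
 assumes "h < 2*NN" "h' < 2*NN"
 shows "tr (seta s 5 (r*(2*NN)+h) x) r' h' =
  (if r' = r & h' = h then x else tr s r' h')"
 using interleave_inj[OF assms, of r r'] by (auto simp: tr_def interleave_inj[OF assms(2,1)])

lemma T_halve: "regs s x = int h ==> Q (setr s x (int (h div 2))) 1 ==> T (halve x) s Q"
proof (rule T_bnd)
 assume a: "regs s x = int h" "Q (setr s x (int (h div 2))) 1" "bnd B s"
 have "int h <= B" using bnd_regs[OF a(3), of x] a(1) by simp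
 then show ?thesis unfolding halve_def using a(1,2) B2 by (intro T_Assign) (auto simp: zdiv_int)
qed

definition upd_while :: com where
 "upd_while = While (Less (N 0) (R 18))
   (If (Less (TRe (R 15) (R 18\<boxplus>R 18)) (TRe (R 15) (R 18\<boxplus>R 18\<boxplus>N 1)))
     (Store 5 (TRi (R 15) (R 18)) (TRe (R 15) (R 18\<boxplus>R 18)))
     (Store 5 (TRi (R 15) (R 18)) (TRe (R 15) (R 18\<boxplus>R 18\<boxplus>N 1))) ;; halve 18)"

text \<open>Only the node in register 18 may violate the minimum condition. Repairing it shifts the
  possible violation to its parent, and past the root the register is 0, where nothing is
  required.\<close>

lemma upd_while_spec:
 assumes s: "regs s 1 = int NN" "regs s 15 = int r" "regs s 18 = int h0" "h0 < NN"
  and v: "\<And>h. 1 <= h ==> h < NN ==> h \<noteq> h0 ==> tr s r h = min (tr s r (2*h)) (tr s r (2*h+1))"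
  and f: "\<And>k. k < NN ==> tr s r (NN + k) = f k"
 shows "T upd_while s (%s' t. t <= 5*L+1 & trep s' r f &
   (\<forall>r' h. r' \<noteq> r --> h < 2*NN --> tr s' r' h = tr s r' h) & same {18} {5} s s')"
proof -
 define lval where "lval s h \<longleftrightarrow> tr s r h = min (tr s r (2*h)) (tr s r (2*h+1))" for s h
 define I where "I s' kp \<longleftrightarrow> (\<exists>h m. regs s' 18 = int h & h < 2^m & h < NN & kp + 5*m <= 5*L &
   (\<forall>h'. 1 <= h' & h' < NN & h' \<noteq> h --> lval s' h') & (\<forall>k'<NN. tr s' r (NN + k') = f k') &
   (\<forall>r' h. r' \<noteq> r --> h < 2*NN --> tr s' r' h = tr s r' h) & same {18} {5} s s')" for s' kp
 have I0: "I s 0" unfolding I_def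
  by (rule exI[of _ h0], rule exI[of _ L]) (use s v f in \<open>auto simp: NN_def lval_def\<close>)
 show ?thesis unfolding upd_while_def
 proof (rule T_While[where I = I and \<mu> = "%s. nat (regs s 18)", OF I0])
  fix s' kp assume "I s' kp"
  then show "bok B s' (Less (N 0) (R 18))" using B2 by simp
 next
  fix s' kp assume I: "I s' kp" and b': "bnd B s'" and "\<not> bv s' (Less (N 0) (R 18))"
  then show "Suc kp <= 5*L+1 & trep s' r f &
   (\<forall>r' h. r' \<noteq> r --> h < 2*NN --> tr s' r' h = tr s r' h) & same {18} {5} s s'"
   unfolding I_def by (auto simp: trep_def tvalid_def lval_def)
 next
  fix s' kp assume I: "I s' kp" and b': "bnd B s'" and bv: "bv s' (Less (N 0) (R 18))"
  obtain h m where h: "regs s' 18 = int h" "h < 2^m" "h < NN" "kp + 5*m <= 5*L"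
   "\<forall>h'. 1 <= h' & h' < NN & h' \<noteq> h --> lval s' h'" "\<forall>k'<NN. tr s' r (NN + k') = f k'"
   "\<forall>r' h. r' \<noteq> r --> h < 2*NN --> tr s' r' h = tr s r' h" "same {18} {5} s s'"
   using I unfolding I_def by blast
  have h0: "0 < h" using bv h(1) by simp
  have r': "regs s' 1 = int NN" "regs s' 15 = int r" using same_regs[OF h(8)] s by auto
  obtain m' where m: "m = Suc m'" using h(2) h0 by (cases m) auto
  have e1: "av s' (TRe (R 15) (R 18\<boxplus>R 18)) = tr s' r (2*h)"
   by (rule av_TRe) (use h(1) r' in auto)
  have e2: "av s' (TRe (R 15) (R 18\<boxplus>R 18\<boxplus>N 1)) = tr s' r (2*h+1)"
   by (rule av_TRe) (use h(1) r' in auto)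
  have e3: "av s' (TRi (R 15) (R 18)) = int (r*(2*NN)+h)"
   by (rule av_TRi) (use h(1) r' in auto)
  have e1': "0 <= av s' (TRi (R 15) (R 18\<boxplus>R 18))" "0 <= av s' (TRi (R 15) (R 18\<boxplus>R 18\<boxplus>N 1))"
   using h(1) r' by (auto simp: TRi_def)
  let ?v = "min (tr s' r (2*h)) (tr s' r (2*h+1))"
  let ?t1 = "seta s' 5 (r*(2*NN)+h) ?v"
  have trB: "\<bar>tr s' r h'\<bar> <= B" for h' unfolding tr_def by (rule bnd_arrs[OF b'])
  have t1: "tr ?t1 r' h' = (if r' = r & h' = h then ?v else tr s' r' h')" if "h' < 2*NN" for r' h'
   using tr_store[of h h'] that h(3) by simp
  let ?t2 = "setr ?t1 18 (int (h div 2))"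
  have t2: "tr ?t2 r' h' = (if r' = r & h' = h then ?v else tr s' r' h')" if "h' < 2*NN" for r' h'
   using t1[OF that] by (simp add: tr_def)
  \<comment> \<open>The store affects the condition at \<open>h\<close>, where it now holds, and at
    the parent of \<open>h\<close>, which becomes the exempted node.\<close>
  have lv: "lval ?t2 h'" if h': "1 <= h'" "h' < NN" "h' \<noteq> h div 2" for h'
  proof -
   have ne: "2*h' \<noteq> h" "2*h'+1 \<noteq> h" using h' by auto
   show "lval ?t2 h'"
   proof (cases "h' = h")
    case True
    then show ?thesis unfolding lval_def using t2[of h r] t2[of "2*h" r] t2[of "2*h+1" r] h(3) h0
     by auto
   next
    case False
    then have "lval s' h'" using h(5) h' by blast
    then show ?thesis using False h' ne t2[of h' r] t2[of "2*h'" r] t2[of "2*h'+1" r]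
     unfolding lval_def by auto
   qed
  qed
  have I': "I ?t2 (Suc (kp + 4))" unfolding I_def
  proof (rule exI[of _ "h div 2"], rule exI[of _ m'], intro conjI)
   show "same {18} {5} s ?t2" using h(8) by (auto simp: same_def)
   show "\<forall>h'. 1 <= h' & h' < NN & h' \<noteq> h div 2 --> lval ?t2 h'" using lv by blast
   show "\<forall>k'<NN. tr ?t2 r (NN + k') = f k'" using t2 h(3,6) by auto
   show "\<forall>r' h. r' \<noteq> r --> h < 2*NN --> tr ?t2 r' h = tr s r' h" using t2 h(7) by auto
  qed (use h m in auto)
  have "T (Store 5 (TRi (R 15) (R 18)) (TRe (R 15) e)) s'
    (%s1 t. T (halve 18) s1 (%s2 t2. I s2 (Suc (kp + Suc (Suc t+t2))) & nat (regs s2 18) < nat (regs s' 18)))"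
   if e: "av s' (TRe (R 15) e) = ?v" "0 <= av s' (TRi (R 15) e)" "aok B s' e" "leaves e <= 5" for e
  proof (rule T_StoreV[OF e3 e(1)])
   show "\<bar>?v\<bar> <= B" using trB by (simp add: min_def)
   show "T (halve 18) ?t1 (%s2 t2. I s2 (Suc (kp + Suc (Suc 1+t2))) & nat (regs s2 18) < nat (regs s' 18))"
   proof (rule T_halve)
    show "regs ?t1 18 = int h" using h(1) by simp
    show "I ?t2 (Suc (kp + Suc (Suc 1+1))) & nat (regs ?t2 18) < nat (regs s' 18)"
     using I' h0 h(1) by (simp add: eval_nat_numeral)
   qed
  qed (use e in auto)
  note st = this
  have mn: "bv s' (Less (TRe (R 15) (R 18\<boxplus>R 18)) (TRe (R 15) (R 18\<boxplus>R 18\<boxplus>N 1))) =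
   (tr s' r (2*h) < tr s' r (2*h+1))" by (simp only: bv.simps e1 e2)
  show "T (If (Less (TRe (R 15) (R 18\<boxplus>R 18)) (TRe (R 15) (R 18\<boxplus>R 18\<boxplus>N 1)))
    (Store 5 (TRi (R 15) (R 18)) (TRe (R 15) (R 18\<boxplus>R 18)))
    (Store 5 (TRi (R 15) (R 18)) (TRe (R 15) (R 18\<boxplus>R 18\<boxplus>N 1))) ;; halve 18) s'
   (%s'' t. I s'' (Suc (kp + t)) & nat (regs s'' 18) < nat (regs s' 18))"
  proof (rule T_Seq, rule T_If)
   show "bok B s' (Less (TRe (R 15) (R 18\<boxplus>R 18)) (TRe (R 15) (R 18\<boxplus>R 18\<boxplus>N 1)))"
    using e1' B2 by simp
  qed (rule st; use e1 e2 e1' mn B2 in \<open>simp add: min_def del: av.simps bv.simps\<close>)+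
 qed
qed

lemma upd_spec:
 assumes s: "regs s 1 = int NN" "regs s 15 = int r" "regs s 16 = int k" "k < NN" "trep s r f"
 shows "T upd s (%s' t. t <= 7*LG & trep s' r (f(k := regs s 17)) &
   (\<forall>r' h. r' \<noteq> r --> h < 2*NN --> tr s' r' h = tr s r' h) & same {18} {5} s s')"
proof (rule T_bnd)
 assume b: "bnd B s"
 let ?x = "regs s 17"
 let ?s1 = "setr s 18 (int (NN + k))"
 let ?s2 = "seta ?s1 5 (r*(2*NN)+(NN + k)) ?x"
 let ?s3 = "setr ?s2 18 (int ((NN + k) div 2))"
 have tr3: "tr ?s3 r' h' = (if r' = r & h' = NN + k then ?x else tr s r' h')" if "h' < 2*NN" for r' h'
  using tr_store[of "NN + k" h' ?s1 r ?x r'] that s(4) by (simp add: tr_def)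
 have v: "tr ?s3 r h' = min (tr ?s3 r (2*h')) (tr ?s3 r (2*h'+1))"
  if "1 <= h'" "h' < NN" "h' \<noteq> (NN + k) div 2" for h'
 proof -
  have "2*h' \<noteq> NN + k" "2*h'+1 \<noteq> NN + k" using that by auto
  then show ?thesis using s(5) that tr3[of h' r] tr3[of "2*h'" r] tr3[of "2*h'+1" r]
   by (auto simp: trep_def tvalid_def)
 qed
 have f: "tr ?s3 r (NN + k') = (f(k := ?x)) k'" if "k' < NN" for k'
  using tr3[of "NN + k'" r] that s(5) by (auto simp: trep_def)
 have W: "T upd_while ?s3 (%s' t. t <= 5*L+1 & trep s' r (f(k := ?x)) &
   (\<forall>r' h. r' \<noteq> r --> h < 2*NN --> tr s' r' h = tr ?s3 r' h) & same {18} {5} ?s3 s')"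
  by (rule upd_while_spec[OF _ _ _ _ v f]) (use s in auto)
 show ?thesis unfolding upd_def upd_while_def[symmetric]
 proof (rule T_AssignS[where v = "int (NN + k)"], goal_cases)
  case 5
  show ?case
  proof (rule T_StoreS[where p = "r*(2*NN)+(NN + k)" and v = ?x], goal_cases)
   case 1
   show ?case by (rule av_TRi) (use s in auto)
  next
   case 8
   show ?case
   proof (rule T_Seq, rule T_halve[where h = "NN + k"], goal_cases)
    case 2
    show ?case
    proof (rule T_conseq[OF W], goal_cases)
     case (1 s' t)
     then have "\<forall>r' h. r' \<noteq> r --> h < 2*NN --> tr s' r' h = tr s r' h" using tr3 by simp
     moreover have "same {18} {5} s s'" using 1 by (auto simp: same_def)
     ultimately show ?case using 1 by (simp add: LG_def)
    qed
   qed simp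
  qed (use s bnd_regs[OF b, of 17] in auto)
 qed (use s B_facts in auto)
qed

end

text \<open>\<open>x\<close> is the minimum of \<open>x0\<close> and all \<open>val h\<close> with
  \<open>h\<close> in \<open>S\<close>, phrased so that \<open>S\<close> may be empty.\<close>

definition accres :: "int => int => nat set => (nat => int) => bool" where
 "accres x0 x S val \<longleftrightarrow> x <= x0 & (\<forall>h\<in>S. x <= val h) & (x = x0 \<or> (\<exists>h\<in>S. x = val h))"

lemma level_unique:
 fixes h l m :: nat
 assumes "2^l <= h" "h < 2^Suc l" "2^m <= h" "h < 2^Suc m"
 shows "l = m"
proof -
 have "False" if "l < m" "h < 2^Suc l" "2^m <= h" for l m :: nat
 proof -
  have "(2::nat)^Suc l <= 2^m" using that(1) by (intro power_increasing) auto
  then show False using that by linarith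
 qed
 then show ?thesis using assms by (metis nat_neq_iff)
qed

section \<open>Breadth-first search with a cap on the processed nodes\<close>

context par
begin

lemma finite_vis:
 assumes "\<And>h. P h ==> h < NN"
 shows "vis P \<subseteq> {1..<2*NN}" "finite (vis P)"
proof -
 show "vis P \<subseteq> {1..<2*NN}"
 proof
  fix h assume "h \<in> vis P"
  then have "1 <= h & h < 2*NN \<or> h = 1" using vis_bounds[of P NN h] assms by blast
  then show "h \<in> {1..<2*NN}" using NN0 by auto
 qed
 then show "finite (vis P)" by (rule finite_subset) simp
qed

text \<open>The cap makes the time bound unconditional; only completeness depends on how many nodes
  are reachable. Heap numbers enter the queue in increasing order, because the children of a later
  node are numbered after those of an earlier one. So no node is queued twice, and the queue length
  can be compared with the number of reachable nodes.\<close>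

lemma bfs_spec:
 fixes P ac :: "nat => bool" and val :: "nat => int" and x :: nat
 defines "X \<equiv> {19, 20, 21, x}"
 assumes x: "x \<notin> {19, 20, 21, 33}"
  and cap: "regs s 33 = int cap" "int (2 * cap+8) <= B"
  and P: "\<And>h. P h ==> h < NN"
  and tst: "\<And>s' h. same X {6} s s' ==> regs s' 21 = int h ==> 1 <= h ==> h < 2*NN ==> bnd B s' ==>
    bok B s' tst & bv s' tst = P h"
  and els: "\<And>s' h. same X {6} s s' ==> regs s' 21 = int h ==> 1 <= h ==> h < 2*NN ==> bnd B s' ==>
    \<not> P h ==> T els s' (%s'' t. t <= 4 &
     s'' = setr s' x (if ac h then min (regs s' x) (val h) else regs s' x))"
 shows "T (bfs tst els) s (%s' t. t <= 11 * cap+8 & same X {6} s s' &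
   (\<exists>Pr. Pr \<subseteq> vis P & (card (vis P) <= cap --> Pr = vis P) &
    accres (regs s x) (regs s' x) {h \<in> Pr. \<not> P h & ac h} val))"
proof -
 define I where "I s' kp \<longleftrightarrow> (\<exists>qs hd. regs s' 19 = int hd & regs s' 20 = int (length qs) & hd <= length qs &
  hd <= cap & (\<forall>y<length qs. arrs s' 6 y = int (qs ! y)) & sorted_wrt (<) qs & set qs \<subseteq> vis P & 1 \<in> set qs &
  (\<forall>y<hd. P (qs ! y) --> 2*qs ! y \<in> set qs & Suc (2*qs ! y) \<in> set qs) &
  (hd = 0 --> qs = [1]) & (\<forall>y\<in>set qs. 0 < hd --> y <= 2*qs ! (hd - 1)+1) & length qs <= 2*hd+1 &
  kp <= 11*hd & same X {6} s s' &
  accres (regs s x) (regs s' x) {h \<in> set (take hd qs). \<not> P h & ac h} val)" for s' kp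
 let ?W = "While (Conj (Less (R 19) (R 20)) (Less (R 19) (R 33)))
   (Assign 21 (Rd 6 (R 19)) ;; Assign 19 (R 19\<boxplus>N 1) ;;
    If tst (Store 6 (R 20) (R 21\<boxplus>R 21) ;; Store 6 (R 20\<boxplus>N 1) (R 21\<boxplus>R 21\<boxplus>N 1) ;;
        Assign 20 (R 20\<boxplus>N 2))
     els)"
 note fv = finite_vis[of P, OF P]
 have I_mono: "I s' kp ==> kp' <= kp ==> I s' kp'" for s' kp kp'
  unfolding I_def by (elim exE conjE) (intro exI conjI, assumption+, simp+)
 have main: "T ?W s0 (%s' t. t <= 11 * cap+1 & same X {6} s s' &
   (\<exists>Pr. Pr \<subseteq> vis P & (card (vis P) <= cap --> Pr = vis P) &
    accres (regs s x) (regs s' x) {h \<in> Pr. \<not> P h & ac h} val))" if "I s0 0" for s0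
 proof (rule T_While[where I = I and \<mu> = "%s. cap - nat (regs s 19)", OF that])
  fix s' kp assume I: "I s' kp" and b: "bnd B s'" and bv: "\<not> bv s' (Conj (Less (R 19) (R 20)) (Less (R 19) (R 33)))"
  obtain qs hd where q: "regs s' 19 = int hd" "regs s' 20 = int (length qs)" "hd <= length qs"
   "hd <= cap" "sorted_wrt (<) qs" "set qs \<subseteq> vis P" "1 \<in> set qs"
   "\<forall>y<hd. P (qs ! y) --> 2*qs ! y \<in> set qs & Suc (2*qs ! y) \<in> set qs"
   "kp <= 11*hd" "same X {6} s s'"
   "accres (regs s x) (regs s' x) {h \<in> set (take hd qs). \<not> P h & ac h} val"
   using I unfolding I_def by blast
  have r33: "regs s' 33 = int cap" using same_regs[OF q(10), of 33] cap x by (simp add: X_def)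
  have or: "hd = length qs \<or> hd = cap" using bv q(1-4) r33 by auto
  \<comment> \<open>The queue entries are distinct and reachable, so the queue is no longer than the
    cap. Even if the cap ended the loop, the queue was exhausted.\<close>
  have "Pr_ok": "set (take hd qs) = vis P" if c: "card (vis P) <= cap"
  proof -
   have "length qs = card (set qs)" using q(5) by (metis distinct_card strict_sorted_iff)
   also have "\<dots> <= card (vis P)" using q(6) fv(2) by (rule card_mono[rotated])
   finally have hd: "hd = length qs" using or q(3) c by linarith
   have "h \<in> set qs" if "h \<in> vis P" for h
    using that
   proof induction
    case vis_root
    then show ?case using q(7) by simp
   next
    case (vis_left h)
    then show ?case using q(8) hd by (metis in_set_conv_nth)
   next
    case (vis_right h)
    then show ?case using q(8) hd by (metis in_set_conv_nth)
   qed
   then show ?thesis using q(6) hd by auto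
  qed
  have sub: "set (take hd qs) \<subseteq> vis P" using q(6) set_take_subset by fast
  have "\<exists>Pr. Pr \<subseteq> vis P & (card (vis P) <= cap --> Pr = vis P) &
    accres (regs s x) (regs s' x) {h \<in> Pr. \<not> P h & ac h} val"
   by (rule exI[of _ "set (take hd qs)"]) (use sub Pr_ok q(11) in blast)
  then show "Suc kp <= 11 * cap+1 & same X {6} s s' & (\<exists>Pr. Pr \<subseteq> vis P & (card (vis P) <= cap --> Pr = vis P) &
    accres (regs s x) (regs s' x) {h \<in> Pr. \<not> P h & ac h} val)"
   using q(4,9,10) by simp
 next
  fix s' kp assume I: "I s' kp" and b: "bnd B s'" and bv: "bv s' (Conj (Less (R 19) (R 20)) (Less (R 19) (R 33)))"
  obtain qs hd where q: "regs s' 19 = int hd" "regs s' 20 = int (length qs)" "hd <= length qs"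
   "hd <= cap" "sorted_wrt (<) qs" "set qs \<subseteq> vis P" "1 \<in> set qs"
   "\<forall>y<hd. P (qs ! y) --> 2*qs ! y \<in> set qs & Suc (2*qs ! y) \<in> set qs"
   "kp <= 11*hd" "same X {6} s s'"
   "accres (regs s x) (regs s' x) {h \<in> set (take hd qs). \<not> P h & ac h} val"
   "\<forall>y<length qs. arrs s' 6 y = int (qs ! y)" "hd = 0 --> qs = [1]"
   "\<forall>y\<in>set qs. 0 < hd --> y <= 2*qs ! (hd - 1)+1" "length qs <= 2*hd+1"
   using I unfolding I_def by blast
  have r33: "regs s' 33 = int cap" using same_regs[OF q(10), of 33] cap x by (simp add: X_def)
  have lt: "hd < length qs" "hd < cap" using bv q r33 by auto
  define h where "h = qs ! hd"
  have hv: "h \<in> vis P" unfolding h_def using q(6) lt(1) nth_mem by blast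
  then have h1: "1 <= h" "h < 2*NN" using fv(1) by auto
  have hB: "2*int h+1 <= B" using h1 B_facts by linarith
  \<comment> \<open>Once a node has been processed, every queued node is at most one more than twice
    the last processed one, which is smaller than \<open>h\<close>.\<close>
  have less: "y < 2*h" if "y \<in> set qs" for y
  proof (cases "hd = 0")
   case True
   then show ?thesis using q(13) that h1 by auto
  next
   case False
   then have "qs ! (hd - 1) < h" unfolding h_def using q(5) lt(1) by (simp add: sorted_wrt_nth_less)
   then show ?thesis using q(14) that False by fastforce
  qed
  have tk: "set (take (Suc hd) qs) = insert h (set (take hd qs))"
   unfolding h_def using lt(1) by (simp add: take_Suc_conv_app_nth)
  let ?s1 = "setr s' 21 (int h)"
  let ?s2 = "setr ?s1 19 (int (Suc hd))"
  have sm2: "same X {6} s ?s2" using q(10) by (auto simp: same_def X_def)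
  have capB: "int cap <= B" "int (length qs)+2 <= B" using cap(2) q(15) lt by linarith+
  show "T (Assign 21 (Rd 6 (R 19)) ;; Assign 19 (R 19\<boxplus>N 1) ;;
    If tst (Store 6 (R 20) (R 21\<boxplus>R 21) ;; Store 6 (R 20\<boxplus>N 1) (R 21\<boxplus>R 21\<boxplus>N 1) ;;
        Assign 20 (R 20\<boxplus>N 2)) els) s'
    (%s'' t. I s'' (Suc (kp + t)) & cap - nat (regs s'' 19) < cap - nat (regs s' 19))"
  proof (rule T_AssignS[where v = "int h"], goal_cases)
   case 5
   show ?case
   proof (rule T_AssignS[where v = "int (Suc hd)"], goal_cases)
    case 5
    show ?case
    proof (rule T_bnd)
     assume b2: "bnd B ?s2"
     note tt = tst[OF sm2 _ h1 b2, simplified]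
     show ?thesis
     proof (rule T_If, goal_cases)
      case 1
      show ?case using tt by simp
     next
      case 2
      then have Ph: "P h" using tt by simp
      let ?qs = "qs @ [2*h, Suc (2*h)]"
      let ?t1 = "seta ?s2 6 (length qs) (int (2*h))"
      let ?t2 = "seta ?t1 6 (Suc (length qs)) (int (Suc (2*h)))"
      let ?t3 = "setr ?t2 20 (int (length qs+2))"
      have I3: "I ?t3 (Suc (kp + 10))" unfolding I_def
      proof (rule exI[of _ ?qs], rule exI[of _ "Suc hd"], intro conjI)
       show "\<forall>y<length ?qs. arrs ?t3 6 y = int (?qs ! y)"
        using q(12) by (auto simp: nth_append less_Suc_eq)
       show "sorted_wrt (<) ?qs" using sorted_wrt_snoc2[OF q(5) less] by simp
       show "set ?qs \<subseteq> vis P" using q(6) vis_left[OF hv Ph] vis_right[OF hv Ph] by simp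
       show "\<forall>y<Suc hd. P (?qs ! y) --> 2*?qs ! y \<in> set ?qs & Suc (2*?qs ! y) \<in> set ?qs"
        using q(8) lt(1) by (auto simp: nth_append less_Suc_eq h_def)
       show "\<forall>y\<in>set ?qs. 0 < Suc hd --> y <= 2*?qs ! (Suc hd - 1)+1"
        using less lt(1) by (auto simp: nth_append h_def[symmetric] dest!: less)
       show "same X {6} s ?t3" using sm2 by (auto simp: same_def X_def)
       have "{h' \<in> set (take (Suc hd) ?qs). \<not> P h' & ac h'} = {h \<in> set (take hd qs). \<not> P h & ac h}"
        using lt(1) tk Ph by auto
       then show "accres (regs s x) (regs ?t3 x) {h \<in> set (take (Suc hd) ?qs). \<not> P h & ac h} val"
        using q(11) x by simp
       show "regs ?t3 19 = int (Suc hd)" "regs ?t3 20 = int (length ?qs)" by simp_all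
       show "Suc hd <= length ?qs" "Suc hd <= cap" "1 \<in> set ?qs" "Suc hd = 0 --> ?qs = [1]"
        "length ?qs <= 2*Suc hd+1" "Suc (kp + 10) <= 11*Suc hd"
        using q(7,9,15) lt by simp_all
      qed
      show ?case
       apply (rule T_StoreS[where p = "length qs" and v = "int (2*h)"])
           apply (use q(2) hB B2 in simp_all)[7]
       apply (rule T_StoreS[where p = "Suc (length qs)" and v = "int (Suc (2*h))"])
           apply (use q(2) hB B2 in simp_all)[7]
       apply (rule T_AssignV[where v = "int (length qs+2)"])
         apply (use q(2) capB B_facts in simp_all)[4]
       apply (rule conjI, rule I_mono[OF I3], simp)
       using lt(2) q(1) by simp
     next
      case 3
      then have Ph: "\<not> P h" using tt by simp
      show ?case
      proof (rule T_conseq[OF els[OF sm2 _ h1 b2 Ph]], goal_cases)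
       case 1
       show ?case by simp
      next
       case (2 s'' t)
       let ?v = "if ac h then min (regs s' x) (val h) else regs s' x"
       have s'': "s'' = setr ?s2 x ?v" using 2 x by simp
       have "I s'' (Suc (kp + Suc (Suc (Suc (Suc (Suc t))))))" unfolding I_def
       proof (rule exI[of _ qs], rule exI[of _ "Suc hd"], intro conjI)
        show "\<forall>y<Suc hd. P (qs ! y) --> 2*qs ! y \<in> set qs & Suc (2*qs ! y) \<in> set qs"
         using q(8) Ph by (auto simp: less_Suc_eq h_def)
        show "\<forall>y\<in>set qs. 0 < Suc hd --> y <= 2*qs ! (Suc hd - 1)+1"
         using less by (auto simp: h_def[symmetric] dest!: less)
        show "same X {6} s s''" using sm2 unfolding s'' by (auto simp: same_def X_def)
        have "{h' \<in> set (take (Suc hd) qs). \<not> P h' & ac h'} =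
          (if ac h then insert h {h \<in> set (take hd qs). \<not> P h & ac h} else {h \<in> set (take hd qs). \<not> P h & ac h})"
         using tk Ph by auto
        moreover have "regs s'' x = ?v" unfolding s'' by simp
        ultimately show "accres (regs s x) (regs s'' x) {h \<in> set (take (Suc hd) qs). \<not> P h & ac h} val"
         using q(11) by (auto simp: accres_def min_def)
        show "\<forall>y<length qs. arrs s'' 6 y = int (qs ! y)" unfolding s'' using q(12) by simp
        show "regs s'' 19 = int (Suc hd)" "regs s'' 20 = int (length qs)"
         unfolding s'' using q(2) x by simp_all
        show "Suc (kp + Suc (Suc (Suc (Suc (Suc t))))) <= 11*Suc hd" using q(9) 2(1) by simp
        show "Suc hd <= length qs" "Suc hd <= cap" "1 \<in> set qs" "Suc hd = 0 --> qs = [1]"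
         "length qs <= 2*Suc hd+1" "sorted_wrt (<) qs" "set qs \<subseteq> vis P"
         using q(5,6,7,15) lt by simp_all
       qed
       moreover have "regs s'' 19 = int (Suc hd)" unfolding s'' using x by simp
       ultimately show ?case using lt q(1) by simp
      qed
     qed
    qed
   qed (use q(1) lt capB B2 in auto)
  qed (use q(1,12) lt h_def hB in auto)
 qed (use B2 in simp)
 let ?s3 = "s\<lparr>arrs := (arrs s)(6 := (arrs s 6)(0 := 1)), regs := (regs s)(19 := 0, 20 := 1)\<rparr>"
 have I0: "I ?s3 0" unfolding I_def
  by (rule exI[of _ "[1]"], rule exI[of _ 0]) (use x vis_root in \<open>auto simp: accres_def same_def X_def\<close>)
 show ?thesis unfolding bfs_def
  apply (rule T_StoreS[where p = 0 and v = 1])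
      apply (use B2 in simp_all)[7]
  apply (rule T_AssignS[where v = 0])
    apply (use B2 in simp_all)[4]
  apply (rule T_AssignS[where v = 1])
    apply (use B2 in simp_all)[4]
  apply (rule T_conseq, rule main)
  using I0 by simp_all
qed

section \<open>Branch and bound\<close>

text \<open>The columns whose leaf lies below node \<open>h\<close>: in heap order, the ancestors of
  a leaf are the quotients of its number by powers of two.\<close>

definition lv :: "nat => nat set" where
 "lv h = {k. k < NN & (\<exists>d. (NN + k) div 2^d = h)}"

lemma tree_lower:
 assumes t: "trep s r f" and k: "k \<in> lv h" and h: "1 <= h"
 shows "tr s r h <= f k"
proof -
 obtain d where d: "(NN + k) div 2^d = h" and kN: "k < NN" using k by (auto simp: lv_def)
 show ?thesis using d h
 proof (induction d arbitrary: h)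
  case 0
  then show ?case using t kN by (auto simp: trep_def)
 next
  case (Suc d)
  define h' where "h' = (NN + k) div 2^d"
  have hh: "h = h' div 2" using Suc.prems(1) unfolding h'_def
   by (metis div_mult2_eq mult.commute power_Suc)
  have "h' <= NN + k" unfolding h'_def by simp
  then have "h < NN" using hh kN by simp
  moreover have "h' = 2*h \<or> h' = 2*h+1" using hh by presburger
  moreover have "tr s r h' <= f k" using Suc.IH[of h'] h'_def hh Suc.prems(2) by auto
  ultimately show ?case using t Suc.prems(2) by (auto simp: trep_def tvalid_def min_def)
 qed
qed

lemma tree_attained:
 assumes t: "trep s r f"
 shows "1 <= h ==> h < 2*NN ==> \<exists>k\<in>lv h. tr s r h = f k"
proof (induction "2*NN - h" arbitrary: h rule: less_induct)
 case less
 show ?case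
 proof (cases "h < NN")
  case False
  then have "h - NN \<in> lv h" using less.prems unfolding lv_def
   by (intro CollectI conjI exI[of _ 0]) auto
  moreover have "tr s r h = f (h - NN)"
  proof -
   have "h - NN < NN" "NN+(h - NN) = h" using False less.prems by auto
   then show ?thesis using t unfolding trep_def by metis
  qed
  ultimately show ?thesis by blast
 next
  case True
  have "tr s r h = min (tr s r (2*h)) (tr s r (2*h+1))"
   using t less.prems True by (simp add: trep_def tvalid_def)
  then obtain h' where h': "h' = 2*h \<or> h' = 2*h+1" "tr s r h = tr s r h'"
   by (metis min_def)
  then obtain k where k: "k \<in> lv h'" "tr s r h' = f k"
   using less.hyps[of h'] less.prems True by fastforce
  then obtain d where d: "(NN + k) div 2^d = h'" and kN: "k < NN" by (auto simp: lv_def)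
  have "(NN + k) div 2^Suc d = h" using d h'(1)
   by (simp only: power_Suc mult.commute[of 2] div_mult2_eq) auto
  then have "k \<in> lv h" unfolding lv_def using kN by blast
  then show ?thesis using h'(2) k(2) by auto
 qed
qed

lemma lv_leaf: "k < NN ==> k \<in> lv (NN + k)"
 unfolding lv_def by (intro CollectI conjI exI[of _ 0]) auto

text \<open>On a fixed level a column determines the node above it, so nodes of one level can be
  counted through columns below them.\<close>

lemma lv_level:
 assumes "k \<in> lv h" "2^l <= h" "h < 2^Suc l"
 shows "h = (NN + k) div 2^(L - l)"
proof -
 obtain d where d: "(NN + k) div 2^d = h" and kN: "k < NN" using assms(1) by (auto simp: lv_def)
 have dL: "d <= L"
 proof (rule ccontr)
  assume "\<not> d <= L"
  then have "(2::nat)^Suc L <= 2^d" by (intro power_increasing) auto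
  then have "NN + k < 2^d" using kN by (simp add: NN_def)
  then show False using d assms(2) by simp
 qed
 have s: "(2::nat)^(L - d)*2^d = NN" using dL by (simp add: NN_def power_add[symmetric])
 have "2^(L - d) <= h" unfolding d[symmetric]
 proof -
  have "2^(L - d) = NN div 2^d" unfolding s[symmetric] by simp
  also have "\<dots> <= (NN + k) div 2^d" by (rule div_le_mono) simp
  finally show "2^(L - d) <= (NN + k) div 2^d" .
 qed
 moreover have "h < 2^Suc (L - d)"
 proof -
  have "NN + k < 2^Suc (L - d)*2^d" using s kN by simp
  then show ?thesis unfolding d[symmetric] by (simp add: less_mult_imp_div_less)
 qed
 ultimately have "l = L - d" using level_unique assms(2,3) by blast
 then show ?thesis using d dL by simp
qed

text \<open>Walk from the root to the leaf of \<open>k\<close>. Leaves are outside \<open>P\<close>,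
  so the walk meets a first node outside \<open>P\<close>, and everything up to that node is
  visited.\<close>

lemma vis_cover:
 assumes P: "\<And>h. P h ==> h < NN" and k: "k < NN"
 shows "\<exists>h\<in>vis P. \<not> P h & k \<in> lv h"
proof -
 have "(NN + k) div 2^d \<in> vis P ==> \<exists>h\<in>vis P. \<not> P h & k \<in> lv h" for d
 proof (induction d)
  case 0
  then show ?case using P[of "NN + k"] lv_leaf[OF k] by force
 next
  case (Suc d)
  let ?h = "(NN + k) div 2^Suc d" and ?h' = "(NN + k) div 2^d"
  have hh: "?h = ?h' div 2" by (metis div_mult2_eq mult.commute power_Suc)
  show ?case
  proof (cases "P ?h")
   case True
   have "x = 2*(x div 2) \<or> x = Suc (2*(x div 2))" for x :: nat by presburger
   then have "?h' = 2*?h \<or> ?h' = Suc (2*?h)" unfolding hh by blast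
   then have "?h' \<in> vis P" using vis_left[OF Suc.prems True] vis_right[OF Suc.prems True] by metis
   then show ?thesis by (rule Suc.IH)
  next
   case False
   have "k \<in> lv ?h" unfolding lv_def using k by blast
   then show ?thesis using False Suc.prems by blast
  qed
 qed
 note * = this
 have "(NN + k) div 2^L = 1" using k by (auto simp: NN_def div_nat_eqI)
 then show ?thesis using *[of L] vis_root by simp
qed

text \<open>Every visited node except the root is a child of an expanded one, which gives the factor
  2; the expanded ones are counted level by level.\<close>

lemma card_vis:
 assumes P: "\<And>h. P h ==> h < NN"
  and c: "\<And>l. l <= L ==> card {h \<in> vis P. P h & 2^l <= h & h < 2^Suc l} <= c"
 shows "card (vis P) <= 2*LG * c+1"
proof -
 let ?S = "{h \<in> vis P. P h}"
 let ?A = "%l. {h \<in> vis P. P h & 2^l <= h & h < 2^Suc l}"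
 note fv = finite_vis[of P, OF P]
 have fS: "finite ?S" using fv(2) by simp
 have "?S \<subseteq> (\<Union>l\<le>L. ?A l)"
 proof
  fix h assume h: "h \<in> ?S"
  then have "1 <= h" "h < 2^Suc L" using fv(1) by (auto simp: NN_def)
  then obtain l where "2^l <= h" "h < 2^Suc l" using ex_power_ivl1[of 2 h] by auto
  moreover have "l <= L"
  proof (rule ccontr)
   assume "\<not> l <= L"
   then have "(2::nat)^Suc L <= 2^l" by (intro power_increasing) auto
   then show False using calculation \<open>h < 2 ^ Suc L\<close> by linarith
  qed
  ultimately show "h \<in> (\<Union>l\<le>L. ?A l)" using h by blast
 qed
 then have "card ?S <= card (\<Union>l\<le>L. ?A l)" using fv(2) by (intro card_mono) auto
 also have "\<dots> <= (\<Sum>l\<le>L. card (?A l))" by (rule card_UN_le) simp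
 also have "\<dots> <= (\<Sum>l\<le>L. c)" using c by (intro sum_mono) auto
 also have "\<dots> = LG * c" by (simp add: LG_def)
 finally have S: "card ?S <= LG * c" .
 have "h \<in> {1} \<union> (%h. 2*h) ` ?S \<union> (%h. Suc (2*h)) ` ?S" if "h \<in> vis P" for h
  using that by cases auto
 then have "card (vis P) <= card ({1} \<union> (%h. 2*h) ` ?S \<union> (%h. Suc (2*h)) ` ?S)"
  using fS by (intro card_mono) auto
 also have "\<dots> <= 1 + card ?S + card ?S"
  using card_Un_le[of "{1} \<union> (%h. 2*h) ` ?S" "(%h. Suc (2*h)) ` ?S"]
   card_Un_le[of "{1}" "(%h. 2*h) ` ?S"] card_image_le[OF fS, of "%h. 2*h"]
   card_image_le[OF fS, of "%h. Suc (2*h)"] by simp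
 finally show ?thesis using S by simp
qed

end

text \<open>Common interface of the two kinds of lower bounds: sums of exact minima of row and
  query, where nodes with a large spread are \<open>high\<close>, and minima of outdated sums, where
  no node is.\<close>

locale search_data = par W B n L for W B n L +
 fixes lb vl :: "nat => int" and high :: "nat => bool" and D :: nat
 assumes lb: "1 <= h ==> k \<in> lv h ==> lb h <= vl k"
  and low: "1 <= h ==> h < 2*NN ==> \<not> high h ==> \<exists>k\<in>lv h. vl k <= lb h+int D"
  and high_inner: "high h ==> h < NN"
  and few_high: "l <= L ==> card {h. high h & 2^l <= h & h < 2^Suc l} <= NN div D"
begin

definition opt :: int where "opt = Min (vl ` {..<NN})"
definition near :: "nat set" where "near = {k. k < NN & vl k <= opt+2*int D}"

lemma opt_le: "k < NN ==> opt <= vl k"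
 unfolding opt_def by (intro Min_le) auto

lemma opt_attained: "\<exists>k<NN. vl k = opt"
proof -
 have "opt \<in> vl ` {..<NN}" unfolding opt_def using NN0 by (intro Min_in) auto
 then show ?thesis by auto
qed

lemma lv_less: "k \<in> lv h ==> k < NN" by (simp add: lv_def)

lemma card_vis_high: "card (vis high) <= 4*LG*(NN div D)+1"
proof -
 have "card {h \<in> vis high. high h & 2^l <= h & h < 2^Suc l} <= NN div D" if "l <= L" for l
 proof -
  have "finite {h. high h & 2^l <= h & h < 2^Suc l}"
   by (rule finite_subset[of _ "{..<2^Suc l}"]) auto
  then have "card {h \<in> vis high. high h & 2^l <= h & h < 2^Suc l} <= card {h. high h & 2^l <= h & h < 2^Suc l}"
   by (intro card_mono) auto
  then show ?thesis using few_high[OF that] by simp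
 qed
 from card_vis[of high, OF high_inner this] show ?thesis by simp
qed

text \<open>Phase 1 expands only high nodes, and the nodes where it stops cover all columns. Each of
  them has a column of value at most \<open>lb h + D\<close>, so no \<open>lb h + D\<close> is below
  the optimum; the one above an optimal column has \<open>lb h <= opt\<close>.\<close>

lemma bound_after_phase1:
 assumes "accres ub0 ub {h \<in> vis high. \<not> high h & True} (%h. lb h+int D)" "opt <= ub0"
 shows "opt <= ub" "ub <= opt+int D"
proof -
 have v: "1 <= h" "h < 2*NN" if "h \<in> vis high" for h
  using finite_vis(1)[of high, OF high_inner] that by auto
 have "opt <= lb h+int D" if "h \<in> vis high" "\<not> high h" for h
  using low[OF v[OF that(1)] that(2)] opt_le lv_less by (meson order_trans)
 then show "opt <= ub" using assms unfolding accres_def by auto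
 obtain k where k: "k < NN" "vl k = opt" using opt_attained by blast
 obtain h where "h \<in> vis high" "\<not> high h" "k \<in> lv h" using vis_cover[of high, OF high_inner k(1)] by blast
 moreover from this have "lb h <= opt" using lb v k(2) by fastforce
 ultimately show "ub <= opt+int D" using assms(1) unfolding accres_def by fastforce
qed

text \<open>This fixes the width \<open>2 * D\<close> of \<open>near\<close>: an expanded node that
  is not high has a column of value at most \<open>lb h + D <= ub + D <= opt + 2 * D\<close>. So
  each level has at most \<open>NN div D\<close> expanded nodes that are due to near columns and as
  many high ones.\<close>

lemma card_vis_phase2:
 assumes ub: "ub <= opt+int D" and T: "card near <= NN div D"
 shows "card (vis (%h. h < NN & lb h <= ub)) <= 4*LG*(NN div D)+1"
proof -
 let ?P = "%h. h < NN & lb h <= ub"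
 have P: "\<And>h. ?P h ==> h < NN" by blast
 have fT: "finite near" unfolding near_def by simp
 have "card {h \<in> vis ?P. ?P h & 2^l <= h & h < 2^Suc l} <= 2*(NN div D)" if l: "l <= L" for l
 proof -
  let ?H = "{h. high h & 2^l <= h & h < 2^Suc l}"
  have fH: "finite ?H" by (rule finite_subset[of _ "{..<2^Suc l}"]) auto
  have "{h \<in> vis ?P. ?P h & 2^l <= h & h < 2^Suc l} \<subseteq> ?H \<union> (%k. (NN + k) div 2^(L - l)) ` near"
  proof
   fix h assume h: "h \<in> {h \<in> vis ?P. ?P h & 2^l <= h & h < 2^Suc l}"
   show "h \<in> ?H \<union> (%k. (NN + k) div 2^(L - l)) ` near"
   proof (cases "high h")
    case False
    have "1 <= h" using h finite_vis(1)[of ?P, OF P] by auto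
    then obtain k where k: "k \<in> lv h" "vl k <= lb h+int D" using low[of h] False h by auto
    then have "k \<in> near" unfolding near_def using ub h lv_less by auto
    moreover have "h = (NN + k) div 2^(L - l)" using lv_level[OF k(1)] h by blast
    ultimately show ?thesis by blast
   qed (use h in blast)
  qed
  then have "card {h \<in> vis ?P. ?P h & 2^l <= h & h < 2^Suc l} <= card (?H \<union> (%k. (NN + k) div 2^(L - l)) ` near)"
   using fH fT by (intro card_mono) auto
  also have "\<dots> <= card ?H + card near"
   using card_Un_le[of ?H "(%k. (NN + k) div 2^(L - l)) ` near"]
    card_image_le[OF fT, of "%k. (NN + k) div 2^(L - l)"] by linarith
  finally show ?thesis using few_high[OF l] T by linarith
 qed
 from card_vis[of ?P, OF P this] show ?thesis by simp
qed

text \<open>Every node above an optimal column has \<open>lb h <= opt <= ub\<close>, so on this path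
  the search can stop only at the leaf.\<close>

lemma opt_leaf_visited:
 assumes "opt <= ub" "k < NN" "vl k = opt"
 shows "NN + k \<in> vis (%h. h < NN & lb h <= ub)"
proof -
 let ?P = "%h. h < NN & lb h <= ub"
 have P: "\<And>h. ?P h ==> h < NN" by blast
 obtain h where h: "h \<in> vis ?P" "\<not> ?P h" "k \<in> lv h" using vis_cover[of ?P, OF P assms(2)] by blast
 have "1 <= h" "h < 2*NN" using h(1) finite_vis(1)[of ?P, OF P] by auto
 then have "lb h <= ub" using lb[OF _ h(3)] assms by fastforce
 then have "NN <= h" using h(2) by simp
 obtain d where d: "(NN + k) div 2^d = h" using h(3) by (auto simp: lv_def)
 have "d = 0"
 proof (rule ccontr)
  assume "d \<noteq> 0"
  then have "(2::nat)^1 <= 2^d" by (intro power_increasing) auto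
  then have "(NN + k) div 2^d <= (NN + k) div 2" by (intro div_le_mono2) auto
  then show False using d \<open>NN <= h\<close> assms(2) by linarith
 qed
 then show ?thesis using d h(1) by simp
qed

end

text \<open>Trees of \<open>f\<close> and \<open>- f\<close> add up at a node to minus the spread of
  \<open>f\<close> below it. So the test says that the row and the query both vary by more than
  \<open>D\<close>; with the zero tree in registers 24 and 25 it always fails.\<close>

definition tst1 :: bexp where
 "tst1 = Conj (Less (TRe (R 24) (R 21)\<boxplus>TRe (R 25) (R 21)\<boxplus>R 3) (N 0))
   (Less (TRe (R 0\<boxplus>R 0) (R 21)\<boxplus>TRe (R 0\<boxplus>R 0\<boxplus>N 1) (R 21)\<boxplus>R 3) (N 0))"

definition els1 :: com where
 "els1 = If (Less (TRe (R 22) (R 21)\<boxplus>TRe (R 23) (R 21)\<boxplus>R 3) (R 26))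
   (Assign 26 (TRe (R 22) (R 21)\<boxplus>TRe (R 23) (R 21)\<boxplus>R 3)) SKIP"

definition tst2 :: bexp where
 "tst2 = Conj (Less (R 21) (R 1)) (Neg (Less (R 26) (TRe (R 22) (R 21)\<boxplus>TRe (R 23) (R 21))))"

definition els2 :: com where
 "els2 = If (Less (R 21) (R 1)) SKIP
   (If (Less (MMe (R 13) (R 21\<boxminus>R 1)\<boxplus>Rd 4 (R 21\<boxminus>R 1)) (R 27))
    (Assign 27 (MMe (R 13) (R 21\<boxminus>R 1)\<boxplus>Rd 4 (R 21\<boxminus>R 1))) SKIP)"

text \<open>Register 33 is the node bound of \<open>card_vis_high\<close> and
  \<open>card_vis_phase2\<close>. Register 26, the upper bound found by phase 1, starts at
  \<open>8 * NN\<close>, which no sum exceeds. Register 27 starts at the current answer, so the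
  search can only improve it.\<close>

definition search :: com where
 "search = Assign 33 (N 4\<boxtimes>R 2\<boxtimes>Bin Div (R 1) (R 3)\<boxplus>N 1) ;; Assign 26 (N 8\<boxtimes>R 1) ;;
   bfs tst1 els1 ;; Assign 27 (Rd 2 (R 13)) ;; bfs tst2 els2 ;; Store 2 (R 13) (R 27)"

context par
begin

lemma wr_search: "wregs search \<subseteq> {19, 20, 21, 26, 27, 33}" "warrs search \<subseteq> {2, 6}"
 by (auto simp: search_def bfs_def els1_def els2_def)

lemma trB: "bnd B s ==> \<bar>tr s r h\<bar> <= B" unfolding tr_def by (rule bnd_arrs)

text \<open>Two capped searches at 11 steps per node, with cap
  \<open>4 * LG * (NN div D) + 1\<close>, account for the factor 88. The number of near-optimal
  columns influences exactness only, not the time.\<close>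

lemma search_spec:
 fixes vl :: "nat => int"
 defines "lb \<equiv> %s r1 r2 h. tr s r1 h+tr s r2 h"
 defines "hi \<equiv> %s g1 g2 D h. 1 <= h & h < 2*NN & tr s g1 h+tr s g2 h+int D < 0 & tr s (2*n) h+tr s (2*n+1) h+int D < 0"
 assumes s: "regs s 0 = int n" "regs s 1 = int NN" "regs s 2 = int LG" "regs s 3 = int D" "regs s 13 = int i"
   "regs s 22 = int r1" "regs s 23 = int r2" "regs s 24 = int g1" "regs s 25 = int g2"
  and D: "0 < D" "D <= NN" and i: "i < n"
  and val: "\<And>k. k < NN ==> vl k = mm s i k+arrs s 4 k" "\<And>k. k < NN ==> \<bar>vl k\<bar> <= 8*int NN"
  and lbB: "\<And>h. 1 <= h ==> h < 2*NN ==> \<bar>lb s r1 r2 h\<bar> <= 8*int NN"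
  and sd: "search_data W B n L (lb s r1 r2) vl (hi s g1 g2 D) D"
 shows "T search s (%s' t. t <= 88*LG*(NN div D)+60 & (\<forall>p. p \<noteq> i --> arrs s' 2 p = arrs s 2 p) &
   arrs s' 2 i <= arrs s 2 i & (arrs s' 2 i = arrs s 2 i \<or> (\<exists>k<NN. arrs s' 2 i = vl k)) &
   (card {k. k < NN & vl k <= Min (vl ` {..<NN})+2*int D} <= NN div D -->
    arrs s' 2 i <= Min (vl ` {..<NN})))"
proof (rule T_bnd)
 assume b: "bnd B s"
 interpret S: search_data W B n L "lb s r1 r2" vl "hi s g1 g2 D" D by (rule sd)
 let ?lb = "lb s r1 r2" and ?hi = "hi s g1 g2 D"
 define cap where "cap = 4*LG*(NN div D)+1"
 have capB: "int (2 * cap+8) <= B"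
 proof (rule B_quad)
  have "LG <= n+1" using L_le by (simp add: LG_def)
  moreover have "NN div D <= 2*n" using NN_less div_le_dividend[of NN D] by linarith
  ultimately have "LG*(NN div D) <= (n+1)*(2*n)" by (rule mult_le_mono)
  then have "2 * cap+8 <= 8*((n+1)*(2*n))+10" unfolding cap_def by simp
  also have "\<dots> <= 1000*(n+2)^2" by (simp add: power2_eq_square algebra_simps)
  finally show "2 * cap+8 <= 1000*(n+2)^2" .
 qed
 have capv: "4*int LG*(int NN div int D)+1 = int cap" by (simp add: cap_def zdiv_int)
 let ?s1 = "setr s 33 (int cap)"
 let ?s2 = "setr ?s1 26 (8*int NN)"
 have opt_ub: "S.opt <= 8*int NN" using S.opt_le[OF NN0] val(2)[OF NN0] by linarith
 have DB: "int D <= int NN" using D by simp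
 have b1: "T (bfs tst1 els1) ?s2 (%s' t. t <= 11 * cap+8 & same {19, 20, 21, 26} {6} ?s2 s' &
   (\<exists>Pr. Pr \<subseteq> vis ?hi & (card (vis ?hi) <= cap --> Pr = vis ?hi) &
    accres (regs ?s2 26) (regs s' 26) {h \<in> Pr. \<not> ?hi h & True} (%h. ?lb h+int D)))"
 proof (rule bfs_spec[where x = 26 and P = ?hi and ac = "%_. True"])
  show "?hi h ==> h < NN" for h by (rule S.high_inner)
 next
  fix s' h assume sm: "same {19, 20, 21, 26} {6} ?s2 s'" and h: "regs s' 21 = int h" "1 <= h" "h < 2*NN" and b': "bnd B s'"
  have r: "regs s' r = regs s r" if "r \<notin> {19, 20, 21, 26, 33}" for r using same_regs[OF sm] that by auto
  have t: "tr s' = tr s" using same_arrs[OF sm, of 5] by (auto simp: tr_def fun_eq_iff)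
  have "av s' (TRe (R 24) (R 21)) = tr s g1 h" "av s' (TRe (R 25) (R 21)) = tr s g2 h"
   "av s' (TRe (R 0\<boxplus>R 0) (R 21)) = tr s (2*n) h" "av s' (TRe (R 0\<boxplus>R 0\<boxplus>N 1) (R 21)) = tr s (2*n+1) h"
   unfolding t[symmetric] by (rule av_TRe; use h r s in simp)+
  moreover have "0 <= av s' (TRi (R 24) (R 21))" "0 <= av s' (TRi (R 25) (R 21))"
   "0 <= av s' (TRi (R 0\<boxplus>R 0) (R 21))" "0 <= av s' (TRi (R 0\<boxplus>R 0\<boxplus>N 1) (R 21))"
   using h r s by (simp_all add: TRi_def)
  ultimately show "bok B s' tst1 & bv s' tst1 = ?hi h"
   unfolding tst1_def hi_def using B2 r s h(2,3) by (simp del: av.simps(3))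
 next
  fix s' h assume sm: "same {19, 20, 21, 26} {6} ?s2 s'" and h: "regs s' 21 = int h" "1 <= h" "h < 2*NN" and b': "bnd B s'"
  have r: "regs s' r = regs s r" if "r \<notin> {19, 20, 21, 26, 33}" for r using same_regs[OF sm] that by auto
  have t: "tr s' = tr s" using same_arrs[OF sm, of 5] by (auto simp: tr_def fun_eq_iff)
  have e: "av s' (TRe (R 22) (R 21)) = tr s r1 h" "av s' (TRe (R 23) (R 21)) = tr s r2 h"
   unfolding t[symmetric] by (rule av_TRe; use h r s in simp)+
  have p: "0 <= av s' (TRi (R 22) (R 21))" "0 <= av s' (TRi (R 23) (R 21))"
   using h r s by (simp_all add: TRi_def)
  have B: "\<bar>?lb h+int D\<bar> <= B" using lbB[OF h(2,3)] DB B_facts by linarith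
  show "T els1 s' (%s'' t. t <= 4 & s'' = s'\<lparr>regs := (regs s')
    (26 := if True then min (regs s' 26) (?lb h+int D) else regs s' 26)\<rparr>)"
   unfolding els1_def
   by (intro T_If T_Assign T_Skip) (use e p B2 r s B in \<open>auto simp: min_def lb_def simp del: av.simps(3)\<close>)
 qed (use capB in auto)
 show ?thesis unfolding search_def
 proof (rule T_AssignS[where v = "int cap"], goal_cases)
  case 5
  show ?case
  proof (rule T_AssignS[where v = "8*int NN"], goal_cases)
   case 5
   show ?case
   proof (rule T_Seq, rule T_conseq[OF b1], goal_cases)
    case (1 s3 t3)
    have "card (vis ?hi) <= cap" using S.card_vis_high by (simp add: cap_def)
    then have acc1: "accres (8*int NN) (regs s3 26) {h \<in> vis ?hi. \<not> ?hi h & True} (%h. ?lb h+int D)"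
     and sm3: "same {19, 20, 21, 26} {6} ?s2 s3" and t3: "t3 <= 11 * cap+8" using 1 by auto
    note ub = S.bound_after_phase1[OF acc1 opt_ub]
    define ub3 where "ub3 = regs s3 26"
    let ?P = "%h. h < NN & ?lb h <= ub3"
    let ?s4 = "setr s3 27 (arrs s 2 i)"
    have r3: "regs s3 r = regs s r" if "r \<notin> {19, 20, 21, 26, 33}" for r using same_regs[OF sm3] that by auto
    have a3: "arrs s3 a = arrs s a" if "a \<noteq> 6" for a using same_arrs[OF sm3] that by auto
    have b2: "T (bfs tst2 els2) ?s4 (%s' t. t <= 11 * cap+8 & same {19, 20, 21, 27} {6} ?s4 s' &
      (\<exists>Pr. Pr \<subseteq> vis ?P & (card (vis ?P) <= cap --> Pr = vis ?P) &
       accres (regs ?s4 27) (regs s' 27) {h \<in> Pr. \<not> ?P h & NN <= h} (%h. vl (h - NN))))"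
    proof (rule bfs_spec[where x = 27 and P = ?P and ac = "%h. NN <= h"])
     show "regs ?s4 33 = int cap" using same_regs[OF sm3, of 33] by simp
    next
     fix s' h assume sm: "same {19, 20, 21, 27} {6} ?s4 s'" and h: "regs s' 21 = int h" "1 <= h" "h < 2*NN" and b': "bnd B s'"
     have r: "regs s' r = regs s r" if "r \<notin> {19, 20, 21, 26, 27, 33}" for r using same_regs[OF sm] r3 that by auto
     have u: "regs s' 26 = ub3" using same_regs[OF sm, of 26] by (simp add: ub3_def)
     have t: "tr s' = tr s" using same_arrs[OF sm, of 5] a3[of 5] by (auto simp: tr_def fun_eq_iff)
     have e: "av s' (TRe (R 22) (R 21)) = tr s r1 h" "av s' (TRe (R 23) (R 21)) = tr s r2 h"
      unfolding t[symmetric] by (rule av_TRe; use h r s in simp)+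
     have p: "0 <= av s' (TRi (R 22) (R 21))" "0 <= av s' (TRi (R 23) (R 21))"
      using h r s by (simp_all add: TRi_def)
     show "bok B s' tst2 & bv s' tst2 = ?P h"
      unfolding tst2_def lb_def using e p B2 r s u h(1) by (auto simp del: av.simps(3))
    next
     fix s' h assume sm: "same {19, 20, 21, 27} {6} ?s4 s'" and h: "regs s' 21 = int h" "1 <= h" "h < 2*NN" and b': "bnd B s'"
     have r: "regs s' r = regs s r" if "r \<notin> {19, 20, 21, 26, 27, 33}" for r using same_regs[OF sm] r3 that by auto
     have a: "arrs s' a = arrs s a" if "a \<noteq> 6" for a using same_arrs[OF sm] a3 that by auto
     have mm: "mm s' = mm s" using a[of 3] by (auto simp: mm_def fun_eq_iff)
     have reg: "regs s' 1 = int NN" "regs s' 13 = int i" using r s by auto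
     show "T els2 s' (%s'' t. t <= 4 & s'' = s'\<lparr>regs := (regs s')
       (27 := if NN <= h then min (regs s' 27) (vl (h - NN)) else regs s' 27)\<rparr>)"
     proof (cases "h < NN")
      case True
      then show ?thesis unfolding els2_def using reg h(1)
       by (intro T_If T_Skip) auto
     next
      case False
      then have k: "h - NN < NN" using h by auto
      have hk: "av s' (R 21\<boxminus>R 1) = int (h - NN)" using reg h False by simp
      have e: "av s' (MMe (R 13) (R 21\<boxminus>R 1)) = mm s i (h - NN)"
       unfolding mm[symmetric] by (rule av_MMe[OF _ hk]) (use reg in auto)
      have e': "av s' (Rd 4 (R 21\<boxminus>R 1)) = arrs s 4 (h - NN)"
       unfolding av.simps(3) hk nat_int using a[of 4] by simp
      have p: "0 <= av s' (MMi (R 13) (R 21\<boxminus>R 1))" "0 <= av s' (R 21\<boxminus>R 1)"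
       unfolding hk using reg hk by (simp_all add: MMi_def)
      have B: "\<bar>vl (h - NN)\<bar> <= B" using val(2)[OF k] B_facts by linarith
      have ev: "av s' (MMe (R 13) (R 21\<boxminus>R 1)\<boxplus>Rd 4 (R 21\<boxminus>R 1)) = vl (h - NN)"
       unfolding val(1)[OF k] av.simps(4) e e' by simp
      have nl: "\<not> bv s' (Less (R 21) (R 1))" using reg h(1) False by simp
      have "T (If (Less (MMe (R 13) (R 21\<boxminus>R 1)\<boxplus>Rd 4 (R 21\<boxminus>R 1)) (R 27))
    (Assign 27 (MMe (R 13) (R 21\<boxminus>R 1)\<boxplus>Rd 4 (R 21\<boxminus>R 1))) SKIP) s' (%s'' t. Suc t <= 4 & s'' = s'\<lparr>regs := (regs s')
       (27 := if NN <= h then min (regs s' 27) (vl (h - NN)) else regs s' 27)\<rparr>)"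
       apply (rule T_If)
        apply (use p in simp)
        apply (rule T_Assign)
         apply (use p in simp)
         apply simp
        apply (use ev B in simp)
        apply (use ev False in \<open>simp add: min_def\<close>)
       apply (rule T_Skip)
       apply (use ev False in \<open>simp add: min_def\<close>)
       done
      note inner = this
      show ?thesis unfolding els2_def
       by (rule T_If) (simp, use nl in blast, rule inner)
     qed
    qed (use capB in auto)
    have sB: "\<bar>arrs s 2 i\<bar> <= B" using bnd_arrs[OF b] .
    show ?case
    proof (rule T_AssignS[where v = "arrs s 2 i"], goal_cases)
     case 5
     show ?case
     proof (rule T_Seq, rule T_conseq[OF b2], goal_cases)
      case (1 s5 t5)
      then obtain Pr where Pr: "Pr \<subseteq> vis ?P" "card (vis ?P) <= cap --> Pr = vis ?P"
       "accres (arrs s 2 i) (regs s5 27) {h \<in> Pr. \<not> ?P h & NN <= h} (%h. vl (h - NN))"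
       and sm5: "same {19, 20, 21, 27} {6} ?s4 s5" and t5: "t5 <= 11 * cap+8" and b5: "bnd B s5" by auto
      have h2: "h - NN < NN" if "h \<in> Pr" "NN <= h" for h
       using finite_vis(1)[of ?P] Pr(1) that by fastforce
      have le: "regs s5 27 <= arrs s 2 i" using Pr(3) by (simp add: accres_def)
      have at: "regs s5 27 = arrs s 2 i \<or> (\<exists>k<NN. regs s5 27 = vl k)"
       using Pr(3) h2 unfolding accres_def by fastforce
      have op: "regs s5 27 <= S.opt" if "card S.near <= NN div D"
      proof -
       have "Pr = vis ?P" using Pr(2) S.card_vis_phase2[OF _ that, of ub3] ub(2) by (simp add: cap_def ub3_def)
       moreover obtain k where k: "k < NN" "vl k = S.opt" using S.opt_attained by blast
       moreover have "NN + k \<in> vis ?P" using S.opt_leaf_visited[OF _ k] ub(1) by (simp add: ub3_def)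
       ultimately have "NN + k \<in> {h \<in> Pr. \<not> ?P h & NN <= h}" by simp
       then have "regs s5 27 <= vl (NN + k - NN)" using Pr(3) unfolding accres_def by blast
       then show ?thesis using k by simp
      qed
      have r5: "regs s5 13 = int i" using same_regs[OF sm5, of 13] r3[of 13] s by simp
      have a5: "arrs s5 2 = arrs s 2" using same_arrs[OF sm5, of 2] a3[of 2] by simp
      show ?case
      proof (rule T_StoreV[where p = i and v = "regs s5 27"], goal_cases)
       case 8
       show ?case using le at op t3 t5 a5 unfolding S.opt_def S.near_def cap_def by auto
      qed (use r5 bnd_regs[OF b5] in auto)
     qed
    qed (use r3 s a3 sB in auto)
   qed
  qed (use s B_facts B2 in auto)
 qed (use s D capv capB B_facts in simp_all)
qed

end

text \<open>
 Row \<open>R 13\<close> of the answer. Register 12 is the mode: 1 if the rows of the matrix or the query are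
 monotone, 2 if the columns are, 3 if the queries are monotone in time. In modes 2 and 3 a tree of
 outdated sums (\<open>2n + 3\<close> and \<open>2n + 4 + i\<close>) is first refreshed at the columns listed in array 7.
 Trees \<open>i\<close>, \<open>n + i\<close>, \<open>2n\<close>, \<open>2n + 1\<close>, \<open>2n + 2\<close> hold row \<open>i\<close>, its negation, the query, its negation and 0.
\<close>

definition refresh :: com where
 "refresh = While (Less (R 28) (R 29))
   (Assign 16 (Rd 7 (R 28)) ;; Assign 17 (MMe (R 13) (R 16)\<boxplus>Rd 4 (R 16)) ;; upd ;;
   Assign 28 (R 28\<boxplus>N 1))"

definition row_tail :: com where
 "row_tail = Assign 15 (R 22) ;; refresh ;; search"

text \<open>Array 8 is an offset table into the event list of array 7. The stride
  \<open>n + 1\<close> leaves room for an end marker after the last row of each radius.\<close>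

definition EPi :: "aexp => aexp" where
 "EPi i = R 3\<boxtimes>(R 0\<boxplus>N 1)\<boxplus>i"

definition row :: com where
 "row = If (Equal (R 12) (N 1))
   (Assign 22 (R 13) ;; Assign 23 (R 0\<boxplus>R 0) ;; Assign 24 (R 13) ;; Assign 25 (R 0\<boxplus>R 13) ;;
    Assign 28 (N 0) ;; Assign 29 (N 0))
   (Assign 23 (R 0\<boxplus>R 0\<boxplus>N 2) ;; Assign 24 (R 23) ;; Assign 25 (R 23) ;;
    If (Equal (R 12) (N 2))
     (Assign 22 (R 0\<boxplus>R 0\<boxplus>N 3) ;; Assign 28 (Rd 8 (EPi (R 13))) ;; Assign 29 (Rd 8 (EPi (R 13\<boxplus>N 1))))
     (Assign 22 (R 0\<boxplus>R 0\<boxplus>N 4\<boxplus>R 13) ;; Assign 28 (R 11) ;; Assign 29 (R 37))) ;;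
  row_tail"

section \<open>Search nodes under monotonicity and with outdated sums\<close>

context par
begin

text \<open>Nodes of one level cover disjoint blocks of consecutive columns. For monotone
  \<open>f\<close> the value ranges of these blocks do not overlap, and each node of
  \<open>H\<close> uses up at least \<open>D\<close> of the \<open>n\<close> possible
  values.\<close>

lemma mono_few:
 fixes f :: "nat => int"
 assumes mono: "\<And>k. k+1 < NN ==> f k <= f (k+1)"
  and rng: "\<And>k. k < NN ==> 1 <= f k & f k <= int n" and D: "0 < D"
  and H: "\<And>h. h \<in> H ==> 2^l <= h & h < 2^Suc l & (\<exists>k1\<in>lv h. \<exists>k2\<in>lv h. f k1+int D < f k2)"
 shows "card H <= NN div D"
proof -
 have fm: "f a <= f b" if "a <= b" "b < NN" for a b
  using that
 proof (induction b rule: dec_induct)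
  case (step m)
  then show ?case using mono[of m] by force
 qed simp
 have fH: "finite H" by (rule finite_subset[of _ "{..<2^Suc l}"]) (use H in auto)
 have "\<exists>p. fst p \<in> lv h & snd p \<in> lv h & f (fst p)+int D < f (snd p)" if h: "h \<in> H" for h
 proof -
  obtain k1 k2 where "k1 \<in> lv h" "k2 \<in> lv h" "f k1+int D < f k2" using H[OF h] by blast
  then show ?thesis by (intro exI[of _ "(k1, k2)"]) simp
 qed
 then have "\<forall>h\<in>H. \<exists>p. fst p \<in> lv h & snd p \<in> lv h & f (fst p)+int D < f (snd p)" by blast
 from bchoice[OF this] obtain p where
  p: "\<forall>h\<in>H. fst (p h) \<in> lv h & snd (p h) \<in> lv h & f (fst (p h))+int D < f (snd (p h))" by blast
 define a b where "a h = fst (p h)" and "b h = snd (p h)" for h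
 have ab: "a h \<in> lv h" "b h \<in> lv h" "f (a h)+int D < f (b h)" if "h \<in> H" for h
  using p that by (auto simp: a_def b_def)
 have lt: "a h < NN" "b h < NN" if "h \<in> H" for h using ab[OF that] by (auto simp: lv_def)
 \<comment> \<open>Blocks of a level are ordered like their nodes, so the column of the earlier
   block comes first.\<close>
 have ord: "f (b h) <= f (a h')" if "h \<in> H" "h' \<in> H" "h < h'" for h h'
 proof -
  have "h = (NN+b h) div 2^(L - l)" "h' = (NN+a h') div 2^(L - l)"
   using lv_level[OF ab(2)[OF that(1)], of l] lv_level[OF ab(1)[OF that(2)], of l]
    H[OF that(1)] H[OF that(2)] by auto
  moreover have "(NN+a h') div 2^(L - l) <= (NN+b h) div 2^(L - l)" if "a h' <= b h"
   using that by (intro div_le_mono) simp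
  ultimately have "b h < a h'" using that(3) by linarith
  then show ?thesis using fm lt that by simp
 qed
 let ?J = "%h. {f (a h)<..f (b h)}"
 have dis: "disjoint_family_on ?J H" unfolding disjoint_family_on_def
 proof (intro ballI impI)
  fix h h' assume h: "h \<in> H" "h' \<in> H" "h \<noteq> h'"
  consider "h < h'" | "h' < h" using h(3) by linarith
  then show "?J h \<inter> ?J h' = {}"
  proof cases
   case 1
   then show ?thesis using ord[OF h(1,2)] by auto
  next
   case 2
   then show ?thesis using ord[OF h(2,1)] by auto
  qed
 qed
 have "card H*D = (\<Sum>h\<in>H. D)" by simp
 also have "\<dots> <= (\<Sum>h\<in>H. card (?J h))"
 proof (rule sum_mono)
  fix h assume "h \<in> H"
  then show "D <= card (?J h)" using ab(3)[of h] by simp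
 qed
 also have "\<dots> = card (\<Union>h\<in>H. ?J h)"
  using dis fH by (subst card_UN_disjoint) (auto simp: disjoint_family_on_def)
 also have "\<dots> <= card {1..int n}"
 proof (rule card_mono)
  show "(\<Union>h\<in>H. ?J h) \<subseteq> {1..int n}"
  proof
   fix y assume "y \<in> (\<Union>h\<in>H. ?J h)"
   then obtain h where h: "h \<in> H" "f (a h) < y" "y <= f (b h)" by auto
   then show "y \<in> {1..int n}" using rng[OF lt(1)[OF h(1)]] rng[OF lt(2)[OF h(1)]] by auto
  qed
 qed simp
 also have "\<dots> <= NN" using n_le_NN by simp
 finally show ?thesis using D by (simp add: less_eq_div_iff_mult_less_eq)
qed

text \<open>Deliberately one-sided: with many near-optimal columns the search may miss the optimum,
  and then a sampled column must already have supplied it.\<close>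

definition outpost :: "nat => (nat => int) => int => int => bool" where
 "outpost D vl x x' \<longleftrightarrow> x' <= x & (x' = x \<or> (\<exists>k<NN. x' = vl k)) &
   (card {k. k < NN & vl k <= Min (vl ` {..<NN})+2*int D} <= NN div D --> x' <= Min (vl ` {..<NN}))"

definition base :: "state => nat => bool" where
 "base s D \<longleftrightarrow> regs s 0 = int n & regs s 1 = int NN & regs s 2 = int LG & regs s 3 = int D & 0 < D & D <= NN"

lemma lv_nonempty_bound: "k \<in> lv h ==> h < 2*NN"
proof -
 assume "k \<in> lv h"
 then obtain d where "(NN + k) div 2^d = h" "k < NN" by (auto simp: lv_def)
 moreover have "(NN + k) div 2^d <= NN + k" by simp
 ultimately show ?thesis by linarith
qed

lemma lv_leaf_eq: "NN <= h ==> k \<in> lv h ==> h = NN + k"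
proof -
 assume a: "NN <= h" "k \<in> lv h"
 then obtain d where d: "(NN + k) div 2^d = h" "k < NN" by (auto simp: lv_def)
 have "d = 0"
 proof (rule ccontr)
  assume "d \<noteq> 0"
  then have "(2::nat)^1 <= 2^d" by (intro power_increasing) auto
  then have "(NN + k) div 2^d <= (NN + k) div 2" by (intro div_le_mono2) auto
  then show False using d a by linarith
 qed
 then show ?thesis using d by simp
qed

text \<open>A node is high only if row and query both vary by more than \<open>D\<close> below it,
  so monotonicity of either one makes high nodes rare. If one of them varies by at most
  \<open>D\<close>, the column minimising the other comes within \<open>D\<close> of the sum of the
  two minima.\<close>

lemma search_exact:
 fixes f v :: "nat => int"
 assumes s: "base s D" "regs s 13 = int i" "i < n" "regs s 22 = int i" "regs s 23 = int (2*n)"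
   "regs s 24 = int i" "regs s 25 = int (n+i)"
  and t: "trep s i f" "trep s (n+i) (%k. - f k)" "trep s (2*n) v" "trep s (2*n+1) (%k. - v k)"
  and m: "\<And>k. k < NN ==> mm s i k = f k" "\<And>k. k < NN ==> arrs s 4 k = v k"
  and rng: "\<And>k. k < NN ==> 1 <= f k & f k <= int n" "\<And>k. k < NN ==> 1 <= v k & v k <= int n"
  and mono: "(\<forall>k. k+1 < NN --> f k <= f (k+1)) \<or> (\<forall>k. k+1 < NN --> v k <= v (k+1))"
 shows "T search s (%s' t. t <= 88*LG*(NN div D)+60 & (\<forall>p. p \<noteq> i --> arrs s' 2 p = arrs s 2 p) &
   outpost D (%k. f k + v k) (arrs s 2 i) (arrs s' 2 i))"
 unfolding outpost_def
proof (rule search_spec)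
 have D: "0 < D" "D <= NN" using s(1) by (auto simp: base_def)
 have nN: "int n <= int NN" using n_le_NN by simp
 have att: "\<exists>k\<in>lv h. tr s i h = f k" "\<exists>k\<in>lv h. tr s (n+i) h = - f k"
  "\<exists>k\<in>lv h. tr s (2*n) h = v k" "\<exists>k\<in>lv h. tr s (2*n+1) h = - v k" if "1 <= h" "h < 2*NN" for h
  using tree_attained[OF t(1) that] tree_attained[OF t(2) that] tree_attained[OF t(3) that]
   tree_attained[OF t(4) that] by auto
 have lo: "tr s i h <= f k" "tr s (n+i) h <= - f k" "tr s (2*n) h <= v k" "tr s (2*n+1) h <= - v k"
  if "1 <= h" "k \<in> lv h" for h k
  using tree_lower[OF t(1) that(2,1)] tree_lower[OF t(2) that(2,1)] tree_lower[OF t(3) that(2,1)]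
   tree_lower[OF t(4) that(2,1)] by auto
 have lvN: "k < NN" if "k \<in> lv h" for k h using that by (simp add: lv_def)
 show "\<bar>tr s i h+tr s (2*n) h\<bar> <= 8*int NN" if h: "1 <= h" "h < 2*NN" for h
 proof -
  obtain k k' where k: "k \<in> lv h" "tr s i h = f k" "k' \<in> lv h" "tr s (2*n) h = v k'"
   using att[OF h] by blast
  then show ?thesis using rng(1)[of k] rng(2)[of k'] lvN nN by auto
 qed
 let ?lb = "%h. tr s i h+tr s (2*n) h"
 let ?hi = "%h. 1 <= h & h < 2*NN & tr s i h+tr s (n+i) h+int D < 0 &
   tr s (2*n) h+tr s (2*n+1) h+int D < 0"
 show "search_data W B n L ?lb (%k. f k + v k) ?hi D"
 proof unfold_locales
  fix h k assume "1 <= h" "k \<in> lv h"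
  then show "?lb h <= f k + v k" using lo[of h k] by simp
 next
  fix h assume h: "1 <= h" "h < 2*NN" "\<not> ?hi h"
  obtain k k' where k: "k \<in> lv h" "tr s i h = f k" "k' \<in> lv h" "tr s (2*n) h = v k'"
   using att[OF h(1,2)] by blast
  consider "0 <= tr s i h+tr s (n+i) h+int D" | "0 <= tr s (2*n) h+tr s (2*n+1) h+int D"
   using h by linarith
  then show "\<exists>k\<in>lv h. f k + v k <= ?lb h+int D"
  proof cases
   case 1
   then have "f k' + v k' <= ?lb h+int D" using lo(2)[OF h(1) k(3)] k(4) by linarith
   then show ?thesis using k(3) by blast
  next
   case 2
   then have "f k + v k <= ?lb h+int D" using lo(4)[OF h(1) k(1)] k(2) by linarith
   then show ?thesis using k(1) by blast
  qed
 next
  fix h assume h: "?hi h"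
  show "h < NN"
  proof (rule ccontr)
   assume n: "\<not> h < NN"
   obtain k k' where "k \<in> lv h" "tr s i h = f k" "k' \<in> lv h" "tr s (n+i) h = - f k'"
    using att h by blast
   moreover from this have "k = k'" using lv_leaf_eq[of h k] lv_leaf_eq[of h k'] n by simp
   ultimately show False using h by simp
  qed
 next
  fix l assume "l <= L"
  let ?H = "{h. ?hi h & 2^l <= h & h < 2^Suc l}"
  from mono show "card ?H <= NN div D"
  proof
   assume mf: "\<forall>k. k+1 < NN --> f k <= f (k+1)"
   show ?thesis
   proof (rule mono_few[of f D ?H l])
    fix h assume h: "h \<in> ?H"
    then obtain k k' where "k \<in> lv h" "tr s i h = f k" "k' \<in> lv h" "tr s (n+i) h = - f k'"
     using att by blast
    then show "2^l <= h & h < 2^Suc l & (\<exists>k1\<in>lv h. \<exists>k2\<in>lv h. f k1+int D < f k2)"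
     using h by (intro conjI bexI[of _ k] bexI[of _ k']) auto
   qed (use mf rng(1) D in auto)
  next
   assume mv: "\<forall>k. k+1 < NN --> v k <= v (k+1)"
   show ?thesis
   proof (rule mono_few[of v D ?H l])
    fix h assume h: "h \<in> ?H"
    then obtain k k' where "k \<in> lv h" "tr s (2*n) h = v k" "k' \<in> lv h" "tr s (2*n+1) h = - v k'"
     using att by blast
    then show "2^l <= h & h < 2^Suc l & (\<exists>k1\<in>lv h. \<exists>k2\<in>lv h. v k1+int D < v k2)"
     using h by (intro conjI bexI[of _ k] bexI[of _ k']) auto
   qed (use mv rng(2) D in auto)
  qed
 qed
 show "\<bar>f k + v k\<bar> <= 8*int NN" if "k < NN" for k using rng[OF that] nN by linarith
qed (use s m in \<open>auto simp: base_def\<close>)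

text \<open>The outdated sums \<open>g\<close> lie at most \<open>D\<close> below the true ones, so
  their exact minimum over a node is a lower bound with error at most \<open>D\<close>, and no node
  is high. The zero tree fills the second summand, so the same search program applies.\<close>

lemma search_stale:
 fixes f v g :: "nat => int"
 assumes s: "base s D" "regs s 13 = int i" "i < n" "regs s 22 = int r" "regs s 23 = int (2*n+2)"
   "regs s 24 = int (2*n+2)" "regs s 25 = int (2*n+2)"
  and t: "trep s r g" and z: "\<And>h. h < 2*NN ==> tr s (2*n+2) h = 0"
  and m: "\<And>k. k < NN ==> mm s i k = f k" "\<And>k. k < NN ==> arrs s 4 k = v k"
  and rng: "\<And>k. k < NN ==> 1 <= f k & f k <= int n" "\<And>k. k < NN ==> 1 <= v k & v k <= int n"
  and g: "\<And>k. k < NN ==> g k <= f k + v k & f k + v k <= g k+int D"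
 shows "T search s (%s' t. t <= 88*LG*(NN div D)+60 & (\<forall>p. p \<noteq> i --> arrs s' 2 p = arrs s 2 p) &
   outpost D (%k. f k + v k) (arrs s 2 i) (arrs s' 2 i))"
 unfolding outpost_def
proof (rule search_spec)
 have D: "0 < D" "D <= NN" using s(1) by (auto simp: base_def)
 have nN: "int n <= int NN" using n_le_NN by simp
 have lvN: "k < NN" if "k \<in> lv h" for k h using that by (simp add: lv_def)
 show "\<bar>tr s r h+tr s (2*n+2) h\<bar> <= 8*int NN" if h: "1 <= h" "h < 2*NN" for h
 proof -
  obtain k where k: "k \<in> lv h" "tr s r h = g k" using tree_attained[OF t h] by blast
  show ?thesis using rng(1)[OF lvN[OF k(1)]] rng(2)[OF lvN[OF k(1)]] g[OF lvN[OF k(1)]] k(2) nN D z[OF h(2)] by auto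
 qed
 let ?lb = "%h. tr s r h+tr s (2*n+2) h"
 let ?hi = "%h. 1 <= h & h < 2*NN & tr s (2*n+2) h+tr s (2*n+2) h+int D < 0 &
   tr s (2*n) h+tr s (2*n+1) h+int D < 0"
 have hi: "?hi = (%_. False)" using z by auto
 show "search_data W B n L ?lb (%k. f k + v k) ?hi D" unfolding hi
 proof unfold_locales
  fix h k assume hk: "1 <= h" "k \<in> lv h"
  then show "?lb h <= f k + v k"
   using tree_lower[OF t hk(2,1)] g[OF lvN[OF hk(2)]] z[OF lv_nonempty_bound[OF hk(2)]] by simp
 next
  fix h :: nat assume h: "1 <= h" "h < 2*NN"
  obtain k where k: "k \<in> lv h" "tr s r h = g k" using tree_attained[OF t h] by blast
  then show "\<exists>k\<in>lv h. f k + v k <= ?lb h+int D"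
   using g[OF lvN[OF k(1)]] z[OF h(2)] by (intro bexI[of _ k]) auto
 qed auto
 show "\<bar>f k + v k\<bar> <= 8*int NN" if "k < NN" for k using rng(1)[OF that] rng(2)[OF that] nN by linarith
qed (use s m in \<open>auto simp: base_def\<close>)

lemma refresh_spec:
 assumes s: "regs s 1 = int NN" "regs s 13 = int i" "regs s 15 = int r" "regs s 28 = int lo" "regs s 29 = int (lo+length evs)"
  and ev: "\<And>x. x < length evs ==> arrs s 7 (lo+x) = int (evs ! x)" "\<And>k. k \<in> set evs ==> k < NN"
  and t: "trep s r f" and val: "\<And>k. k \<in> set evs ==> mm s i k+arrs s 4 k = vl k" "\<And>k. k \<in> set evs ==> \<bar>vl k\<bar> <= B"
 shows "T refresh s (%s' t. t <= length evs*(7*LG+8)+1 &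
   trep s' r (%k. if k \<in> set evs then vl k else f k) &
   (\<forall>r' h. r' \<noteq> r --> h < 2*NN --> tr s' r' h = tr s r' h))"
proof -
 define I where "I s' kp \<longleftrightarrow> (\<exists>x\<le>length evs. regs s' 28 = int (lo+x) & same {16, 17, 18, 28} {5} s s' &
   trep s' r (%k. if k \<in> set (take x evs) then vl k else f k) & kp <= x*(7*LG+8) &
   (\<forall>r' h. r' \<noteq> r --> h < 2*NN --> tr s' r' h = tr s r' h))" for s' kp
 show ?thesis unfolding refresh_def
 proof (rule T_While[where I = I and \<mu> = "%s'. nat (regs s' 29 - regs s' 28)"])
  show "I s 0" unfolding I_def by (rule exI[of _ 0]) (use s t in auto)
 next
  fix s' kp assume I: "I s' kp" and "\<not> bv s' (Less (R 28) (R 29))"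
  then obtain x where x: "x <= length evs" "regs s' 28 = int (lo+x)" "same {16, 17, 18, 28} {5} s s'"
   "trep s' r (%k. if k \<in> set (take x evs) then vl k else f k)" "kp <= x*(7*LG+8)"
   "\<forall>r' h. r' \<noteq> r --> h < 2*NN --> tr s' r' h = tr s r' h" "\<not> regs s' 28 < regs s' 29"
   unfolding I_def by auto
  have "regs s' 29 = int (lo+length evs)" using same_regs[OF x(3), of 29] s by simp
  then have "x = length evs" using x by simp
  then show "Suc kp <= length evs*(7*LG+8)+1 & trep s' r (%k. if k \<in> set evs then vl k else f k) &
   (\<forall>r' h. r' \<noteq> r --> h < 2*NN --> tr s' r' h = tr s r' h)" using x by simp
 next
  fix s' kp assume I: "I s' kp" and b: "bnd B s'" and "bv s' (Less (R 28) (R 29))"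
  then obtain x where x: "x <= length evs" "regs s' 28 = int (lo+x)" "same {16, 17, 18, 28} {5} s s'"
   "trep s' r (%k. if k \<in> set (take x evs) then vl k else f k)" "kp <= x*(7*LG+8)"
   "\<forall>r' h. r' \<noteq> r --> h < 2*NN --> tr s' r' h = tr s r' h" "regs s' 28 < regs s' 29"
   unfolding I_def by auto
  have r: "regs s' q = regs s q" if "q \<notin> {16, 17, 18, 28}" for q using same_regs[OF x(3) that] .
  have a: "arrs s' q = arrs s q" if "q \<noteq> 5" for q using same_arrs[OF x(3)] that by simp
  have xl: "x < length evs" using x(2,7) r[of 29] s by simp
  define k where "k = evs ! x"
  have k: "k \<in> set evs" "k < NN" using xl ev(2) by (auto simp: k_def)
  have mm: "mm s' = mm s" using a[of 3] by (auto simp: mm_def fun_eq_iff)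
  have e7: "arrs s' 7 (lo+x) = int k" using ev(1)[OF xl] a[of 7] by (simp add: k_def)
  have kB: "int k <= B" using k(2) B_facts by linarith
  have hiB: "\<bar>int (lo+length evs)\<bar> <= B" using bnd_regs[OF b, of 29] r[of 29] s by simp
  let ?s1 = "setr s' 16 (int k)"
  let ?s2 = "setr ?s1 17 (vl k)"
  have e: "av ?s1 (MMe (R 13) (R 16)) = mm s i k"
  proof -
   have "av ?s1 (MMe (R 13) (R 16)) = mm ?s1 i k" by (rule av_MMe) (use r s in auto)
   then show ?thesis using a[of 3] by (simp add: mm_def del: av.simps)
  qed
  have t2: "trep ?s2 r (%k. if k \<in> set (take x evs) then vl k else f k)"
   by (rule trep_cong[OF x(4)]) (simp add: tr_def)
  have U: "T upd ?s2 (%s3 t. t <= 7*LG &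
    trep s3 r ((%k. if k \<in> set (take x evs) then vl k else f k)(k := regs ?s2 17)) &
    (\<forall>r' h. r' \<noteq> r --> h < 2*NN --> tr s3 r' h = tr ?s2 r' h) & same {18} {5} ?s2 s3)"
   by (rule upd_spec[OF _ _ _ _ t2]) (use r s k in auto)
  show "T (Assign 16 (Rd 7 (R 28)) ;; Assign 17 (MMe (R 13) (R 16)\<boxplus>Rd 4 (R 16)) ;; upd ;;
   Assign 28 (R 28\<boxplus>N 1)) s' (%s'' t. I s'' (Suc (kp + t)) &
     nat (regs s'' 29 - regs s'' 28) < nat (regs s' 29 - regs s' 28))"
  proof (rule T_AssignS[where v = "int k"], goal_cases)
   case 1
   show ?case using x(2) e7 by (simp del: of_nat_add)
  next
   case 5
   show ?case
   proof (rule T_AssignS[where v = "vl k"], goal_cases)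
    case 1
    show ?case using e a[of 4] val(1)[OF k(1)] by (simp del: av.simps(3)) simp
   next
    case 2
    show ?case using r s by (simp add: MMi_def)
   next
    case 5
    show ?case
    proof (rule T_Seq, rule T_conseq[OF U], goal_cases)
     case (1 s3 t3)
     have r3: "regs s3 28 = int (lo+x)" using 1 same_regs[of "{18}" "{5}" ?s2 s3 28] x(2) by simp
     show ?case
     proof (rule T_AssignV[where v = "int (lo+Suc x)"], goal_cases)
      case 5
      let ?s4 = "setr s3 28 (int (lo+Suc x))"
      have "same {16, 17, 18, 28} {5} s ?s4" using 1 x(3) by (auto simp: same_def)
      moreover have "trep ?s4 r (%k. if k \<in> set (take (Suc x) evs) then vl k else f k)"
      proof -
       have "trep s3 r (%k. if k \<in> set (take (Suc x) evs) then vl k else f k)"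
       proof (rule trep_fun_cong)
        show "trep s3 r ((%k. if k \<in> set (take x evs) then vl k else f k)(k := vl k))" using 1 by simp
       qed (use xl in \<open>auto simp: take_Suc_conv_app_nth k_def\<close>)
       then show ?thesis by (rule trep_cong) (simp add: tr_def)
      qed
      moreover have "\<forall>r' h. r' \<noteq> r --> h < 2*NN --> tr ?s4 r' h = tr s r' h"
       using 1 x(6) by (simp add: tr_def)
      moreover have "Suc (kp + Suc (Suc (Suc (Suc (Suc (t3+1)))))) <= Suc x*(7*LG+8)"
       using 1 x(5) by simp
      moreover have "regs s3 29 = regs s' 29" using 1 same_regs[of "{18}" "{5}" ?s2 s3 29] by simp
      ultimately show ?case using xl x(2,7) unfolding I_def
       by (intro conjI exI[of _ "Suc x"]) auto
     qed (use r3 hiB xl B2 in auto)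
    qed
   qed (use val(2)[OF k(1)] in auto)
  qed (use kB x(2) in auto)
 qed auto
qed

end

context par
begin

lemma search_no5: "5 \<notin> warrs search"
 using wr_search(2) by fastforce

lemma row_tail_exact:
 fixes f v :: "nat => int"
 assumes s: "base s D" "regs s 13 = int i" "i < n" "regs s 22 = int i" "regs s 23 = int (2*n)"
   "regs s 24 = int i" "regs s 25 = int (n+i)" "regs s 28 = 0" "regs s 29 = 0"
  and t: "trep s i f" "trep s (n+i) (%k. - f k)" "trep s (2*n) v" "trep s (2*n+1) (%k. - v k)"
  and m: "\<And>k. k < NN ==> mm s i k = f k" "\<And>k. k < NN ==> arrs s 4 k = v k"
  and rng: "\<And>k. k < NN ==> 1 <= f k & f k <= int n" "\<And>k. k < NN ==> 1 <= v k & v k <= int n"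
  and mono: "(\<forall>k. k+1 < NN --> f k <= f (k+1)) \<or> (\<forall>k. k+1 < NN --> v k <= v (k+1))"
 shows "T row_tail s (%s' t. t <= 88*LG*(NN div D)+66 & (\<forall>p. p \<noteq> i --> arrs s' 2 p = arrs s 2 p) &
   outpost D (%k. f k + v k) (arrs s 2 i) (arrs s' 2 i) & arrs s' 5 = arrs s 5)"
 unfolding row_tail_def
proof (rule T_AssignS[where v = "int i"], goal_cases)
 case 5
 let ?s1 = "setr s 15 (int i)"
 have R: "T refresh ?s1 (%s' t. t = 1 & s' = ?s1)" unfolding refresh_def
  by (rule T_While[where I = "%s' kp. s' = ?s1 & kp = 0" and \<mu> = "%_. 0"]) (use s in auto)
 have tt: "trep ?s1 r g" if "trep s r g" for r g by (rule trep_cong[OF that]) (simp add: tr_def)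
 have S: "T search ?s1 (%s' t. t <= 88*LG*(NN div D)+60 & (\<forall>p. p \<noteq> i --> arrs s' 2 p = arrs ?s1 2 p) &
   outpost D (%k. f k + v k) (arrs ?s1 2 i) (arrs s' 2 i))"
  by (rule search_exact[OF _ _ _ _ _ _ _ tt[OF t(1)] tt[OF t(2)] tt[OF t(3)] tt[OF t(4)] _ _ rng mono])
   (use s m in \<open>auto simp: base_def mm_def\<close>)
 show ?case
 proof (rule T_Seq, rule T_conseq[OF R], goal_cases)
  case (1 s2 t2)
  then have s2: "s2 = ?s1" by simp
  show ?case unfolding s2
  proof (rule T_conseq[OF S], goal_cases)
   case (1 s3 t3)
   have "arrs s3 5 = arrs s 5" using same_arrs[OF 1(2) search_no5] by simp
   then show ?case using 1 \<open>t2 = 1 & s2 = ?s1\<close> by simp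
  qed
 qed
qed (use s bnd_regs B_facts n0 in auto)

lemma row_tail_stale:
 fixes f v g g' :: "nat => int"
 assumes s: "base s D" "regs s 13 = int i" "i < n" "regs s 22 = int r" "r <= 3*n+4" "r \<noteq> 2*n+2" "regs s 23 = int (2*n+2)"
   "regs s 24 = int (2*n+2)" "regs s 25 = int (2*n+2)" "regs s 28 = int lo" "regs s 29 = int (lo+length evs)"
  and ev: "\<And>x. x < length evs ==> arrs s 7 (lo+x) = int (evs ! x)" "\<And>k. k \<in> set evs ==> k < NN"
  and t: "trep s r g" and z: "\<And>h. h < 2*NN ==> tr s (2*n+2) h = 0"
  and m: "\<And>k. k < NN ==> mm s i k = f k" "\<And>k. k < NN ==> arrs s 4 k = v k"
  and rng: "\<And>k. k < NN ==> 1 <= f k & f k <= int n" "\<And>k. k < NN ==> 1 <= v k & v k <= int n"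
  and g': "\<And>k. k < NN ==> g' k = (if k \<in> set evs then f k + v k else g k)"
  and g: "\<And>k. k < NN ==> g' k <= f k + v k & f k + v k <= g' k+int D"
 shows "T row_tail s (%s' t. t <= length evs*(7*LG+8)+88*LG*(NN div D)+66 &
   (\<forall>p. p \<noteq> i --> arrs s' 2 p = arrs s 2 p) &
   outpost D (%k. f k + v k) (arrs s 2 i) (arrs s' 2 i) & trep s' r g' &
   (\<forall>r' h. r' \<noteq> r --> h < 2*NN --> tr s' r' h = tr s r' h))"
 unfolding row_tail_def
proof (rule T_AssignS[where v = "int r"], goal_cases)
 case 5
 let ?s1 = "setr s 15 (int r)"
 have t1: "trep ?s1 r g" by (rule trep_cong[OF t]) (simp add: tr_def)
 have nB: "2*int n <= B" using B_lin[of "2*n"] by simp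
 have vB: "\<bar>f k + v k\<bar> <= B" if "k < NN" for k using rng(1)[OF that] rng(2)[OF that] nB by linarith
 have R: "T refresh ?s1 (%s' t. t <= length evs*(7*LG+8)+1 &
   trep s' r (%k. if k \<in> set evs then f k + v k else g k) &
   (\<forall>r' h. r' \<noteq> r --> h < 2*NN --> tr s' r' h = tr ?s1 r' h))"
  by (rule refresh_spec[where i = i and lo = lo and vl = "%k. f k + v k", OF _ _ _ _ _ _ _ t1])
   (use s ev m vB in \<open>auto simp: base_def mm_def\<close>)
 show ?case
 proof (rule T_Seq, rule T_conseq[OF R], goal_cases)
  case (1 s2 t2)
  have sm: "same {16, 17, 18, 28} {5} ?s1 s2" using 1(2) by (simp add: refresh_def insert_commute)
  have r2: "regs s2 q = regs s q" if "q \<notin> {15, 16, 17, 18, 28}" for q using same_regs[OF sm] that by auto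
  have a2: "arrs s2 q = arrs s q" if "q \<noteq> 5" for q using same_arrs[OF sm] that by auto
  have t2: "trep s2 r g'" by (rule trep_fun_cong) (use 1(1) g' in auto)
  have z2: "tr s2 (2*n+2) h = 0" if "h < 2*NN" for h
  proof -
   have "tr s2 (2*n+2) h = tr ?s1 (2*n+2) h" using 1(1) s(6)[THEN not_sym] that by blast
   then show ?thesis using z[OF that] by (simp add: tr_def)
  qed
  have S: "T search s2 (%s' t. t <= 88*LG*(NN div D)+60 & (\<forall>p. p \<noteq> i --> arrs s' 2 p = arrs s2 2 p) &
   outpost D (%k. f k + v k) (arrs s2 2 i) (arrs s' 2 i))"
   by (rule search_stale[OF _ _ _ _ _ _ _ t2 z2 _ _ rng g])
    (use s m r2 a2 in \<open>auto simp: base_def mm_def\<close>)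
  show ?case
  proof (rule T_conseq[OF S], goal_cases)
   case (1 s3 t3)
   have a5: "arrs s3 5 = arrs s2 5" using same_arrs[OF 1(2) search_no5] by simp
   have tr3: "tr s3 = tr s2" using a5 by (auto simp: tr_def fun_eq_iff)
   have "trep s3 r g'" by (rule trep_cong[OF t2]) (simp add: tr3)
   then show ?case using 1(1) \<open>t2 <= _ & _\<close> a2[of 2] tr3 by (simp add: tr_def)
  qed
 qed
qed (use s B_facts NN_less n_le_NN B_lin[of r] in auto)

lemma row_exact:
 fixes f v :: "nat => int"
 assumes s: "base s D" "regs s 12 = 1" "regs s 13 = int i" "i < n"
  and t: "trep s i f" "trep s (n+i) (%k. - f k)" "trep s (2*n) v" "trep s (2*n+1) (%k. - v k)"
  and m: "\<And>k. k < NN ==> mm s i k = f k" "\<And>k. k < NN ==> arrs s 4 k = v k"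
  and rng: "\<And>k. k < NN ==> 1 <= f k & f k <= int n" "\<And>k. k < NN ==> 1 <= v k & v k <= int n"
  and mono: "(\<forall>k. k+1 < NN --> f k <= f (k+1)) \<or> (\<forall>k. k+1 < NN --> v k <= v (k+1))"
 shows "T row s (%s' t. t <= 88*LG*(NN div D)+90 & (\<forall>p. p \<noteq> i --> arrs s' 2 p = arrs s 2 p) &
   outpost D (%k. f k + v k) (arrs s 2 i) (arrs s' 2 i) & arrs s' 5 = arrs s 5)"
proof -
 let ?s1 = "s\<lparr>regs := (regs s)(22 := int i, 23 := int (2*n), 24 := int i, 25 := int (n+i), 28 := 0, 29 := 0)\<rparr>"
 have bB: "int (2*n) <= B" "int (n+i) <= B" "int i <= B" "2 <= B" using B_lin[of "2*n"] B_lin[of "n+i"] B_lin[of i] s(4) B2 by auto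
 have r: "regs s 0 = int n" using s by (simp add: base_def)
 have tt: "trep ?s1 r g" if "trep s r g" for r g by (rule trep_cong[OF that]) (simp add: tr_def)
 have tl: "T row_tail ?s1 (%s' t. t <= 88*LG*(NN div D)+66 & (\<forall>p. p \<noteq> i --> arrs s' 2 p = arrs ?s1 2 p) &
   outpost D (%k. f k + v k) (arrs ?s1 2 i) (arrs s' 2 i) & arrs s' 5 = arrs ?s1 5)"
  by (rule row_tail_exact[OF _ _ _ _ _ _ _ _ _ tt[OF t(1)] tt[OF t(2)] tt[OF t(3)] tt[OF t(4)] _ _ rng mono])
   (use s m in \<open>auto simp: base_def mm_def\<close>)
 have pre: "T (Assign 22 (R 13) ;; Assign 23 (R 0\<boxplus>R 0) ;; Assign 24 (R 13) ;; Assign 25 (R 0\<boxplus>R 13) ;;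
    Assign 28 (N 0) ;; Assign 29 (N 0)) s (%s' t. s' = ?s1 & t = 11)"
  by (intro T_Seq T_Assign) (use s r bB in \<open>simp_all\<close>)
 show ?thesis unfolding row_def
 proof (rule T_Seq, rule T_If, goal_cases)
  case 2
  show ?case
  proof (rule T_conseq[OF pre], goal_cases)
   case (1 s' t)
   then have s': "s' = ?s1" "t = 11" by auto
   show ?case unfolding s' by (rule T_conseq[OF tl]) auto
  qed
 qed (use s bB in auto)
qed

lemma row_stale:
 fixes f v g g' :: "nat => int"
 assumes s: "base s D" "regs s 13 = int i" "i < n"
  and md: "regs s 12 = 2 & r = 2*n+3 & arrs s 8 (D*(n+1)+i) = int lo &
    arrs s 8 (D*(n+1)+i+1) = int (lo+length evs) \<or>
   regs s 12 = 3 & r = 2*n+4+i & regs s 11 = int lo & regs s 37 = int (lo+length evs)"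
  and ev: "\<And>x. x < length evs ==> arrs s 7 (lo+x) = int (evs ! x)" "\<And>k. k \<in> set evs ==> k < NN"
  and t: "trep s r g" and z: "\<And>h. h < 2*NN ==> tr s (2*n+2) h = 0"
  and m: "\<And>k. k < NN ==> mm s i k = f k" "\<And>k. k < NN ==> arrs s 4 k = v k"
  and rng: "\<And>k. k < NN ==> 1 <= f k & f k <= int n" "\<And>k. k < NN ==> 1 <= v k & v k <= int n"
  and g': "\<And>k. k < NN ==> g' k = (if k \<in> set evs then f k + v k else g k)"
  and g: "\<And>k. k < NN ==> g' k <= f k + v k & f k + v k <= g' k+int D"
 shows "T row s (%s' t. t <= length evs*(7*LG+8)+88*LG*(NN div D)+90 &
   (\<forall>p. p \<noteq> i --> arrs s' 2 p = arrs s 2 p) &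
   outpost D (%k. f k + v k) (arrs s 2 i) (arrs s' 2 i) & trep s' r g' &
   (\<forall>r' h. r' \<noteq> r --> h < 2*NN --> tr s' r' h = tr s r' h))"
proof (rule T_bnd)
 assume b: "bnd B s"
 let ?s1 = "s\<lparr>regs := (regs s)(23 := int (2*n+2), 24 := int (2*n+2), 25 := int (2*n+2), 22 := int r, 28 := int lo, 29 := int (lo+length evs))\<rparr>"
 have rn: "r <= 3*n+4" "r \<noteq> 2*n+2" using md s(3) by auto
 have bB: "int (2*n+2) <= B" "int (2*n+3) <= B" "int r <= B" "4 <= B"
  using B_lin[of "2*n+2"] B_lin[of "2*n+3"] B_lin[of r] B_facts rn by auto
 have loB: "\<bar>int lo\<bar> <= B" "\<bar>int (lo+length evs)\<bar> <= B"
  using md bnd_regs[OF b, of 11] bnd_regs[OF b, of 37] bnd_arrs[OF b, of 8 "D*(n+1)+i"]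
   bnd_arrs[OF b, of 8 "D*(n+1)+i+1"] by auto
 have r: "regs s 0 = int n" "regs s 3 = int D" using s by (auto simp: base_def)
 have tt: "trep ?s1 r g" by (rule trep_cong[OF t]) (simp add: tr_def)
 have tl: "T row_tail ?s1 (%s' t. t <= length evs*(7*LG+8)+88*LG*(NN div D)+66 &
   (\<forall>p. p \<noteq> i --> arrs s' 2 p = arrs ?s1 2 p) &
   outpost D (%k. f k + v k) (arrs ?s1 2 i) (arrs s' 2 i) & trep s' r g' &
   (\<forall>r' h. r' \<noteq> r --> h < 2*NN --> tr s' r' h = tr ?s1 r' h))"
  by (rule row_tail_stale[where lo = lo, OF _ _ _ _ _ _ _ _ _ _ _ _ _ tt _ _ _ rng g' g])
   (use s m rn ev z in \<open>auto simp: base_def mm_def tr_def\<close>)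
 have ep: "av s' (EPi (R 13)) = int (D*(n+1)+i)" "av s' (EPi (R 13\<boxplus>N 1)) = int (D*(n+1)+i+1)"
  if "regs s' 0 = int n" "regs s' 3 = int D" "regs s' 13 = int i" for s'
  using that by (simp_all add: EPi_def algebra_simps)
 have lf: "leaves (EPi (R 13)) = 4" "leaves (EPi (R 13\<boxplus>N 1)) = 5" by (simp_all add: EPi_def)
 have ao: "aok B s' (EPi (R 13))" "aok B s' (EPi (R 13\<boxplus>N 1))" for s' using B2 by (simp_all add: EPi_def)
 have pre: "T (Assign 23 (R 0\<boxplus>R 0\<boxplus>N 2) ;; Assign 24 (R 23) ;; Assign 25 (R 23) ;;
    If (Equal (R 12) (N 2))
     (Assign 22 (R 0\<boxplus>R 0\<boxplus>N 3) ;; Assign 28 (Rd 8 (EPi (R 13))) ;; Assign 29 (Rd 8 (EPi (R 13\<boxplus>N 1))))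
     (Assign 22 (R 0\<boxplus>R 0\<boxplus>N 4\<boxplus>R 13) ;; Assign 28 (R 11) ;; Assign 29 (R 37))) s
   (%s' t. s' = ?s1 & t = 12)"
 proof (cases "regs s 12 = 2")
  case True
  then have rr: "r = 2*n+3" "arrs s 8 (D*(n+1)+i) = int lo" "arrs s 8 (D*(n+1)+i+1) = int (lo+length evs)"
   using md by auto
  have ix: "nat (int (D*(n+1)+i)) = D*(n+1)+i" "nat (int (D*(n+1)+i+1)) = D*(n+1)+i+1"
   by (simp_all only: nat_int)
  show ?thesis
   apply (rule T_AssignS[where v = "int (2*n+2)"], (use r bB in simp_all)[4])
   apply (rule T_AssignS[where v = "int (2*n+2)"], (use r bB in simp_all)[4])
   apply (rule T_AssignS[where v = "int (2*n+2)"], (use r bB in simp_all)[4])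
   apply (rule T_If, (use bB in simp))
    apply (rule T_AssignS[where v = "int (2*n+3)"], (use r bB in simp_all)[4])
    apply (rule T_AssignS[where v = "int lo"])
      apply (subst av.simps(3), subst ep; (simp only: ix)?; use r s rr in simp)
     apply (use ao lf ep r s loB in simp_all)[3]
    apply (rule T_AssignV[where v = "int (lo+length evs)"])
      apply (subst av.simps(3), subst ep; (simp only: ix)?; use r s rr in simp)
     apply (use ao lf ep r s loB in simp_all)[3]
    apply (use rr in simp)
   using True by simp
 next
  case False
  then have rr: "r = 2*n+4+i" "regs s 11 = int lo" "regs s 37 = int (lo+length evs)"
   using md by auto
  show ?thesis
   apply (rule T_AssignS[where v = "int (2*n+2)"], (use r bB in simp_all)[4])
   apply (rule T_AssignS[where v = "int (2*n+2)"], (use r bB in simp_all)[4])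
   apply (rule T_AssignS[where v = "int (2*n+2)"], (use r bB in simp_all)[4])
   apply (rule T_If, (use bB in simp))
   using False apply simp
    apply (rule T_AssignS[where v = "int r"], (use r bB s rr in simp_all)[4])
    apply (rule T_AssignS[where v = "int lo"], (use rr loB in simp_all)[4])
    apply (rule T_AssignV[where v = "int (lo+length evs)"], (use rr loB in simp_all)[4])
   by simp
 qed
 show ?thesis unfolding row_def
 proof (rule T_Seq, rule T_If, goal_cases)
  case 2
  then show ?case using md by simp
 next
  case 3
  show ?case
  proof (rule T_conseq[OF pre], goal_cases)
   case (1 s' t)
   then have s': "s' = ?s1" "t = 12" by auto
   show ?case unfolding s' by (rule T_conseq[OF tl]) (auto simp: tr_def)
  qed
 qed (use bB in auto)
qed

end

section \<open>Running the equality algorithms in parallel\<close>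

text \<open>
 If the simulated steps (register 4) of the current value of \<open>D\<close> (register 3) exceed the budget
 \<open>4 (L + 1) N\<^sup>3 / D\<close>, then \<open>D\<close> is halved. This balances the two parts of the running time without
 knowing the exponent of the equality algorithm, which need not be a computable number.
\<close>

definition chk :: com where
 "chk = If (Conj (Less (N 4\<boxtimes>R 2\<boxtimes>R 1\<boxtimes>R 1\<boxtimes>R 1) (R 4\<boxtimes>R 3)) (Less (N 1) (R 3)))
   (halve 3 ;; Assign 4 (N 0)) SKIP"

text \<open>Copy \<open>i\<close> belongs to sample \<open>i div ZZ\<close> and offset
  \<open>i mod ZZ\<close>. Both ranges shrink with the radius, so lowering \<open>D\<close> retires
  copies and never starts one.\<close>

definition inst_body :: "com => com" where
 "inst_body c = Assign 31 (Bin Div (R 6) (R 7)) ;; Assign 35 (Bin Mod (R 6) (R 7)) ;;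
   If (Conj (Less (R 31) (R 3\<boxtimes>(N 4\<boxtimes>R 2))) (Less (R 35) (N 2\<boxtimes>R 3\<boxplus>N 1)))
    (Assign 34 (Rd 10 (R 31)) ;; c ;; chk) SKIP"

definition inst_loop :: "com => com" where
 "inst_loop c = for_loop 6 (R 5) (inst_body c)"

lemma wr_inst_loop [simp]: "wregs (inst_loop c) = {3, 4, 6, 31, 34, 35} \<union> wregs c" "warrs (inst_loop c) = warrs c"
 by (auto simp: inst_loop_def inst_body_def chk_def halve_def)

definition zero_state :: state where "zero_state = \<lparr>regs = (%_. 0), arrs = (%_ _. 0)\<rparr>"

text \<open>\<open>SA i r\<close> is the state of copy \<open>i\<close> after \<open>r\<close>
  phases, preprocessing being the first of them, and \<open>TA i r\<close> the length of the phase
  that follows. The starting radius \<open>2^e0\<close> lies between half the cube root of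
  \<open>n\<close> and the cube root.\<close>

locale inst = par W B n L for W B n L +
 fixes e0 tA :: nat and SA :: "nat => nat => state" and TA :: "nat => nat => nat"
 assumes e0L: "e0 <= L" and D0_le: "(2^e0)^3 <= n" and D0_gt: "n < 8*(2^e0)^3"
  and SA0: "SA i 0 = zero_state"
  and TA_sum: "i < 2^e0*(4*LG)*(2*2^e0+1) ==> (\<Sum>r\<le>n. TA i r) <= tA"
  and KB: "int (2^e0*(4*LG)*(2*2^e0+1)*Suc tA) <= B"
begin

definition ZZ :: nat where "ZZ = 2*2^e0+1"
definition LP :: nat where "LP = 4*LG"
definition KI :: nat where "KI = 2^e0*LP*ZZ"

definition active :: "nat => nat => bool" where
 "active D i \<longleftrightarrow> i < KI & i div ZZ < D*LP & i mod ZZ <= 2*D"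

definition spent :: "nat => (nat => nat) => nat" where
 "spent D f = (\<Sum>i | active D i. \<Sum>r<f i. TA i r)"

text \<open>Certificate that \<open>D\<close> is not too small: it exceeds half the cube root of
  \<open>n\<close>, as the starting radius does, or the budget was exceeded at radius
  \<open>2 * D\<close>, which is possible only if \<open>tA\<close> is large compared with
  \<open>(NN / D)^3\<close>.\<close>

definition Dok :: "nat => bool" where
 "Dok D \<longleftrightarrow> n < 8*D^3 \<or> NN^3 < 24*D^3*tA"

text \<open>Potential for the simulated steps, made so that it survives resetting the counter.
  Within budget the counter is at most \<open>NN^3 * LP div 2^e\<close>; halving doubles that
  summand, which replaces the lost count. The last summand pays for the phase that overran the
  budget, at most \<open>tA\<close> per halving.\<close>

definition pot :: "nat => nat => nat" where
 "pot e cnt = cnt+NN^3*LP div 2^e+(e0 - e)*tA"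

definition iregs :: "state => nat => nat => bool" where
 "iregs s e cnt \<longleftrightarrow> regs s 0 = int n & regs s 1 = int NN & regs s 2 = int LG & regs s 3 = 2^e &
   regs s 4 = int cnt & regs s 5 = int KI & regs s 7 = int ZZ"

text \<open>In round \<open>r\<close>, copies below \<open>p\<close> have finished their phase and
  the others have not. The budget is asserted only for \<open>e >= 1\<close>, since radius 1 cannot
  be halved.\<close>

definition ist :: "nat => nat => state => nat => nat => bool" where
 "ist r p s e cnt \<longleftrightarrow> iregs s e cnt & e <= e0 &
   (\<forall>i. active (2^e) i --> view KI i s = SA i (if i < p then Suc r else r)) &
   cnt <= spent (2^e) (%i. if i < p then Suc r else r) & (1 <= e --> cnt*2^e <= NN^3*LP) & Dok (2^e)"

lemma KI_less: "active D i ==> i < KI" by (simp add: active_def)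

lemma finite_active: "finite {i. active D i}"
 by (rule finite_subset[of _ "{..<KI}"]) (auto simp: active_def)

lemma card_active: "card {i. active D i} <= D*LP*(2*D+1)"
proof -
 have Z: "0 < ZZ" by (simp add: ZZ_def)
 have "inj_on (%i. (i div ZZ, i mod ZZ)) {i. active D i}"
  by (rule inj_onI) (metis prod.inject div_mult_mod_eq)
 moreover have "(%i. (i div ZZ, i mod ZZ)) ` {i. active D i} \<subseteq> {..<D*LP} \<times> {..2*D}"
  by (auto simp: active_def)
 ultimately have "card {i. active D i} <= card ({..<D*LP} \<times> {..2*D})"
  by (rule card_inj_on_le) simp
 then show ?thesis by simp
qed

lemma TA_le: "active D i ==> r <= Suc n ==> (\<Sum>q<r. TA i q) <= tA"
proof -
 assume a: "active D i" "r <= Suc n"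
 have "(\<Sum>q<r. TA i q) <= (\<Sum>q\<le>n. TA i q)" using a(2) by (intro sum_mono2) auto
 also have "\<dots> <= tA" using TA_sum[of i] a(1) by (simp add: active_def KI_def LP_def ZZ_def)
 finally show ?thesis .
qed

lemma TA_le1: "active D i ==> r <= n ==> TA i r <= tA"
 using TA_le[of D i "Suc r"] by simp

lemma spent_le:
 assumes "\<And>i. f i <= Suc n"
 shows "spent D f <= D*LP*(2*D+1)*tA" "spent D f <= KI*tA"
proof -
 have s: "spent D f <= card {i. active D i}*tA"
  unfolding spent_def using TA_le assms sum_bounded_above[of "{i. active D i}" "%i. \<Sum>r<f i. TA i r" tA] by auto
 then show "spent D f <= D*LP*(2*D+1)*tA" using card_active[of D] by (meson le_trans mult_le_mono1)
 have "card {i. active D i} <= card {..<KI}" by (rule card_mono) (auto simp: active_def)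
 then show "spent D f <= KI*tA" using s by (metis card_lessThan le_trans mult_le_mono1)
qed

lemma KI_B: "int (KI*tA) <= B" "int KI <= B"
proof -
 have "KI*Suc tA = 2^e0*(4*LG)*(2*2^e0+1)*Suc tA" by (simp add: KI_def LP_def ZZ_def)
 then have "int (KI*Suc tA) <= B" using KB by simp
 moreover have "KI*tA <= KI*Suc tA" "KI <= KI*Suc tA" by simp_all
 ultimately show "int (KI*tA) <= B" "int KI <= B" by linarith+
qed

lemma spent_step:
 assumes "active D p"
 shows "spent D (%i. if i < Suc p then Suc r else r) = spent D (%i. if i < p then Suc r else r)+TA p r"
proof -
 let ?A = "{i. active D i}"
 have "(\<Sum>i\<in>?A - {p}. \<Sum>q<(if i < Suc p then Suc r else r). TA i q) =
   (\<Sum>i\<in>?A - {p}. \<Sum>q<(if i < p then Suc r else r). TA i q)"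
  by (intro sum.cong) auto
 then show ?thesis unfolding spent_def using assms finite_active[of D]
  by (simp add: sum.remove[of ?A p])
qed

lemma spent_skip:
 assumes "\<not> active D p"
 shows "spent D (%i. if i < Suc p then Suc r else r) = spent D (%i. if i < p then Suc r else r)"
 unfolding spent_def
proof (rule sum.cong)
 fix i assume "i \<in> {i. active D i}"
 then have "i \<noteq> p" using assms by auto
 then show "(\<Sum>q<(if i < Suc p then Suc r else r). TA i q) = (\<Sum>q<(if i < p then Suc r else r). TA i q)"
  by (simp add: less_Suc_eq)
qed simp

lemma active_half: "active (2^e) i ==> active (2^Suc e) i"
 by (auto simp: active_def)

lemma pow_e_le: "e <= e0 ==> (2::nat)^e <= NN"
 using e0L power_increasing[of e L "2::nat"] by (simp add: NN_def)

lemma pot_halve: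
 assumes "1 <= e" "e <= e0" "cnt*2^e <= NN^3*LP" "x <= tA"
 shows "pot e cnt+x <= pot (e - 1) 0"
proof -
 obtain e' where e: "e = Suc e'" using assms(1) by (cases e) auto
 \<comment> \<open>\<open>NN\<close> is a power of two with exponent at least \<open>e\<close>, so
   the quotients are exact and double exactly.\<close>
 have dv: "2^Suc e' dvd NN^3*LP"
 proof -
  have "(2::nat)^Suc e' dvd 2^L" using assms(2) e e0L by (intro le_imp_power_dvd) auto
  then show ?thesis by (simp add: NN_def power3_eq_cube dvd_mult2)
 qed
 obtain c where c: "NN^3*LP = 2^Suc e' * c" using dv by (elim dvdE)
 have d1: "NN^3*LP div 2^e = c" unfolding c e by simp
 have d2: "NN^3*LP div 2^e' = 2 * c" unfolding c by simp
 have "cnt <= c" using assms(3) unfolding c e by (simp add: mult.commute)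
 moreover have "e0 - e' = Suc (e0 - e)" using e assms(2) by simp
 ultimately show ?thesis unfolding pot_def using assms(4) d1 d2 e by simp
qed

lemma chk_spec:
 assumes r: "iregs s e cnt" and e: "e <= e0" and r': "r <= n" and p: "active (2^e) p"
  and v: "\<forall>i. active (2^e) i --> view KI i s = SA i (if i < Suc p then Suc r else r)"
  and c: "cnt = cnt0+TA p r" "cnt0 <= spent (2^e) (%i. if i < p then Suc r else r)"
   "1 <= e --> cnt0*2^e <= NN^3*LP" and D: "Dok (2^e)"
 shows "T chk s (%s' t. t <= 5 & (\<exists>e' cnt'. ist r (Suc p) s' e' cnt' & e' <= e & pot e cnt0+TA p r <= pot e' cnt'))"
proof -
 have pw: "int (2^e) = 2^e" by simp
 have cle: "cnt <= spent (2^e) (%i. if i < Suc p then Suc r else r)" using c spent_step[OF p] by simp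
 have "(if i < Suc p then Suc r else r) <= Suc n" for i using r' by simp
 note sl = spent_le[of "%i. if i < Suc p then Suc r else r" "2^e", OF this]
 have ta: "TA p r <= tA" using TA_le1[OF p r'] .
 define b where "b = Conj (Less (N 4\<boxtimes>R 2\<boxtimes>R 1\<boxtimes>R 1\<boxtimes>R 1) (R 4\<boxtimes>R 3)) (Less (N 1) (R 3))"
 have bv: "bv s b \<longleftrightarrow> NN^3*LP < cnt*2^e & 1 <= e"
 proof -
  have "4*int LG*int NN*int NN*int NN < int cnt*2^e \<longleftrightarrow> int (NN^3*LP) < int (cnt*2^e)"
   by (simp add: LP_def power3_eq_cube mult_ac)
  moreover have "(1 < (2::int)^e) = (1 <= e)"
   using one_less_power[of "2::int" e] by (cases e) auto
  ultimately show ?thesis unfolding b_def using r unfolding iregs_def by (simp del: of_nat_mult of_nat_power)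
 qed
 show ?thesis unfolding chk_def b_def[symmetric]
 proof (rule T_If)
  show "bok B s b" unfolding b_def using B_facts by simp
 next
  assume "bv s b"
  then have big: "NN^3*LP < cnt*2^e" "1 <= e" using bv by auto
  obtain e' where e': "e = Suc e'" using big(2) by (cases e) auto
  have p2: "regs s 3 = int (2^e)" "2^e div 2 = (2::nat)^e'" using r e' by (auto simp: iregs_def)
  let ?s1 = "setr s 3 (int (2^e div 2))"
  let ?s2 = "setr ?s1 4 0"
  \<comment> \<open>At most \<open>2^e * LP * (2 * 2^e + 1)\<close> copies are active, and none
    takes more than \<open>tA\<close> steps in total. With the exceeded budget this gives
    \<open>NN^3 < 3 * (2^e)^3 * tA\<close>, and 24 is 3 times the cube of 2.\<close>
  have dok: "Dok (2^e')"
  proof -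
   have "cnt <= 2^e*LP*(2*2^e+1)*tA" using cle sl(1) by (rule le_trans)
   also have "\<dots> <= 2^e*LP*(3*2^e)*tA" by (intro mult_le_mono) auto
   finally have "cnt*2^e <= 2^e*LP*(3*2^e)*tA*2^e" by (rule mult_le_mono1)
   then have "NN^3*LP < 2^e*LP*(3*2^e)*tA*2^e" using big(1) by linarith
   also have "\<dots> = (24*(2^e')^3*tA)*LP" unfolding e' by (simp add: power3_eq_cube mult_ac)
   finally have "NN^3 < 24*(2^e')^3*tA" by (rule mult_right_less_imp_less) simp
   then show ?thesis unfolding Dok_def by blast
  qed
  have I: "ist r (Suc p) ?s2 e' 0" unfolding ist_def
  proof (intro conjI allI impI)
   show "iregs ?s2 e' 0" using r p2 by (simp add: iregs_def)
   fix i assume "active (2^e') i"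
   then show "view KI i ?s2 = SA i (if i < Suc p then Suc r else r)" using v active_half e' by simp
  qed (use e e' dok in auto)
  have P: "pot e cnt0+TA p r <= pot e' 0" using pot_halve[OF big(2) e _ ta, of cnt0] c(3) big(2) e' by simp
  show "T (halve 3 ;; Assign 4 (N 0)) s (%s' t. Suc t <= 5 &
    (\<exists>e' cnt'. ist r (Suc p) s' e' cnt' & e' <= e & pot e cnt0+TA p r <= pot e' cnt'))"
  proof (rule T_Seq, rule T_halve[OF p2(1)], rule T_AssignV[where v = 0], goal_cases)
   case 5
   show ?case using I P e' by - (rule conjI, simp, rule exI[of _ e'], rule exI[of _ 0], auto)
  qed (use B2 in auto)
 next
  assume "\<not> bv s b"
  then have "1 <= e --> cnt*2^e <= NN^3*LP" using bv by auto
  then have "ist r (Suc p) s e cnt" unfolding ist_def using r e v cle D by simp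
  then show "T SKIP s (%s' t. Suc t <= 5 &
    (\<exists>e' cnt'. ist r (Suc p) s' e' cnt' & e' <= e & pot e cnt0+TA p r <= pot e' cnt'))"
   by - (rule T_Skip, rule conjI, simp, rule exI[of _ e], rule exI[of _ cnt], auto simp: pot_def c(1))
 qed
qed

text \<open>
 The commands \<open>c\<close> load the input of copy \<open>p\<close>, run one phase of the simulated algorithm, and collect its
 answers in array 2; \<open>X\<close> and \<open>OI\<close> are invariants of the unmodified part of the memory and of array 2.
\<close>

lemma round_spec:
 assumes r: "r <= n"
  and wc: "wregs c \<subseteq> {4, 13, 14, 32, 36}" "warrs c \<subseteq> {2} \<union> {12..}"
  and X: "\<And>s s'. X s ==> same {3, 4, 6, 13, 14, 31, 32, 34, 35, 36} ({2} \<union> {12..}) s s' ==> X s'"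
  and xs: "\<And>s p. X s ==> p < KI ==> arrs s 10 (p div ZZ) = int (pcol p)"
  and O_skip: "\<And>e p a. OI e p a ==> \<not> active (2^e) p ==> OI e (Suc p) a"
  and O_mono: "\<And>e e' p a. OI e p a ==> e' <= e ==> OI e' p a"
  and c: "\<And>s e cnt p. X s ==> iregs s e cnt ==> active (2^e) p ==> OI e p (arrs s 2) ==> regs s 6 = int p ==>
    regs s 34 = int (pcol p) ==> regs s 35 = int (p mod ZZ) ==> view KI p s = SA p r ==>
    int (cnt+TA p r) <= B ==>
    T c s (%s' t. t <= C+5*TA p r & OI e (Suc p) (arrs s' 2) & view KI p s' = SA p (Suc r) &
     (\<forall>i<KI. i \<noteq> p --> view KI i s' = view KI i s) & regs s' 4 = int (cnt+TA p r))"
  and s: "X s" "ist r 0 s e cnt" "OI e 0 (arrs s 2)"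
 shows "T (inst_loop c) s (%s' t. \<exists>e' cnt'. X s' & ist (Suc r) 0 s' e' cnt' & OI e' KI (arrs s' 2) & e' <= e &
   t+5*pot e cnt <= KI*(C+22)+3+5*pot e' cnt')"
proof -
 \<comment> \<open>The simulation takes up to five real steps per counted one, so five times the
   increase of the potential is added to a fixed cost per copy.\<close>
 define I where "I p s' kp \<longleftrightarrow> (\<exists>e' cnt'. X s' & ist r p s' e' cnt' & OI e' p (arrs s' 2) & e' <= e &
   kp + 5*pot e cnt <= p*(C+22)+5*pot e' cnt')" for p s' kp
 have Z0: "0 < ZZ" by (simp add: ZZ_def)
 show ?thesis unfolding inst_loop_def
 proof (rule T_for[where I = I and m = KI])
  show "6 \<notin> wregs (inst_body c)" using wc(1) by (auto simp: inst_body_def chk_def halve_def)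
  show "int KI <= B" by (rule KI_B)
  show "I 0 (setr s 6 0) 0" unfolding I_def
  proof (rule exI[of _ e], rule exI[of _ cnt], intro conjI)
   show "X (setr s 6 0)" by (rule X[OF s(1)]) (auto simp: same_def)
   show "ist r 0 (setr s 6 0) e cnt" using s(2) by (simp add: ist_def iregs_def)
  qed (use s in auto)
 next
  fix p s' kp assume "I p s' kp"
  then show "aok B s' (R 5) & av s' (R 5) = int KI" unfolding I_def ist_def iregs_def by auto
 next
  fix s' kp assume "I KI s' kp"
  then obtain e' cnt' where i: "X s'" "ist r KI s' e' cnt'" "OI e' KI (arrs s' 2)" "e' <= e"
   "kp + 5*pot e cnt <= KI*(C+22)+5*pot e' cnt'" unfolding I_def by blast
  \<comment> \<open>All active copies lie below \<open>KI\<close>, so having finished all of them in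
    round \<open>r\<close> is the same as standing before copy 0 of the next round.\<close>
  have "spent (2^e') (%i. if i < KI then Suc r else r) = spent (2^e') (%_. Suc r)"
   unfolding spent_def by (rule sum.cong) (auto simp: active_def)
  then have "ist (Suc r) 0 s' e' cnt'" using i(2) KI_less unfolding ist_def by auto
  then show "\<exists>e' cnt'. X s' & ist (Suc r) 0 s' e' cnt' & OI e' KI (arrs s' 2) & e' <= e &
    kp + 3+5*pot e cnt <= KI*(C+22)+3+5*pot e' cnt'"
   using i by - (rule exI[of _ e'], rule exI[of _ cnt'], auto)
 next
  fix p s' kp assume p: "p < KI" and "I p s' kp" and r6: "regs s' 6 = int p" and b: "bnd B s'"
  then obtain e' cnt' where i: "X s'" "ist r p s' e' cnt'" "OI e' p (arrs s' 2)" "e' <= e"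
   "kp + 5*pot e cnt <= p*(C+22)+5*pot e' cnt'" unfolding I_def by blast
  let ?fin = "%s2 t. I (Suc p) (setr s2 6 (int (Suc p))) (kp + t+3)"
  let ?s1 = "setr s' 31 (int (p div ZZ))"
  let ?s2 = "setr ?s1 35 (int (p mod ZZ))"
  have ir: "iregs s' e' cnt'" and e'0: "e' <= e0" and vw: "\<And>i. active (2^e') i ==> view KI i s' = SA i (if i < p then Suc r else r)"
   and cn: "cnt' <= spent (2^e') (%i. if i < p then Suc r else r)" "1 <= e' --> cnt'*2^e' <= NN^3*LP"
   and dok: "Dok (2^e')" using i(2) by (auto simp: ist_def)
  have pB: "int p <= B" "int (p div ZZ) <= B" "int (p mod ZZ) <= B"
  proof -
   show "int p <= B" using p KI_B(2) by linarith
   moreover have "p div ZZ <= p" "p mod ZZ <= p" by simp_all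
   ultimately show "int (p div ZZ) <= B" "int (p mod ZZ) <= B" by linarith+
  qed
  have r7: "regs s' 7 = int ZZ" using ir by (simp add: iregs_def)
  define bb where "bb = Conj (Less (R 31) (R 3\<boxtimes>(N 4\<boxtimes>R 2))) (Less (R 35) (N 2\<boxtimes>R 3\<boxplus>N 1))"
  have bb: "bv ?s2 bb \<longleftrightarrow> active (2^e') p"
  proof -
   have "2^e'*(4*int LG) = int (2^e'*LP)" by (simp add: LP_def)
   then have a1: "int (p div ZZ) < 2^e'*(4*int LG) \<longleftrightarrow> p div ZZ < 2^e'*LP"
    by (simp only: of_nat_less_iff)
   have "2*2^e'+1 = int (2*2^e'+1)" by simp
   then have "int (p mod ZZ) < 2*2^e'+1 \<longleftrightarrow> p mod ZZ < 2*2^e'+1"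
    by (simp only: of_nat_less_iff)
   then have a2: "int (p mod ZZ) < 2*2^e'+1 \<longleftrightarrow> p mod ZZ <= 2*2^e'" by linarith
   show ?thesis using ir p a1 a2 unfolding bb_def iregs_def active_def by simp
  qed
  have X2: "X ?s2" by (rule X[OF i(1)]) (auto simp: same_def)
  have ir2: "iregs ?s2 e' cnt'" using ir by (simp add: iregs_def)
  show "T (inst_body c) s' ?fin" unfolding inst_body_def bb_def[symmetric]
  proof (rule T_AssignS[where v = "int (p div ZZ)"], goal_cases)
   case 5
   show ?case
   proof (rule T_AssignS[where v = "int (p mod ZZ)"], goal_cases)
    case 5
    show ?case
    proof (rule T_If, goal_cases)
     case 1
     show ?case unfolding bb_def using B_facts by simp
    next
     case 2
     then have act: "active (2^e') p" using bb by simp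
     let ?s3 = "setr ?s2 34 (int (pcol p))"
     have X3: "X ?s3" by (rule X[OF X2]) (auto simp: same_def)
     have ir3: "iregs ?s3 e' cnt'" using ir2 by (simp add: iregs_def)
     have x10: "arrs s' 10 (p div ZZ) = int (pcol p)" using xs[OF i(1) p] .
     have cB: "\<bar>int (pcol p)\<bar> <= B" using bnd_arrs[OF b, of 10 "p div ZZ"] x10 by simp
     have vp: "view KI p ?s3 = SA p r" using vw[OF act] by simp
     have cntB: "int (cnt'+TA p r) <= B"
     proof -
      have "cnt'+TA p r <= spent (2^e') (%i. if i < Suc p then Suc r else r)" using cn(1) spent_step[OF act] by simp
      also have "\<dots> <= KI*tA" by (rule spent_le(2)) (use r in auto)
      finally show ?thesis using KI_B(1) by linarith
     qed
     have Cs: "T c ?s3 (%s' t. t <= C+5*TA p r & OI e' (Suc p) (arrs s' 2) & view KI p s' = SA p (Suc r) &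
       (\<forall>i<KI. i \<noteq> p --> view KI i s' = view KI i ?s3) & regs s' 4 = int (cnt'+TA p r))"
      by (rule c[OF X3 ir3 act _ _ _ _ vp cntB]) (use i r6 in auto)
     show ?case
     proof (rule T_AssignS[where v = "int (pcol p)"], goal_cases)
      case 1
      show ?case using x10 by simp
     next
      case 5
      show ?case
      proof (rule T_Seq, rule T_conseq[OF Cs], goal_cases)
       case (1 s4 t4)
       have sm: "same {4, 13, 14, 32, 36} ({2} \<union> {12..}) ?s3 s4" by (rule same_mono[OF 1(2) wc])
       have ir4: "iregs s4 e' (cnt'+TA p r)" using ir3 1(1) same_regs[OF sm] unfolding iregs_def by simp
       have v4: "\<forall>i. active (2^e') i --> view KI i s4 = SA i (if i < Suc p then Suc r else r)"
       proof (intro allI impI)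
        fix i assume a: "active (2^e') i"
        show "view KI i s4 = SA i (if i < Suc p then Suc r else r)"
        proof (cases "i = p")
         case True
         then show ?thesis using 1(1) by simp
        next
         case False
         then have "view KI i s4 = view KI i ?s3" using 1(1) KI_less[OF a] by blast
         then show ?thesis using vw[OF a] False by (simp add: less_Suc_eq)
        qed
       qed
       have K: "T chk s4 (%s' t. t <= 5 & (\<exists>e'' cnt''. ist r (Suc p) s' e'' cnt'' & e'' <= e' & pot e' cnt'+TA p r <= pot e'' cnt''))"
        by (rule chk_spec[OF ir4 e'0 r act v4 refl cn dok])
       show ?case
       proof (rule T_conseq[OF K], goal_cases)
        case (1 s5 t5)
        then obtain e'' cnt'' where j: "ist r (Suc p) s5 e'' cnt''" "e'' <= e'" "pot e' cnt'+TA p r <= pot e'' cnt''"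
         and t5: "t5 <= 5" by blast
        have smk: "same {3, 4} {} s4 s5" using 1(2) by (simp add: chk_def halve_def insert_commute)
        let ?s6 = "setr s5 6 (int (Suc p))"
        have X6: "X ?s6"
        proof (rule X[OF X3])
         show "same {3, 4, 6, 13, 14, 31, 32, 34, 35, 36} ({2} \<union> {12..}) ?s3 ?s6"
          using sm smk by (auto simp: same_def)
        qed
        have "arrs s5 2 = arrs s4 2" using same_arrs[OF smk, of 2] by simp
        then have O6: "OI e'' (Suc p) (arrs ?s6 2)" using \<open>t4 <= _ & _\<close> O_mono[OF _ j(2)] by simp
        have i6: "ist r (Suc p) ?s6 e'' cnt''" using j(1) by (simp add: ist_def iregs_def)
        show ?case unfolding I_def
         using X6 O6 i6 j i(4,5) t5 \<open>t4 <= _ & _\<close> by - (rule exI[of _ e''], rule exI[of _ cnt''], auto)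
       qed
      qed
     qed (use cB in auto)
    next
     case 3
     then have act: "\<not> active (2^e') p" using bb by simp
     let ?s6 = "setr ?s2 6 (int (Suc p))"
     have X6: "X ?s6" by (rule X[OF X2]) (auto simp: same_def)
     have sp: "spent (2^e') (%i. if i < Suc p then Suc r else r) = spent (2^e') (%i. if i < p then Suc r else r)"
      by (rule spent_skip[OF act])
     have "ist r (Suc p) ?s6 e' cnt'" unfolding ist_def
     proof (intro conjI allI impI)
      show "iregs ?s6 e' cnt'" using ir by (simp add: iregs_def)
      fix i assume a: "active (2^e') i"
      then have "i \<noteq> p" using act by auto
      then show "view KI i ?s6 = SA i (if i < Suc p then Suc r else r)" using vw[OF a] by (simp add: less_Suc_eq)
     qed (use e'0 cn dok sp in auto)
     then have "I (Suc p) ?s6 (kp + Suc (Suc (Suc (Suc (Suc 1))))+3)" unfolding I_def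
      using X6 O_skip[OF i(3) act] i(4,5) by - (rule exI[of _ e'], rule exI[of _ cnt'], auto)
     then show ?case by (intro T_Skip) simp
    qed
   qed (use r6 r7 Z0 pB in \<open>auto simp: zmod_int\<close>)
  qed (use r6 r7 Z0 pB in \<open>auto simp: zdiv_int[symmetric]\<close>)
 qed simp
qed

end

section \<open>Feeding one simulated copy and reading its answer\<close>

definition prep_body :: "com => com" where
 "prep_body c = Store 12 (R 6) (R 0) ;;
   for_loop 36 (R 0\<boxtimes>R 0) (Store 13 (R 36\<boxtimes>R 5\<boxplus>R 6) (Rd 0 (R 36)\<boxminus>MMe (Bin Div (R 36) (R 0)) (R 34))) ;;
   ccom c"

text \<open>Arrays 13, 14 and 15 are the arrays 0, 1 and 2 of the copies: their matrices, queries
  and answers.\<close>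

definition query_load :: com where
 "query_load = for_loop 14 (R 0) (Store 14 (R 14\<boxtimes>R 5\<boxplus>R 6) (Rd 4 (R 34)\<boxminus>Rd 4 (R 14)\<boxminus>R 35))"

definition query_collect :: com where
 "query_collect = for_loop 13 (R 0)
   (If (Equal (Rd 15 (R 13\<boxtimes>R 5\<boxplus>R 6)) (N 1))
    (Assign 32 (MMe (R 13) (R 34)\<boxplus>Rd 4 (R 34)\<boxminus>R 35) ;;
    If (Less (R 32) (Rd 2 (R 13))) (Store 2 (R 13) (R 32)) SKIP)
    SKIP)"

definition query_body :: "com => com" where
 "query_body c = query_load ;; ccom c ;; query_collect"

lemma view_store:
 assumes "i < K" "j < K"
 shows "view K j (s\<lparr>arrs := (arrs s)(a+13 := (arrs s (a+13))(x*K+i := v))\<rparr>) =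
  (if j = i then (view K i s)\<lparr>arrs := (arrs (view K i s))(a := (arrs (view K i s) a)(x := v))\<rparr> else view K j s)"
 using assms by (auto simp: view_def interleave_inj fun_eq_iff)

lemma view_store_reg:
 assumes "i < K" "j < K"
 shows "view K j (seta s 12 (x*K+i) v) =
  (if j = i then (view K i s)\<lparr>regs := (regs (view K i s))(x := v)\<rparr> else view K j s)"
 using assms by (auto simp: view_def interleave_inj fun_eq_iff)

lemma view_cong: "(\<And>a. 12 <= a ==> arrs s' a = arrs s a) ==> view K j s' = view K j s"
 by (simp add: view_def)

text \<open>\<open>SC\<close> and \<open>TC\<close> describe the runs of the equality algorithm for
  every column \<open>c\<close> and offset \<open>d\<close> instead of every copy: which columns are
  used becomes known only after sampling, whereas the runs are fixed beforehand. Padding repeats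
  column \<open>n - 1\<close>, which keeps monotone sequences monotone and creates no new
  sums.\<close>

locale red = par W B n L for W B n L +
 fixes e0 tA :: nat and Mh vh :: "nat => nat => int" and pA qA :: com and WA :: int
  and SC :: "nat => nat => nat => state" and TC :: "nat => nat => nat => nat" and xs :: "nat list"
 assumes e0L: "e0 <= L" and D0_le: "(2^e0)^3 <= n" and D0_gt: "n < 8*(2^e0)^3"
  and KB: "int (2^e0*(4*LG)*(2*2^e0+1)*Suc tA) <= B"
  and prepC: "c < NN ==> d <= 2*2^e0 ==>
   bs WA pA (init_state n (mat n n (%(i, k). Mh i k - Mh i c))) (SC c d 0) (TC c d 0)"
  and queryC: "c < NN ==> d <= 2*2^e0 ==> j < n ==>
   bs WA qA (put_query n (vec n (%k. vh j c - vh j k - int d)) (SC c d j)) (SC c d (Suc j)) (TC c d (Suc j))"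
  and ansC: "c < NN ==> d <= 2*2^e0 ==> j < n ==> i < n ==>
   arrs (SC c d (Suc j)) 2 i = (if \<exists>k<n. Mh i k - Mh i c = vh j c - vh j k - int d then 1 else 0)"
  and sumC: "c < NN ==> d <= 2*2^e0 ==> (\<Sum>r\<le>n. TC c d r) <= tA"
  and WA: "WA <= B" and det: "deterministic pA" "deterministic qA"
  and cmaxB: "int (cmax pA) <= B" "int (cmax qA) <= B"
  and xs: "length xs = 2^e0*(4*LG)" "set xs \<subseteq> {..<NN}"
  and Mr: "i < n ==> k < NN ==> 1 <= Mh i k & Mh i k <= int n"
  and vr: "j < n ==> k < NN ==> 1 <= vh j k & vh j k <= int n"
  and Mpad: "Mh i k = Mh i (min k (n - 1))" and vpad: "vh j k = vh j (min k (n - 1))"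
begin

definition pc :: "nat => nat" where "pc i = xs ! (i div (2*2^e0+1))"
definition dl :: "nat => nat" where "dl i = i mod (2*2^e0+1)"

lemma dl_le: "dl i <= 2*2^e0"
proof -
 have "dl i < 2*2^e0+1" unfolding dl_def by simp
 then show ?thesis by simp
qed

lemma pc_less: "i < 2^e0*(4*LG)*(2*2^e0+1) ==> pc i < NN"
proof -
 assume "i < 2^e0*(4*LG)*(2*2^e0+1)"
 then have "i div (2*2^e0+1) < length xs" unfolding xs(1) by (rule less_mult_imp_div_less)
 then show ?thesis unfolding pc_def using xs(2) nth_mem by blast
qed

text \<open>\<open>inst\<close> counts phases from the empty memory and \<open>SC\<close> from the
  state after preprocessing, hence the shift by one.\<close>

sublocale inst W B n L e0 tA "%i r. if r = 0 then zero_state else SC (pc i) (dl i) (r - 1)" "%i r. TC (pc i) (dl i) r"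
 by unfold_locales (use e0L D0_le D0_gt KB sumC pc_less dl_le in auto)

lemma KI_eq: "KI = 2^e0*(4*LG)*(2*2^e0+1)" by (simp add: KI_def LP_def ZZ_def)
lemma pc_KI: "i < KI ==> pc i < NN" using pc_less by (simp add: KI_eq)
lemma dl_ZZ: "dl i = i mod ZZ" by (simp add: dl_def ZZ_def)
lemma pc_ZZ: "pc i = xs ! (i div ZZ)" by (simp add: pc_def ZZ_def)

definition Xreg :: "nat set" where "Xreg = {3, 4, 6, 13, 14, 31, 32, 34, 35, 36}"
definition Xarr :: "nat set" where "Xarr = {2} \<union> {12..}"

lemma MhB: "i < n ==> k < NN ==> c < NN ==> \<bar>Mh i k - Mh i c\<bar> <= B"
 using Mr[of i k] Mr[of i c] B_facts by linarith

lemma nnB: "int (n*n) <= B"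
 by (rule B_quad) (simp add: power2_eq_square)

lemma D0_n: "2^e0 <= n"
proof -
 have "(2::nat)^e0*1 <= 2^e0*(2^e0*2^e0)" by (intro mult_le_mono) simp_all
 also have "\<dots> = (2^e0)^3" by (simp only: power3_eq_cube mult.assoc)
 finally show ?thesis using D0_le by linarith
qed

text \<open>The memory of a copy is zero at first, so writing register 0 and the matrix is enough to
  reach \<open>init_state\<close>.\<close>

lemma prep_body_spec:
 assumes s: "iregs s e cnt" "p < KI" "regs s 6 = int p" "regs s 34 = int (pc p)"
  and v: "view KI p s = zero_state" and B: "int (cnt+TC (pc p) (dl p) 0) <= B"
  and A: "\<And>q. q < n*n ==> arrs s 0 q = Mh (q div n) (q mod n)"
   "\<And>i k. i < n ==> k < NN ==> mm s i k = Mh i k"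
 shows "T (prep_body pA) s (%s' t. t <= 4*n*n+10+5*TC (pc p) (dl p) 0 &
   view KI p s' = SC (pc p) (dl p) 0 & (\<forall>i<KI. i \<noteq> p --> view KI i s' = view KI i s) &
   regs s' 4 = int (cnt+TC (pc p) (dl p) 0))"
proof -
 let ?c = "pc p"
 let ?s1 = "seta s 12 p (int n)"
 let ?E = "%q. Mh (q div n) (q mod n) - Mh (q div n) ?c"
 define vq where "vq q = \<lparr>regs = (%_. 0)(0 := int n), arrs = (%_ _. 0)(0 := (%x. if x < q then ?E x else 0))\<rparr>" for q :: nat
 have cN: "?c < NN" using pc_KI s(2) by simp
 have r: "regs s 0 = int n" "regs s 1 = int NN" "regs s 5 = int KI" "regs s 4 = int cnt" using s(1) by (auto simp: iregs_def)
 define I where "I q s' \<longleftrightarrow> view KI p s' = vq q & (\<forall>i<KI. i \<noteq> p --> view KI i s' = view KI i s) & same {36} {12, 13} s s'" for q s'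
 have v1: "view KI p ?s1 = vq 0" "\<forall>i<KI. i \<noteq> p --> view KI i ?s1 = view KI i s"
  using view_store_reg[of p KI _ s 0 "int n"] s(2) v by (auto simp: vq_def zero_state_def)
 have L: "T (for_loop 36 (R 0\<boxtimes>R 0) (Store 13 (R 36\<boxtimes>R 5\<boxplus>R 6) (Rd 0 (R 36)\<boxminus>MMe (Bin Div (R 36) (R 0)) (R 34)))) ?s1
   (%s' t. I (n*n) s' & t <= n*n*4+3)"
 proof (rule T_for_const[where I = I and m = "n*n" and K = 1])
  show "int (n*n) <= B" by (rule nnB)
  show "I 0 (setr ?s1 36 0)" unfolding I_def using v1 by (auto simp: same_def)
 next
  fix q s' assume "I q s'"
  then show "aok B s' (R 0\<boxtimes>R 0) & av s' (R 0\<boxtimes>R 0) = int (n*n)"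
   unfolding I_def using same_regs[of "{36}" "{12, 13}" s s' 0] r by simp
 next
  fix q s' assume q: "q < n*n" and I: "I q s'" and r36: "regs s' 36 = int q" and b: "bnd B s'"
  have sm: "same {36} {12, 13} s s'" using I by (simp add: I_def)
  have r': "regs s' x = regs s x" if "x \<noteq> 36" for x using same_regs[OF sm] that by simp
  have a': "arrs s' x = arrs s x" if "x \<noteq> 12" "x \<noteq> 13" for x using same_arrs[OF sm] that by simp
  have qn: "q div n < n" "q mod n < n" using q n0 by (auto simp: less_mult_imp_div_less)
  have qN: "q mod n < NN" using qn(2) n_le_NN by (rule less_le_trans)
  have em: "av s' (MMe (Bin Div (R 36) (R 0)) (R 34)) = Mh (q div n) ?c"
  proof -
   have "av s' (MMe (Bin Div (R 36) (R 0)) (R 34)) = mm s' (q div n) ?c"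
    by (rule av_MMe) (use r36 r' r s in \<open>auto simp: zdiv_int\<close>)
   also have "\<dots> = Mh (q div n) ?c" using A(2)[OF qn(1) cN] a'[of 3] by (simp add: mm_def)
   finally show ?thesis .
  qed
  have pm: "0 <= av s' (MMi (Bin Div (R 36) (R 0)) (R 34))"
   using r36 r' r s by (simp add: MMi_def zdiv_int[symmetric])
  have ea: "av s' (Rd 0 (R 36)\<boxminus>MMe (Bin Div (R 36) (R 0)) (R 34)) = ?E q"
   unfolding av.simps(4) em using r36 A(1)[OF q] a'[of 0] by simp
  show "T (Store 13 (R 36\<boxtimes>R 5\<boxplus>R 6) (Rd 0 (R 36)\<boxminus>MMe (Bin Div (R 36) (R 0)) (R 34))) s'
   (%s2 t. t <= 1 & I (Suc q) (setr s2 36 (int (Suc q))))"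
  proof (rule T_StoreV[where p = "q*KI+p" and v = "?E q"], goal_cases)
   case 2
   show ?case by (rule ea)
  next
   case 5
   show ?case using pm r36 n0 r' r by simp
  next
   case 7
   show ?case using MhB[OF qn(1) qN cN] .
  next
   case 8
   let ?t = "seta s' 13 (q*KI+p) (?E q)"
   have "view KI i ?t = (if i = p then (view KI p s')\<lparr>arrs := (arrs (view KI p s'))(0 := (arrs (view KI p s') 0)(q := ?E q))\<rparr> else view KI i s')"
    if "i < KI" for i using view_store[of p KI i s' 0 q "?E q"] s(2) that by simp
   moreover have "(vq q)\<lparr>arrs := (arrs (vq q))(0 := (arrs (vq q) 0)(q := ?E q))\<rparr> = vq (Suc q)"
    by (auto simp: vq_def fun_eq_iff less_Suc_eq)
   ultimately show ?case using I s(2) unfolding I_def by (auto simp: same_def)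
  qed (use r36 r' r s in auto)
 qed (use n0 in auto)
 have vi: "vq (n*n) = init_state n (mat n n (%(i, k). Mh i k - Mh i ?c))"
 proof -
  have "(if x < n*n then ?E x else 0) = (if x < n*n then mat n n (%(i, k). Mh i k - Mh i ?c) $$ (x div n, x mod n) else 0)" for x
   using n0 by (auto simp: less_mult_imp_div_less)
  then show ?thesis by (simp add: vq_def init_state_def)
 qed
 have pB: "int p <= B" using s(2) KI_B(2) by linarith
 show ?thesis unfolding prep_body_def
 proof (rule T_StoreS[where p = p and v = "int n"], goal_cases)
  case 8
  show ?case
  proof (rule T_Seq, rule T_conseq[OF L], goal_cases)
   case (1 s2 t2)
   have I: "I (n*n) s2" and t2: "t2 <= n*n*4+3" using 1 by auto
   have sm: "same {36} {12, 13} s s2" using I by (simp add: I_def)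
   have C: "T (ccom pA) s2 (%s' t'. t' <= 5*TC ?c (dl p) 0 & simpost KI p s2 s' (TC ?c (dl p) 0) (SC ?c (dl p) 0))"
   proof (rule T_ccom[OF _ WA det(1) cmaxB(1)])
    show "bs WA pA (view KI p s2) (SC ?c (dl p) 0) (TC ?c (dl p) 0)"
     using I prepC[OF cN dl_le] vi by (simp add: I_def)
   qed (use s(2,3) r same_regs[OF sm] KI_B(2) B in auto)
   show ?case
    by (rule T_conseq[OF C]) (use I t2 r same_regs[OF sm] in \<open>auto simp: simpost_def I_def\<close>)
  qed
 qed (use s(3) r B_facts pB in auto)
qed

definition hitv :: "nat => nat => nat => int" where
 "hitv j q i = Mh i (pc q) + vh j (pc q) - int (dl q)"

text \<open>Rearranging \<open>M[i,k] - M[i,c] = v[c] - v[k] - d\<close> shows that every positive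
  answer certifies \<open>hitv\<close> as an attained sum. Taking the minimum over all copies is
  therefore safe, whatever the samples are.\<close>

definition hit :: "nat => nat => nat => bool" where
 "hit j q i \<longleftrightarrow> (\<exists>k<n. Mh i k + vh j k = hitv j q i)"

definition outI :: "nat => nat => nat => (nat => int) => bool" where
 "outI j e p a \<longleftrightarrow> (\<forall>i<n. (a i = 8*int NN \<or> (\<exists>k<NN. a i = Mh i k + vh j k)) &
   (\<forall>q<p. active (2^e) q --> hit j q i --> a i <= hitv j q i))"

lemma query_load_spec:
 assumes s: "iregs s e cnt" "p < KI" "regs s 6 = int p" "regs s 34 = int (pc p)" "regs s 35 = int (dl p)"
  and j: "j < n" and A: "\<And>k. k < NN ==> arrs s 4 k = vh j k"
 shows "T query_load s (%s' t. t <= n*4+3 &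
   view KI p s' = put_query n (vec n (%k. vh j (pc p) - vh j k - int (dl p))) (view KI p s) &
   (\<forall>i<KI. i \<noteq> p --> view KI i s' = view KI i s) & same {14} {14} s s')"
proof -
 let ?c = "pc p"
 let ?w = "%k. vh j ?c - vh j k - int (dl p)"
 let ?v = "view KI p s"
 define vq where "vq q = ?v\<lparr>arrs := (arrs ?v)(1 := (%x. if x < q then ?w x else arrs ?v 1 x))\<rparr>" for q :: nat
 have cN: "?c < NN" using pc_KI s(2) by simp
 have r: "regs s 0 = int n" "regs s 5 = int KI" using s(1) by (auto simp: iregs_def)
 define I where "I q s' \<longleftrightarrow> view KI p s' = vq q & (\<forall>i<KI. i \<noteq> p --> view KI i s' = view KI i s) & same {14} {14} s s'" for q s'
 have fin: "vq n = put_query n (vec n ?w) ?v"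
 proof -
  have "(if x < n then ?w x else arrs ?v 1 x) = (if x < n then vec n ?w $ x else arrs ?v 1 x)" for x by simp
  then show ?thesis by (simp add: vq_def put_query_def)
 qed
 show ?thesis unfolding query_load_def
 proof (rule T_for_const[where I = I and m = n and K = 1])
  show "int n <= B" using B_facts by linarith
  show "I 0 (setr s 14 0)" unfolding I_def vq_def by (auto simp: same_def)
 next
  fix q s' assume "I q s'"
  then show "aok B s' (R 0) & av s' (R 0) = int n"
   unfolding I_def using same_regs[of "{14}" "{14}" s s' 0] r by simp
 next
  fix s' kp assume "I n s'" "kp <= n*(1+3)+3"
  then show "kp <= n*4+3 & view KI p s' = put_query n (vec n ?w) ?v &
    (\<forall>i<KI. i \<noteq> p --> view KI i s' = view KI i s) & same {14} {14} s s'"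
   unfolding I_def fin by simp
 next
  fix q s' assume q: "q < n" and I: "I q s'" and r14: "regs s' 14 = int q" and b: "bnd B s'"
  have sm: "same {14} {14} s s'" using I by (simp add: I_def)
  have r': "regs s' x = regs s x" if "x \<noteq> 14" for x using same_regs[OF sm] that by simp
  have a4: "arrs s' 4 = arrs s 4" using same_arrs[OF sm] by simp
  have qN: "q < NN" using q n_le_NN by simp
  have d2: "int (dl p) <= 2*int n"
  proof -
   have "dl p <= 2*n" using dl_le[of p] D0_n by linarith
   then show ?thesis by linarith
  qed
  have n3: "3*int n <= B" using B_lin[of "3*n"] by simp
  show "T (Store 14 (R 14\<boxtimes>R 5\<boxplus>R 6) (Rd 4 (R 34)\<boxminus>Rd 4 (R 14)\<boxminus>R 35)) s'
   (%s2 t. t <= 1 & I (Suc q) (setr s2 14 (int (Suc q))))"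
  proof (rule T_StoreV[where p = "q*KI+p" and v = "?w q"], goal_cases)
   case 2
   show ?case using r14 r' s a4 A[OF cN] A[OF qN] by simp
  next
   case 7
   show ?case using vr[OF j cN] vr[OF j qN] d2 n3 by linarith
  next
   case 8
   let ?t = "seta s' 14 (q*KI+p) (?w q)"
   have "view KI i ?t = (if i = p then (view KI p s')\<lparr>arrs := (arrs (view KI p s'))(1 := (arrs (view KI p s') 1)(q := ?w q))\<rparr> else view KI i s')"
    if "i < KI" for i using view_store[of p KI i s' 1 q "?w q"] s(2) that by simp
   moreover have "(vq q)\<lparr>arrs := (arrs (vq q))(1 := (arrs (vq q) 1)(q := ?w q))\<rparr> = vq (Suc q)"
    by (auto simp: vq_def fun_eq_iff less_Suc_eq)
   ultimately show ?case using I s(2) unfolding I_def by (auto simp: same_def)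
  qed (use r14 r' r s in auto)
 qed auto
qed

lemma query_collect_spec:
 assumes s: "iregs s e cnt" "active (2^e') p" "regs s 6 = int p" "regs s 34 = int (pc p)" "regs s 35 = int (dl p)"
  and j: "j < n" and A: "\<And>k. k < NN ==> arrs s 4 k = vh j k" "\<And>i k. i < n ==> k < NN ==> mm s i k = Mh i k"
  and v: "view KI p s = SC (pc p) (dl p) (Suc j)" and O0: "outI j e' p (arrs s 2)"
 shows "T query_collect s (%s' t. t <= n*9+3 & outI j e' (Suc p) (arrs s' 2) & same {13, 32} {2} s s')"
proof -
 have p: "p < KI" using s(2) by (rule KI_less)
 let ?c = "pc p"
 have cN: "?c < NN" using pc_KI p by simp
 have r: "regs s 0 = int n" "regs s 1 = int NN" "regs s 5 = int KI" using s(1) by (auto simp: iregs_def)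
 have bit: "arrs s 15 (i*KI+p) = (if hit j p i then 1 else 0)" if i: "i < n" for i
 proof -
  have "arrs s 15 (i*KI+p) = arrs (view KI p s) 2 i" by (simp add: view_def)
  also have "\<dots> = (if \<exists>k<n. Mh i k - Mh i ?c = vh j ?c - vh j k - int (dl p) then 1 else 0)"
   unfolding v by (rule ansC[OF cN dl_le j i])
  also have "(\<exists>k<n. Mh i k - Mh i ?c = vh j ?c - vh j k - int (dl p)) = hit j p i"
   unfolding hit_def hitv_def by (intro ex_cong1) (auto simp: algebra_simps)
  finally show ?thesis .
 qed
 define I where "I q s' \<longleftrightarrow> (\<forall>i<n. (arrs s' 2 i = 8*int NN \<or> (\<exists>k<NN. arrs s' 2 i = Mh i k + vh j k)) &
   (\<forall>q'<p. active (2^e') q' --> hit j q' i --> arrs s' 2 i <= hitv j q' i) &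
   (i < q --> hit j p i --> arrs s' 2 i <= hitv j p i)) & same {13, 32} {2} s s'" for q s'
 have d2: "int (dl p) <= 2*int n"
 proof -
  have "dl p <= 2*n" using dl_le[of p] D0_n by linarith
  then show ?thesis by linarith
 qed
 have n4: "4*int n <= B" using B_lin[of "4*n"] by simp
 have hB: "\<bar>hitv j p i\<bar> <= B" if "i < n" for i
  unfolding hitv_def using Mr[OF that cN] vr[OF j cN] d2 n4 by linarith
 show ?thesis unfolding query_collect_def
 proof (rule T_for_const[where I = I and m = n and K = 6])
  show "int n <= B" using B_facts by linarith
  show "I 0 (setr s 13 0)" using O0 unfolding I_def outI_def by (auto simp: same_def)
 next
  fix q s' assume "I q s'"
  then show "aok B s' (R 0) & av s' (R 0) = int n"
   unfolding I_def using same_regs[of "{13, 32}" "{2}" s s' 0] r by simp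
 next
  fix s' kp assume "I n s'" "kp <= n*(6+3)+3"
  then show "kp <= n*9+3 & outI j e' (Suc p) (arrs s' 2) & same {13, 32} {2} s s'"
   unfolding I_def outI_def by (auto simp: less_Suc_eq)
 next
  fix q s' assume q: "q < n" and I: "I q s'" and r13: "regs s' 13 = int q" and b: "bnd B s'"
  have sm: "same {13, 32} {2} s s'" using I by (simp add: I_def)
  have r': "regs s' x = regs s x" if "x \<notin> {13, 32}" for x using same_regs[OF sm] that by simp
  have a': "arrs s' x = arrs s x" if "x \<noteq> 2" for x using same_arrs[OF sm] that by simp
  have em: "av s' (MMe (R 13) (R 34)) = Mh q ?c"
  proof -
   have "av s' (MMe (R 13) (R 34)) = mm s' q ?c" by (rule av_MMe) (use r13 r' r s in auto)
   also have "\<dots> = Mh q ?c" using A(2)[OF q cN] a'[of 3] by (simp add: mm_def)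
   finally show ?thesis .
  qed
  have pm: "0 <= av s' (MMi (R 13) (R 34))" using r13 r' r s by (simp add: MMi_def)
  have e15: "av s' (Rd 15 (R 13\<boxtimes>R 5\<boxplus>R 6)) = (if hit j p q then 1 else 0)"
  proof -
   have "av s' (R 13\<boxtimes>R 5\<boxplus>R 6) = int (q*KI+p)" using r13 r' r s by simp
   then show ?thesis unfolding av.simps(3) using bit[OF q] a'[of 15] by (simp only: nat_int)
  qed
  have p15: "0 <= av s' (R 13\<boxtimes>R 5\<boxplus>R 6)" using r13 r' r s by simp
  have ev: "av s' (MMe (R 13) (R 34)\<boxplus>Rd 4 (R 34)\<boxminus>R 35) = hitv j p q"
   unfolding av.simps(4) em using r' s a'[of 4] A(1)[OF cN] by (simp add: hitv_def)
  let ?t1 = "setr s' 32 (hitv j p q)"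
  let ?t2 = "seta ?t1 2 q (hitv j p q)"
  show "T (If (Equal (Rd 15 (R 13\<boxtimes>R 5\<boxplus>R 6)) (N 1))
    (Assign 32 (MMe (R 13) (R 34)\<boxplus>Rd 4 (R 34)\<boxminus>R 35) ;;
    If (Less (R 32) (Rd 2 (R 13))) (Store 2 (R 13) (R 32)) SKIP)
    SKIP) s' (%s2 t. t <= 6 & I (Suc q) (setr s2 13 (int (Suc q))))"
  proof (rule T_If, goal_cases)
   case 1
   show ?case using p15 B2 by simp
  next
   case 2
   then have h: "hit j p q" using e15 by (simp del: av.simps(3) split: if_splits)
   have ex: "\<exists>k<NN. hitv j p q = Mh q k + vh j k"
   proof -
    obtain k where "k < n" "Mh q k + vh j k = hitv j p q" using h unfolding hit_def by blast
    then show ?thesis using n_le_NN by (intro exI[of _ k]) auto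
   qed
   show ?case
   proof (rule T_AssignS[where v = "hitv j p q"], goal_cases)
    case 1
    show ?case by (rule ev)
   next
    case 2
    show ?case using pm r' s by simp
   next
    case 4
    show ?case by (rule hB[OF q])
   next
    case 5
    show ?case
    proof (rule T_If, goal_cases)
     case 1
     show ?case using r13 by simp
    next
     case 2
     have lt: "hitv j p q < arrs s' 2 q" using 2 r13 by simp
     show ?case
     proof (rule T_StoreV[where p = q and v = "hitv j p q"], goal_cases)
      case 8
      have "I (Suc q) (setr ?t2 13 (int (Suc q)))" unfolding I_def
      proof (intro conjI allI impI)
       fix i assume i: "i < n"
       let ?a = "arrs (setr ?t2 13 (int (Suc q))) 2"
       show "?a i = 8*int NN \<or> (\<exists>k<NN. ?a i = Mh i k + vh j k)"
        using I i ex by (auto simp: I_def)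
       show "?a i <= hitv j q' i" if "q' < p" "active (2^e') q'" "hit j q' i" for q'
       proof -
        have "arrs s' 2 i <= hitv j q' i" using I i that unfolding I_def by blast
        then show ?thesis using lt by (cases "i = q") auto
       qed
       show "?a i <= hitv j p i" if "i < Suc q" "hit j p i"
        using I i that unfolding I_def by (auto simp: less_Suc_eq)
      qed (use sm in \<open>auto simp: same_def\<close>)
      then show ?case by simp
     qed (use r13 hB[OF q] in auto)
    next
     case 3
     then have "arrs s' 2 q <= hitv j p q" using r13 by simp
     then have "I (Suc q) (setr ?t1 13 (int (Suc q)))"
      using I sm unfolding I_def by (auto simp: less_Suc_eq same_def)
     then show ?case by (intro T_Skip) simp
    qed
   qed auto
  next
   case 3
   then have h: "\<not> hit j p q" using e15 by (simp del: av.simps(3) split: if_splits)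
   have "I (Suc q) (setr s' 13 (int (Suc q)))"
    using I h sm unfolding I_def by (auto simp: less_Suc_eq same_def)
   then show ?case by (intro T_Skip) simp
  qed
 qed auto
qed

lemma query_body_spec:
 assumes s: "iregs s e cnt" "active (2^e) p" "regs s 6 = int p" "regs s 34 = int (pc p)" "regs s 35 = int (dl p)"
  and j: "j < n" and A: "\<And>k. k < NN ==> arrs s 4 k = vh j k" "\<And>i k. i < n ==> k < NN ==> mm s i k = Mh i k"
  and v: "view KI p s = SC (pc p) (dl p) j" and O0: "outI j e p (arrs s 2)"
  and B: "int (cnt+TC (pc p) (dl p) (Suc j)) <= B"
 shows "T (query_body qA) s (%s' t. t <= 13*n+8+5*TC (pc p) (dl p) (Suc j) & outI j e (Suc p) (arrs s' 2) &
   view KI p s' = SC (pc p) (dl p) (Suc j) & (\<forall>i<KI. i \<noteq> p --> view KI i s' = view KI i s) &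
   regs s' 4 = int (cnt+TC (pc p) (dl p) (Suc j)))"
proof -
 have p: "p < KI" using s(2) by (rule KI_less)
 have cN: "pc p < NN" using pc_KI p by simp
 have r: "regs s 0 = int n" "regs s 1 = int NN" "regs s 5 = int KI" "regs s 4 = int cnt" using s(1) by (auto simp: iregs_def)
 show ?thesis unfolding query_body_def
 proof (rule T_Seq, rule T_conseq[OF query_load_spec[OF s(1) p s(3-5) j A(1)]], goal_cases)
  case (2 s1 t1)
  have sm1: "same {14} {14} s s1" using 2 by blast
  have C: "T (ccom qA) s1 (%s' t'. t' <= 5*TC (pc p) (dl p) (Suc j) &
    simpost KI p s1 s' (TC (pc p) (dl p) (Suc j)) (SC (pc p) (dl p) (Suc j)))"
  proof (rule T_ccom[OF _ WA det(2) cmaxB(2)])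
   show "bs WA qA (view KI p s1) (SC (pc p) (dl p) (Suc j)) (TC (pc p) (dl p) (Suc j))"
    using 2 queryC[OF cN dl_le j] v by simp
  qed (use p s(3) r same_regs[OF sm1] KI_B(2) B in auto)
  show ?case
  proof (rule T_Seq, rule T_conseq[OF C], goal_cases)
   case (1 s2 t2)
   have r2: "regs s2 = (regs s1)(4 := regs s1 4+int (TC (pc p) (dl p) (Suc j)))" and a2: "\<And>a. a < 12 ==> arrs s2 a = arrs s1 a"
    and v2: "view KI p s2 = SC (pc p) (dl p) (Suc j)" and v2': "\<forall>i<KI. i \<noteq> p --> view KI i s2 = view KI i s1"
    using 1(1) by (auto simp: simpost_def)
   have a: "arrs s2 x = arrs s x" if "x < 12" for x using a2[OF that] same_arrs[OF sm1, of x] that by simp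
   have rr: "regs s2 x = regs s x" if "x \<notin> {4, 14}" for x using r2 same_regs[OF sm1, of x] that by simp
   have K: "T query_collect s2 (%s' t. t <= n*9+3 & outI j e (Suc p) (arrs s' 2) & same {13, 32} {2} s2 s')"
   proof (rule query_collect_spec[OF _ s(2) _ _ _ j _ _ v2])
    show "iregs s2 e (cnt+TC (pc p) (dl p) (Suc j))"
     using s(1) rr r2 same_regs[OF sm1, of 4] unfolding iregs_def by simp
   qed (use s rr a A O0 in \<open>auto simp: mm_def\<close>)
   show ?case
   proof (rule T_conseq[OF K], goal_cases)
    case (1 s3 t3)
    have sm3: "same {13, 32} {2} s2 s3" using 1 by blast
    have v3: "view KI i s3 = view KI i s2" for i by (rule view_cong) (use same_arrs[OF sm3] in auto)
    have "regs s3 4 = int (cnt+TC (pc p) (dl p) (Suc j))"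
     using same_regs[OF sm3, of 4] r2 same_regs[OF sm1, of 4] r by simp
    then show ?case using 1(1) \<open>t2 <= _ & _\<close> 2(1) v2 v2' v3 by simp
   qed
  qed
 qed auto
qed

lemma outI_skip: "outI j e p a ==> \<not> active (2^e) p ==> outI j e (Suc p) a"
 unfolding outI_def by (auto simp: less_Suc_eq)

lemma active_mono: "active D i ==> D <= D' ==> active D' i"
 unfolding active_def using mult_le_mono1[of D D' LP] by linarith

text \<open>Fewer copies are active at a smaller radius, so halving in the middle of a round keeps
  what has been collected.\<close>

lemma outI_mono: "outI j e p a ==> e' <= e ==> outI j e' p a"
proof -
 assume a: "outI j e p a" "e' <= e"
 have "active (2^e) q" if "active (2^e') q" for q
  by (rule active_mono[OF that]) (use a(2) in \<open>auto intro: power_increasing\<close>)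
 then show ?thesis using a(1) unfolding outI_def by blast
qed

end

section \<open>The query program\<close>

definition load_q :: com where
 "load_q = Assign 10 (N 1) ;;
   for_loop 14 (R 1)
   (If (Less (R 14) (R 0)) (Assign 32 (R 14)) (Assign 32 (R 0\<boxminus>N 1)) ;;
    Assign 17 (Rd 1 (R 32)) ;; Store 4 (R 14) (R 17) ;; Assign 16 (R 14) ;;
    Assign 15 (R 0\<boxplus>R 0) ;; upd ;;
    Assign 17 (N 0\<boxminus>R 17) ;; Assign 15 (R 0\<boxplus>R 0\<boxplus>N 1) ;; upd ;;
    If (Less (N 0) (R 14)) (If (Less (Rd 4 (R 14)) (Rd 4 (R 14\<boxminus>N 1))) (Assign 10 (N 0)) SKIP) SKIP)"

definition init_out :: com where
 "init_out = for_loop 13 (R 0) (Store 2 (R 13) (N 8\<boxtimes>R 1))"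

text \<open>Monotonicity of the rows, the columns and the current query can be tested on the data at
  hand. Monotonicity in time cannot, since it concerns future queries, but by the guarantee it must
  hold once the other three tests fail.\<close>

definition choose_mode :: com where
 "choose_mode = If (Equal (R 8) (N 1)) (Assign 12 (N 1))
   (If (Equal (R 9) (N 1)) (Assign 12 (N 2)) (If (Equal (R 10) (N 1)) (Assign 12 (N 1)) (Assign 12 (N 3))))"

text \<open>Starting again from register 11 at every query overwrites the list of the previous
  query; the precomputed events before that position stay.\<close>

definition scan :: com where
 "scan = Assign 37 (R 11) ;;
   If (Equal (R 12) (N 3))
   (for_loop 14 (R 1)
    (If (Less (Rd 9 (R 14)\<boxplus>R 3) (Rd 4 (R 14)))
     (Store 9 (R 14) (Rd 4 (R 14)) ;; Store 7 (R 37) (R 14) ;; Assign 37 (R 37\<boxplus>N 1)) SKIP))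
   SKIP"

definition query_prog :: "com => com" where
 "query_prog c = load_q ;; init_out ;; inst_loop (query_body c) ;; choose_mode ;; scan ;; for_loop 13 (R 0) row"

context red
begin

definition rowsM :: bool where "rowsM \<longleftrightarrow> (\<forall>i<n. \<forall>k. k+1 < NN --> Mh i k <= Mh i (k+1))"
definition colsM :: bool where "colsM \<longleftrightarrow> (\<forall>i. i+1 < n --> (\<forall>k<NN. Mh i k <= Mh (i+1) k))"
definition vmono :: "nat => bool" where "vmono j \<longleftrightarrow> (\<forall>k. k+1 < NN --> vh j k <= vh j (k+1))"
definition timeM :: bool where "timeM \<longleftrightarrow> (\<forall>j. j+1 < n --> (\<forall>k<NN. vh j k <= vh (j+1) k))"

lemma load_q_spec:
 assumes s: "regs s 0 = int n" "regs s 1 = int NN" and j: "j < n"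
  and A: "\<And>k. k < n ==> arrs s 1 k = vh j k" and t: "trep s (2*n) f0" "trep s (2*n+1) f1"
 shows "T load_q s (%s' t. t <= NN*(14*LG+32)+5 & (\<forall>k<NN. arrs s' 4 k = vh j k) &
   trep s' (2*n) (vh j) & trep s' (2*n+1) (%k. - vh j k) & regs s' 10 = (if vmono j then 1 else 0) &
   (\<forall>r h. r \<noteq> 2*n --> r \<noteq> 2*n+1 --> h < 2*NN --> tr s' r h = tr s r h) &
   same {10, 14, 15, 16, 17, 18, 32} {4, 5} s s')"
proof -
 define I where "I q s' \<longleftrightarrow> (\<forall>k<q. arrs s' 4 k = vh j k) &
   trep s' (2*n) (%k. if k < q then vh j k else f0 k) & trep s' (2*n+1) (%k. if k < q then - vh j k else f1 k) &
   regs s' 10 = (if \<forall>k. k+1 < q --> vh j k <= vh j (k+1) then 1 else 0) &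
   (\<forall>r h. r \<noteq> 2*n --> r \<noteq> 2*n+1 --> h < 2*NN --> tr s' r h = tr s r h) &
   same {10, 14, 15, 16, 17, 18, 32} {4, 5} s s'" for q s'
 have BB: "int (2*n+1) <= B" "int n <= B" "int NN <= B" "2 <= B" using B_lin[of "2*n+1"] B_facts by auto
 let ?s0 = "setr s 10 1"
 have tr0: "tr (s'\<lparr>regs := x\<rparr>) = tr s'" for s' x by (simp add: tr_def fun_eq_iff)
 have trr: "trep (s'\<lparr>regs := x\<rparr>) = trep s'" for s' x by (simp add: trep_def tvalid_def tr0 fun_eq_iff)
 have tra: "tr (s'\<lparr>arrs := (arrs s')(4 := x)\<rparr>) = tr s'" for s' x by (simp add: tr_def fun_eq_iff)
 have tra': "trep (s'\<lparr>arrs := (arrs s')(4 := x)\<rparr>) = trep s'" for s' x by (simp add: trep_def tvalid_def tra fun_eq_iff)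
 show ?thesis unfolding load_q_def
 proof (rule T_AssignS[where v = 1], goal_cases)
  case 5
  show ?case
  proof (rule T_for_const[where I = I and m = NN and K = "14*LG+29"])
   show "I 0 (setr ?s0 14 0)" unfolding I_def using t by (auto simp: same_def trr tr0)
  next
   fix q s' assume "I q s'"
   then show "aok B s' (R 1) & av s' (R 1) = int NN"
    unfolding I_def using same_regs[of "{10, 14, 15, 16, 17, 18, 32}" "{4, 5}" s s' 1] s by simp
  next
   fix s' kp assume I: "I NN s'" and k: "kp <= NN*(14*LG+29+3)+3"
   have "trep s' (2*n) (vh j)" "trep s' (2*n+1) (%k. - vh j k)"
    using I trep_fun_cong[of s' "2*n" "%k. if k < NN then vh j k else f0 k"]
     trep_fun_cong[of s' "2*n+1" "%k. if k < NN then - vh j k else f1 k"] unfolding I_def by auto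
   then show "Suc (Suc kp) <= NN*(14*LG+32)+5 & (\<forall>k<NN. arrs s' 4 k = vh j k) &
   trep s' (2*n) (vh j) & trep s' (2*n+1) (%k. - vh j k) & regs s' 10 = (if vmono j then 1 else 0) &
   (\<forall>r h. r \<noteq> 2*n --> r \<noteq> 2*n+1 --> h < 2*NN --> tr s' r h = tr s r h) &
   same {10, 14, 15, 16, 17, 18, 32} {4, 5} s s'" using I k unfolding I_def vmono_def by (simp add: add.commute)
  next
   fix q s' assume q: "q < NN" and I: "I q s'" and r14: "regs s' 14 = int q" and b: "bnd B s'"
   have sm: "same {10, 14, 15, 16, 17, 18, 32} {4, 5} s s'" using I by (simp add: I_def)
   have r': "regs s' 0 = int n" "regs s' 1 = int NN" using same_regs[OF sm] s by auto
   define m where "m = min q (n - 1)"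
   have m: "m < n" "vh j m = vh j q" using n0 vpad[of j q] by (auto simp: m_def)
   have a1: "arrs s' 1 m = vh j q" using same_arrs[OF sm, of 1] A[OF m(1)] m(2) by simp
   have vB: "\<bar>vh j q\<bar> <= B" using vr[OF j q] BB by linarith
   let ?s1 = "setr s' 32 (int m)"
   let ?s2 = "setr ?s1 17 (vh j q)"
   let ?s3 = "seta ?s2 4 q (vh j q)"
   let ?s4 = "setr ?s3 16 (int q)"
   let ?s5 = "setr ?s4 15 (int (2*n))"
   have t5: "trep ?s5 (2*n) (%k. if k < q then vh j k else f0 k)" "trep ?s5 (2*n+1) (%k. if k < q then - vh j k else f1 k)"
    using I unfolding I_def by (simp_all only: trr tra')
   have U1: "T upd ?s5 (%s6 t. t <= 7*LG & trep s6 (2*n) ((%k. if k < q then vh j k else f0 k)(q := regs ?s5 17)) &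
    (\<forall>r' h. r' \<noteq> 2*n --> h < 2*NN --> tr s6 r' h = tr ?s5 r' h) & same {18} {5} ?s5 s6)"
    by (rule upd_spec[OF _ _ _ q t5(1)]) (use r' in simp_all)
   have st1: "T (If (Less (R 14) (R 0)) (Assign 32 (R 14)) (Assign 32 (R 0\<boxminus>N 1))) s' (%s2 t. s2 = ?s1 & t = 2)"
   proof (rule T_If, goal_cases)
    case 2
    then show ?case using r14 r' q BB by (intro T_AssignV[where v = "int m"]) (auto simp: m_def)
   next
    case 3
    then have "m = n - 1" using r14 r' by (simp add: m_def)
    then show ?case using r14 r' q BB n0 by (intro T_AssignV[where v = "int m"]) (auto simp: of_nat_diff)
   qed simp
   have fin: "T (If (Less (N 0) (R 14)) (If (Less (Rd 4 (R 14)) (Rd 4 (R 14\<boxminus>N 1))) (Assign 10 (N 0)) SKIP) SKIP) s9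
     (%s10 t. t <= 3 & I (Suc q) (setr s10 14 (int (Suc q))))"
    if s9: "\<forall>k<Suc q. arrs s9 4 k = vh j k" "trep s9 (2*n) (%k. if k < Suc q then vh j k else f0 k)"
     "trep s9 (2*n+1) (%k. if k < Suc q then - vh j k else f1 k)" "regs s9 10 = regs s' 10" "regs s9 14 = int q"
     "\<forall>r h. r \<noteq> 2*n --> r \<noteq> 2*n+1 --> h < 2*NN --> tr s9 r h = tr s r h"
     "same {10, 14, 15, 16, 17, 18, 32} {4, 5} s s9" for s9
   proof -
    let ?P = "%q. \<forall>k. k+1 < q --> vh j k <= vh j (k+1)"
    have r10: "regs s9 10 = (if ?P q then 1 else 0)" using s9(4) I by (simp add: I_def)
    have Iq: "I (Suc q) (setr s10 14 (int (Suc q)))"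
     if "s10 = s9 \<or> s10 = setr s9 10 0" "regs s10 10 = (if ?P (Suc q) then 1 else 0)" for s10
     unfolding I_def using s9 that by (auto simp: trr tr0 same_def)
    show ?thesis
    proof (cases "q = 0")
     case True
     have "?P (Suc q)" using True by simp
     then have "regs s9 10 = (if ?P (Suc q) then 1 else 0)" using r10 True by simp
     then show ?thesis using Iq[of s9] s9(5) True B2 by (intro T_If T_Skip) auto
    next
     case False
     then obtain q' where q': "q = Suc q'" by (cases q) auto
     have P: "?P (Suc q) \<longleftrightarrow> ?P q & vh j q' <= vh j q" unfolding q' by (auto simp: less_Suc_eq)
     have i1: "av s9 (R 14\<boxminus>N 1) = int q'" using s9(5) q' by simp
     have e: "arrs s9 4 q = vh j q" "arrs s9 4 q' = vh j q'" using s9(1) q' by auto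
     have bv: "bv s9 (Less (Rd 4 (R 14)) (Rd 4 (R 14\<boxminus>N 1))) \<longleftrightarrow> \<not> vh j q' <= vh j q"
      unfolding bv.simps av.simps(3) i1 using s9(5) e by auto
     show ?thesis
     proof (rule T_If, goal_cases)
      case 2
      show ?case
      proof (rule T_If, goal_cases)
       case 1
       show ?case using s9(5) i1 B2 by simp
      next
       case 2
       have n: "\<not> vh j q' <= vh j q" using bv 2 by blast
       show ?case using Iq[of "setr s9 10 0"] n P B2 by (intro T_AssignV[where v = 0]) auto
      next
       case 3
       have n: "vh j q' <= vh j q" using bv 3 by blast
       show ?case using Iq[of s9] n P r10 by (intro T_Skip) auto
      qed
     qed (use s9(5) False B2 in auto)
    qed
   qed
   show "T (If (Less (R 14) (R 0)) (Assign 32 (R 14)) (Assign 32 (R 0\<boxminus>N 1)) ;;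
    Assign 17 (Rd 1 (R 32)) ;; Store 4 (R 14) (R 17) ;; Assign 16 (R 14) ;;
    Assign 15 (R 0\<boxplus>R 0) ;; upd ;;
    Assign 17 (N 0\<boxminus>R 17) ;; Assign 15 (R 0\<boxplus>R 0\<boxplus>N 1) ;; upd ;;
    If (Less (N 0) (R 14)) (If (Less (Rd 4 (R 14)) (Rd 4 (R 14\<boxminus>N 1))) (Assign 10 (N 0)) SKIP) SKIP) s'
    (%s2 t. t <= 14*LG+29 & I (Suc q) (setr s2 14 (int (Suc q))))"
   proof (rule T_Seq, rule T_conseq[OF st1], goal_cases)
    case (1 u1 w1)
    then have u1: "u1 = ?s1" "w1 = 2" by auto
    show ?case unfolding u1
     apply (rule T_AssignS[where v = "vh j q"], (use a1 vB in simp_all)[4])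
     apply (rule T_StoreS[where p = q and v = "vh j q"], (use r14 vB in simp_all)[7])
     apply (rule T_AssignS[where v = "int q"], (use r14 q BB in simp_all)[4])
     apply (rule T_AssignS[where v = "int (2*n)"], (use r' BB in simp_all)[4])
    proof (rule T_Seq, rule T_conseq[OF U1], goal_cases)
     case (1 s6 w6)
     have sm6: "same {18} {5} ?s5 s6" using 1 by blast
     let ?s7 = "setr s6 17 (- vh j q)"
     let ?s8 = "setr ?s7 15 (int (2*n+1))"
     have r6: "regs s6 0 = int n" "regs s6 1 = int NN" "regs s6 14 = int q" "regs s6 16 = int q" "regs s6 17 = vh j q"
      "regs s6 10 = regs s' 10"
      using same_regs[OF sm6] r' r14 by auto
     have t8: "trep ?s8 (2*n+1) (%k. if k < q then - vh j k else f1 k)"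
      unfolding trr by (rule trep_cong[OF t5(2)]) (use 1 in simp)
     have t8': "trep ?s8 (2*n) (%k. if k < Suc q then vh j k else f0 k)"
     proof -
      have "trep s6 (2*n) ((%k. if k < q then vh j k else f0 k)(q := vh j q))" using 1 by simp
      then show ?thesis unfolding trr by (rule trep_fun_cong) (auto simp: less_Suc_eq)
     qed
     have U2: "T upd ?s8 (%s9 t. t <= 7*LG & trep s9 (2*n+1) ((%k. if k < q then - vh j k else f1 k)(q := regs ?s8 17)) &
      (\<forall>r' h. r' \<noteq> 2*n+1 --> h < 2*NN --> tr s9 r' h = tr ?s8 r' h) & same {18} {5} ?s8 s9)"
      by (rule upd_spec[OF _ _ _ q t8]) (use r6 in simp_all)
     have w6: "w6 <= 7*LG" and o6: "\<forall>r' h. r' \<noteq> 2*n --> h < 2*NN --> tr s6 r' h = tr ?s5 r' h" using 1 by auto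
     show ?case
      apply (rule T_AssignS[where v = "- vh j q"], (use r6 vB B2 in simp_all)[4])
      apply (rule T_AssignS[where v = "int (2*n+1)"], (use r6 BB in simp_all)[4])
     proof (rule T_Seq, rule T_conseq[OF U2], goal_cases)
      case (1 s9 w9)
      have sm9: "same {18} {5} ?s8 s9" using 1 by blast
      have a9: "arrs s9 4 = (arrs s' 4)(q := vh j q)" using same_arrs[OF sm9, of 4] same_arrs[OF sm6, of 4] by simp
      have F: "T (If (Less (N 0) (R 14)) (If (Less (Rd 4 (R 14)) (Rd 4 (R 14\<boxminus>N 1))) (Assign 10 (N 0)) SKIP) SKIP) s9
       (%s10 t. t <= 3 & I (Suc q) (setr s10 14 (int (Suc q))))"
      proof (rule fin)
       show "\<forall>k<Suc q. arrs s9 4 k = vh j k" using I a9 unfolding I_def by (auto simp: less_Suc_eq)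
       show "trep s9 (2*n) (%k. if k < Suc q then vh j k else f0 k)"
        by (rule trep_cong[OF t8']) (use 1 in simp)
       show "trep s9 (2*n+1) (%k. if k < Suc q then - vh j k else f1 k)"
       proof -
        have "trep s9 (2*n+1) ((%k. if k < q then - vh j k else f1 k)(q := - vh j q))" using 1 by simp
        then show ?thesis by (rule trep_fun_cong) (auto simp: less_Suc_eq)
       qed
       show "\<forall>r h. r \<noteq> 2*n --> r \<noteq> 2*n+1 --> h < 2*NN --> tr s9 r h = tr s r h"
       proof (intro allI impI)
        fix r h assume a: "r \<noteq> 2*n" "r \<noteq> 2*n+1" "h < 2*NN"
        have "tr s9 r h = tr ?s8 r h" using 1 a by blast
        also have "\<dots> = tr s6 r h" by (simp only: tr0)
        also have "\<dots> = tr ?s5 r h" using o6 a by blast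
        also have "\<dots> = tr s' r h" by (simp only: tr0 tra)
        also have "\<dots> = tr s r h" using I a unfolding I_def by blast
        finally show "tr s9 r h = tr s r h" .
       qed
       show "regs s9 10 = regs s' 10" "regs s9 14 = int q" using same_regs[OF sm9] r6 by auto
       show "same {10, 14, 15, 16, 17, 18, 32} {4, 5} s s9" using sm sm6 sm9 by (auto simp: same_def)
      qed
      show ?case by (rule T_conseq[OF F]) (use 1 w6 u1 in auto)
     qed
    qed
   qed
  qed (use BB in auto)
 qed (use B2 in auto)
qed

lemma init_out_spec:
 assumes s: "regs s 0 = int n" "regs s 1 = int NN"
 shows "T init_out s (%s' t. t <= n*4+3 & (\<forall>i<n. arrs s' 2 i = 8*int NN) & same {13} {2} s s')"
 unfolding init_out_def
proof (rule T_for_const[where I = "%q s'. (\<forall>i<q. arrs s' 2 i = 8*int NN) & same {13} {2} s s'" and m = n and K = 1])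
 fix q s' assume a: "q < n" "(\<forall>i<q. arrs s' 2 i = 8*int NN) & same {13} {2} s s'" "regs s' 13 = int q"
 then have r: "regs s' 1 = int NN" using same_regs[of "{13}" "{2}" s s' 1] s by simp
 show "T (Store 2 (R 13) (N 8\<boxtimes>R 1)) s' (%s'' t. t <= 1 &
   (\<forall>i<Suc q. arrs (setr s'' 13 (int (Suc q))) 2 i = 8*int NN) &
   same {13} {2} s (setr s'' 13 (int (Suc q))))"
  by (rule T_StoreV[where p = q and v = "8*int NN"]) (use a r B_facts in \<open>auto simp: less_Suc_eq same_def\<close>)
next
 fix q s' assume "(\<forall>i<q. arrs s' 2 i = 8*int NN) & same {13} {2} s s'"
 then show "aok B s' (R 0) & av s' (R 0) = int n" using same_regs[of "{13}" "{2}" s s' 0] s by simp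
qed (use B_facts in \<open>auto simp: same_def\<close>)

lemma choose_mode_spec:
 assumes "regs s 8 = (if rowsM then 1 else 0)" "regs s 9 = (if colsM then 1 else 0)" "regs s 10 = (if vmono j then 1 else 0)"
 shows "T choose_mode s (%s' t. t <= 4 & s' = setr s 12 (if rowsM then 1 else if colsM then 2 else if vmono j then 1 else 3))"
proof -
 have c: "regs s 8 = 1 \<longleftrightarrow> rowsM" "regs s 9 = 1 \<longleftrightarrow> colsM" "regs s 10 = 1 \<longleftrightarrow> vmono j" and B: "3 <= B"
  using assms B_facts by auto
 show ?thesis unfolding choose_mode_def
  apply (rule T_If, (use B in simp))
   apply (rule T_AssignV[where v = 1], (use c B in simp_all)[5])
  apply (rule T_If, (use B in simp))
   apply (rule T_AssignV[where v = 2], (use c B in simp_all)[5])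
  apply (rule T_If, (use B in simp))
   apply (rule T_AssignV[where v = 1], (use c B in simp_all)[5])
  apply (rule T_AssignV[where v = 3], (use c B in simp_all)[5])
  done
qed

text \<open>Columns whose outdated query entry (array 9) is refreshed.\<close>

definition late :: "(nat => int) => nat => nat => nat => nat list" where
 "late st e j q = filter (%k. st k+2^e < vh j k) [0..<q]"

lemma scan_spec:
 assumes s: "regs s 1 = int NN" "regs s 3 = 2^e" "regs s 11 = int PT" "regs s 12 = 3"
  and PT: "int (PT+NN+1) <= B"
  and A: "\<And>k. k < NN ==> arrs s 4 k = vh j k"
 shows "T scan s (%s' t. t <= NN*10+10 & regs s' 37 = int (PT+length (late (arrs s 9) e j NN)) &
   (\<forall>x<length (late (arrs s 9) e j NN). arrs s' 7 (PT+x) = int (late (arrs s 9) e j NN ! x)) &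
   (\<forall>p<PT. arrs s' 7 p = arrs s 7 p) &
   (\<forall>k<NN. arrs s' 9 k = (if k \<in> set (late (arrs s 9) e j NN) then vh j k else arrs s 9 k)) & same {14, 37} {7, 9} s s')"
proof (rule T_bnd)
 assume b0: "bnd B s"
 let ?l = "late (arrs s 9) e j"
 define I where "I q s' \<longleftrightarrow> regs s' 37 = int (PT+length (?l q)) &
   (\<forall>x<length (?l q). arrs s' 7 (PT+x) = int (?l q ! x)) & (\<forall>p<PT. arrs s' 7 p = arrs s 7 p) &
   (\<forall>k<NN. arrs s' 9 k = (if k \<in> set (?l q) then vh j k else arrs s 9 k)) & same {14, 37} {7, 9} s s'" for q s'
 have ll: "length (?l q) <= q" for q unfolding late_def by (rule le_trans[OF length_filter_le]) simp
 have lS: "?l (Suc q) = (if arrs s 9 q+2^e < vh j q then ?l q @ [q] else ?l q)" for q by (simp add: late_def)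
 have lm: "k \<in> set (?l q) ==> k < q" for k q by (simp add: late_def)
 show ?thesis unfolding scan_def
 proof (rule T_AssignS[where v = "int PT"], goal_cases)
  case 5
  let ?s0 = "setr s 37 (int PT)"
  show ?case
  proof (rule T_If, goal_cases)
   case 2
   show ?case
   proof (rule T_for_const[where I = I and m = NN and K = 6])
    show "I 0 (setr ?s0 14 0)" unfolding I_def by (auto simp: late_def same_def)
   next
    fix q s' assume "I q s'"
    then show "aok B s' (R 1) & av s' (R 1) = int NN"
     unfolding I_def using same_regs[of "{14, 37}" "{7, 9}" s s' 1] s by simp
   next
    fix s' kp assume "I NN s'" "kp <= NN*(6+3)+3"
    then show "Suc (Suc (Suc kp)) <= NN*10+10 & regs s' 37 = int (PT+length (?l NN)) &
     (\<forall>x<length (?l NN). arrs s' 7 (PT+x) = int (?l NN ! x)) & (\<forall>p<PT. arrs s' 7 p = arrs s 7 p) &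
     (\<forall>k<NN. arrs s' 9 k = (if k \<in> set (?l NN) then vh j k else arrs s 9 k)) & same {14, 37} {7, 9} s s'"
     unfolding I_def by auto
   next
    fix q s' assume q: "q < NN" and I: "I q s'" and r14: "regs s' 14 = int q" and b: "bnd B s'"
    have sm: "same {14, 37} {7, 9} s s'" using I by (simp add: I_def)
    have r': "regs s' 3 = 2^e" using same_regs[OF sm] s by auto
    have a4: "arrs s' 4 q = vh j q" using same_arrs[OF sm, of 4] A[OF q] by simp
    have a9: "arrs s' 9 q = arrs s 9 q" using I q lm[of q q] unfolding I_def by auto
    have r37: "regs s' 37 = int (PT+length (?l q))" using I by (simp add: I_def)
    have pB: "int (PT+length (?l q))+1 <= B" using PT ll[of q] q by linarith
    have vB: "\<bar>vh j q\<bar> <= B" using bnd_arrs[OF b, of 4 q] a4 by simp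
    show "T (If (Less (Rd 9 (R 14)\<boxplus>R 3) (Rd 4 (R 14)))
     (Store 9 (R 14) (Rd 4 (R 14)) ;; Store 7 (R 37) (R 14) ;; Assign 37 (R 37\<boxplus>N 1)) SKIP) s'
     (%s2 t. t <= 6 & I (Suc q) (setr s2 14 (int (Suc q))))"
    proof (rule T_If, goal_cases)
     case 1
     show ?case using r14 by simp
    next
     case 2
     then have c: "arrs s 9 q+2^e < vh j q" using r14 r' a4 a9 by simp
     let ?t1 = "seta s' 9 q (vh j q)"
     let ?t2 = "seta ?t1 7 (PT+length (?l q)) (int q)"
     let ?t3 = "setr ?t2 37 (int (PT+length (?l q)+1))"
     have "I (Suc q) (setr ?t3 14 (int (Suc q)))" unfolding I_def
     proof (intro conjI allI impI)
      fix x assume "x < length (?l (Suc q))"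
      then show "arrs (setr ?t3 14 (int (Suc q))) 7 (PT+x) = int (?l (Suc q) ! x)"
       using I c unfolding I_def lS by (auto simp: nth_append less_Suc_eq)
     qed (use I c sm in \<open>auto simp: I_def lS same_def\<close>)
     note fin = this
     show ?case
      apply (rule T_StoreS[where p = q and v = "vh j q"], (use r14 a4 vB in simp_all)[7])
      apply (rule T_StoreS[where p = "PT+length (?l q)" and v = "int q"], (use r14 r37 q B_facts in simp_all)[7])
      apply (rule T_AssignV[where v = "int (PT+length (?l q)+1)"], (use r37 pB B2 in simp_all)[4])
      using fin by simp
    next
     case 3
     then have c: "\<not> arrs s 9 q+2^e < vh j q" using r14 r' a4 a9 by simp
     have "I (Suc q) (setr s' 14 (int (Suc q)))"
      using I c sm unfolding I_def lS by (auto simp: same_def)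
     then show ?case by (intro T_Skip) simp
    qed
   qed (use B_facts in auto)
  qed (use s B_facts in auto)
 qed (use s PT B2 in auto)
qed

end

section \<open>All rows of one query in the three modes\<close>

definition RR :: "nat set" where "RR = {13} \<union> {15..29} \<union> {33}"

lemma wr_row: "wregs row \<subseteq> RR - {13}" "warrs row \<subseteq> {2, 5, 6}"
 by (auto simp: row_def row_tail_def refresh_def search_def bfs_def els1_def els2_def RR_def)

context red
begin

text \<open>The outdated copy of row \<open>i\<close> when columns are refreshed as soon as they are off by more than \<open>E\<close>.\<close>

fun cur :: "nat => nat => nat => int" where
 "cur E 0 k = Mh 0 k"
| "cur E (Suc i) k = (if cur E i k+int E < Mh (Suc i) k then Mh (Suc i) k else cur E i k)"

text \<open>Row 0 reloads every column, because the tree shared by all rows still holds sums of the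
  previous query.\<close>

definition isev :: "nat => nat => nat => bool" where
 "isev E i k \<longleftrightarrow> i = 0 \<or> cur E (i - 1) k+int E < Mh i k"

definition evs :: "nat => nat => nat list" where
 "evs E i = filter (isev E i) [0..<NN]"

lemma cur_bounds: "i < n ==> k < NN ==> 1 <= cur E i k & cur E i k <= int n"
proof (induction i)
 case 0
 then show ?case using Mr by simp
next
 case (Suc i)
 then show ?case using Mr[of "Suc i" k] by auto
qed

lemma cur_stale: "colsM ==> i < n ==> k < NN ==> cur E i k <= Mh i k & Mh i k <= cur E i k+int E"
proof (induction i)
 case (Suc i)
 have "Mh i k <= Mh (Suc i) k" using Suc.prems unfolding colsM_def by simp
 then show ?case using Suc by auto
qed simp

text \<open>Every event after the one in row 0 raises the outdated entry by more than
  \<open>E\<close>; the summand \<open>E\<close> on the right pays for that first event.\<close>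

lemma count_events:
 assumes k: "k < NN"
 shows "Suc m <= n ==> int (\<Sum>i<Suc m. if isev E i k then 1 else 0)*int E <= cur E m k+int E"
proof (induction m)
 case 0
 then show ?case using Mr[of 0 k] k by (simp add: isev_def)
next
 case (Suc m)
 have IH: "int (\<Sum>i<Suc m. if isev E i k then 1 else 0)*int E <= cur E m k+int E" using Suc by simp
 show ?case
 proof (cases "isev E (Suc m) k")
  case True
  then have "cur E m k+int E < cur E (Suc m) k" by (simp add: isev_def)
  moreover have "int (\<Sum>i<Suc (Suc m). if isev E i k then 1 else 0)*int E =
    int (\<Sum>i<Suc m. if isev E i k then 1 else 0)*int E+int E"
   using True by (simp add: algebra_simps)
  ultimately show ?thesis using IH by linarith
 next
  case False
  then have "cur E (Suc m) k = cur E m k" by (simp add: isev_def)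
  moreover have "(\<Sum>i<Suc (Suc m). if isev E i k then 1 else 0) = (\<Sum>i<Suc m. if isev E i k then 1 else (0::nat))"
   using False by simp
  ultimately show ?thesis using IH by simp
 qed
qed

lemma length_evs: "length (evs E i) = (\<Sum>k<NN. if isev E i k then 1 else 0)"
proof -
 have "length (filter P [0..<m]) = (\<Sum>k<m. if P k then 1 else 0)" for P m by (induction m) auto
 then show ?thesis by (simp add: evs_def)
qed

text \<open>A column has at most \<open>n / E + 1\<close> events since entries are at most
  \<open>n\<close>; this is at most \<open>2 * nu\<close> because
  \<open>n <= NN <= nu * E\<close>.\<close>

lemma total_events:
 assumes nu: "NN <= nu*E"
 shows "(\<Sum>i<n. length (evs E i)) <= NN*(2*nu)"
proof -
 have E: "0 < E" using nu NN0 by (cases E) auto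
 have nu0: "0 < nu" using nu NN0 by (cases nu) auto
 have "(\<Sum>i<n. length (evs E i)) = (\<Sum>k<NN. \<Sum>i<n. if isev E i k then 1 else 0)"
  unfolding length_evs by (rule sum.swap)
 also have "\<dots> <= (\<Sum>k<NN. 2*nu)"
 proof (rule sum_mono)
  fix k assume "k \<in> {..<NN}"
  then have k: "k < NN" by simp
  obtain m where m: "n = Suc m" using n0 by (cases n) auto
  let ?c = "\<Sum>i<n. if isev E i k then 1 else (0::nat)"
  have "int ?c*int E <= cur E m k+int E" using count_events[OF k, of m E] m by simp
  also have "\<dots> <= int n+int E" using cur_bounds[of m k E] k m by simp
  finally have "int (?c*E) <= int (n+E)" by simp
  then have "?c*E <= n+E" by linarith
  also have "\<dots> <= nu*E+nu*E" using n_le_NN nu nu0 by (intro add_mono) auto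
  finally have "?c*E <= nu*E+nu*E" .
  then have "?c*E <= (2*nu)*E" by (simp only: mult_2 add_mult_distrib)
  then show "?c <= 2*nu" using E by (simp only: mult_le_cancel2)
 qed
 also have "\<dots> = NN*(2*nu)" by simp
 finally show ?thesis .
qed

abbreviation vl :: "nat => nat => nat => int" where "vl j i k \<equiv> Mh i k + vh j k"

lemma trep_same5: "arrs s' 5 = arrs s 5 ==> trep s' r f = trep s r f"
 by (simp add: trep_def tvalid_def tr_def)

lemma rows_exact:
 assumes s: "base s (2^e)" "regs s 12 = 1" and j: "j < n"
  and t: "\<And>i. i < n ==> trep s i (Mh i)" "\<And>i. i < n ==> trep s (n+i) (%k. - Mh i k)"
   "trep s (2*n) (vh j)" "trep s (2*n+1) (%k. - vh j k)"
  and m: "\<And>i k. i < n ==> k < NN ==> mm s i k = Mh i k" "\<And>k. k < NN ==> arrs s 4 k = vh j k"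
  and mono: "rowsM \<or> vmono j"
 shows "T (for_loop 13 (R 0) row) s (%s' t. t <= n*(88*LG*(NN div 2^e)+93)+3 &
   (\<forall>i<n. outpost (2^e) (vl j i) (arrs s 2 i) (arrs s' 2 i)) & arrs s' 5 = arrs s 5)"
proof -
 define I where "I q s' \<longleftrightarrow> (\<forall>i<n. if i < q then outpost (2^e) (vl j i) (arrs s 2 i) (arrs s' 2 i)
   else arrs s' 2 i = arrs s 2 i) & arrs s' 5 = arrs s 5 & same RR {2, 5, 6} s s'" for q s'
 have RRn: "0 \<notin> RR" "1 \<notin> RR" "2 \<notin> RR" "3 \<notin> RR" "12 \<notin> RR" by (auto simp: RR_def)
 show ?thesis
 proof (rule T_for_const[where I = I and m = n and K = "88*LG*(NN div 2^e)+90"])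
  show "13 \<notin> wregs row" using wr_row(1) by auto
  show "int n <= B" using B_facts by linarith
  show "I 0 (setr s 13 0)" unfolding I_def by (auto simp: same_def RR_def)
 next
  fix q s' assume "I q s'"
  then show "aok B s' (R 0) & av s' (R 0) = int n"
   unfolding I_def using same_regs[of RR "{2, 5, 6}" s s' 0] RRn s by (simp add: base_def)
 next
  fix s' kp assume I: "I n s'" and "kp <= n*(88*LG*(NN div 2^e)+90+3)+3"
  then show "kp <= n*(88*LG*(NN div 2^e)+93)+3 &
   (\<forall>i<n. outpost (2^e) (vl j i) (arrs s 2 i) (arrs s' 2 i)) & arrs s' 5 = arrs s 5"
   unfolding I_def by (simp add: add.commute)
 next
  fix q s' assume q: "q < n" and I: "I q s'" and r13: "regs s' 13 = int q"
  have sm: "same RR {2, 5, 6} s s'" and a5: "arrs s' 5 = arrs s 5" using I by (auto simp: I_def)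
  have r': "regs s' x = regs s x" if "x \<notin> RR" for x using same_regs[OF sm that] .
  have a': "arrs s' x = arrs s x" if "x \<notin> {2, 6}" for x using same_arrs[OF sm, of x] a5 that by (cases "x = 5") auto
  have R: "T row s' (%s'' t. t <= 88*LG*(NN div 2^e)+90 & (\<forall>p. p \<noteq> q --> arrs s'' 2 p = arrs s' 2 p) &
    outpost (2^e) (%k. Mh q k + vh j k) (arrs s' 2 q) (arrs s'' 2 q) & arrs s'' 5 = arrs s' 5)"
  proof (rule row_exact)
   show "(\<forall>k. k+1 < NN --> Mh q k <= Mh q (k+1)) \<or> (\<forall>k. k+1 < NN --> vh j k <= vh j (k+1))"
    using mono q unfolding rowsM_def vmono_def by blast
   show "base s' (2^e)" using s(1) r' RRn unfolding base_def by simp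
   show "regs s' 12 = 1" using s r' RRn by simp
  qed (use q r13 t trep_same5[OF a5] m a' Mr vr[OF j] in \<open>auto simp: mm_def\<close>)
  show "T row s' (%s'' t. t <= 88*LG*(NN div 2^e)+90 & I (Suc q) (setr s'' 13 (int (Suc q))))"
  proof (rule T_conseq[OF R], goal_cases)
   case (1 s2 t2)
   have sm2: "same RR {2, 5, 6} s' s2" by (rule same_mono[OF 1(2)]) (use wr_row in auto)
   have "same RR {2, 5, 6} s s2" by (rule same_trans[OF sm sm2]) auto
   then have "same RR {2, 5, 6} s (setr s2 13 (int (Suc q)))" by (auto simp: same_def RR_def)
   moreover have "arrs s' 2 q = arrs s 2 q" using I q unfolding I_def by auto
   ultimately show ?case using 1(1) I q unfolding I_def by (auto simp: less_Suc_eq)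
  qed
 qed simp
qed

text \<open>One tree serves all rows because they are treated in order: after row \<open>i\<close>
  it holds \<open>cur E i k + v[k]\<close>. Refreshing is charged per event, and
  \<open>total_events\<close> bounds the events over all rows.\<close>

lemma rows_cols:
 assumes s: "base s (2^e)" "regs s 12 = 2" and j: "j < n"
  and t: "trep s (2*n+3) g0" and z: "\<And>h. h < 2*NN ==> tr s (2*n+2) h = 0"
  and m: "\<And>i k. i < n ==> k < NN ==> mm s i k = Mh i k" "\<And>k. k < NN ==> arrs s 4 k = vh j k"
  and ev: "\<And>i. i < n ==> \<exists>lo. arrs s 8 (2^e*(n+1)+i) = int lo &
    arrs s 8 (2^e*(n+1)+i+1) = int (lo+length (evs (2^e) i)) &
    (\<forall>x<length (evs (2^e) i). arrs s 7 (lo+x) = int (evs (2^e) i ! x))"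
  and mono: colsM
 shows "T (for_loop 13 (R 0) row) s (%s' t. t <= (\<Sum>i<n. length (evs (2^e) i))*(7*LG+8)+n*(88*LG*(NN div 2^e)+93)+3 &
   (\<forall>i<n. outpost (2^e) (vl j i) (arrs s 2 i) (arrs s' 2 i)) & (\<exists>g. trep s' (2*n+3) g) &
   (\<forall>r h. r \<noteq> 2*n+3 --> h < 2*NN --> tr s' r h = tr s r h))"
proof -
 define I where "I q s' kp \<longleftrightarrow> (\<forall>i<n. if i < q then outpost (2^e) (vl j i) (arrs s 2 i) (arrs s' 2 i)
   else arrs s' 2 i = arrs s 2 i) & (\<exists>g. trep s' (2*n+3) g & (0 < q --> (\<forall>k<NN. g k = cur (2^e) (q - 1) k + vh j k))) &
   (\<forall>r h. r \<noteq> 2*n+3 --> h < 2*NN --> tr s' r h = tr s r h) & same RR {2, 5, 6} s s' &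
   kp <= (\<Sum>i<q. length (evs (2^e) i))*(7*LG+8)+q*(88*LG*(NN div 2^e)+93)" for q s' kp
 have RRn: "0 \<notin> RR" "1 \<notin> RR" "2 \<notin> RR" "3 \<notin> RR" "12 \<notin> RR" by (auto simp: RR_def)
 show ?thesis
 proof (rule T_for[where I = I and m = n])
  show "13 \<notin> wregs row" using wr_row(1) by auto
  show "int n <= B" using B_facts by linarith
  have "trep (setr s 13 0) (2*n+3) g0" using t by (simp add: trep_def tvalid_def tr_def)
  then show "I 0 (setr s 13 0) 0" unfolding I_def by (auto simp: same_def RR_def tr_def)
 next
  fix q s' kp assume "I q s' kp"
  then have "same RR {2, 5, 6} s s'" by (simp add: I_def)
  then show "aok B s' (R 0) & av s' (R 0) = int n"
   using same_regs[of RR "{2, 5, 6}" s s' 0] RRn s by (simp add: base_def)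
 next
  fix s' kp assume I: "I n s' kp"
  then show "kp + 3 <= (\<Sum>i<n. length (evs (2^e) i))*(7*LG+8)+n*(88*LG*(NN div 2^e)+93)+3 &
   (\<forall>i<n. outpost (2^e) (vl j i) (arrs s 2 i) (arrs s' 2 i)) & (\<exists>g. trep s' (2*n+3) g) &
   (\<forall>r h. r \<noteq> 2*n+3 --> h < 2*NN --> tr s' r h = tr s r h)"
   unfolding I_def by auto
 next
  fix q s' kp assume q: "q < n" and I: "I q s' kp" and r13: "regs s' 13 = int q"
  have sm: "same RR {2, 5, 6} s s'" using I by (simp add: I_def)
  have r': "regs s' x = regs s x" if "x \<notin> RR" for x using same_regs[OF sm that] .
  have a': "arrs s' x = arrs s x" if "x \<notin> {2, 5, 6}" for x using same_arrs[OF sm that] .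
  obtain g where g: "trep s' (2*n+3) g" "0 < q --> (\<forall>k<NN. g k = cur (2^e) (q - 1) k + vh j k)"
   using I unfolding I_def by blast
  have oth: "\<forall>r h. r \<noteq> 2*n+3 --> h < 2*NN --> tr s' r h = tr s r h" using I unfolding I_def by blast
  obtain lo where lo: "arrs s 8 (2^e*(n+1)+q) = int lo"
   "arrs s 8 (2^e*(n+1)+q+1) = int (lo+length (evs (2^e) q))"
   "\<forall>x<length (evs (2^e) q). arrs s 7 (lo+x) = int (evs (2^e) q ! x)" using ev[OF q] by blast
  have R: "T row s' (%s'' t. t <= length (evs (2^e) q)*(7*LG+8)+88*LG*(NN div 2^e)+90 &
    (\<forall>p. p \<noteq> q --> arrs s'' 2 p = arrs s' 2 p) &
    outpost (2^e) (%k. Mh q k + vh j k) (arrs s' 2 q) (arrs s'' 2 q) &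
    trep s'' (2*n+3) (%k. cur (2^e) q k + vh j k) &
    (\<forall>r' h. r' \<noteq> 2*n+3 --> h < 2*NN --> tr s'' r' h = tr s' r' h))"
  proof (rule row_stale[where lo = lo and evs = "evs (2^e) q" and g = g])
   show "base s' (2^e)" using s(1) r' RRn unfolding base_def by simp
   have "arrs s' 8 = arrs s 8" using a' by simp
   then show "regs s' 12 = 2 & 2*n+3 = 2*n+3 & arrs s' 8 (2^e*(n+1)+q) = int lo &
    arrs s' 8 (2^e*(n+1)+q+1) = int (lo+length (evs (2^e) q)) \<or>
    regs s' 12 = 3 & 2*n+3 = 2*n+4+q & regs s' 11 = int lo & regs s' 37 = int (lo+length (evs (2^e) q))"
    using s r' RRn lo by simp
   fix k assume k: "k < NN"
   show "cur (2^e) q k + vh j k = (if k \<in> set (evs (2^e) q) then Mh q k + vh j k else g k)"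
   proof (cases q)
    case 0
    then show ?thesis using k by (simp add: evs_def isev_def)
   next
    case (Suc q')
    then show ?thesis using k g(2) by (auto simp: evs_def isev_def)
   qed
   show "cur (2^e) q k + vh j k <= Mh q k + vh j k & Mh q k + vh j k <= cur (2^e) q k + vh j k+int (2^e)"
    using cur_stale[OF mono q k, of "2^e"] by linarith
  next
   fix x assume "x < length (evs (2^e) q)"
   then show "arrs s' 7 (lo+x) = int (evs (2^e) q ! x)" using lo(3) a'[of 7] by simp
  next
   fix h assume h: "h < 2*NN"
   have "tr s' (2*n+2) h = tr s (2*n+2) h" using oth h by simp
   then show "tr s' (2*n+2) h = 0" using z[OF h] by simp
  qed (use q r13 g(1) m a' Mr vr[OF j] in \<open>auto simp: mm_def evs_def\<close>)
  show "T row s' (%s'' t. I (Suc q) (setr s'' 13 (int (Suc q))) (kp + t+3))"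
  proof (rule T_conseq[OF R], goal_cases)
   case (1 s2 t2)
   let ?s3 = "setr s2 13 (int (Suc q))"
   have sm2: "same RR {2, 5, 6} s' s2" by (rule same_mono[OF 1(2)]) (use wr_row in auto)
   have "same RR {2, 5, 6} s s2" by (rule same_trans[OF sm sm2]) auto
   then have a: "same RR {2, 5, 6} s ?s3" by (auto simp: same_def RR_def)
   have b: "arrs s' 2 q = arrs s 2 q" using I q unfolding I_def by auto
   have c: "\<forall>i<n. if i < Suc q then outpost (2^e) (vl j i) (arrs s 2 i) (arrs ?s3 2 i) else arrs ?s3 2 i = arrs s 2 i"
    using 1(1) I b q unfolding I_def by (auto simp: less_Suc_eq)
   have d: "\<exists>g. trep ?s3 (2*n+3) g & (0 < Suc q --> (\<forall>k<NN. g k = cur (2^e) (Suc q - 1) k + vh j k))"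
    using 1(1) by (intro exI[of _ "%k. cur (2^e) q k + vh j k"]) (simp add: trep_def tvalid_def tr_def)
   have f: "\<forall>r h. r \<noteq> 2*n+3 --> h < 2*NN --> tr ?s3 r h = tr s r h" using 1(1) oth by (simp add: tr_def)
   have k: "kp <= (\<Sum>i<q. length (evs (2^e) i))*(7*LG+8)+q*(88*LG*(NN div 2^e)+93)"
    using I unfolding I_def by blast
   have "kp + t2+3 <= (\<Sum>i<Suc q. length (evs (2^e) i))*(7*LG+8)+Suc q*(88*LG*(NN div 2^e)+93)"
    using k 1(1) by (simp add: algebra_simps)
   then show ?case unfolding I_def using a c d f by blast
  qed
 qed simp
qed

text \<open>Every row keeps its own tree across queries, and all rows refresh the same columns, so
  one list \<open>l\<close> serves all of them.\<close>

lemma rows_time: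
 assumes s: "base s (2^e)" "regs s 12 = 3" "regs s 11 = int PT" "regs s 37 = int (PT+length l)" and j: "j < n"
  and t: "\<And>i. i < n ==> \<exists>g. trep s (2*n+4+i) g & (\<forall>k<NN. k \<notin> set l --> g k = Mh i k+arrs s 9 k)"
  and l: "\<And>k. k \<in> set l ==> k < NN & arrs s 9 k = vh j k" "\<And>x. x < length l ==> arrs s 7 (PT+x) = int (l ! x)"
  and z: "\<And>h. h < 2*NN ==> tr s (2*n+2) h = 0"
  and m: "\<And>i k. i < n ==> k < NN ==> mm s i k = Mh i k" "\<And>k. k < NN ==> arrs s 4 k = vh j k"
  and st: "\<And>k. k < NN ==> arrs s 9 k <= vh j k & vh j k <= arrs s 9 k+2^e"
 shows "T (for_loop 13 (R 0) row) s (%s' t. t <= n*(length l*(7*LG+8)+88*LG*(NN div 2^e)+93)+3 &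
   (\<forall>i<n. outpost (2^e) (vl j i) (arrs s 2 i) (arrs s' 2 i)) & (\<forall>i<n. trep s' (2*n+4+i) (%k. Mh i k+arrs s 9 k)) &
   (\<forall>r h. r < 2*n+4 --> h < 2*NN --> tr s' r h = tr s r h))"
proof -
 define I where "I q s' \<longleftrightarrow> (\<forall>i<n. if i < q then outpost (2^e) (vl j i) (arrs s 2 i) (arrs s' 2 i)
   else arrs s' 2 i = arrs s 2 i) & (\<forall>i<q. trep s' (2*n+4+i) (%k. Mh i k+arrs s 9 k)) &
   (\<forall>r h. (\<forall>i<q. r \<noteq> 2*n+4+i) --> h < 2*NN --> tr s' r h = tr s r h) & same RR {2, 5, 6} s s'" for q s'
 have RRn: "0 \<notin> RR" "1 \<notin> RR" "2 \<notin> RR" "3 \<notin> RR" "12 \<notin> RR" "11 \<notin> RR" "37 \<notin> RR" by (auto simp: RR_def)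
 show ?thesis
 proof (rule T_for_const[where I = I and m = n and K = "length l*(7*LG+8)+88*LG*(NN div 2^e)+90"])
  show "13 \<notin> wregs row" using wr_row(1) by auto
  show "int n <= B" using B_facts by linarith
  show "I 0 (setr s 13 0)" unfolding I_def by (auto simp: same_def RR_def tr_def)
 next
  fix q s' assume "I q s'"
  then have "same RR {2, 5, 6} s s'" by (simp add: I_def)
  then show "aok B s' (R 0) & av s' (R 0) = int n"
   using same_regs[of RR "{2, 5, 6}" s s' 0] RRn s by (simp add: base_def)
 next
  fix s' kp assume I: "I n s'" and k: "kp <= n*(length l*(7*LG+8)+88*LG*(NN div 2^e)+90+3)+3"
  have "\<forall>r h. r < 2*n+4 --> h < 2*NN --> tr s' r h = tr s r h" using I unfolding I_def by auto
  then show "kp <= n*(length l*(7*LG+8)+88*LG*(NN div 2^e)+93)+3 &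
   (\<forall>i<n. outpost (2^e) (vl j i) (arrs s 2 i) (arrs s' 2 i)) & (\<forall>i<n. trep s' (2*n+4+i) (%k. Mh i k+arrs s 9 k)) &
   (\<forall>r h. r < 2*n+4 --> h < 2*NN --> tr s' r h = tr s r h)"
   using I k unfolding I_def by (simp add: add_ac)
 next
  fix q s' assume q: "q < n" and I: "I q s'" and r13: "regs s' 13 = int q"
  have sm: "same RR {2, 5, 6} s s'" using I by (simp add: I_def)
  have r': "regs s' x = regs s x" if "x \<notin> RR" for x using same_regs[OF sm that] .
  have a': "arrs s' x = arrs s x" if "x \<notin> {2, 5, 6}" for x using same_arrs[OF sm that] .
  have oth: "\<forall>r h. (\<forall>i<q. r \<noteq> 2*n+4+i) --> h < 2*NN --> tr s' r h = tr s r h" using I unfolding I_def by blast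
  obtain g where g: "trep s (2*n+4+q) g" "\<forall>k<NN. k \<notin> set l --> g k = Mh q k+arrs s 9 k" using t[OF q] by blast
  have g': "trep s' (2*n+4+q) g" by (rule trep_cong[OF g(1)]) (use oth in simp)
  have R: "T row s' (%s'' t. t <= length l*(7*LG+8)+88*LG*(NN div 2^e)+90 &
    (\<forall>p. p \<noteq> q --> arrs s'' 2 p = arrs s' 2 p) &
    outpost (2^e) (%k. Mh q k + vh j k) (arrs s' 2 q) (arrs s'' 2 q) &
    trep s'' (2*n+4+q) (%k. Mh q k+arrs s 9 k) &
    (\<forall>r' h. r' \<noteq> 2*n+4+q --> h < 2*NN --> tr s'' r' h = tr s' r' h))"
  proof (rule row_stale[where lo = PT and evs = l and g = g])
   show "base s' (2^e)" using s(1) r' RRn unfolding base_def by simp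
   show "regs s' 12 = 2 & 2*n+4+q = 2*n+3 & arrs s' 8 (2^e*(n+1)+q) = int PT &
    arrs s' 8 (2^e*(n+1)+q+1) = int (PT+length l) \<or>
    regs s' 12 = 3 & 2*n+4+q = 2*n+4+q & regs s' 11 = int PT & regs s' 37 = int (PT+length l)"
    using s r' RRn by simp
   fix k assume k: "k < NN"
   show "Mh q k+arrs s 9 k = (if k \<in> set l then Mh q k + vh j k else g k)" using g(2) l(1) k by auto
   show "Mh q k+arrs s 9 k <= Mh q k + vh j k & Mh q k + vh j k <= Mh q k+arrs s 9 k+int (2^e)"
    using st[OF k] by simp
  next
   fix h assume h: "h < 2*NN"
   have "tr s' (2*n+2) h = tr s (2*n+2) h" using oth h by simp
   then show "tr s' (2*n+2) h = 0" using z[OF h] by simp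
  qed (use q r13 g' m a' Mr vr[OF j] l in \<open>auto simp: mm_def\<close>)
  show "T row s' (%s'' t. t <= length l*(7*LG+8)+88*LG*(NN div 2^e)+90 &
    I (Suc q) (setr s'' 13 (int (Suc q))))"
  proof (rule T_conseq[OF R], goal_cases)
   case (1 s2 t2)
   let ?s3 = "setr s2 13 (int (Suc q))"
   have sm2: "same RR {2, 5, 6} s' s2" by (rule same_mono[OF 1(2)]) (use wr_row in auto)
   have "same RR {2, 5, 6} s s2" by (rule same_trans[OF sm sm2]) auto
   then have a: "same RR {2, 5, 6} s ?s3" by (auto simp: same_def RR_def)
   have b: "arrs s' 2 q = arrs s 2 q" using I q unfolding I_def by auto
   have c: "\<forall>i<n. if i < Suc q then outpost (2^e) (vl j i) (arrs s 2 i) (arrs ?s3 2 i) else arrs ?s3 2 i = arrs s 2 i"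
    using 1(1) I b q unfolding I_def by (auto simp: less_Suc_eq)
   have o2: "\<And>r' h. r' \<noteq> 2*n+4+q ==> h < 2*NN ==> tr ?s3 r' h = tr s' r' h" using 1(1) by (simp add: tr_def)
   have d: "\<forall>i<Suc q. trep ?s3 (2*n+4+i) (%k. Mh i k+arrs s 9 k)"
   proof (intro allI impI)
    fix i assume i: "i < Suc q"
    show "trep ?s3 (2*n+4+i) (%k. Mh i k+arrs s 9 k)"
    proof (cases "i = q")
     case True
     then show ?thesis using 1(1) by (simp add: trep_def tvalid_def tr_def)
    next
     case False
     have "trep s' (2*n+4+i) (%k. Mh i k+arrs s 9 k)" using I False i unfolding I_def by auto
     then show ?thesis by (rule trep_cong) (use o2 False in simp)
    qed
   qed
   have f: "\<forall>r h. (\<forall>i<Suc q. r \<noteq> 2*n+4+i) --> h < 2*NN --> tr ?s3 r h = tr s r h" using o2 oth by simp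
   show ?case unfolding I_def using 1(1) a c d f by blast
  qed
 qed simp
qed

end

section \<open>Correct answers from a good sample\<close>

context red
begin

text \<open>The only event that depends on the samples. All radii are included because the radius in
  force at a given query depends on running times; at radius \<open>2^e\<close> only the prefix of
  samples whose copies are active may be used.\<close>

definition good :: bool where
 "good \<longleftrightarrow> (\<forall>j<n. \<forall>i<n. \<forall>e\<le>e0. NN div 2^e < card {k. k < NN & vl j i k <= Min (vl j i ` {..<NN})+2*2^e} -->
   (\<exists>a<2^e*LP. vl j i (xs ! a) <= Min (vl j i ` {..<NN})+2*2^e))"

text \<open>Padded columns repeat column \<open>n - 1\<close>, so an optimal column can be chosen
  among the original ones, the only ones that the equality instances contain.\<close>

lemma opt_attained_n: "i < n ==> \<exists>k<n. vl j i k = Min (vl j i ` {..<NN})"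
proof -
 have "Min (vl j i ` {..<NN}) \<in> vl j i ` {..<NN}" using NN0 by (intro Min_in) auto
 then obtain k where k: "k < NN" "vl j i k = Min (vl j i ` {..<NN})" by auto
 have "vl j i (min k (n - 1)) = vl j i k" using Mpad[of i k] vpad[of j k] by simp
 then show ?thesis using k n0 by (intro exI[of _ "min k (n - 1)"]) auto
qed

text \<open>If there are few near-optimal columns, the search has found the optimum. Otherwise some
  active sample \<open>b\<close> exceeds the optimum by \<open>d <= 2 * 2^e\<close>, and the copy
  for \<open>b\<close> and \<open>d\<close> has answered positively. In both cases the answer is an
  attained sum, because the optimum is below the initial \<open>8 * NN\<close>.\<close>

lemma result_correct:
 assumes "good" "j < n" "i < n" "e <= e0" "outI j e KI a" "outpost (2^e) (vl j i) (a i) x"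
 shows "x = Min (vl j i ` {..<NN})"
proof -
 let ?u = "Min (vl j i ` {..<NN})" and ?T = "{k. k < NN & vl j i k <= Min (vl j i ` {..<NN})+2*2^e}"
 have lo: "?u <= vl j i k" if "k < NN" for k using that by (intro Min_le) auto
 obtain k0 where k0: "k0 < n" "vl j i k0 = ?u" using opt_attained_n[OF assms(3)] by blast
 have ub: "?u <= 2*int n" using lo[OF NN0] Mr[OF assms(3) NN0] vr[OF assms(2) NN0] by linarith
 have a: "a i = 8*int NN \<or> (\<exists>k<NN. a i = vl j i k)" using assms(3,5) by (simp add: outI_def)
 have x: "x <= a i" "x = a i \<or> (\<exists>k<NN. x = vl j i k)" "card ?T <= NN div 2^e --> x <= ?u"
  using assms(6) by (auto simp: outpost_def)
 have le: "x <= ?u"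
 proof (cases "card ?T <= NN div 2^e")
  case False
  then have "NN div 2^e < card ?T" by simp
  then obtain b where b: "b < 2^e*LP" "vl j i (xs ! b) <= ?u+2*2^e"
   using assms(1-4) unfolding good_def by blast
  have p2: "(2::nat)^e <= 2^e0" using assms(4) by (intro power_increasing) auto
  have bl: "b < length xs"
  proof -
   have "2^e*LP <= 2^e0*LP" using p2 by (rule mult_le_mono1)
   then show ?thesis using b(1) xs(1) unfolding LP_def by linarith
  qed
  have xb: "xs ! b < NN" using bl xs(2) nth_mem by blast
  define d where "d = nat (vl j i (xs ! b) - ?u)"
  have d: "int d = vl j i (xs ! b) - ?u" using lo[OF xb] by (simp add: d_def)
  then have "int d <= int (2*2^e)" using b(2) by simp
  then have d2: "d <= 2*2^e" by linarith
  define q where "q = b*ZZ+d"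
  have dZ: "d < ZZ" unfolding ZZ_def using d2 p2 by linarith
  have qd: "q div ZZ = b" "q mod ZZ = d" unfolding q_def using dZ by auto
  have "q < KI"
  proof -
   have "q < Suc b*ZZ" unfolding q_def using dZ by simp
   also have "\<dots> <= (2^e0*LP)*ZZ" using bl xs(1) by (intro mult_le_mono1) (simp add: LP_def)
   finally show ?thesis by (simp add: KI_def)
  qed
  then have act: "active (2^e) q" unfolding active_def using qd b(1) d2 by simp
  have hv: "hitv j q i = ?u" unfolding hitv_def pc_ZZ dl_ZZ qd using d by simp
  have "hit j q i" unfolding hit_def hv using k0 by blast
  then have "a i <= hitv j q i" using assms(3,5) act \<open>q < KI\<close> unfolding outI_def by blast
  then have "a i <= ?u" unfolding hv .
  then show ?thesis using x(1) by simp
 qed (use x in blast)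
 have "8*int NN > ?u" using ub n_le_NN n0 by linarith
 then have "\<exists>k<NN. x = vl j i k" using x(2) a le by auto
 then show ?thesis using le lo by fastforce
qed

end

text \<open>\<open>nu\<close> bounds \<open>NN / D\<close> for every radius with a certificate
  \<open>Dok\<close> and stands for that quotient in all time bounds. \<open>PT\<close> is the
  position in array 7 where the precomputed events end and the list of \<open>scan\<close>
  begins.\<close>

locale qry = red W B n L e0 tA Mh vh pA qA WA SC TC xs for W B n L e0 tA Mh vh pA qA WA SC TC xs +
 fixes nu PT :: nat
 assumes nu: "e <= e0 ==> Dok (2^e) ==> NN <= nu*2^e"
  and PTB: "int (PT+NN+1) <= B"
  and mono: "rowsM \<or> colsM \<or> (\<forall>j<n. vmono j) \<or> timeM"
begin

definition evok :: "state => bool" where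
 "evok s \<longleftrightarrow> (\<forall>e\<le>e0. \<forall>i<n. \<exists>lo. arrs s 8 (2^e*(n+1)+i) = int lo &
   arrs s 8 (2^e*(n+1)+i+1) = int (lo+length (evs (2^e) i)) & lo+length (evs (2^e) i) <= PT &
   (\<forall>x<length (evs (2^e) i). arrs s 7 (lo+x) = int (evs (2^e) i ! x)))"

definition stat :: "state => bool" where
 "stat s \<longleftrightarrow> regs s 8 = (if rowsM then 1 else 0) & regs s 9 = (if colsM then 1 else 0) & regs s 11 = int PT &
   (\<forall>i<n. \<forall>k<NN. mm s i k = Mh i k) & (\<forall>a<length xs. arrs s 10 a = int (xs ! a)) & evok s"

definition trees :: "state => bool" where
 "trees s \<longleftrightarrow> (\<forall>i<n. trep s i (Mh i) & trep s (n+i) (%k. - Mh i k)) & (\<forall>h<2*NN. tr s (2*n+2) h = 0) &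
   (\<exists>f. trep s (2*n) f) & (\<exists>f. trep s (2*n+1) f) & (\<exists>f. trep s (2*n+3) f)"

text \<open>\<open>- 2 * NN\<close> marks a column that has never been loaded; the leaves of the
  trees are arbitrary there.\<close>

definition stale :: "state => nat => bool" where
 "stale s j \<longleftrightarrow> (\<forall>k<NN. arrs s 9 k = - 2*int NN \<or> (\<exists>j'<j. arrs s 9 k = vh j' k)) &
   (\<forall>i<n. \<exists>g. trep s (2*n+4+i) g & (\<forall>k<NN. arrs s 9 k \<noteq> - 2*int NN --> g k = Mh i k+arrs s 9 k))"

text \<open>Potential for the refreshes over time: a refresh raises the stored entry by more than
  the radius. The shift by \<open>2 * NN\<close> makes columns that were never loaded count as
  zero.\<close>

definition vpot :: "state => nat" where
 "vpot s = (\<Sum>k<NN. nat (arrs s 9 k+2*int NN))"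

definition CQ :: nat where
 "CQ = NN*(14*LG+32)+KI*(13*n+30)+NN*(2*nu)*(7*LG+8)+n*(88*LG*nu+97)+NN*10+100"

lemma evok_cong: "evok s ==> arrs s' 8 = arrs s 8 ==> (\<And>p. p < PT ==> arrs s' 7 p = arrs s 7 p) ==> evok s'"
 unfolding evok_def
proof (intro allI impI)
 fix e i assume a: "\<forall>e\<le>e0. \<forall>i<n. \<exists>lo. arrs s 8 (2^e*(n+1)+i) = int lo &
   arrs s 8 (2^e*(n+1)+i+1) = int (lo+length (evs (2^e) i)) & lo+length (evs (2^e) i) <= PT &
   (\<forall>x<length (evs (2^e) i). arrs s 7 (lo+x) = int (evs (2^e) i ! x))"
  and b: "arrs s' 8 = arrs s 8" "\<And>p. p < PT ==> arrs s' 7 p = arrs s 7 p" and ei: "e <= e0" "i < n"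
 then obtain lo where lo: "arrs s 8 (2^e*(n+1)+i) = int lo"
   "arrs s 8 (2^e*(n+1)+i+1) = int (lo+length (evs (2^e) i))" "lo+length (evs (2^e) i) <= PT"
   "\<forall>x<length (evs (2^e) i). arrs s 7 (lo+x) = int (evs (2^e) i ! x)" by blast
 show "\<exists>lo. arrs s' 8 (2^e*(n+1)+i) = int lo &
   arrs s' 8 (2^e*(n+1)+i+1) = int (lo+length (evs (2^e) i)) & lo+length (evs (2^e) i) <= PT &
   (\<forall>x<length (evs (2^e) i). arrs s' 7 (lo+x) = int (evs (2^e) i ! x))"
  by (rule exI[of _ lo]) (use lo b in auto)
qed

lemma stat_cong:
 assumes "stat s" "regs s' 8 = regs s 8" "regs s' 9 = regs s 9" "regs s' 11 = regs s 11" "arrs s' 3 = arrs s 3"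
  "arrs s' 8 = arrs s 8" "arrs s' 10 = arrs s 10" "\<And>p. p < PT ==> arrs s' 7 p = arrs s 7 p"
 shows "stat s'"
 using assms evok_cong[of s s'] by (simp add: stat_def mm_def)

lemma inst_round:
 assumes j: "j < n" and s: "stat s" "ist (Suc j) 0 s e cnt" "\<And>k. k < NN ==> arrs s 4 k = vh j k"
  and o: "\<And>i. i < n ==> arrs s 2 i = 8*int NN"
 shows "T (inst_loop (query_body qA)) s (%s' t. \<exists>e' cnt'. same Xreg Xarr s s' & ist (Suc (Suc j)) 0 s' e' cnt' &
   outI j e' KI (arrs s' 2) & e' <= e & t+5*pot e cnt <= KI*(13*n+30)+3+5*pot e' cnt')"
proof -
 have R: "T (inst_loop (query_body qA)) s (%s' t. \<exists>e' cnt'. same Xreg Xarr s s' & ist (Suc (Suc j)) 0 s' e' cnt' &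
   outI j e' KI (arrs s' 2) & e' <= e & t+5*pot e cnt <= KI*(13*n+8+22)+3+5*pot e' cnt')"
 proof (rule round_spec[where X = "same Xreg Xarr s" and OI = "outI j" and pcol = pc and C = "13*n+8"])
  show "Suc j <= n" using j by simp
  show "wregs (query_body qA) \<subseteq> {4, 13, 14, 32, 36}" using wregs_ccom[of qA]
   by (auto simp: query_body_def query_load_def query_collect_def)
  show "warrs (query_body qA) \<subseteq> {2} \<union> {12..}" using warrs_ccom[of qA]
   by (auto simp: query_body_def query_load_def query_collect_def)
  show "outI j e 0 (arrs s 2)" using o by (simp add: outI_def)
 next
  fix s1 s2 assume "same Xreg Xarr s s1" "same {3, 4, 6, 13, 14, 31, 32, 34, 35, 36} ({2} \<union> {12..}) s1 s2"
  then show "same Xreg Xarr s s2" using same_trans[of Xreg Xarr s s1 Xreg Xarr s2] by (simp add: Xreg_def Xarr_def)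
 next
  fix s1 p assume sm: "same Xreg Xarr s s1" and p: "p < KI"
  have "p div ZZ < length xs" using p unfolding KI_def xs(1) LP_def by (rule less_mult_imp_div_less)
  moreover have "arrs s1 10 = arrs s 10" using same_arrs[OF sm, of 10] by (simp add: Xarr_def)
  ultimately show "arrs s1 10 (p div ZZ) = int (pc p)" using s(1) by (simp add: stat_def pc_ZZ)
 next
  fix s1 e1 cnt1 p
  assume a: "same Xreg Xarr s s1" "iregs s1 e1 cnt1" "active (2^e1) p" "outI j e1 p (arrs s1 2)" "regs s1 6 = int p"
   "regs s1 34 = int (pc p)" "regs s1 35 = int (p mod ZZ)"
   "view KI p s1 = (if Suc j = 0 then zero_state else SC (pc p) (dl p) (Suc j - 1))"
   "int (cnt1+TC (pc p) (dl p) (Suc j)) <= B"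
  have a3: "arrs s1 3 = arrs s 3" "arrs s1 4 = arrs s 4" using same_arrs[OF a(1)] by (auto simp: Xarr_def)
  have "T (query_body qA) s1 (%s' t. t <= 13*n+8+5*TC (pc p) (dl p) (Suc j) & outI j e1 (Suc p) (arrs s' 2) &
   view KI p s' = SC (pc p) (dl p) (Suc j) & (\<forall>i<KI. i \<noteq> p --> view KI i s' = view KI i s1) &
   regs s' 4 = int (cnt1+TC (pc p) (dl p) (Suc j)))"
   by (rule query_body_spec[OF a(2,3,5,6) _ j])
    (use a a3 s in \<open>auto simp: dl_ZZ stat_def mm_def\<close>)
  then show "T (query_body qA) s1 (%s' t. t <= 13*n+8+5*TC (pc p) (dl p) (Suc j) & outI j e1 (Suc p) (arrs s' 2) &
   view KI p s' = (if Suc (Suc j) = 0 then zero_state else SC (pc p) (dl p) (Suc (Suc j) - 1)) &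
   (\<forall>i<KI. i \<noteq> p --> view KI i s' = view KI i s1) & regs s' 4 = int (cnt1+TC (pc p) (dl p) (Suc j)))" by simp
 qed (use s outI_skip outI_mono in auto)
 show ?thesis by (rule T_conseq[OF R]) (simp add: add.assoc)
qed

lemma trep_regs: "trep (s\<lparr>regs := r\<rparr>) = trep s" "tr (s\<lparr>regs := r\<rparr>) = tr s"
 by (simp_all add: trep_def tvalid_def tr_def fun_eq_iff)

lemma late_props:
 assumes "k \<in> set (late st e j NN)" shows "k < NN" "st k+2^e < vh j k"
 using assms by (auto simp: late_def)

text \<open>Each listed column adds more than \<open>2^e\<close> to the potential. The radius may
  differ from query to query, so the count is scaled by \<open>NN <= nu * 2^e\<close> to make
  contributions of different radii comparable.\<close>

lemma vpot_refresh:
 assumes j: "j < n" and old: "\<And>k. k < NN ==> - 2*int NN <= st k"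
  and e: "NN <= nu*2^e"
 shows "length (late st e j NN)*NN+nu*(\<Sum>k<NN. nat (st k+2*int NN)) <=
  nu*(\<Sum>k<NN. nat ((if k \<in> set (late st e j NN) then vh j k else st k)+2*int NN))"
proof -
 have len: "length (late st e j NN) = (\<Sum>k<NN. if st k+2^e < vh j k then 1 else 0)"
 proof -
  have "length (filter P [0..<m]) = (\<Sum>k<m. if P k then 1 else 0)" for P m by (induction m) auto
  then show ?thesis by (simp add: late_def)
 qed
 have "length (late st e j NN)*2^e+(\<Sum>k<NN. nat (st k+2*int NN)) =
   (\<Sum>k<NN. (if st k+2^e < vh j k then 1 else 0)*2^e+nat (st k+2*int NN))"
  unfolding len by (simp add: sum.distrib sum_distrib_right)
 also have "\<dots> <= (\<Sum>k<NN. nat ((if k \<in> set (late st e j NN) then vh j k else st k)+2*int NN))"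
 proof (rule sum_mono)
  fix k assume "k \<in> {..<NN}"
  then have k: "k < NN" by simp
  show "(if st k+2^e < vh j k then 1 else 0)*2^e+nat (st k+2*int NN) <=
   nat ((if k \<in> set (late st e j NN) then vh j k else st k)+2*int NN)"
  proof (cases "st k+2^e < vh j k")
   case True
   then have "k \<in> set (late st e j NN)" using k by (simp add: late_def)
   moreover have "2^e+nat (st k+2*int NN) <= nat (vh j k+2*int NN)"
   proof -
    have "int (2^e+nat (st k+2*int NN)) = 2^e+(st k+2*int NN)" using old[OF k] by simp
    also have "\<dots> <= vh j k+2*int NN" using True by linarith
    finally show ?thesis by linarith
   qed
   ultimately show ?thesis using True by simp
  next
   case False
   then have "k \<notin> set (late st e j NN)" by (auto simp: late_def)
   then show ?thesis using False by simp
  qed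
 qed
 finally have *: "length (late st e j NN)*2^e+(\<Sum>k<NN. nat (st k+2*int NN)) <=
   (\<Sum>k<NN. nat ((if k \<in> set (late st e j NN) then vh j k else st k)+2*int NN))" .
 have "length (late st e j NN)*NN <= length (late st e j NN)*(nu*2^e)" using e by (rule mult_le_mono2)
 also have "\<dots> = nu*(length (late st e j NN)*2^e)" by (simp only: mult_ac)
 finally have "length (late st e j NN)*NN+nu*(\<Sum>k<NN. nat (st k+2*int NN)) <=
   nu*(length (late st e j NN)*2^e+(\<Sum>k<NN. nat (st k+2*int NN)))" by (simp add: distrib_left)
 also have "\<dots> <= nu*(\<Sum>k<NN. nat ((if k \<in> set (late st e j NN) then vh j k else st k)+2*int NN))"
  using * by (rule mult_le_mono2)
 finally show ?thesis .
qed

lemma timeM_le: "j' <= j ==> timeM ==> j < n ==> k < NN ==> vh j' k <= vh j k"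
proof (induction j rule: dec_induct)
 case (step m)
 have "vh m k <= vh (m+1) k" using step.prems unfolding timeM_def by simp
 then show ?case using step by simp
qed simp

definition finish :: com where "finish = choose_mode ;; scan ;; for_loop 13 (R 0) row"

text \<open>\<open>m\<close> is the number of columns refreshed because the query has moved on. Its
  cost has no good bound for a single query and is left explicit, to be paid by the increase of
  \<open>vpot\<close>; in modes 1 and 2 it is 0.\<close>

lemma finish_spec:
 assumes j: "j < n" and s: "stat s" "base s (2^e)" "e <= e0" "Dok (2^e)" "trees s" "stale s j"
  and v: "trep s (2*n) (vh j)" "trep s (2*n+1) (%k. - vh j k)" "\<And>k. k < NN ==> arrs s 4 k = vh j k"
   "regs s 10 = (if vmono j then 1 else 0)"
 shows "T finish s (%s' t. \<exists>m. trees s' & stat s' & stale s' (Suc j) & m*NN+nu * vpot s <= nu * vpot s' &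
   t <= NN*(2*nu)*(7*LG+8)+n*(88*LG*nu+93)+NN*10+40+n*(7*LG+8)*m &
   (\<forall>i<n. outpost (2^e) (vl j i) (arrs s 2 i) (arrs s' 2 i)) &
   same ({12, 14, 37} \<union> RR) {2, 5, 6, 7, 9} s s')"
proof -
 have q: "NN div 2^e <= nu"
 proof -
  have "NN div 2^e <= nu*2^e div 2^e" using nu[OF s(3,4)] by (rule div_le_mono)
  then show ?thesis by simp
 qed
 have qn: "n*(88*LG*(NN div 2^e)+93) <= n*(88*LG*nu+93)"
  using q by (intro mult_le_mono2 add_mono) auto
 let ?md = "if rowsM then 1 else if colsM then 2 else if vmono j then 1 else (3::int)"
 let ?s1 = "setr s 12 ?md"
 have CM: "T choose_mode s (%s' t. t <= 4 & s' = ?s1)"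
  by (rule choose_mode_spec) (use s(1) v(4) in \<open>auto simp: stat_def\<close>)
 have RRn: "x \<notin> RR" if "x \<in> {0, 1, 2, 3, 8, 9, 10, 11, 12, 37}" for x using that by (auto simp: RR_def)
 have e3: "regs s 3 = 2^e" "regs s 0 = int n" "regs s 1 = int NN" "regs s 11 = int PT" using s(1,2) by (auto simp: base_def stat_def)
 have mm: "mm s i k = Mh i k" if "i < n" "k < NN" for i k using s(1) that by (simp add: stat_def)
 have zz: "tr s (2*n+2) h = 0" if "h < 2*NN" for h using s(5) that by (simp add: trees_def)
 show ?thesis unfolding finish_def
 proof (rule T_Seq, rule T_conseq[OF CM], goal_cases)
  case (1 s' t')
  then have s': "s' = ?s1" and t': "t' <= 4" by auto
  show ?case
  proof (cases "?md = 3")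
   case False
   let ?s2 = "setr ?s1 37 (int PT)"
   have SC: "T scan ?s1 (%s2 t. t <= 4 & s2 = ?s2)" unfolding scan_def
    apply (rule T_AssignS[where v = "int PT"], (use e3 PTB in simp_all)[4])
    apply (rule T_If, (use B_facts in simp))
     apply (use False in simp)
    by (rule T_Skip) simp
   have base2: "base ?s2 (2^e)" using s(2) by (simp add: base_def)
   \<comment> \<open>Modes 1 and 2 change no tree except number \<open>2 * n + 3\<close>, so what
     follows the row loop is argued once for both.\<close>
   have fin: ?thesis if R: "T (for_loop 13 (R 0) row) ?s2 (%s' t. t <= NN*(2*nu)*(7*LG+8)+n*(88*LG*nu+93)+3 &
     (\<forall>i<n. outpost (2^e) (vl j i) (arrs ?s2 2 i) (arrs s' 2 i)) & (\<exists>g. trep s' (2*n+3) g) &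
     (\<forall>r h. r \<noteq> 2*n+3 --> h < 2*NN --> tr s' r h = tr ?s2 r h))"
    unfolding s'
   proof (rule T_Seq, rule T_conseq[OF SC], goal_cases)
    case (1 s2 t2)
    then have s2: "s2 = ?s2" and t2: "t2 <= 4" by auto
    show ?case unfolding s2
    proof (rule T_conseq[OF R], goal_cases)
     case (1 s3 t3)
     have sm3: "same RR {2, 5, 6} ?s2 s3" by (rule same_mono[OF 1(2)]) (use wr_row in \<open>auto simp: RR_def\<close>)
     have smF: "same ({12, 14, 37} \<union> RR) {2, 5, 6, 7, 9} s s3" using sm3 by (auto simp: same_def)
     have oth: "tr s3 r h = tr s r h" if "r \<noteq> 2*n+3" "h < 2*NN" for r h
      using 1(1) that by (simp add: tr_def)
     have tc: "trep s3 r f" if "trep s r f" "r \<noteq> 2*n+3" for r f by (rule trep_cong[OF that(1)]) (use oth that in simp)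
     have tr3: "trees s3"
      unfolding trees_def
     proof (intro conjI allI impI)
      fix i assume "i < n"
      then show "trep s3 i (Mh i)" "trep s3 (n+i) (%k. - Mh i k)" using tc s(5) unfolding trees_def by auto
     next
      fix h assume "h < 2*NN"
      then show "tr s3 (2*n+2) h = 0" using oth zz by simp
     next
      show "\<exists>f. trep s3 (2*n) f" using tc[OF v(1)] by auto
      show "\<exists>f. trep s3 (2*n+1) f" using tc[OF v(2)] by auto
      show "\<exists>f. trep s3 (2*n+3) f" using 1(1) by blast
     qed
     have a3: "arrs s3 x = arrs s x" if "x \<notin> {2, 5, 6}" for x using same_arrs[OF sm3 that] by simp
     have r3: "regs s3 8 = regs s 8" "regs s3 9 = regs s 9" "regs s3 11 = regs s 11"
      using same_regs[OF sm3, of 8] same_regs[OF sm3, of 9] same_regs[OF sm3, of 11] RRn by simp_all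
     have st3: "stat s3" by (rule stat_cong[OF s(1)]) (use a3 r3 in simp_all)
     have sl3: "stale s3 (Suc j)" unfolding stale_def
     proof (intro conjI allI impI)
      fix k assume "k < NN"
      then have *: "arrs s 9 k = - 2*int NN \<or> (\<exists>j'<j. arrs s 9 k = vh j' k)" using s(6) unfolding stale_def by blast
      show "arrs s3 9 k = - 2*int NN \<or> (\<exists>j'<Suc j. arrs s3 9 k = vh j' k)"
       proof -
       have "arrs s3 9 = arrs s 9" using a3 by simp
       then show ?thesis using * less_SucI unfolding \<open>arrs s3 9 = arrs s 9\<close> by blast
      qed
     next
      fix i assume i: "i < n"
      obtain g where "trep s (2*n+4+i) g" "\<forall>k<NN. arrs s 9 k \<noteq> - 2*int NN --> g k = Mh i k+arrs s 9 k"
       using s(6) i unfolding stale_def by blast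
      then show "\<exists>g. trep s3 (2*n+4+i) g & (\<forall>k<NN. arrs s3 9 k \<noteq> - 2*int NN --> g k = Mh i k+arrs s3 9 k)"
       using tc[of "2*n+4+i" g] a3[of 9] by (intro exI[of _ g]) auto
     qed
     have vp: "vpot s3 = vpot s" unfolding vpot_def using a3[of 9] by simp
     have tm: "Suc (t'+Suc (t2+t3)) <= NN*(2*nu)*(7*LG+8)+n*(88*LG*nu+93)+NN*10+40+n*(7*LG+8)*0"
      using 1(1) t' t2 by linarith
     have op: "\<forall>i<n. outpost (2^e) (vl j i) (arrs s 2 i) (arrs s3 2 i)" using 1(1) by simp
     have "0*NN+nu * vpot s <= nu * vpot s3" using vp by simp
     then show ?case using tr3 st3 sl3 tm op smF by blast
    qed
   qed
   show ?thesis
   proof (cases "?md = 1")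
    case True
    then have mo: "rowsM \<or> vmono j" by (auto split: if_splits)
    have R: "T (for_loop 13 (R 0) row) ?s2 (%s' t. t <= n*(88*LG*(NN div 2^e)+93)+3 &
     (\<forall>i<n. outpost (2^e) (vl j i) (arrs ?s2 2 i) (arrs s' 2 i)) & arrs s' 5 = arrs ?s2 5)"
     by (rule rows_exact[OF base2 _ j _ _ _ _ _ _ mo])
      (use True s(5) v mm in \<open>auto simp: trep_regs trees_def mm_def\<close>)
    show ?thesis
    proof (rule fin, rule T_conseq[OF R], goal_cases)
     case (1 s3 t3)
     have "tr s3 = tr ?s2" using 1(1) by (simp add: tr_def fun_eq_iff)
     moreover have "\<exists>g. trep s3 (2*n+3) g"
     proof -
      obtain g where "trep s (2*n+3) g" using s(5) unfolding trees_def by blast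
      then have "trep s3 (2*n+3) g" using 1(1) by (simp add: trep_def tvalid_def tr_def)
      then show ?thesis by blast
     qed
     moreover have "t3 <= NN*(2*nu)*(7*LG+8)+n*(88*LG*nu+93)+3"
      using 1(1) qn by linarith
     ultimately show ?case using 1(1) by simp
    qed
   next
    case False
    with \<open>?md \<noteq> 3\<close> have mo: "colsM" "?md = 2" by (auto split: if_splits)
    obtain g where g: "trep s (2*n+3) g" using s(5) unfolding trees_def by blast
    have R: "T (for_loop 13 (R 0) row) ?s2 (%s' t. t <= (\<Sum>i<n. length (evs (2^e) i))*(7*LG+8)+n*(88*LG*(NN div 2^e)+93)+3 &
     (\<forall>i<n. outpost (2^e) (vl j i) (arrs ?s2 2 i) (arrs s' 2 i)) & (\<exists>g. trep s' (2*n+3) g) &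
     (\<forall>r h. r \<noteq> 2*n+3 --> h < 2*NN --> tr s' r h = tr ?s2 r h))"
    proof (rule rows_cols[OF base2 _ j _ _ _ _ _ mo(1)])
     show "trep ?s2 (2*n+3) g" using g by (simp add: trep_regs)
     show "regs ?s2 12 = 2" using mo(2) by simp
     show "tr ?s2 (2*n+2) h = 0" if "h < 2*NN" for h using zz[OF that] by (simp add: tr_def)
     fix i assume "i < n"
     then have "\<exists>lo. arrs s 8 (2^e*(n+1)+i) = int lo & arrs s 8 (2^e*(n+1)+i+1) = int (lo+length (evs (2^e) i)) &
      (\<forall>x<length (evs (2^e) i). arrs s 7 (lo+x) = int (evs (2^e) i ! x))"
      using s(1,3) unfolding stat_def evok_def by blast
     then show "\<exists>lo. arrs ?s2 8 (2^e*(n+1)+i) = int lo & arrs ?s2 8 (2^e*(n+1)+i+1) = int (lo+length (evs (2^e) i)) &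
      (\<forall>x<length (evs (2^e) i). arrs ?s2 7 (lo+x) = int (evs (2^e) i ! x))" by simp
    qed (use v(3) mm in \<open>auto simp: mm_def\<close>)
    show ?thesis
    proof (rule fin, rule T_conseq[OF R], goal_cases)
     case (1 s3 t3)
     have "(\<Sum>i<n. length (evs (2^e) i))*(7*LG+8) <= NN*(2*nu)*(7*LG+8)"
      using total_events[OF nu[OF s(3,4)]] by (rule mult_le_mono1)
     then have "t3 <= NN*(2*nu)*(7*LG+8)+n*(88*LG*nu+93)+3" using 1(1) qn by linarith
     then show ?case using 1(1) by blast
    qed
   qed
  next
   case True
   then have nm: "\<not> rowsM" "\<not> colsM" "\<not> vmono j" by (auto split: if_splits)
   then have tm: timeM using mono j by blast
   let ?l = "late (arrs s 9) e j NN"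
   have SC: "T scan ?s1 (%s' t. t <= NN*10+10 & regs s' 37 = int (PT+length (late (arrs ?s1 9) e j NN)) &
     (\<forall>x<length (late (arrs ?s1 9) e j NN). arrs s' 7 (PT+x) = int (late (arrs ?s1 9) e j NN ! x)) &
     (\<forall>p<PT. arrs s' 7 p = arrs ?s1 7 p) &
     (\<forall>k<NN. arrs s' 9 k = (if k \<in> set (late (arrs ?s1 9) e j NN) then vh j k else arrs ?s1 9 k)) & same {14, 37} {7, 9} ?s1 s')"
    by (rule scan_spec) (use e3 True PTB v(3) in auto)
   have old: "arrs s 9 k = - 2*int NN \<or> (\<exists>j'<j. arrs s 9 k = vh j' k)" if "k < NN" for k
    using s(6) that unfolding stale_def by blast
   have p2: "(2::int)^e <= int NN" using pow_e_le[OF s(3)] by (metis of_nat_le_iff of_nat_numeral of_nat_power)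
   have old2: "- 2*int NN <= arrs s 9 k" if "k < NN" for k
   proof -
    from old[OF that] show ?thesis
    proof
     assume "\<exists>j'<j. arrs s 9 k = vh j' k"
     then obtain j' where j': "j' < j" "arrs s 9 k = vh j' k" by blast
     then show ?thesis using vr[of j' k] j that by simp
    qed simp
   qed
   \<comment> \<open>Entries are positive and \<open>2^e <= NN\<close>, so a column marked as never
     loaded is late at every radius.\<close>
   have fresh: "k \<in> set ?l" if "k < NN" "arrs s 9 k = - 2*int NN" for k
    proof -
    have "2^e - 2*int NN < vh j k" using p2 vr[OF j that(1)] NN0 by linarith
    then show ?thesis using that by (simp add: late_def)
   qed
   have nol: "arrs s 9 k \<noteq> - 2*int NN & arrs s 9 k <= vh j k & vh j k <= arrs s 9 k+2^e" if k: "k < NN" "k \<notin> set ?l" for k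
   proof -
    have ne: "arrs s 9 k \<noteq> - 2*int NN" using fresh k by blast
    then obtain j' where j': "j' < j" "arrs s 9 k = vh j' k" using old[OF k(1)] by blast
    then have "arrs s 9 k <= vh j k" using timeM_le[OF _ tm j k(1), of j'] by simp
    moreover have "vh j k <= arrs s 9 k+2^e" using k by (simp add: late_def)
    ultimately show ?thesis using ne by blast
   qed
   show ?thesis unfolding s'
   proof (rule T_Seq, rule T_conseq[OF SC], goal_cases)
    case (1 s2 t2)
    have sm2: "same {14, 37} {7, 9} ?s1 s2" using 1 by blast
    have t2: "t2 <= NN*10+10" and r37: "regs s2 37 = int (PT+length ?l)" and a7: "\<And>x. x < length ?l ==> arrs s2 7 (PT+x) = int (?l ! x)"
     and a7': "\<And>p. p < PT ==> arrs s2 7 p = arrs s 7 p" and a9: "\<And>k. k < NN ==> arrs s2 9 k = (if k \<in> set ?l then vh j k else arrs s 9 k)"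
     using 1(1) by auto
    have a2: "arrs s2 x = arrs s x" if "x \<notin> {7, 9}" for x using same_arrs[OF sm2 that] by simp
    have r2: "regs s2 x = regs s x" if "x \<notin> {12, 14, 37}" for x using same_regs[OF sm2, of x] that by simp
    have r12: "regs s2 12 = 3" using same_regs[OF sm2, of 12] True by simp
    have tr2: "tr s2 = tr s" using a2[of 5] by (simp add: tr_def fun_eq_iff)
    have trp2: "trep s2 = trep s" using tr2 by (simp add: trep_def tvalid_def fun_eq_iff)
    have st2: "arrs s2 9 k <= vh j k & vh j k <= arrs s2 9 k+2^e & arrs s2 9 k \<noteq> - 2*int NN" if k: "k < NN" for k
     using a9[OF k] nol[OF k] vr[OF j k] NN0 by (cases "k \<in> set ?l") auto
    have R: "T (for_loop 13 (R 0) row) s2 (%s' t. t <= n*(length ?l*(7*LG+8)+88*LG*(NN div 2^e)+93)+3 &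
      (\<forall>i<n. outpost (2^e) (vl j i) (arrs s2 2 i) (arrs s' 2 i)) & (\<forall>i<n. trep s' (2*n+4+i) (%k. Mh i k+arrs s2 9 k)) &
      (\<forall>r h. r < 2*n+4 --> h < 2*NN --> tr s' r h = tr s2 r h))"
    proof (rule rows_time[where PT = PT])
     show "base s2 (2^e)" using s(2) r2 unfolding base_def by simp
     fix i assume i: "i < n"
     obtain g where g: "trep s (2*n+4+i) g" "\<forall>k<NN. arrs s 9 k \<noteq> - 2*int NN --> g k = Mh i k+arrs s 9 k"
      using s(6) i unfolding stale_def by blast
     have "\<forall>k<NN. k \<notin> set ?l --> g k = Mh i k+arrs s2 9 k" using g(2) nol a9 by simp
     then show "\<exists>g. trep s2 (2*n+4+i) g & (\<forall>k<NN. k \<notin> set ?l --> g k = Mh i k+arrs s2 9 k)"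
      using g(1) trp2 by auto
    next
     fix k assume "k \<in> set ?l"
     then show "k < NN & arrs s2 9 k = vh j k" using late_props(1)[of k "arrs s 9" e j] a9[of k] by simp
    qed (use r12 r37 r2 e3 j a7 a2 tr2 zz mm v(3) st2 in \<open>auto simp: mm_def\<close>)
    show ?case
    proof (rule T_conseq[OF R], goal_cases)
     case (1 s3 t3)
     have sm3: "same RR {2, 5, 6} s2 s3" by (rule same_mono[OF 1(2)]) (use wr_row in \<open>auto simp: RR_def\<close>)
     have smF: "same ({12, 14, 37} \<union> RR) {2, 5, 6, 7, 9} s s3" using sm3 sm2 by (auto simp: same_def)
     have oth: "tr s3 r h = tr s r h" if "r < 2*n+4" "h < 2*NN" for r h using 1(1) that tr2 by simp
     have tc: "trep s3 r f" if "trep s r f" "r < 2*n+4" for r f by (rule trep_cong[OF that(1)]) (use oth that in simp)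
     have tr3: "trees s3"
      unfolding trees_def
     proof (intro conjI allI impI)
      fix i assume "i < n"
      then show "trep s3 i (Mh i)" "trep s3 (n+i) (%k. - Mh i k)" using tc s(5) unfolding trees_def by auto
     next
      fix h assume "h < 2*NN"
      then show "tr s3 (2*n+2) h = 0" using oth zz by simp
     next
      show "\<exists>f. trep s3 (2*n) f" using tc[OF v(1)] by auto
      show "\<exists>f. trep s3 (2*n+1) f" using tc[OF v(2)] by auto
      show "\<exists>f. trep s3 (2*n+3) f" proof -
       obtain f where "trep s (2*n+3) f" using s(5) unfolding trees_def by blast
       then show ?thesis using tc[of "2*n+3" f] by auto
      qed
     qed
     have a3: "arrs s3 x = arrs s2 x" if "x \<notin> {2, 5, 6}" for x using same_arrs[OF sm3 that] .
     have r3: "regs s3 8 = regs s 8" "regs s3 9 = regs s 9" "regs s3 11 = regs s 11"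
      using same_regs[OF sm3, of 8] same_regs[OF sm3, of 9] same_regs[OF sm3, of 11] RRn r2 by simp_all
     have st3: "stat s3" by (rule stat_cong[OF s(1)]) (use a3 a2 r3 a7' in simp_all)
     have a93: "arrs s3 9 = arrs s2 9" using a3 by simp
     have sl3: "stale s3 (Suc j)" unfolding stale_def
     proof (intro conjI allI impI)
      fix k assume k: "k < NN"
      show "arrs s3 9 k = - 2*int NN \<or> (\<exists>j'<Suc j. arrs s3 9 k = vh j' k)"
      proof (cases "k \<in> set ?l")
       case True
       then show ?thesis using a93 a9[OF k] by auto
      next
       case False
       then have *: "arrs s3 9 k = arrs s 9 k" using a93 a9[OF k] by simp
       show ?thesis unfolding * using old[OF k] less_SucI by blast
      qed
     next
      fix i assume i: "i < n"
      then have "trep s3 (2*n+4+i) (%k. Mh i k+arrs s2 9 k)" using 1(1) by blast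
      then show "\<exists>g. trep s3 (2*n+4+i) g & (\<forall>k<NN. arrs s3 9 k \<noteq> - 2*int NN --> g k = Mh i k+arrs s3 9 k)"
       unfolding a93 by blast
     qed
     have vp: "length ?l*NN+nu * vpot s <= nu * vpot s3"
     proof -
      have "vpot s3 = (\<Sum>k<NN. nat ((if k \<in> set ?l then vh j k else arrs s 9 k)+2*int NN))"
       unfolding vpot_def a93 by (rule sum.cong) (use a9 in auto)
      then show ?thesis using vpot_refresh[OF j old2 nu[OF s(3,4)]] by (simp add: vpot_def)
     qed
     have "n*(length ?l*(7*LG+8)+88*LG*(NN div 2^e)+93) =
      n*(7*LG+8)*length ?l+n*(88*LG*(NN div 2^e)+93)" by (simp add: algebra_simps)
     then have tm: "Suc (t'+Suc (t2+t3)) <= NN*(2*nu)*(7*LG+8)+n*(88*LG*nu+93)+NN*10+40+n*(7*LG+8)*length ?l"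
      using 1(1) t' t2 qn by linarith
     have op: "\<forall>i<n. outpost (2^e) (vl j i) (arrs s 2 i) (arrs s3 2 i)" using 1(1) a2[of 2] by simp
     show ?case using tr3 st3 sl3 vp tm op smF by blast
    qed
   qed
  qed
 qed
qed

end

context qry
begin

lemma ist_cong:
 assumes "ist r p s e cnt" "\<And>x. x \<in> {0, 1, 2, 3, 4, 5, 7} ==> regs s' x = regs s x" "\<And>a. 12 <= a ==> arrs s' a = arrs s a"
 shows "ist r p s' e cnt"
proof -
 have "view KI i s' = view KI i s" for i unfolding view_def using assms(3) by simp
 moreover have "iregs s' e cnt = iregs s e cnt" unfolding iregs_def using assms(2) by simp
 ultimately show ?thesis using assms(1) unfolding ist_def by simp
qed

lemma stale_cong:
 assumes "stale s j" "arrs s' 9 = arrs s 9" "\<And>r h. 2*n+4 <= r ==> h < 2*NN ==> tr s' r h = tr s r h"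
 shows "stale s' j"
 unfolding stale_def
proof (intro conjI allI impI)
 fix k assume "k < NN"
 then show "arrs s' 9 k = - 2*int NN \<or> (\<exists>j'<j. arrs s' 9 k = vh j' k)" using assms(1) unfolding assms(2) stale_def by blast
next
 fix i assume "i < n"
 then obtain g where g: "trep s (2*n+4+i) g" "\<forall>k<NN. arrs s 9 k \<noteq> - 2*int NN --> g k = Mh i k+arrs s 9 k"
  using assms(1) unfolding stale_def by blast
 have "trep s' (2*n+4+i) g" by (rule trep_cong[OF g(1)]) (use assms(3) in simp)
 then show "\<exists>g. trep s' (2*n+4+i) g & (\<forall>k<NN. arrs s' 9 k \<noteq> - 2*int NN --> g k = Mh i k+arrs s' 9 k)"
  using g(2) unfolding assms(2) by blast
qed

lemma trees_cong:
 assumes "trees s" "arrs s' 5 = arrs s 5" shows "trees s'"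
proof -
 have "tr s' = tr s" using assms(2) by (simp add: tr_def fun_eq_iff)
 then have "trep s' = trep s" by (simp add: trep_def tvalid_def fun_eq_iff)
 then show ?thesis using assms(1) \<open>tr s' = tr s\<close> by (simp add: trees_def)
qed

lemma query_spec:
 assumes j: "j < n" and s: "stat s" "trees s" "stale s j" "ist (Suc j) 0 s e cnt" "\<And>k. k < n ==> arrs s 1 k = vh j k"
 shows "T (query_prog qA) s (%s' t. \<exists>e' cnt' m. stat s' & trees s' & stale s' (Suc j) & ist (Suc (Suc j)) 0 s' e' cnt' &
   m*NN+nu * vpot s <= nu * vpot s' & t+5*pot e cnt <= CQ+5*pot e' cnt'+n*(7*LG+8)*m &
   (good --> (\<forall>i<n. arrs s' 2 i = Min (vl j i ` {..<NN}))))"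
proof -
 have r: "regs s 0 = int n" "regs s 1 = int NN" using s(4) by (auto simp: ist_def iregs_def)
 obtain f0 f1 where f: "trep s (2*n) f0" "trep s (2*n+1) f1" using s(2) unfolding trees_def by blast
 have Q: "query_prog qA = load_q ;; init_out ;; inst_loop (query_body qA) ;; finish" by (simp add: query_prog_def finish_def)
 show ?thesis unfolding Q
 proof (rule T_Seq, rule T_conseq[OF load_q_spec[OF r j s(5) f]], assumption, goal_cases)
  case (1 s1 t1)
  then have t1: "t1 <= NN*(14*LG+32)+5" and v1: "\<And>k. k < NN ==> arrs s1 4 k = vh j k"
   and v2: "trep s1 (2*n) (vh j)" "trep s1 (2*n+1) (%k. - vh j k)" "regs s1 10 = (if vmono j then 1 else 0)"
   and o1: "\<And>r h. r \<noteq> 2*n ==> r \<noteq> 2*n+1 ==> h < 2*NN ==> tr s1 r h = tr s r h"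
   and m1: "same {10, 14, 15, 16, 17, 18, 32} {4, 5} s s1" by auto
  have a1: "arrs s1 a = arrs s a" if "a \<noteq> 4" "a \<noteq> 5" for a using same_arrs[OF m1, of a] that by simp
  have st1: "stat s1" by (rule stat_cong[OF s(1)]) (use a1 same_regs[OF m1] in simp_all)
  have sl1: "stale s1 j" by (rule stale_cong[OF s(3)]) (use a1 o1 in auto)
  have tc: "trep s1 r f" if "trep s r f" "r \<noteq> 2*n" "r \<noteq> 2*n+1" for r f by (rule trep_cong[OF that(1)]) (use o1 that in simp)
  have tr1: "trees s1" unfolding trees_def
  proof (intro conjI allI impI)
   fix i assume "i < n"
   then show "trep s1 i (Mh i)" "trep s1 (n+i) (%k. - Mh i k)" using tc s(2) unfolding trees_def by auto
  next
   fix h assume "h < 2*NN"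
   then show "tr s1 (2*n+2) h = 0" using o1 s(2) unfolding trees_def by simp
  next
   show "\<exists>f. trep s1 (2*n) f" "\<exists>f. trep s1 (2*n+1) f" using v2 by blast+
   obtain f where "trep s (2*n+3) f" using s(2) unfolding trees_def by blast
   then show "\<exists>f. trep s1 (2*n+3) f" using tc[of "2*n+3" f] by auto
  qed
  have is1: "ist (Suc j) 0 s1 e cnt" by (rule ist_cong[OF s(4)]) (use a1 same_regs[OF m1] in auto)
  have r1: "regs s1 0 = int n" "regs s1 1 = int NN" using is1 by (auto simp: ist_def iregs_def)
  show ?case
  proof (rule T_Seq, rule T_conseq[OF init_out_spec[OF r1]], goal_cases)
   case (1 s2 t2)
   then have t2: "t2 <= n*4+3" and o2: "\<And>i. i < n ==> arrs s2 2 i = 8*int NN" and m2: "same {13} {2} s1 s2" by auto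
   have a2: "arrs s2 a = arrs s1 a" if "a \<noteq> 2" for a using same_arrs[OF m2, of a] that by simp
   have st2: "stat s2" by (rule stat_cong[OF st1]) (use a2 same_regs[OF m2] in simp_all)
   have is2: "ist (Suc j) 0 s2 e cnt" by (rule ist_cong[OF is1]) (use a2 same_regs[OF m2] in auto)
   have v4: "arrs s2 4 k = vh j k" if "k < NN" for k using a2 v1 that by simp
   show ?case
   proof (rule T_Seq, rule T_conseq[OF inst_round[OF j st2 is2 v4 o2]], assumption, assumption, goal_cases)
    case (1 s3 t3)
    then obtain e' cnt' where m3: "same Xreg Xarr s2 s3" and is3: "ist (Suc (Suc j)) 0 s3 e' cnt'" and
     oi: "outI j e' KI (arrs s3 2)" and t3: "t3+5*pot e cnt <= KI*(13*n+30)+3+5*pot e' cnt'" by blast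
    have a3: "arrs s3 a = arrs s2 a" if "a \<in> {3,4,5,7,8,9,10}" for a
     by (rule same_arrs[OF m3]) (use that in \<open>auto simp: Xarr_def\<close>)
    have r3: "regs s3 x = regs s2 x" if "x \<in> {8,9,10,11}" for x
     by (rule same_regs[OF m3]) (use that in \<open>auto simp: Xreg_def\<close>)
    have st3: "stat s3" by (rule stat_cong[OF st2]) (use a3 r3 in simp_all)
    have a5: "arrs s3 5 = arrs s1 5" using a3 a2 by simp
    then have t5: "tr s3 = tr s1" by (simp add: tr_def fun_eq_iff)
    have tp5: "trep s3 = trep s1" using t5 by (simp add: trep_def tvalid_def fun_eq_iff)
    have tr3: "trees s3" by (rule trees_cong[OF tr1 a5])
    have sl3: "stale s3 j" by (rule stale_cong[OF sl1]) (use a3 a2 t5 in simp_all)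
    have e': "e' <= e0" "Dok (2^e')" "iregs s3 e' cnt'" using is3 by (auto simp: ist_def)
    have b3: "base s3 (2^e')" using e'(3) pow_e_le[OF e'(1)] unfolding base_def iregs_def by simp
    have vp: "vpot s3 = vpot s" unfolding vpot_def using a3[of 9] a2[of 9] a1[of 9] by simp
    have F: "T finish s3 (%s' t. \<exists>m. trees s' & stat s' & stale s' (Suc j) & m*NN+nu * vpot s3 <= nu * vpot s' &
     t <= NN*(2*nu)*(7*LG+8)+n*(88*LG*nu+93)+NN*10+40+n*(7*LG+8)*m &
     (\<forall>i<n. outpost (2^e') (vl j i) (arrs s3 2 i) (arrs s' 2 i)) &
     same ({12, 14, 37} \<union> RR) {2, 5, 6, 7, 9} s3 s')"
     by (rule finish_spec[OF j st3 b3 e'(1,2) tr3 sl3])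
      (use v2 v1 a3 a2 r3 same_regs[OF m2, of 10] in \<open>simp_all add: tp5\<close>)
    show ?case
    proof (rule T_conseq[OF F], goal_cases)
     case (1 s4 t4)
     then obtain m where m: "trees s4" "stat s4" "stale s4 (Suc j)" "m*NN+nu * vpot s3 <= nu * vpot s4"
      and t4: "t4 <= NN*(2*nu)*(7*LG+8)+n*(88*LG*nu+93)+NN*10+40+n*(7*LG+8)*m"
      and op: "\<And>i. i < n ==> outpost (2^e') (vl j i) (arrs s3 2 i) (arrs s4 2 i)"
      and m4: "same ({12, 14, 37} \<union> RR) {2, 5, 6, 7, 9} s3 s4" by blast
     have is4: "ist (Suc (Suc j)) 0 s4 e' cnt'"
     proof (rule ist_cong[OF is3])
      fix x :: nat assume "x \<in> {0, 1, 2, 3, 4, 5, 7}"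
      then have "x \<notin> {12, 14, 37} \<union> RR" by (auto simp: RR_def)
      then show "regs s4 x = regs s3 x" by (rule same_regs[OF m4])
     next
      fix a :: nat assume "12 <= a"
      then show "arrs s4 a = arrs s3 a" by (intro same_arrs[OF m4]) auto
     qed
     have res: "good --> (\<forall>i<n. arrs s4 2 i = Min (vl j i ` {..<NN}))"
      using result_correct[OF _ j _ e'(1) oi op] by blast
     have "n*(88*LG*nu+97) = n*(88*LG*nu+93)+n*4" by (simp add: algebra_simps)
     then have "Suc (t1+Suc (t2+Suc (t3+t4)))+5*pot e cnt <= CQ+5*pot e' cnt'+n*(7*LG+8)*m"
      unfolding CQ_def using t1 t2 t3 t4 by linarith
     then show ?case using m is4 res unfolding vp by blast
    qed
   qed
  qed
 qed
qed

end

section \<open>Preprocessing\<close>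

definition fill :: com where
 "fill = for_loop 14 (R 0\<boxtimes>R 1)
   (Assign 13 (Bin Div (R 14) (R 1)) ;; Assign 16 (Bin Mod (R 14) (R 1)) ;;
   If (Less (R 16) (R 0)) (Assign 32 (R 16)) (Assign 32 (R 0\<boxminus>N 1)) ;;
   Store 3 (R 14) (Rd 0 (R 13\<boxtimes>R 0\<boxplus>R 32)))"

text \<open>Works on the flat array: the right neighbour is the next cell unless a row ends there,
  the lower neighbour lies \<open>NN\<close> cells further. \<open>Conj\<close> evaluates both
  sides, so cells past the end are read, but the first conjunct is false there.\<close>

definition flags :: com where
 "flags = Assign 8 (N 1) ;; Assign 9 (N 1) ;; for_loop 14 (R 0\<boxtimes>R 1)
   (If (Conj (Less (N 0) (Bin Mod (R 14\<boxplus>N 1) (R 1))) (Less (Rd 3 (R 14\<boxplus>N 1)) (Rd 3 (R 14)))) (Assign 8 (N 0)) SKIP ;;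
   If (Conj (Less (R 14\<boxplus>R 1) (R 0\<boxtimes>R 1)) (Less (Rd 3 (R 14\<boxplus>R 1)) (Rd 3 (R 14)))) (Assign 9 (N 0)) SKIP)"

definition tree_loop :: "aexp => aexp => com" where
 "tree_loop eo ev = for_loop 14 (R 0\<boxtimes>R 1)
   (Assign 16 (Bin Mod (R 14) (R 1)) ;; Assign 15 (eo\<boxplus>Bin Div (R 14) (R 1)) ;; Assign 17 ev ;; upd)"

definition init_st :: com where
 "init_st = for_loop 14 (R 1) (Store 9 (R 14) (N (- 2)\<boxtimes>R 1))"

context red
begin

lemma flat: "p < n*NN ==> p div NN < n" "p mod NN < NN" "p div NN*NN+p mod NN = p"
 using NN0 by (auto simp: less_mult_imp_div_less)

lemma nNB: "int (n*NN+NN+1) <= B"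
proof (rule B_quad)
 have "n*NN <= n*(2*n)" using NN_less by (intro mult_le_mono2) simp
 then have "n*NN <= 2*(n*n)" by simp
 moreover have "(n+2)\<^sup>2 = n*n+4*n+4" by (simp add: power2_eq_square algebra_simps)
 ultimately show "n*NN+NN+1 <= 1000*(n+2)\<^sup>2" using NN_less by linarith
qed

lemma fill_spec:
 assumes s: "regs s 0 = int n" "regs s 1 = int NN" and A: "\<And>q. q < n*n ==> arrs s 0 q = Mh (q div n) (q mod n)"
 shows "T fill s (%s' t. t <= n*NN*12+3 & (\<forall>p<n*NN. arrs s' 3 p = Mh (p div NN) (p mod NN)) & same {13, 14, 16, 32} {3} s s')"
 unfolding fill_def
proof (rule T_for_const[where I = "%p s'. (\<forall>q<p. arrs s' 3 q = Mh (q div NN) (q mod NN)) & same {13, 14, 16, 32} {3} s s'" and m = "n*NN" and K = 9])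
 fix p s' assume p: "p < n*NN" and I: "(\<forall>q<p. arrs s' 3 q = Mh (q div NN) (q mod NN)) & same {13, 14, 16, 32} {3} s s'"
  and r14: "regs s' 14 = int p" and b: "bnd B s'"
 have sm: "same {13, 14, 16, 32} {3} s s'" using I by blast
 have r': "regs s' 0 = int n" "regs s' 1 = int NN" using same_regs[OF sm] s by auto
 let ?i = "p div NN" and ?k = "p mod NN"
 define m where "m = min ?k (n - 1)"
 have m: "m < n" "Mh ?i m = Mh ?i ?k" using n0 Mpad[of ?i ?k] by (auto simp: m_def)
 have q: "?i*n+m < n*n"
 proof -
  have "?i*n+m < Suc ?i*n" using m by simp
  also have "\<dots> <= n*n" using flat(1)[OF p] by (intro mult_le_mono1) simp
  finally show ?thesis .
 qed
 have "arrs s' 0 (?i*n+m) = arrs s 0 (?i*n+m)" using same_arrs[OF sm, of 0] by simp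
 also have "\<dots> = Mh ?i ?k" using A[OF q] m by simp
 finally have a0: "arrs s' 0 (?i*n+m) = Mh ?i ?k" .
 have a0': "arrs s' 0 (nat (int ?i*int n+int m)) = Mh ?i ?k" using a0 by (metis nat_int of_nat_add of_nat_mult)
 have M: "\<bar>Mh ?i ?k\<bar> <= B" using Mr[OF flat(1)[OF p] flat(2)[of p]] B_facts by linarith
 have iB: "int ?i <= B" "int ?k <= B" "int m <= B" using flat[of p] p m B_facts by auto
 let ?s1 = "setr s' 13 (int ?i)"
 let ?s2 = "setr ?s1 16 (int ?k)"
 let ?s3 = "setr ?s2 32 (int m)"
 have st: "T (If (Less (R 16) (R 0)) (Assign 32 (R 16)) (Assign 32 (R 0\<boxminus>N 1))) ?s2 (%s2 t. s2 = ?s3 & t = 2)"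
 proof (rule T_If, goal_cases)
  case 2
  then show ?case using r' iB by (intro T_AssignV[where v = "int m"]) (auto simp: m_def)
 next
  case 3
  then have "m = n - 1" using r' by (simp add: m_def)
  then show ?case using r' iB n0 B2 by (intro T_AssignV[where v = "int m"]) (auto simp: of_nat_diff)
 qed simp
 show "T (Assign 13 (Bin Div (R 14) (R 1)) ;; Assign 16 (Bin Mod (R 14) (R 1)) ;;
   If (Less (R 16) (R 0)) (Assign 32 (R 16)) (Assign 32 (R 0\<boxminus>N 1)) ;;
   Store 3 (R 14) (Rd 0 (R 13\<boxtimes>R 0\<boxplus>R 32))) s' (%s'' t. t <= 9 &
   (\<forall>q<Suc p. arrs (setr s'' 14 (int (Suc p))) 3 q = Mh (q div NN) (q mod NN)) &
   same {13, 14, 16, 32} {3} s (setr s'' 14 (int (Suc p))))"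
  apply (rule T_AssignS[where v = "int ?i"], (use r' r14 iB NN0 in \<open>simp_all add: zdiv_int[symmetric]\<close>)[4])
  apply (rule T_AssignS[where v = "int ?k"], (use r' r14 iB NN0 in \<open>simp_all add: zmod_int[symmetric]\<close>)[4])
  apply (rule T_Seq, rule T_conseq[OF st])
  apply (elim conjE, hypsubst)
  apply (rule T_StoreV[where p = p and v = "Mh ?i ?k"])
  using r' r14 a0' M I sm by (auto simp: less_Suc_eq same_def)
next
 fix p s' assume "(\<forall>q<p. arrs s' 3 q = Mh (q div NN) (q mod NN)) & same {13, 14, 16, 32} {3} s s'"
 then show "aok B s' (R 0\<boxtimes>R 1) & av s' (R 0\<boxtimes>R 1) = int (n*NN)"
  using same_regs[of "{13, 14, 16, 32}" "{3}" s s'] s by simp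
qed (use nNB in \<open>auto simp: same_def\<close>)

lemma mm_flat: "(\<forall>p<n*NN. arrs s 3 p = Mh (p div NN) (p mod NN)) ==> i < n ==> k < NN ==> mm s i k = Mh i k"
proof -
 assume a: "\<forall>p<n*NN. arrs s 3 p = Mh (p div NN) (p mod NN)" and i: "i < n" "k < NN"
 have "i*NN + k < Suc i*NN" using i by simp
 also have "\<dots> <= n*NN" using i by (intro mult_le_mono1) simp
 finally show "mm s i k = Mh i k" unfolding mm_def using a i by simp
qed

lemma flags_spec:
 assumes s: "regs s 0 = int n" "regs s 1 = int NN" and A: "\<And>p. p < n*NN ==> arrs s 3 p = Mh (p div NN) (p mod NN)"
 shows "T flags s (%s' t. t <= n*NN*8+7 & regs s' 8 = (if rowsM then 1 else 0) & regs s' 9 = (if colsM then 1 else 0) &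
   same {8, 9, 14} {} s s')"
proof -
 define P where "P p \<longleftrightarrow> (\<forall>q<p. (q+1) mod NN \<noteq> 0 --> arrs s 3 q <= arrs s 3 (q+1))" for p
 define Q where "Q p \<longleftrightarrow> (\<forall>q<p. q+NN < n*NN --> arrs s 3 q <= arrs s 3 (q+NN))" for p
 define I where "I p s' \<longleftrightarrow> regs s' 8 = (if P p then 1 else 0) & regs s' 9 = (if Q p then 1 else 0) & same {8, 9, 14} {} s s'" for p s'
 have PP: "P (Suc p) \<longleftrightarrow> P p & ((p+1) mod NN \<noteq> 0 --> arrs s 3 p <= arrs s 3 (p+1))" for p
  unfolding P_def by (auto simp: less_Suc_eq)
 have QQ: "Q (Suc p) \<longleftrightarrow> Q p & (p+NN < n*NN --> arrs s 3 p <= arrs s 3 (p+NN))" for p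
  unfolding Q_def by (auto simp: less_Suc_eq)
 have mmA: "arrs s 3 (i*NN + k) = Mh i k" if "i < n" "k < NN" for i k
  using mm_flat[of s i k] A that by (simp add: mm_def)
 have rows: "rowsM \<longleftrightarrow> P (n*NN)"
 proof
  assume r: rowsM
  show "P (n*NN)" unfolding P_def
  proof (intro allI impI)
   fix q assume q: "q < n*NN" "(q+1) mod NN \<noteq> 0"
   have k: "q mod NN+1 < NN"
   proof (rule ccontr)
    assume "\<not> q mod NN+1 < NN"
    then have "q mod NN+1 = NN" using flat(2)[of q] by simp
    then show False using q(2) by (metis mod_add_left_eq mod_self)
   qed
   have "Mh (q div NN) (q mod NN) <= Mh (q div NN) (q mod NN+1)" using r flat(1)[OF q(1)] k unfolding rowsM_def by blast
   then have "arrs s 3 (q div NN*NN+q mod NN) <= arrs s 3 (q div NN*NN+(q mod NN+1))"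
    by (simp only: mmA[OF flat(1)[OF q(1)] flat(2)] mmA[OF flat(1)[OF q(1)] k])
   then show "arrs s 3 q <= arrs s 3 (q+1)" by (simp only: add.assoc[symmetric] flat(3))
  qed
 next
  assume p: "P (n*NN)"
  show rowsM unfolding rowsM_def
  proof (intro allI impI)
   fix i k assume i: "i < n" "k+1 < NN"
   have "i*NN + k < Suc i*NN" using i by simp
   also have "\<dots> <= n*NN" using i by (intro mult_le_mono1) simp
   finally have "i*NN + k < n*NN" .
   moreover have "(i*NN + k+1) mod NN \<noteq> 0"
   proof -
    have "(i*NN + k+1) mod NN = (k+1) mod NN" by (metis add.assoc mod_mult_self3)
    then show ?thesis using i(2) by simp
   qed
   ultimately have "arrs s 3 (i*NN + k) <= arrs s 3 (i*NN + k+1)" using p unfolding P_def by blast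
   then show "Mh i k <= Mh i (k+1)" using mmA[of i k] mmA[of i "k+1"] i by (simp add: add.assoc)
  qed
 qed
 have cols: "colsM \<longleftrightarrow> Q (n*NN)"
 proof
  assume r: colsM
  show "Q (n*NN)" unfolding Q_def
  proof (intro allI impI)
   fix q assume q: "q < n*NN" "q+NN < n*NN"
   have e: "q+NN = (q div NN+1)*NN+q mod NN" using flat(3)[of q] by (simp add: algebra_simps)
   have "(q+NN) div NN < n" using flat(1)[OF q(2)] .
   then have i: "q div NN+1 < n" using NN0 by simp
   have "Mh (q div NN) (q mod NN) <= Mh (q div NN+1) (q mod NN)" using r i flat(2) unfolding colsM_def by blast
   then have "arrs s 3 (q div NN*NN+q mod NN) <= arrs s 3 ((q div NN+1)*NN+q mod NN)"
    using mmA[OF flat(1)[OF q(1)] flat(2)[of q]] mmA[OF i flat(2)[of q]] by simp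
   then show "arrs s 3 q <= arrs s 3 (q+NN)" unfolding flat(3) e .
  qed
 next
  assume p: "Q (n*NN)"
  show colsM unfolding colsM_def
  proof (intro allI impI)
   fix i k assume i: "i+1 < n" "k < NN"
   have e: "i*NN + k+NN = (i+1)*NN + k" by simp
   have "(i+1)*NN + k < Suc (i+1)*NN" using i by simp
   also have "\<dots> <= n*NN" using i by (intro mult_le_mono1) simp
   finally have "i*NN + k+NN < n*NN" using e by simp
   then have "arrs s 3 (i*NN + k) <= arrs s 3 (i*NN + k+NN)" using p unfolding Q_def by simp
   then show "Mh i k <= Mh (i+1) k" using mmA[of i k] mmA[of "i+1" k] i unfolding e by simp
  qed
 qed
 let ?s1 = "setr s 8 1"
 let ?s2 = "setr ?s1 9 1"
 show ?thesis unfolding flags_def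
  apply (rule T_AssignS[where v = 1], (use B2 in simp_all)[4])
  apply (rule T_AssignS[where v = 1], (use B2 in simp_all)[4])
 proof (rule T_for_const[where I = I and m = "n*NN" and K = 5])
  show "I 0 (setr ?s2 14 0)" by (simp add: I_def P_def Q_def same_def)
 next
  fix p s' assume "I p s'"
  then show "aok B s' (R 0\<boxtimes>R 1) & av s' (R 0\<boxtimes>R 1) = int (n*NN)"
   using same_regs[of "{8, 9, 14}" "{}" s s'] s by (simp add: I_def)
 next
  fix s' kp assume "I (n*NN) s'" "kp <= n*NN*(5+3)+3"
  then show "Suc (Suc (Suc (Suc kp))) <= n*NN*8+7 & regs s' 8 = (if rowsM then 1 else 0) & regs s' 9 = (if colsM then 1 else 0) &
   same {8, 9, 14} {} s s'" unfolding I_def rows cols by simp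
 next
  fix p s' assume p: "p < n*NN" and I: "I p s'" and r14: "regs s' 14 = int p" and b: "bnd B s'"
  have sm: "same {8, 9, 14} {} s s'" using I by (simp add: I_def)
  have r': "regs s' 0 = int n" "regs s' 1 = int NN" using same_regs[OF sm] s by auto
  have a3: "arrs s' 3 = arrs s 3" using same_arrs[OF sm] by simp
  let ?b1 = "Conj (Less (N 0) (Bin Mod (R 14\<boxplus>N 1) (R 1))) (Less (Rd 3 (R 14\<boxplus>N 1)) (Rd 3 (R 14)))"
  let ?b2 = "Conj (Less (R 14\<boxplus>R 1) (R 0\<boxtimes>R 1)) (Less (Rd 3 (R 14\<boxplus>R 1)) (Rd 3 (R 14)))"
  have n1: "nat (int p+1) = p+1" "nat (int p+int NN) = p+NN" by auto
  have bv1: "bv s' ?b1 \<longleftrightarrow> \<not> ((p+1) mod NN \<noteq> 0 --> arrs s 3 p <= arrs s 3 (p+1))"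
  proof -
   have "(int p+1) mod int NN = int ((p+1) mod NN)" by (simp add: zmod_int add.commute)
   then show ?thesis using r' r14 a3 n1 by (simp del: of_nat_mod) auto
  qed
  let ?s3 = "setr s' 8 (if P (Suc p) then 1 else 0)"
  let ?s4 = "setr ?s3 9 (if Q (Suc p) then 1 else 0)"
  have bv2: "bv ?s3 ?b2 \<longleftrightarrow> \<not> (p+NN < n*NN --> arrs s 3 p <= arrs s 3 (p+NN))"
  proof -
   have "int p+int NN < int n*int NN \<longleftrightarrow> p+NN < n*NN" by (metis of_nat_add of_nat_less_iff of_nat_mult)
   then show ?thesis using r' r14 a3 n1 by auto
  qed
  have c1: "T (If ?b1 (Assign 8 (N 0)) SKIP) s' (%s2 t. s2 = ?s3 & t = 2)"
  proof (rule T_If, goal_cases)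
   case 1
   show ?case using r' r14 NN0 B2 by simp
  next
   case 2
   then have "\<not> P (Suc p)" using bv1 PP by blast
   then show ?case using B2 by (intro T_AssignV[where v = 0]) auto
  next
   case 3
   then have "P (Suc p) = P p" using bv1 PP by blast
   then have "(regs s')(8 := if P (Suc p) then 1 else 0) = regs s'" using I by (intro fun_upd_idem) (simp add: I_def)
   then show ?case by (intro T_Skip) simp
  qed
  have c2: "T (If ?b2 (Assign 9 (N 0)) SKIP) ?s3 (%s2 t. s2 = ?s4 & t = 2)"
  proof (rule T_If, goal_cases)
   case 1
   show ?case using r' r14 by simp
  next
   case 2
   then have "\<not> Q (Suc p)" using bv2 QQ by blast
   then show ?case using B2 by (intro T_AssignV[where v = 0]) auto
  next
   case 3
   then have "Q (Suc p) = Q p" using bv2 QQ by blast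
   then have "(regs ?s3)(9 := if Q (Suc p) then 1 else 0) = regs ?s3" using I by (intro fun_upd_idem) (simp add: I_def)
   then show ?case by (intro T_Skip) simp
  qed
  show "T (If ?b1 (Assign 8 (N 0)) SKIP ;; If ?b2 (Assign 9 (N 0)) SKIP) s'
    (%s2 t. t <= 5 & I (Suc p) (setr s2 14 (int (Suc p))))"
   apply (rule T_Seq, rule T_conseq[OF c1], elim conjE, hypsubst)
   apply (rule T_conseq[OF c2], elim conjE, hypsubst)
   using sm by (auto simp: I_def same_def)
 qed (use nNB in auto)
qed

text \<open>Building by point updates only needs each tree to be valid beforehand, which holds in
  all-zero memory; for \<open>n * NN\<close> leaves the extra logarithmic factor is
  affordable.\<close>

lemma tree_loop_spec:
 assumes s: "regs s 0 = int n" "regs s 1 = int NN" and t: "\<And>i. i < n ==> \<exists>f. trep s (b0+i) f"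
  and b0: "b0 <= n" "leaves eo <= 2" "\<And>s'. regs s' 0 = int n ==> aok B s' eo & av s' eo = int b0"
  and g: "leaves ev <= 2" "\<And>s' p. p < n*NN ==> regs s' 0 = int n ==> regs s' 1 = int NN ==> regs s' 14 = int p ==> arrs s' 3 = arrs s 3 ==>
    aok B s' ev & av s' ev = g (p div NN) (p mod NN)"
   "\<And>i k. i < n ==> k < NN ==> \<bar>g i k\<bar> <= B"
 shows "T (tree_loop eo ev) s (%s' t. t <= n*NN*(7*LG+9)+3 & (\<forall>i<n. trep s' (b0+i) (g i)) &
   (\<forall>r h. r < b0 \<or> b0+n <= r --> h < 2*NN --> tr s' r h = tr s r h) & same {14, 15, 16, 17, 18} {5} s s')"
proof -
 define I where "I p s' \<longleftrightarrow> (\<forall>i<n. \<exists>f. trep s' (b0+i) f & (\<forall>k<NN. i*NN + k < p --> f k = g i k)) &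
   (\<forall>r h. r < b0 \<or> b0+n <= r --> h < 2*NN --> tr s' r h = tr s r h) & same {14, 15, 16, 17, 18} {5} s s'" for p s'
 have tr0: "tr (s'\<lparr>regs := x\<rparr>) = tr s'" for s' x by (simp add: tr_def fun_eq_iff)
 have trr: "trep (s'\<lparr>regs := x\<rparr>) = trep s'" for s' x by (simp add: trep_def tvalid_def tr0 fun_eq_iff)
 show ?thesis unfolding tree_loop_def
 proof (rule T_for_const[where I = I and m = "n*NN" and K = "7*LG+6"])
  show "I 0 (setr s 14 0)" unfolding I_def using t by (simp add: trr tr0)
 next
  fix p s' assume "I p s'"
  then show "aok B s' (R 0\<boxtimes>R 1) & av s' (R 0\<boxtimes>R 1) = int (n*NN)"
   using same_regs[of "{14, 15, 16, 17, 18}" "{5}" s s'] s by (simp add: I_def)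
 next
  fix s' kp assume I: "I (n*NN) s'" and k: "kp <= n*NN*(7*LG+6+3)+3"
  have "trep s' (b0+i) (g i)" if i: "i < n" for i
  proof -
   obtain f where f: "trep s' (b0+i) f" "\<forall>k<NN. i*NN + k < n*NN --> f k = g i k" using I i unfolding I_def by blast
   have "f k = g i k" if "k < NN" for k
   proof -
    have "i*NN + k < Suc i*NN" using that by simp
    also have "\<dots> <= n*NN" using i by (intro mult_le_mono1) simp
    finally show ?thesis using f that by blast
   qed
   then show ?thesis using trep_fun_cong[OF f(1)] by blast
  qed
  then show "kp <= n*NN*(7*LG+9)+3 & (\<forall>i<n. trep s' (b0+i) (g i)) &
   (\<forall>r h. r < b0 \<or> b0+n <= r --> h < 2*NN --> tr s' r h = tr s r h) & same {14, 15, 16, 17, 18} {5} s s'"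
   using I k unfolding I_def by (simp add: add.assoc)
 next
  fix p s' assume p: "p < n*NN" and I: "I p s'" and r14: "regs s' 14 = int p" and b: "bnd B s'"
  have sm: "same {14, 15, 16, 17, 18} {5} s s'" using I by (simp add: I_def)
  have r': "regs s' 0 = int n" "regs s' 1 = int NN" using same_regs[OF sm] s by auto
  have a3: "arrs s' 3 = arrs s 3" using same_arrs[OF sm] by simp
  let ?i = "p div NN" and ?k = "p mod NN"
  have ik: "?i < n" "?k < NN" using flat p by auto
  have iB: "int ?k <= B" "int (b0+?i) <= B" "\<bar>g ?i ?k\<bar> <= B" using ik B_facts B_lin[of "b0+?i"] b0(1) g(3)[OF ik] by auto
  let ?s1 = "setr s' 16 (int ?k)"
  let ?s2 = "setr ?s1 15 (int (b0+?i))"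
  let ?s3 = "setr ?s2 17 (g ?i ?k)"
  obtain f where f: "trep s' (b0+?i) f" "\<forall>k<NN. ?i*NN + k < p --> f k = g ?i k" using I ik unfolding I_def by blast
  have U: "T upd ?s3 (%s6 t. t <= 7*LG & trep s6 (b0+?i) (f(?k := regs ?s3 17)) &
    (\<forall>r' h. r' \<noteq> b0+?i --> h < 2*NN --> tr s6 r' h = tr ?s3 r' h) & same {18} {5} ?s3 s6)"
   by (rule upd_spec[OF _ _ _ ik(2)]) (use r' f(1) in \<open>simp_all add: trr\<close>)
  have go: "aok B ?s1 eo & av ?s1 eo = int b0" by (rule b0(3)) (use r' in simp)
  have gv: "aok B ?s2 ev & av ?s2 ev = g ?i ?k" by (rule g(2)[OF p]) (use r' r14 a3 in simp_all)
  show "T (Assign 16 (Bin Mod (R 14) (R 1)) ;; Assign 15 (eo\<boxplus>Bin Div (R 14) (R 1)) ;; Assign 17 ev ;; upd) s'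
   (%s2 t. t <= 7*LG+6 & I (Suc p) (setr s2 14 (int (Suc p))))"
   apply (rule T_AssignS[where v = "int ?k"], (use r' r14 iB NN0 in \<open>simp_all add: zmod_int[symmetric]\<close>)[4])
   apply (rule T_AssignS[where v = "int (b0+?i)"], (use r' r14 iB NN0 go b0(2) in \<open>simp_all add: zdiv_int[symmetric]\<close>)[4])
   apply (rule T_AssignS[where v = "g ?i ?k"], (use gv iB g(1) in simp_all)[4])
  proof (rule T_conseq[OF U], goal_cases)
   case (1 s6 t6)
   have sm6: "same {18} {5} ?s3 s6" using 1 by blast
   have o6: "\<And>r' h. r' \<noteq> b0+?i ==> h < 2*NN ==> tr s6 r' h = tr s' r' h" using 1 by (simp add: tr0)
   have t6: "trep s6 (b0+?i) (f(?k := g ?i ?k))" using 1 by simp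
   have "I (Suc p) (setr s6 14 (int (Suc p)))" unfolding I_def tr0 trr
   proof (intro conjI allI impI)
    fix i assume i: "i < n"
    show "\<exists>f. trep s6 (b0+i) f & (\<forall>k<NN. i*NN + k < Suc p --> f k = g i k)"
    proof (cases "i = ?i")
     case True
     have "(f(?k := g ?i ?k)) k = g ?i k" if "k < NN" "?i*NN + k < Suc p" for k
     proof (cases "k = ?k")
      case False
      then have "?i*NN + k \<noteq> p" using flat(3)[of p] by linarith
      then show ?thesis using f(2) that False by simp
     qed simp
     then show ?thesis using t6 True by blast
    next
     case False
     obtain f' where f': "trep s' (b0+i) f'" "\<forall>k<NN. i*NN + k < p --> f' k = g i k" using I i unfolding I_def by blast
     have "trep s6 (b0+i) f'" by (rule trep_cong[OF f'(1)]) (use o6 False in simp)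
     moreover have "f' k = g i k" if "k < NN" "i*NN + k < Suc p" for k
     proof -
      have "i*NN + k \<noteq> p"
      proof
       assume "i*NN + k = p"
       then have "p div NN = i" using that(1) by auto
       then show False using False by simp
      qed
      then show ?thesis using f'(2) that by simp
     qed
     ultimately show ?thesis by blast
    qed
   next
    fix r h assume a: "r < b0 \<or> b0+n <= r" "h < 2*NN"
    then have "tr s6 r h = tr s' r h" using ik by (intro o6) auto
    then show "tr s6 r h = tr s r h" using I a unfolding I_def by simp
   next
    show "same {14, 15, 16, 17, 18} {5} s (setr s6 14 (int (Suc p)))"
     using sm sm6 by (auto simp: same_def)
   qed
   then show ?case using 1 by simp
  qed
 qed (use nNB in auto)
qed

lemma init_st_spec:
 assumes s: "regs s 1 = int NN"
 shows "T init_st s (%s' t. t <= NN*4+3 & (\<forall>k<NN. arrs s' 9 k = - 2*int NN) & same {14} {9} s s')"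
 unfolding init_st_def
proof (rule T_for_const[where I = "%q s'. (\<forall>i<q. arrs s' 9 i = - 2*int NN) & same {14} {9} s s'" and m = NN and K = 1])
 fix q s' assume a: "q < NN" "(\<forall>i<q. arrs s' 9 i = - 2*int NN) & same {14} {9} s s'" "regs s' 14 = int q"
 then have r: "regs s' 1 = int NN" using same_regs[of "{14}" "{9}" s s' 1] s by simp
 show "T (Store 9 (R 14) (N (- 2)\<boxtimes>R 1)) s' (%s'' t. t <= 1 &
   (\<forall>i<Suc q. arrs (setr s'' 14 (int (Suc q))) 9 i = - 2*int NN) &
   same {14} {9} s (setr s'' 14 (int (Suc q))))"
  by (rule T_StoreV[where p = q and v = "- 2*int NN"]) (use a r B_facts in \<open>auto simp: less_Suc_eq same_def\<close>)
next
 fix q s' assume "(\<forall>i<q. arrs s' 9 i = - 2*int NN) & same {14} {9} s s'"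
 then show "aok B s' (R 1) & av s' (R 1) = int NN" using same_regs[of "{14}" "{9}" s s' 1] s by simp
qed (use B_facts in auto)

end

section \<open>Refresh schedules for matrices with nondecreasing columns\<close>

definition ev_step :: com where
 "ev_step = Assign 13 (Bin Div (R 14) (R 1)) ;; Assign 16 (Bin Mod (R 14) (R 1)) ;;
   If (Equal (R 16) (N 0)) (Store 8 (R 33\<boxtimes>(R 0\<boxplus>N 1)\<boxplus>R 13) (R 11)) SKIP ;;
   If (Conj (Less (N 0) (R 13)) (Neg (Less (Rd 11 (R 16)\<boxplus>R 33) (Rd 3 (R 14))))) SKIP
    (Store 11 (R 16) (Rd 3 (R 14)) ;; Store 7 (R 11) (R 16) ;; Assign 11 (R 11\<boxplus>N 1))"

definition ev_body :: com where
 "ev_body = for_loop 14 (R 0\<boxtimes>R 1) ev_step ;; Store 8 (R 33\<boxtimes>(R 0\<boxplus>N 1)\<boxplus>R 0) (R 11)"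

text \<open>A schedule is precomputed for each radius, as the run may halve down to any of them. It
  depends on the matrix only, since a common query vector shifts the true and the outdated entries
  alike.\<close>

definition events :: com where
 "events = Assign 11 (N 0) ;; Assign 33 (R 3) ;; While (Less (N 0) (R 33)) (ev_body ;; halve 33)"

lemma wr_ev_body [simp]: "wregs ev_body = {11, 13, 14, 16}" "warrs ev_body = {7, 8, 11}"
 by (auto simp: ev_body_def ev_step_def)

context red
begin

definition EL :: "nat => nat => nat list" where
 "EL E p = map (%q. q mod NN) (filter (%q. isev E (q div NN) (q mod NN)) [0..<p])"

text \<open>Larger radii are treated first, so the list for \<open>2^e\<close> starts at position
  \<open>PP (Suc e)\<close> of array 7.\<close>

definition PP :: "nat => nat" where
 "PP m = (\<Sum>e = m..e0. length (EL (2^e) (n*NN)))"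

lemma EL_Suc: "EL E (Suc p) = EL E p @ (if isev E (p div NN) (p mod NN) then [p mod NN] else [])"
 by (simp add: EL_def)

lemma length_EL: "length (EL E p) <= p"
 unfolding EL_def using length_filter_le[of _ "[0..<p]"] by (simp add: order_trans)

lemma EL_row: "EL E (Suc i*NN) = EL E (i*NN) @ evs E i"
proof -
 have u: "[0..<Suc i*NN] = [0..<i*NN] @ map (%k. i*NN + k) [0..<NN]"
  using upt_add_eq_append[of 0 "i*NN" NN] map_add_upt[of "i*NN" NN] by (simp add: add.commute)
 have "map (%q. q mod NN) (filter (%q. isev E (q div NN) (q mod NN)) (map (%k. i*NN + k) ks)) = filter (isev E i) ks"
  if "set ks \<subseteq> {..<NN}" for ks
  using that by (induction ks) auto
 moreover have "set [0..<NN] \<subseteq> {..<NN}" by auto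
 ultimately show ?thesis unfolding EL_def u evs_def filter_append map_append by blast
qed

lemma PP_split: "m <= e0 ==> PP m = PP (Suc m)+length (EL (2^m) (n*NN))"
 unfolding PP_def by (simp add: sum.atLeast_Suc_atMost)

lemma PP_mono: "m <= m' ==> PP m' <= PP m"
 unfolding PP_def by (intro sum_mono2) auto

lemma PP_le: "PP m <= Suc e0*(n*NN)"
proof -
 have "PP m <= PP 0" by (rule PP_mono) simp
 also have "\<dots> <= (\<Sum>e = 0..e0. n*NN)" unfolding PP_def by (intro sum_mono length_EL)
 finally show ?thesis by simp
qed

lemma PPB: "int (PP m+n*NN+NN+2) <= B"
proof (rule B_ge)
 have a: "Suc e0 <= n+1" using e0L L_le by linarith
 have b: "n*NN <= 2*(n+2)^2"
 proof -
  have "n*NN <= n*(2*n)" using NN_less by (intro mult_le_mono2) simp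
  then have "n*NN <= 2*(n*n)" by simp
  moreover have "(n+2)^2 = n*n+4*n+4" by (simp add: power2_eq_square algebra_simps)
  ultimately show ?thesis by linarith
 qed
 have "Suc e0*(n*NN) <= (n+2)^2*(2*(n+2)^2)"
  by (rule mult_le_mono[OF _ b]) (use a pow_le(1) in linarith)
 also have "\<dots> = 2*(n+2)^4" by (simp add: eval_nat_numeral algebra_simps)
 finally have "PP m <= 2*(n+2)^4" using PP_le[of m] by linarith
 then show "PP m+n*NN+NN+2 <= 1000*(n+2)^4" using b pow_le NN_less by linarith
qed

text \<open>Array 11 is indexed by column alone. Cells of the flat matrix less than a row apart lie
  in different columns, so an entry survives until the scan reaches the same column of the next
  row.\<close>

lemma mod_window: "q < p ==> p < q+NN ==> q mod NN \<noteq> p mod NN"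
proof
 assume a: "q < p" "p < q+NN" "q mod NN = p mod NN"
 then have "NN dvd p - q" using mod_eq_dvd_iff_nat[of q p NN] by simp
 then have "NN <= p - q" using a by (intro dvd_imp_le) auto
 then show False using a by linarith
qed

text \<open>The clauses about array 7 below \<open>P0\<close> and array 8 outside the block of
  \<open>E\<close> protect the schedules of the larger radii, which are already in place.\<close>

lemma ev_body_spec:
 assumes s: "regs s 0 = int n" "regs s 1 = int NN" "regs s 33 = int E" "regs s 11 = int P0"
  and A: "\<And>p. p < n*NN ==> arrs s 3 p = Mh (p div NN) (p mod NN)"
  and P0: "int (P0+n*NN+NN+2) <= B" and E: "E <= n"
 shows "T ev_body s (%s' t. t <= n*NN*18+5 & regs s' 11 = int (P0+length (EL E (n*NN))) &
   (\<forall>x<length (EL E (n*NN)). arrs s' 7 (P0+x) = int (EL E (n*NN) ! x)) & (\<forall>p<P0. arrs s' 7 p = arrs s 7 p) &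
   (\<forall>i\<le>n. arrs s' 8 (E*(n+1)+i) = int (P0+length (EL E (i*NN)))) &
   (\<forall>z. z < E*(n+1) \<or> E*(n+1)+n < z --> arrs s' 8 z = arrs s 8 z))"
proof -
 define I where "I p s' \<longleftrightarrow> regs s' 11 = int (P0+length (EL E p)) &
   (\<forall>x<length (EL E p). arrs s' 7 (P0+x) = int (EL E p ! x)) & (\<forall>p<P0. arrs s' 7 p = arrs s 7 p) &
   (\<forall>i. i*NN < p --> arrs s' 8 (E*(n+1)+i) = int (P0+length (EL E (i*NN)))) &
   (\<forall>z. z < E*(n+1) \<or> E*(n+1)+n < z --> arrs s' 8 z = arrs s 8 z) &
   (\<forall>q<p. p <= q+NN --> arrs s' 11 (q mod NN) = cur E (q div NN) (q mod NN)) &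
   same {11, 13, 14, 16} {7, 8, 11} s s'" for p s'
 have EB: "int (E*(n+1)+n) <= B"
 proof (rule B_quad)
  have "E*(n+1) <= n*(n+1)" using E by (rule mult_le_mono1)
  then show "E*(n+1)+n <= 1000*(n+2)\<^sup>2" by (simp add: power2_eq_square algebra_simps)
 qed
 have L1: "T (for_loop 14 (R 0\<boxtimes>R 1) ev_step) s (%s' t. t <= n*NN*18+3 & I (n*NN) s')"
 proof (rule T_for_const[where I = I and m = "n*NN" and K = 15])
  show "I 0 (setr s 14 0)" using s(4) by (simp add: I_def EL_def)
 next
  fix p s' assume "I p s'"
  then show "aok B s' (R 0\<boxtimes>R 1) & av s' (R 0\<boxtimes>R 1) = int (n*NN)"
   using same_regs[of "{11, 13, 14, 16}" "{7, 8, 11}" s s'] s by (simp add: I_def)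
 next
  fix p s' assume p: "p < n*NN" and I: "I p s'" and r14: "regs s' 14 = int p" and b: "bnd B s'"
  have sm: "same {11, 13, 14, 16} {7, 8, 11} s s'" using I by (simp add: I_def)
  have r': "regs s' 0 = int n" "regs s' 1 = int NN" "regs s' 33 = int E" using same_regs[OF sm] s by auto
  have r11: "regs s' 11 = int (P0+length (EL E p))" using I by (simp add: I_def)
  have lB: "int (P0+length (EL E p))+1 <= B"
  proof -
   have "int (P0+length (EL E p))+1 <= int (P0+n*NN+NN+2)" using length_EL[of E p] p by linarith
   then show ?thesis using P0 by linarith
  qed
  let ?i = "p div NN" and ?k = "p mod NN" and ?l = "P0+length (EL E p)"
  have ik: "?i < n" "?k < NN" using flat p by auto
  have a3: "arrs s' 3 p = Mh ?i ?k" using same_arrs[OF sm, of 3] A[OF p] by simp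
  have M: "\<bar>Mh ?i ?k\<bar> <= B" using Mr[OF ik] B_facts by linarith
  have iB: "int ?i <= B" "int ?k <= B" using ik B_facts by auto
  let ?z = "E*(n+1)+?i"
  let ?s1 = "setr s' 13 (int ?i)"
  let ?s2 = "setr ?s1 16 (int ?k)"
  let ?a8 = "if ?k = 0 then (arrs s' 8)(?z := int ?l) else arrs s' 8"
  let ?s3 = "?s2\<lparr>arrs := (arrs ?s2)(8 := ?a8)\<rparr>"
  have c1: "T (If (Equal (R 16) (N 0)) (Store 8 (R 33\<boxtimes>(R 0\<boxplus>N 1)\<boxplus>R 13) (R 11)) SKIP) ?s2 (%s2 t. s2 = ?s3 & t = 2)"
  proof (rule T_If, goal_cases)
   case 2
   then have "?k = 0" by simp
   then show ?case using r' r11 lB B2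
    by (intro T_StoreV[where p = ?z and v = "int ?l"]) (auto simp: algebra_simps)
  next
   case 3
   then have "?k \<noteq> 0" by simp
   then show ?case by (intro T_Skip) simp
  qed (use B2 in simp)
  \<comment> \<open>The previous entry of this column is exactly \<open>NN\<close> cells back, the
    far end of the window kept by the invariant.\<close>
  have cu: "arrs s' 11 ?k = cur E (?i - 1) ?k" if "0 < ?i"
  proof -
   have "NN <= p" using that NN0 by (metis div_less not_le less_irrefl)
   then obtain q where q: "p = q+NN" by (metis add.commute le_Suc_ex)
   have "?k = q mod NN" "?i = Suc (q div NN)" using q NN0 by auto
   moreover have "arrs s' 11 (q mod NN) = cur E (q div NN) (q mod NN)"
    using I q NN0 unfolding I_def by (simp only: less_add_same_cancel1 order_refl)
   ultimately show ?thesis by simp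
  qed
  let ?b = "Conj (Less (N 0) (R 13)) (Neg (Less (Rd 11 (R 16)\<boxplus>R 33) (Rd 3 (R 14))))"
  have bv: "bv ?s3 ?b \<longleftrightarrow> \<not> isev E ?i ?k"
  proof (cases "0 < ?i")
   case True
   then show ?thesis using cu[OF True] r' r14 a3 by (simp add: isev_def)
  next
   case False
   then have "?i = 0" by simp
   then show ?thesis by (simp add: isev_def)
  qed
  have pik: "p = ?i*NN+?k" using flat(3)[of p] by simp
  have Ip8: "\<And>i. i*NN < p ==> arrs s' 8 (E*(n+1)+i) = int (P0+length (EL E (i*NN)))"
   and Ip7: "\<And>x. x < length (EL E p) ==> arrs s' 7 (P0+x) = int (EL E p ! x)" "\<And>x. x < P0 ==> arrs s' 7 x = arrs s 7 x"
   and Ip11: "\<And>q. q < p ==> p <= q+NN ==> arrs s' 11 (q mod NN) = cur E (q div NN) (q mod NN)"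
   using I unfolding I_def by blast+
  have I8: "?a8 (E*(n+1)+i) = int (P0+length (EL E (i*NN)))" if "i*NN < Suc p" for i
  proof (cases "?k = 0")
   case True
   then have pi: "p = ?i*NN" using pik by linarith
   show ?thesis
   proof (cases "i = ?i")
    case True
    then show ?thesis using \<open>?k = 0\<close> pi by simp
   next
    case False
    then have "i*NN \<noteq> p" using pi NN0 by (metis mult_cancel2 less_irrefl)
    then show ?thesis using Ip8[of i] that False by simp
   qed
  next
   case False
   have "i*NN \<noteq> p" using False by (metis mod_mult_self2_is_0)
   then show ?thesis using Ip8[of i] that False by simp
  qed
  have I8': "?a8 z = arrs s 8 z" if "z < E*(n+1) \<or> E*(n+1)+n < z" for z
  proof -
   have "z \<noteq> ?z" using that ik by linarith
   moreover have "arrs s' 8 z = arrs s 8 z" using I that unfolding I_def by blast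
   ultimately show ?thesis by simp
  qed
  have I11: "\<forall>q<Suc p. Suc p <= q+NN --> f (q mod NN) = cur E (q div NN) (q mod NN)"
   if f: "f ?k = cur E ?i ?k" "\<And>k. k \<noteq> ?k ==> f k = arrs s' 11 k" for f
  proof (intro allI impI)
   fix q assume q: "q < Suc p" "Suc p <= q+NN"
   show "f (q mod NN) = cur E (q div NN) (q mod NN)"
   proof (cases "q = p")
    case True
    then show ?thesis using f(1) by simp
   next
    case False
    then have "q < p" using q by simp
    then have ne: "q mod NN \<noteq> ?k" using mod_window[of q p] q by simp
    have "arrs s' 11 (q mod NN) = cur E (q div NN) (q mod NN)" using Ip11[OF \<open>q < p\<close>] q(2) by simp
    then show ?thesis using f(2)[OF ne] by simp
   qed
  qed
  have c2: "T (If ?b SKIP (Store 11 (R 16) (Rd 3 (R 14)) ;; Store 7 (R 11) (R 16) ;; Assign 11 (R 11\<boxplus>N 1))) ?s3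
    (%s2 t. t <= 6 & I (Suc p) (setr s2 14 (int (Suc p))))"
  proof (rule T_If, goal_cases)
   case 1
   show ?case using r14 B2 by simp
  next
   case 2
   then have ne: "\<not> isev E ?i ?k" using bv by blast
   have e: "EL E (Suc p) = EL E p" using ne by (simp add: EL_Suc)
   have "arrs s' 11 ?k = cur E ?i ?k"
   proof (cases ?i)
    case (Suc i')
    then show ?thesis using ne cu by (simp add: isev_def)
   qed (use ne in \<open>simp add: isev_def\<close>)
   then have "\<forall>q<Suc p. Suc p <= q+NN --> arrs s' 11 (q mod NN) = cur E (q div NN) (q mod NN)" by (rule I11) simp
   then have "I (Suc p) (setr ?s3 14 (int (Suc p)))"
    unfolding I_def e
   proof (intro conjI allI impI, goal_cases)
    case 1
    then show ?case using r11 by simp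
   next
    case (2 x)
    then show ?case using Ip7 by simp
   next
    case (3 x)
    then show ?case using Ip7 by simp
   next
    case (4 i)
    then show ?case using I8[of i] by simp
   next
    case (5 z)
    then show ?case using I8'[of z] by simp
   next
    case (6 q)
    then show ?case by simp
   next
    case 7
    show ?case using sm by (simp add: same_def)
   qed
   then show ?case by (intro T_Skip) simp
  next
   case 3
   then have ne: "isev E ?i ?k" using bv by blast
   have e: "EL E (Suc p) = EL E p @ [?k]" using ne by (simp add: EL_Suc)
   have cM: "cur E ?i ?k = Mh ?i ?k"
   proof (cases ?i)
    case 0
    then show ?thesis by (simp only: cur.simps)
   next
    case (Suc i')
    then have "cur E i' ?k+int E < Mh (Suc i') ?k" using ne by (simp add: isev_def)
    then show ?thesis unfolding Suc cur.simps by simp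
   qed
   have q11: "\<forall>q<Suc p. Suc p <= q+NN --> ((arrs s' 11)(?k := Mh ?i ?k)) (q mod NN) = cur E (q div NN) (q mod NN)"
    by (rule I11) (use cM in auto)
   have x7: "((arrs s' 7)(?l := int ?k)) (P0+x) = int ((EL E p @ [?k]) ! x)" if "x < length (EL E p @ [?k])" for x
    using Ip7(1)[of x] that by (auto simp: nth_append less_Suc_eq)
   have p7: "((arrs s' 7)(?l := int ?k)) x = arrs s 7 x" if "x < P0" for x
    using Ip7(2)[OF that] that by simp
   let ?s4 = "seta ?s3 11 ?k (Mh ?i ?k)"
   let ?s5 = "seta ?s4 7 ?l (int ?k)"
   let ?s6 = "setr ?s5 11 (int (Suc ?l))"
   have fin: "I (Suc p) (setr ?s6 14 (int (Suc p)))"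
    unfolding I_def e
   proof (intro conjI allI impI, goal_cases)
    case 1
    then show ?case by simp
   next
    case (2 x)
    then show ?case using x7 by simp
   next
    case (3 x)
    then show ?case using p7 by simp
   next
    case (4 i)
    then show ?case using I8[of i] by simp
   next
    case (5 z)
    then show ?case using I8'[of z] by simp
   next
    case (6 q)
    then show ?case using q11 by simp
   next
    case 7
    show ?case using sm by (simp add: same_def)
   qed
   show ?case
    apply (rule T_StoreS[where p = ?k and v = "Mh ?i ?k"], (use r14 a3 M in simp_all)[7])
    apply (rule T_StoreS[where p = ?l and v = "int ?k"], (use r11 iB in simp_all)[7])
    apply (rule T_AssignV[where v = "int (Suc ?l)"], (use r11 lB B2 in simp_all)[4])
    using fin by simp
  qed
  show "T ev_step s' (%s2 t. t <= 15 & I (Suc p) (setr s2 14 (int (Suc p))))"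
   unfolding ev_step_def
   apply (rule T_AssignS[where v = "int ?i"], (use r' r14 iB NN0 in \<open>simp_all add: zdiv_int[symmetric]\<close>)[4])
   apply (rule T_AssignS[where v = "int ?k"], (use r' r14 iB NN0 in \<open>simp_all add: zmod_int[symmetric]\<close>)[4])
   apply (rule T_Seq, rule T_conseq[OF c1], elim conjE, hypsubst)
   apply (rule T_conseq[OF c2])
   by simp
 qed (use nNB in \<open>auto simp: ev_step_def\<close>)
 show ?thesis unfolding ev_body_def
 proof (rule T_Seq, rule T_conseq[OF L1], goal_cases)
  case (1 s1 t1)
  then have I: "I (n*NN) s1" and t1: "t1 <= n*NN*18+3" by auto
  have sm: "same {11, 13, 14, 16} {7, 8, 11} s s1" using I by (simp add: I_def)
  have r: "regs s1 0 = int n" "regs s1 33 = int E" using same_regs[OF sm] s by auto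
  let ?l = "P0+length (EL E (n*NN))"
  have r11: "regs s1 11 = int ?l" using I by (simp add: I_def)
  have lB: "int ?l <= B"
  proof -
   have "int ?l <= int (P0+n*NN+NN+2)" using length_EL[of E "n*NN"] by linarith
   then show ?thesis using P0 by linarith
  qed
  let ?z = "E*(n+1)+n"
  let ?s2 = "seta s1 8 ?z (int ?l)"
  have i8: "arrs ?s2 8 (E*(n+1)+i) = int (P0+length (EL E (i*NN)))" if "i <= n" for i
  proof (cases "i = n")
   case False
   then have "i*NN < n*NN" using that NN0 by simp
   then have "arrs s1 8 (E*(n+1)+i) = int (P0+length (EL E (i*NN)))" using I unfolding I_def by blast
   then show ?thesis using False by simp
  qed simp
  have i7: "(\<forall>x<length (EL E (n*NN)). arrs s1 7 (P0+x) = int (EL E (n*NN) ! x)) & (\<forall>p<P0. arrs s1 7 p = arrs s 7 p)"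
   and z8: "\<forall>z. z < E*(n+1) \<or> E*(n+1)+n < z --> arrs s1 8 z = arrs s 8 z" using I unfolding I_def by blast+
  show ?case
  proof (rule T_StoreV[where p = ?z and v = "int ?l"])
   show "av s1 (R 33\<boxtimes>(R 0\<boxplus>N 1)\<boxplus>R 0) = int ?z" using r by (simp add: algebra_simps)
   show "Suc (t1+1) <= n*NN*18+5 & regs ?s2 11 = int ?l &
   (\<forall>x<length (EL E (n*NN)). arrs ?s2 7 (P0+x) = int (EL E (n*NN) ! x)) & (\<forall>p<P0. arrs ?s2 7 p = arrs s 7 p) &
   (\<forall>i\<le>n. arrs ?s2 8 (E*(n+1)+i) = int (P0+length (EL E (i*NN)))) &
   (\<forall>z. z < E*(n+1) \<or> E*(n+1)+n < z --> arrs ?s2 8 z = arrs s 8 z)"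
   proof (intro conjI)
    show "\<forall>i\<le>n. arrs ?s2 8 (E*(n+1)+i) = int (P0+length (EL E (i*NN)))" using i8 by blast
   qed (use t1 r11 i7 z8 in auto)
  qed (use r11 lB B2 in auto)
 qed
qed

definition evdone :: "nat => state => bool" where
 "evdone m s \<longleftrightarrow> (\<forall>e. m <= e --> e <= e0 -->
   (\<forall>i\<le>n. arrs s 8 (2^e*(n+1)+i) = int (PP (Suc e)+length (EL (2^e) (i*NN)))) &
   (\<forall>x<length (EL (2^e) (n*NN)). arrs s 7 (PP (Suc e)+x) = int (EL (2^e) (n*NN) ! x)))"

lemma pow_e_n: "e <= e0 ==> 2^e <= n"
 using D0_n power_increasing[of e e0 "2::nat"] by linarith

lemma events_spec:
 assumes s: "regs s 0 = int n" "regs s 1 = int NN" "regs s 3 = 2^e0"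
  and A: "\<And>p. p < n*NN ==> arrs s 3 p = Mh (p div NN) (p mod NN)"
 shows "T events s (%s' t. t <= Suc e0*(n*NN*18+8)+5 & regs s' 11 = int (PP 0) & evdone 0 s' &
   same {11, 13, 14, 16, 33} {7, 8, 11} s s')"
proof -
 define J where "J m s' kp \<longleftrightarrow> m <= Suc e0 & regs s' 33 = (if m = 0 then 0 else 2^(m - 1)) & regs s' 11 = int (PP m) & evdone m s' &
   kp <= (Suc e0 - m)*(n*NN*18+8) & same {11, 13, 14, 16, 33} {7, 8, 11} s s'" for m s' kp
 have pn: "(2::int)^e0 <= int n" using D0_n by (metis of_nat_le_iff of_nat_numeral of_nat_power)
 have pB: "\<bar>(2::int)^e0\<bar> <= B" using pn B_facts zero_le_power[of "2::int" e0] by linarith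
 let ?s1 = "setr s 11 0"
 let ?s2 = "setr ?s1 33 (2^e0)"
 show ?thesis unfolding events_def
  apply (rule T_AssignS[where v = 0], (use B2 in simp_all)[4])
  apply (rule T_AssignS[where v = "2^e0"], (use s pB in simp_all)[4])
 proof (rule T_While[where I = "%s' kp. \<exists>m. J m s' kp" and \<mu> = "%s'. nat (regs s' 33)"])
  have "J (Suc e0) ?s2 0" unfolding J_def by (simp add: PP_def evdone_def same_def)
  then show "\<exists>m. J m ?s2 0" by blast
 next
  fix s' kp assume "\<exists>m. J m s' kp"
  show "bok B s' (Less (N 0) (R 33))" using B2 by simp
 next
  fix s' kp assume "\<exists>m. J m s' kp" "\<not> bv s' (Less (N 0) (R 33))"
  then obtain m where m: "J m s' kp" "\<not> 0 < regs s' 33" by auto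
  then have "m = 0" unfolding J_def by (cases m) auto
  then show "Suc (Suc (Suc (Suc (Suc kp)))) <= Suc e0*(n*NN*18+8)+5 & regs s' 11 = int (PP 0) & evdone 0 s' &
   same {11, 13, 14, 16, 33} {7, 8, 11} s s'" using m(1) unfolding J_def by simp
 next
  fix s' kp assume "\<exists>m. J m s' kp" and b: "bv s' (Less (N 0) (R 33))"
  then obtain m' where m': "J m' s' kp" by blast
  then obtain m where m: "m' = Suc m" using b unfolding J_def by (cases m') auto
  have J: "m <= e0" "regs s' 33 = int (2^m)" "regs s' 11 = int (PP (Suc m))" "evdone (Suc m) s'" "kp <= (Suc e0 - Suc m)*(n*NN*18+8)"
   "same {11, 13, 14, 16, 33} {7, 8, 11} s s'"
   using m' unfolding J_def m by auto
  have r: "regs s' 0 = int n" "regs s' 1 = int NN" using same_regs[OF J(6)] s by auto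
  have A': "arrs s' 3 p = Mh (p div NN) (p mod NN)" if "p < n*NN" for p using same_arrs[OF J(6), of 3] A[OF that] by simp
  have R: "T ev_body s' (%s'' t. t <= n*NN*18+5 & regs s'' 11 = int (PP (Suc m)+length (EL (2^m) (n*NN))) &
   (\<forall>x<length (EL (2^m) (n*NN)). arrs s'' 7 (PP (Suc m)+x) = int (EL (2^m) (n*NN) ! x)) & (\<forall>p<PP (Suc m). arrs s'' 7 p = arrs s' 7 p) &
   (\<forall>i\<le>n. arrs s'' 8 (2^m*(n+1)+i) = int (PP (Suc m)+length (EL (2^m) (i*NN)))) &
   (\<forall>z. z < 2^m*(n+1) \<or> 2^m*(n+1)+n < z --> arrs s'' 8 z = arrs s' 8 z))"
   by (rule ev_body_spec[OF r J(2,3) A' PPB pow_e_n[OF J(1)]])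
  show "T (ev_body ;; halve 33) s' (%s2 t. (\<exists>m. J m s2 (Suc (kp + t))) & nat (regs s2 33) < nat (regs s' 33))"
  proof (rule T_Seq, rule T_conseq[OF R], goal_cases)
   case (1 s2 t2)
   have r11: "regs s2 11 = int (PP m)" unfolding PP_split[OF J(1)] using 1(1) by blast
   have t2: "t2 <= n*NN*18+5"
    and x7: "\<And>x. x < length (EL (2^m) (n*NN)) ==> arrs s2 7 (PP (Suc m)+x) = int (EL (2^m) (n*NN) ! x)"
    and p7: "\<And>p. p < PP (Suc m) ==> arrs s2 7 p = arrs s' 7 p"
    and i8: "\<And>i. i <= n ==> arrs s2 8 (2^m*(n+1)+i) = int (PP (Suc m)+length (EL (2^m) (i*NN)))"
    and z8: "\<And>z. 2^m*(n+1)+n < z ==> arrs s2 8 z = arrs s' 8 z"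
    using 1(1) by blast+
   have sm2: "same {11, 13, 14, 16} {7, 8, 11} s' s2" using 1(2) by simp
   have r33: "regs s2 33 = int (2^m)" using same_regs[OF sm2, of 33] J(2) by simp
   define v where "v = (if m = 0 then 0 else 2^(m - 1) :: int)"
   have v: "int (2^m) div 2 = v" unfolding v_def by (cases m) auto
   have vn: "nat v < nat (int (2^m))" "\<bar>v\<bar> <= B"
   proof -
    have "int (2^m) <= int n" using pow_e_n[OF J(1)] by (simp only: of_nat_le_iff)
    then have mB: "int (2^m) <= B" using B_facts by linarith
    have "v < int (2^m)" "0 <= v" unfolding v_def by (cases m; simp)+
    then show "nat v < nat (int (2^m))" "\<bar>v\<bar> <= B" using mB by linarith+
   qed
   let ?s3 = "setr s2 33 v"
   have ed: "evdone m ?s3" unfolding evdone_def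
   proof (intro allI impI)
    fix e assume e: "m <= e" "e <= e0"
    show "(\<forall>i\<le>n. arrs ?s3 8 (2^e*(n+1)+i) = int (PP (Suc e)+length (EL (2^e) (i*NN)))) &
     (\<forall>x<length (EL (2^e) (n*NN)). arrs ?s3 7 (PP (Suc e)+x) = int (EL (2^e) (n*NN) ! x))"
    proof (cases "e = m")
     case True
     then show ?thesis using i8 x7 by simp
    next
     case False
     then have me: "Suc m <= e" using e by simp
     \<comment> \<open>The offset tables of different radii occupy disjoint blocks of length
       \<open>n + 1\<close>, so the block written for \<open>2^m\<close> misses that of
       \<open>2^e\<close>.\<close>
     have "(2::nat)^m < 2^e" using me by (intro power_strict_increasing) auto
     then have "(2^m+1)*(n+1) <= 2^e*(n+1)" by (intro mult_le_mono1) (simp only: Suc_eq_plus1[symmetric] Suc_le_eq)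
     then have gt: "2^m*(n+1)+n < 2^e*(n+1)+i" for i by (simp add: algebra_simps)
     have lt: "PP (Suc e)+x < PP (Suc m)" if "x < length (EL (2^e) (n*NN))" for x
      using PP_split[OF e(2)] PP_mono[OF me] that by linarith
     have old: "\<And>i. i <= n ==> arrs s' 8 (2^e*(n+1)+i) = int (PP (Suc e)+length (EL (2^e) (i*NN)))"
      "\<And>x. x < length (EL (2^e) (n*NN)) ==> arrs s' 7 (PP (Suc e)+x) = int (EL (2^e) (n*NN) ! x)"
      using J(4) me e(2) unfolding evdone_def by blast+
     show ?thesis
     proof (intro conjI allI impI)
      fix i assume "i <= n"
      have "arrs ?s3 8 (2^e*(n+1)+i) = arrs s' 8 (2^e*(n+1)+i)" using z8[OF gt] by simp
      then show "arrs ?s3 8 (2^e*(n+1)+i) = int (PP (Suc e)+length (EL (2^e) (i*NN)))" using old(1)[OF \<open>i <= n\<close>] by simp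
     next
      fix x assume x: "x < length (EL (2^e) (n*NN))"
      have "arrs ?s3 7 (PP (Suc e)+x) = arrs s' 7 (PP (Suc e)+x)" using p7[OF lt[OF x]] by simp
      then show "arrs ?s3 7 (PP (Suc e)+x) = int (EL (2^e) (n*NN) ! x)" using old(2)[OF x] by simp
     qed
    qed
   qed
   have "Suc (kp + Suc (t2+1)) <= (Suc e0 - m)*(n*NN*18+8)"
   proof -
    have "Suc e0 - m = Suc (Suc e0 - Suc m)" using J(1) by linarith
    then show ?thesis using J(5) t2 by simp
   qed
   moreover have "same {11, 13, 14, 16, 33} {7, 8, 11} s ?s3" using J(6) sm2 by (auto simp: same_def)
   ultimately have "J m ?s3 (Suc (kp + Suc (t2+1)))" unfolding J_def using J(1) ed r11 by (simp add: v_def)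
   then have fin: "\<exists>m. J m ?s3 (Suc (kp + Suc (t2+1)))" by blast
   have "nat v < nat (regs s' 33)" unfolding J(2) using vn(1) by simp
   then show ?case unfolding halve_def using fin v vn r33 B2
    by (intro T_AssignV[where v = v]) auto
  qed
 qed
qed

end

definition prep_b :: "com => com" where
 "prep_b c = fill ;; flags ;; tree_loop (N 0) (Rd 3 (R 14)) ;; tree_loop (R 0) (N 0\<boxminus>Rd 3 (R 14)) ;; events ;; init_st ;;
   inst_loop (prep_body c)"

locale full = red W B n L e0 tA Mh vh pA qA WA SC TC xs for W B n L e0 tA Mh vh pA qA WA SC TC xs +
 fixes nu :: nat
 assumes nu: "e <= e0 ==> Dok (2^e) ==> NN <= nu*2^e"
  and mono: "rowsM \<or> colsM \<or> (\<forall>j<n. vmono j) \<or> timeM"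
begin

sublocale qry W B n L e0 tA Mh vh pA qA WA SC TC xs nu "PP 0"
proof
 show "int (PP 0+NN+1) <= B" using PPB[of 0] by linarith
qed (use nu mono in auto)

text \<open>\<open>EL\<close> enumerates events in row order, so those of row \<open>i\<close> form
  the contiguous segment between the offsets of rows \<open>i\<close> and
  \<open>i + 1\<close>.\<close>

lemma evdone_evok: "evdone 0 s ==> evok s"
 unfolding evok_def
proof (intro allI impI)
 fix e i assume ed: "evdone 0 s" and e: "e <= e0" and i: "i < n"
 let ?E = "2^e"
 let ?lo = "PP (Suc e)+length (EL ?E (i*NN))"
 have p8: "\<And>i. i <= n ==> arrs s 8 (?E*(n+1)+i) = int (PP (Suc e)+length (EL ?E (i*NN)))"
  and x7: "\<And>x. x < length (EL ?E (n*NN)) ==> arrs s 7 (PP (Suc e)+x) = int (EL ?E (n*NN) ! x)"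
  using ed e unfolding evdone_def by blast+
 have row: "EL ?E (Suc i*NN) = EL ?E (i*NN) @ evs ?E i" by (rule EL_row)
 have "\<exists>zs. EL ?E (n*NN) = EL ?E (Suc i*NN) @ zs"
 proof -
  have "[0..<n*NN] = [0..<Suc i*NN] @ [Suc i*NN..<n*NN]"
   using mult_le_mono1[of "Suc i" n NN] i upt_add_eq_append[of 0 "Suc i*NN" "n*NN - Suc i*NN"] by simp
  then show ?thesis unfolding EL_def by auto
 qed
 then obtain zs where zs: "EL ?E (n*NN) = EL ?E (i*NN) @ evs ?E i @ zs" using row by auto
 show "\<exists>lo. arrs s 8 (?E*(n+1)+i) = int lo & arrs s 8 (?E*(n+1)+i+1) = int (lo+length (evs ?E i)) &
   lo+length (evs ?E i) <= PP 0 & (\<forall>x<length (evs ?E i). arrs s 7 (lo+x) = int (evs ?E i ! x))"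
 proof (rule exI[of _ ?lo], intro conjI allI impI)
  show "arrs s 8 (?E*(n+1)+i) = int ?lo" using p8[of i] i by simp
  have "arrs s 8 (?E*(n+1)+Suc i) = int (PP (Suc e)+length (EL ?E (Suc i*NN)))" using i by (intro p8) simp
  then show "arrs s 8 (?E*(n+1)+i+1) = int (?lo+length (evs ?E i))" unfolding row by (simp add: add.assoc)
  have "?lo+length (evs ?E i) <= PP (Suc e)+length (EL ?E (n*NN))" unfolding zs by simp
  also have "\<dots> = PP e" using PP_split[OF e] by simp
  also have "\<dots> <= PP 0" by (rule PP_mono) simp
  finally show "?lo+length (evs ?E i) <= PP 0" .
 next
  fix x assume x: "x < length (evs ?E i)"
  have "arrs s 7 (PP (Suc e)+(length (EL ?E (i*NN))+x)) = int (EL ?E (n*NN) ! (length (EL ?E (i*NN))+x))"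
   by (rule x7) (use x zs in simp)
  then show "arrs s 7 (?lo+x) = int (evs ?E i ! x)" unfolding zs using x by (simp add: nth_append add.assoc)
 qed
qed

definition CP :: nat where
 "CP = n*NN*(14*LG+38)+Suc e0*(n*NN*18+8)+NN*4+KI*(4*n*n+32)+40"

lemma prep_b_spec:
 assumes s: "iregs s e0 0" and A: "\<And>q. q < n*n ==> arrs s 0 q = Mh (q div n) (q mod n)"
  and x: "\<And>a. a < length xs ==> arrs s 10 a = int (xs ! a)" and z: "arrs s 5 = (%_. 0)" "\<And>a. 12 <= a ==> arrs s a = (%_. 0)"
 shows "T (prep_b pA) s (%s' t. \<exists>e cnt. stat s' & trees s' & stale s' 0 & ist (Suc 0) 0 s' e cnt &
   t+5*pot e0 0 <= CP+5*pot e cnt)"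
proof -
 have r: "regs s 0 = int n" "regs s 1 = int NN" "regs s 3 = 2^e0" using s by (auto simp: iregs_def)
 have z0: "trep s r (%_. 0)" "tr s r h = 0" for r h using z(1) by (auto simp: trep_def tvalid_def tr_def)
 have tz: "trep s' r (%_. 0)" if "\<And>h. h < 2*NN ==> tr s' r h = 0" for s' r
  by (rule trep_cong[OF z0(1)]) (use that z0 in simp)
 show ?thesis unfolding prep_b_def
 proof (rule T_Seq, rule T_conseq[OF fill_spec[OF r(1,2) A]], assumption, goal_cases)
  case (1 s1 t1)
  then have t1: "t1 <= n*NN*12+3" and A1: "\<And>p. p < n*NN ==> arrs s1 3 p = Mh (p div NN) (p mod NN)"
   and m1: "same {13, 14, 16, 32} {3} s s1" by auto
  have r1: "regs s1 0 = int n" "regs s1 1 = int NN" using same_regs[OF m1] r by auto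
  show ?case
  proof (rule T_Seq, rule T_conseq[OF flags_spec[OF r1 A1]], assumption, goal_cases)
   case (1 s2 t2)
   then have t2: "t2 <= n*NN*8+7" and fl: "regs s2 8 = (if rowsM then 1 else 0)" "regs s2 9 = (if colsM then 1 else 0)"
    and m2: "same {8, 9, 14} {} s1 s2" by auto
   have r2: "regs s2 0 = int n" "regs s2 1 = int NN" using same_regs[OF m2] r1 by auto
   have A2: "arrs s2 3 p = Mh (p div NN) (p mod NN)" if "p < n*NN" for p using same_arrs[OF m2, of 3] A1[OF that] by simp
   have a5: "arrs s2 5 = arrs s 5" using same_arrs[OF m2, of 5] same_arrs[OF m1, of 5] by simp
   have z2: "tr s2 r h = 0" for r h using a5 z(1) by (simp add: tr_def)
   have MB: "\<bar>Mh i k\<bar> <= B" if "i < n" "k < NN" for i k using Mr[OF that] B_facts by linarith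
   have T1: "T (tree_loop (N 0) (Rd 3 (R 14))) s2 (%s' t. t <= n*NN*(7*LG+9)+3 & (\<forall>i<n. trep s' (0+i) (Mh i)) &
    (\<forall>r h. r < 0 \<or> 0+n <= r --> h < 2*NN --> tr s' r h = tr s2 r h) & same {14, 15, 16, 17, 18} {5} s2 s')"
   proof (rule tree_loop_spec[OF r2])
    fix i assume "i < n"
    show "\<exists>f. trep s2 (0+i) f" using tz[of s2 "0+i", OF z2] by blast
   qed (use A2 MB B2 in auto)
   show ?case
   proof (rule T_Seq, rule T_conseq[OF T1], goal_cases)
    case (1 s3 t3)
    then have t3: "t3 <= n*NN*(7*LG+9)+3" and e3: "\<And>i. i < n ==> trep s3 i (Mh i)"
     and o3: "\<And>r h. n <= r ==> h < 2*NN ==> tr s3 r h = 0" and m3: "same {14, 15, 16, 17, 18} {5} s2 s3" using z2 by auto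
    have r3: "regs s3 0 = int n" "regs s3 1 = int NN" using same_regs[OF m3] r2 by auto
    have A3: "arrs s3 3 p = Mh (p div NN) (p mod NN)" if "p < n*NN" for p using same_arrs[OF m3, of 3] A2[OF that] by simp
    have T2: "T (tree_loop (R 0) (N 0\<boxminus>Rd 3 (R 14))) s3 (%s' t. t <= n*NN*(7*LG+9)+3 & (\<forall>i<n. trep s' (n+i) ((%i k. - Mh i k) i)) &
     (\<forall>r h. r < n \<or> n+n <= r --> h < 2*NN --> tr s' r h = tr s3 r h) & same {14, 15, 16, 17, 18} {5} s3 s')"
    proof (rule tree_loop_spec[OF r3])
     fix i assume "i < n"
     show "\<exists>f. trep s3 (n+i) f" using tz[of s3 "n+i"] o3[of "n+i"] by auto
    qed (use A3 MB B2 in auto)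
    show ?case
    proof (rule T_Seq, rule T_conseq[OF T2], goal_cases)
     case (1 s4 t4)
     then have t4: "t4 <= n*NN*(7*LG+9)+3" and e4: "\<And>i. i < n ==> trep s4 (n+i) (%k. - Mh i k)"
      and o4: "\<And>r h. r < n \<or> n+n <= r ==> h < 2*NN ==> tr s4 r h = tr s3 r h" and m4: "same {14, 15, 16, 17, 18} {5} s3 s4" by auto
     have e4': "trep s4 i (Mh i)" if "i < n" for i by (rule trep_cong[OF e3[OF that]]) (use o4 that in simp)
     have z4: "tr s4 r h = 0" if "2*n <= r" "h < 2*NN" for r h using o4[of r h] o3[of r h] that by simp
     have r4: "regs s4 0 = int n" "regs s4 1 = int NN" "regs s4 3 = 2^e0"
      using same_regs[OF m4] r3 same_regs[OF m3] same_regs[OF m2] same_regs[OF m1] r by auto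
     have A4: "arrs s4 3 p = Mh (p div NN) (p mod NN)" if "p < n*NN" for p using same_arrs[OF m4, of 3] A3[OF that] by simp
     show ?case
     proof (rule T_Seq, rule T_conseq[OF events_spec[OF r4 A4]], assumption, goal_cases)
      case (1 s5 t5)
      then have t5: "t5 <= Suc e0*(n*NN*18+8)+5" and r5: "regs s5 11 = int (PP 0)" and ed: "evdone 0 s5"
       and m5: "same {11, 13, 14, 16, 33} {7, 8, 11} s4 s5" by auto
      have r51: "regs s5 1 = int NN" using same_regs[OF m5] r4 by simp
      show ?case
      proof (rule T_Seq, rule T_conseq[OF init_st_spec[OF r51]], goal_cases)
       case (1 s6 t6)
       then have t6: "t6 <= NN*4+3" and a9: "\<And>k. k < NN ==> arrs s6 9 k = - 2*int NN" and m6: "same {14} {9} s5 s6" by auto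
       define X where "X = {8, 9, 11, 13, 14, 15, 16, 17, 18, 32, 33 :: nat}"
       define Y where "Y = {3, 5, 7, 8, 9, 11 :: nat}"
       have mm6: "same X Y s s6"
        by (rule same_trans, rule same_trans, rule same_trans, rule same_trans, rule same_trans, rule same_mono, rule m1)
         (rule m2 m3 m4 m5 m6 | simp add: X_def Y_def)+
       have a6: "arrs s6 8 = arrs s5 8" "arrs s6 7 = arrs s5 7" "arrs s6 5 = arrs s4 5" "arrs s6 3 = arrs s4 3"
        using same_arrs[OF m6] same_arrs[OF m5] by simp_all
       have ev6: "evok s6" by (rule evok_cong[OF evdone_evok[OF ed]]) (use a6 in auto)
       have st6: "stat s6" unfolding stat_def
       proof (intro conjI allI impI)
        show "regs s6 8 = (if rowsM then 1 else 0)" "regs s6 9 = (if colsM then 1 else 0)"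
         using fl same_regs[OF m3] same_regs[OF m4] same_regs[OF m5] same_regs[OF m6] by simp_all
        show "regs s6 11 = int (PP 0)" using r5 same_regs[OF m6] by simp
        show "mm s6 i k = Mh i k" if "i < n" "k < NN" for i k by (rule mm_flat[OF _ that]) (use A4 a6 in simp)
        show "arrs s6 10 a = int (xs ! a)" if "a < length xs" for a using x[OF that] same_arrs[OF mm6, of 10] by (simp add: Y_def)
       qed (rule ev6)
       have tr6: "tr s6 = tr s4" using a6 by (simp add: tr_def fun_eq_iff)
       have trp6: "trep s6 = trep s4" using tr6 by (simp add: trep_def tvalid_def fun_eq_iff)
       have tz6: "trep s6 r (%_. 0)" if "2*n <= r" for r by (rule tz) (use tr6 z4 that in simp)
       have te6: "trees s6" unfolding trees_def trp6
       proof (intro conjI allI impI)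
        show "\<exists>f. trep s4 (2*n) f" "\<exists>f. trep s4 (2*n+1) f" "\<exists>f. trep s4 (2*n+3) f"
         using tz6[of "2*n"] tz6[of "2*n+1"] tz6[of "2*n+3"] unfolding trp6 by auto
       qed (use e4 e4' tr6 z4 in auto)
       have sl6: "stale s6 0" unfolding stale_def
       proof (intro conjI allI impI)
        fix i assume "i < n"
        have "trep s6 (2*n+4+i) (%_. 0)" by (rule tz6) simp
        then show "\<exists>g. trep s6 (2*n+4+i) g & (\<forall>k<NN. arrs s6 9 k \<noteq> - 2*int NN --> g k = Mh i k+arrs s6 9 k)"
         using a9 by auto
       qed (use a9 in simp)
       have is0: "ist 0 0 s e0 0"
       proof -
        have "view KI i s = zero_state" for i unfolding view_def zero_state_def using z(2) by simp
        then show ?thesis unfolding ist_def using s D0_gt by (simp add: Dok_def)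
       qed
       have is6: "ist 0 0 s6 e0 0" by (rule ist_cong[OF is0]; (rule same_regs[OF mm6] | rule same_arrs[OF mm6]); auto simp: X_def Y_def)
       have R: "T (inst_loop (prep_body pA)) s6 (%s' t. \<exists>e' cnt'. same Xreg Xarr s6 s' & ist (Suc 0) 0 s' e' cnt' &
         True & e' <= e0 & t+5*pot e0 0 <= KI*(4*n*n+10+22)+3+5*pot e' cnt')"
       proof (rule round_spec[where X = "same Xreg Xarr s6" and OI = "%_ _ _. True" and pcol = pc and C = "4*n*n+10"])
        show "wregs (prep_body pA) \<subseteq> {4, 13, 14, 32, 36}" using wregs_ccom[of pA] by (auto simp: prep_body_def)
        show "warrs (prep_body pA) \<subseteq> {2} \<union> {12..}" using warrs_ccom[of pA] by (auto simp: prep_body_def)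
       next
        fix u1 u2 assume "same Xreg Xarr s6 u1" "same {3, 4, 6, 13, 14, 31, 32, 34, 35, 36} ({2} \<union> {12..}) u1 u2"
        then show "same Xreg Xarr s6 u2" using same_trans[of Xreg Xarr s6 u1 Xreg Xarr u2] by (simp add: Xreg_def Xarr_def)
       next
        fix u1 p assume sm: "same Xreg Xarr s6 u1" and p: "p < KI"
        have "p div ZZ < length xs" using p unfolding KI_def xs(1) LP_def by (rule less_mult_imp_div_less)
        moreover have "arrs u1 10 = arrs s6 10" using same_arrs[OF sm, of 10] by (simp add: Xarr_def)
        ultimately show "arrs u1 10 (p div ZZ) = int (pc p)" using st6 by (simp add: stat_def pc_ZZ)
       next
        fix u1 e1 cnt1 p
        assume a: "same Xreg Xarr s6 u1" "iregs u1 e1 cnt1" "active (2^e1) p" "regs u1 6 = int p"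
         "regs u1 34 = int (pc p)" "view KI p u1 = (if (0::nat) = 0 then zero_state else SC (pc p) (dl p) (0 - 1))"
         "int (cnt1+TC (pc p) (dl p) 0) <= B"
        have a0: "arrs u1 3 = arrs s6 3" "arrs u1 0 = arrs s6 0" using same_arrs[OF a(1)] by (auto simp: Xarr_def)
        have "arrs s6 0 = arrs s 0" using same_arrs[OF mm6, of 0] by (simp add: Y_def)
        then have A0: "arrs u1 0 q = Mh (q div n) (q mod n)" if "q < n*n" for q using A[OF that] a0 by simp
        have mA: "mm u1 i k = Mh i k" if "i < n" "k < NN" for i k using st6 that a0 by (simp add: stat_def mm_def)
        have v0: "view KI p u1 = zero_state" using a(6) by simp
        have P: "T (prep_body pA) u1 (%s' t. t <= 4*n*n+10+5*TC (pc p) (dl p) 0 &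
          view KI p s' = SC (pc p) (dl p) 0 & (\<forall>i<KI. i \<noteq> p --> view KI i s' = view KI i u1) &
          regs s' 4 = int (cnt1+TC (pc p) (dl p) 0))"
         by (rule prep_body_spec[OF a(2) KI_less[OF a(3)] a(4,5) v0 a(7) A0 mA])
        show "T (prep_body pA) u1 (%s' t. t <= 4*n*n+10+5*TC (pc p) (dl p) 0 & True &
          view KI p s' = (if Suc 0 = 0 then zero_state else SC (pc p) (dl p) (Suc 0 - 1)) &
          (\<forall>i<KI. i \<noteq> p --> view KI i s' = view KI i u1) & regs s' 4 = int (cnt1+TC (pc p) (dl p) 0))"
         by (rule T_conseq[OF P]) simp
       qed (use is6 in auto)
       show ?case
       proof (rule T_conseq[OF R], goal_cases)
        case (1 s7 t7)
        then obtain e cnt where m7: "same Xreg Xarr s6 s7" and is7: "ist (Suc 0) 0 s7 e cnt"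
         and t7: "t7+5*pot e0 0 <= KI*(4*n*n+10+22)+3+5*pot e cnt" by blast
        have a7: "arrs s7 a = arrs s6 a" if "a \<in> {3,5,7,8,9,10}" for a
         by (rule same_arrs[OF m7]) (use that in \<open>auto simp: Xarr_def\<close>)
        have r7: "regs s7 x = regs s6 x" if "x \<in> {8,9,11}" for x
         by (rule same_regs[OF m7]) (use that in \<open>auto simp: Xreg_def\<close>)
        have st7: "stat s7" by (rule stat_cong[OF st6]) (use a7 r7 in simp_all)
        have te7: "trees s7" by (rule trees_cong[OF te6]) (use a7 in simp)
        have sl7: "stale s7 0" by (rule stale_cong[OF sl6]) (use a7 in \<open>simp_all add: tr_def\<close>)
        have c1: "n*NN*(14*LG+38) = n*NN*12+n*NN*8+n*NN*(7*LG+9)+n*NN*(7*LG+9)"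
         by (simp add: algebra_simps)
        have c2: "KI*(4*n*n+10+22) = KI*(4*n*n+32)" by (simp add: add.assoc)
        have "Suc (t1+Suc (t2+Suc (t3+Suc (t4+Suc (t5+Suc (t6+t7))))))+5*pot e0 0 <= CP+5*pot e cnt"
         unfolding CP_def c1 using t1 t2 t3 t4 t5 t6 t7[unfolded c2] by linarith
        then show ?case using st7 te7 sl7 is7 by blast
       qed
      qed
     qed
    qed
   qed
  qed
 qed
qed

end

section \<open>Parameters and random samples\<close>

definition params :: com where
 "params = Assign 1 (N 1) ;; Assign 2 (N 1) ;; While (Less (R 1) (R 0)) (Assign 1 (R 1\<boxplus>R 1) ;; Assign 2 (R 2\<boxplus>N 1)) ;;
   Assign 3 (N 1) ;; While (Less (N 8\<boxtimes>R 3\<boxtimes>R 3\<boxtimes>R 3) (R 0\<boxplus>N 1)) (Assign 3 (R 3\<boxplus>R 3)) ;;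
   Assign 7 (R 3\<boxplus>R 3\<boxplus>N 1) ;; Assign 5 (R 3\<boxtimes>(N 4\<boxtimes>R 2)\<boxtimes>R 7)"

text \<open>The only random command of the reduction; columns are drawn independently and with
  repetition.\<close>

definition sample :: com where
 "sample = for_loop 31 (R 3\<boxtimes>(N 4\<boxtimes>R 2)) (Rand 32 (R 1) ;; Store 10 (R 31) (R 32))"

context par
begin

lemma size_loop_spec:
 assumes s: "regs s 0 = int n" "regs s 1 = 1" "regs s 2 = 1"
 shows "T (While (Less (R 1) (R 0)) (Assign 1 (R 1\<boxplus>R 1) ;; Assign 2 (R 2\<boxplus>N 1))) s
   (%s' t. t <= 4*L+1 & regs s' 1 = int NN & regs s' 2 = int LG & same {1, 2} {} s s')"
proof (rule T_While[where I = "%s' kp. \<exists>l\<le>L. regs s' 1 = 2^l & regs s' 2 = int (Suc l) & kp = 4*l & same {1, 2} {} s s'"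
   and \<mu> = "%s'. L - nat (regs s' 2 - 1)"])
 show "\<exists>l\<le>L. regs s 1 = 2^l & regs s 2 = int (Suc l) & 0 = 4*l & same {1, 2} {} s s" using s by (intro exI[of _ 0]) simp
next
 fix s' :: state show "bok B s' (Less (R 1) (R 0))" by simp
next
 fix s' kp assume "\<exists>l\<le>L. regs s' 1 = 2^l & regs s' 2 = int (Suc l) & kp = 4*l & same {1, 2} {} s s'" and b: "bv s' (Less (R 1) (R 0))"
 then obtain l where l: "l <= L" "regs s' 1 = 2^l" "regs s' 2 = int (Suc l)" "kp = 4*l" and sm: "same {1, 2} {} s s'" by blast
 have r0: "regs s' 0 = int n" using same_regs[OF sm] s by simp
 have ln: "(2::int)^l < int n" using b l r0 by simp
 have "l \<noteq> L"
 proof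
  assume "l = L"
  then have "int (2^L) < int n" using ln by simp
  then show False using nN by linarith
 qed
 then have lL: "Suc l <= L" using l by simp
 have "int n <= int NN" using n_le_NN by simp
 then have B: "\<bar>2*(2::int)^l\<bar> <= B" using ln B_facts zero_le_power[of "2::int" l] by linarith
 have B2': "\<bar>int (Suc (Suc l))\<bar> <= B" using L_le lL B_facts by simp
 let ?s1 = "setr s' 1 (2^Suc l)"
 let ?s2 = "setr ?s1 2 (int (Suc (Suc l)))"
 show "T (Assign 1 (R 1\<boxplus>R 1) ;; Assign 2 (R 2\<boxplus>N 1)) s' (%s'' t. (\<exists>l\<le>L. regs s'' 1 = 2^l & regs s'' 2 = int (Suc l) &
   Suc (kp + t) = 4*l & same {1, 2} {} s s'') & L - nat (regs s'' 2 - 1) < L - nat (regs s' 2 - 1))"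
  apply (rule T_AssignS[where v = "2^Suc l"], (use l B in simp_all)[4])
  apply (rule T_AssignV[where v = "int (Suc (Suc l))"], (use l B2' B_facts in simp_all)[4])
  using l lL sm by (intro conjI exI[of _ "Suc l"]) (auto simp: same_def)
next
 fix s' kp assume "\<exists>l\<le>L. regs s' 1 = 2^l & regs s' 2 = int (Suc l) & kp = 4*l & same {1, 2} {} s s'" and b: "\<not> bv s' (Less (R 1) (R 0))"
 then obtain l where l: "l <= L" "regs s' 1 = 2^l" "regs s' 2 = int (Suc l)" "kp = 4*l" and sm: "same {1, 2} {} s s'" by blast
 have r0: "regs s' 0 = int n" using same_regs[OF sm] s by simp
 have "int n <= int (2^l)" using b l r0 by simp
 then have ln: "n <= 2^l" by linarith
 have "l = L"
 proof (rule ccontr)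
  assume "l \<noteq> L"
  then have "Suc l <= L" using l by simp
  then have "(2::nat)^Suc l <= 2^L" by (intro power_increasing) auto
  then show False using Nn ln by simp
 qed
 then show "Suc kp <= 4*L+1 & regs s' 1 = int NN & regs s' 2 = int LG & same {1, 2} {} s s'"
  using l sm by (simp add: NN_def LG_def)
qed

text \<open>The test amounts to \<open>8 * D^3 <= n\<close>, that is, \<open>2 * D\<close> is still
  at most the cube root of \<open>n\<close>.\<close>

lemma radius_loop_spec:
 assumes s: "regs s 0 = int n" "regs s 3 = 1" and e0: "(2^e0)^3 <= n" "n < 8*(2^e0)^3"
 shows "T (While (Less (N 8\<boxtimes>R 3\<boxtimes>R 3\<boxtimes>R 3) (R 0\<boxplus>N 1)) (Assign 3 (R 3\<boxplus>R 3))) s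
   (%s' t. t <= 2*e0+1 & regs s' 3 = 2^e0 & same {3} {} s s')"
proof (rule T_While[where I = "%s' kp. \<exists>e\<le>e0. regs s' 3 = 2^e & kp = 2*e & same {3} {} s s'"
   and \<mu> = "%s'. n - nat (regs s' 3)"])
 show "\<exists>e\<le>e0. regs s 3 = 2^e & 0 = 2*e & same {3} {} s s" using s by (intro exI[of _ 0]) simp
next
 fix s' :: state show "bok B s' (Less (N 8\<boxtimes>R 3\<boxtimes>R 3\<boxtimes>R 3) (R 0\<boxplus>N 1))" using B_facts by simp
next
 fix s' kp assume "\<exists>e\<le>e0. regs s' 3 = 2^e & kp = 2*e & same {3} {} s s'" and b: "bv s' (Less (N 8\<boxtimes>R 3\<boxtimes>R 3\<boxtimes>R 3) (R 0\<boxplus>N 1))"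
 then obtain e where e: "e <= e0" "regs s' 3 = int (2^e)" "kp = 2*e" and sm: "same {3} {} s s'" by auto
 have r0: "regs s' 0 = int n" using same_regs[OF sm] s by simp
 have "int (8*(2^e)^3) <= int n" using b r0 e(2) by (simp add: power3_eq_cube mult.assoc)
 then have le: "8*(2^e)^3 <= n" by linarith
 have "e \<noteq> e0" using le e0(2) by auto
 then have ee: "Suc e <= e0" using e by simp
 have e8: "2*2^e <= n"
 proof -
  have "(1::nat)*1 <= 2^e*2^e" by (intro mult_le_mono) auto
  then have "(2::nat)^e*1 <= 2^e*(2^e*2^e)" by (intro mult_le_mono2) simp
  then have "(2::nat)^e <= (2^e)^3" by (simp only: power3_eq_cube mult.assoc mult_1_right)
  then show ?thesis using le by linarith
 qed
 then have "int (2*2^e) <= int n" by (simp only: of_nat_le_iff)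
 then have B: "\<bar>int (2^Suc e)\<bar> <= B" using B_facts by simp
 let ?s1 = "setr s' 3 (int (2^Suc e))"
 have mu: "n - nat (int (2^Suc e)) < n - nat (regs s' 3)"
  unfolding e(2) nat_int power_Suc using e8 zero_less_power[of "2::nat" e] by linarith
 show "T (Assign 3 (R 3\<boxplus>R 3)) s' (%s'' t. (\<exists>e\<le>e0. regs s'' 3 = 2^e & Suc (kp + t) = 2*e & same {3} {} s s'') &
   n - nat (regs s'' 3) < n - nat (regs s' 3))"
  apply (rule T_AssignV[where v = "int (2^Suc e)"], (use e B in simp_all)[4])
  apply (rule conjI)
   apply (rule exI[of _ "Suc e"], use ee e sm in \<open>simp add: same_def\<close>)
  using mu by simp
next
 fix s' kp assume "\<exists>e\<le>e0. regs s' 3 = 2^e & kp = 2*e & same {3} {} s s'" and b: "\<not> bv s' (Less (N 8\<boxtimes>R 3\<boxtimes>R 3\<boxtimes>R 3) (R 0\<boxplus>N 1))"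
 then obtain e where e: "e <= e0" "regs s' 3 = int (2^e)" "kp = 2*e" and sm: "same {3} {} s s'" by auto
 have r0: "regs s' 0 = int n" using same_regs[OF sm] s by simp
 have "\<not> int (8*(2^e)^3) <= int n" using b r0 e(2) by (simp add: power3_eq_cube mult.assoc)
 then have le: "n < 8*(2^e)^3" by linarith
 have "e = e0"
 proof (rule ccontr)
  assume "e \<noteq> e0"
  then have "Suc e <= e0" using e by simp
  then have "((2::nat)^Suc e)^3 <= (2^e0)^3" by (intro power_mono power_increasing) auto
  then have "8*((2::nat)^e)^3 <= (2^e0)^3" by (simp add: power_mult_distrib)
  then show False using le e0(1) by linarith
 qed
 then show "Suc kp <= 2*e0+1 & regs s' 3 = 2^e0 & same {3} {} s s'" using e sm by simp
qed

lemma params_spec: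
 assumes s: "regs s 0 = int n" and e0: "(2^e0)^3 <= n" "n < 8*(2^e0)^3" and KB: "int (2^e0*(4*LG)*(2*2^e0+1)) <= B"
 shows "T params s (%s' t. t <= 4*L+2*e0+20 & regs s' 1 = int NN & regs s' 2 = int LG & regs s' 3 = 2^e0 &
   regs s' 5 = int (2^e0*(4*LG)*(2*2^e0+1)) & regs s' 7 = int (2*2^e0+1) & same {1, 2, 3, 5, 7} {} s s')"
proof -
 let ?s1 = "setr s 1 1"
 let ?s2 = "setr ?s1 2 1"
 have S: "T (While (Less (R 1) (R 0)) (Assign 1 (R 1\<boxplus>R 1) ;; Assign 2 (R 2\<boxplus>N 1))) ?s2
   (%s' t. t <= 4*L+1 & regs s' 1 = int NN & regs s' 2 = int LG & same {1, 2} {} ?s2 s')"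
  by (rule size_loop_spec) (use s in simp_all)
 have DB: "int (2*2^e0+1) <= B"
 proof -
  have "1*(2*2^e0+1) <= 2^e0*(4*LG)*(2*2^e0+1)" by (intro mult_le_mono1) (simp add: LG_def)
  then have "int (2*2^e0+1) <= int (2^e0*(4*LG)*(2*2^e0+1))"
   by (simp only: of_nat_le_iff mult_1)
  then show ?thesis using KB by linarith
 qed
 show ?thesis unfolding params_def
  apply (rule T_AssignS[where v = 1], (use B_facts in simp_all)[4])
  apply (rule T_AssignS[where v = 1], (use B_facts in simp_all)[4])
 proof (rule T_Seq, rule T_conseq[OF S], goal_cases)
  case (1 s3 t3)
  then have t3: "t3 <= 4*L+1" and r3: "regs s3 1 = int NN" "regs s3 2 = int LG" and m3: "same {1, 2} {} ?s2 s3" by auto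
  have r30: "regs s3 0 = int n" using same_regs[OF m3, of 0] s by simp
  have m3': "same {1, 2} {} s s3" using m3 by (auto simp: same_def)
  let ?s4 = "setr s3 3 1"
  have D: "T (While (Less (N 8\<boxtimes>R 3\<boxtimes>R 3\<boxtimes>R 3) (R 0\<boxplus>N 1)) (Assign 3 (R 3\<boxplus>R 3))) ?s4
    (%s' t. t <= 2*e0+1 & regs s' 3 = 2^e0 & same {3} {} ?s4 s')"
   by (rule radius_loop_spec[OF _ _ e0]) (use r30 in simp_all)
  show ?case
   apply (rule T_AssignS[where v = 1], (use B_facts in simp_all)[4])
  proof (rule T_Seq, rule T_conseq[OF D], goal_cases)
   case (1 s5 t5)
   then have t5: "t5 <= 2*e0+1" and r5: "regs s5 3 = int (2^e0)" and m5: "same {3} {} ?s4 s5" by auto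
   have r52: "regs s5 2 = int LG" "regs s5 1 = int NN" using same_regs[OF m5, of 2] same_regs[OF m5, of 1] r3 by auto
   have m5': "same {1, 2, 3} {} s s5" using m5 m3' by (auto simp: same_def)
   let ?v7 = "int (2*2^e0+1)" and ?v5 = "int (2^e0*(4*LG)*(2*2^e0+1))"
   let ?s6 = "setr s5 7 ?v7"
   let ?s7 = "setr ?s6 5 ?v5"
   have fin: "same {1, 2, 3, 5, 7} {} s ?s7" using m5' by (auto simp: same_def)
   show ?case
    apply (rule T_AssignS[where v = "?v7"])
      apply (use r5 in simp)
      apply (use B_facts in simp)
     apply simp
     apply (use DB in simp)
    apply (rule T_AssignV[where v = "?v5"])
      apply (use r5 r52 in \<open>simp add: algebra_simps\<close>)
      apply (use B_facts in simp)
     apply simp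
     apply (use KB in \<open>simp only: abs_of_nat\<close>)
    using t3 t5 r52 r5 fin by simp
  qed
 qed
qed

definition sstep :: "state => int => state" where
 "sstep u y = u\<lparr>arrs := (arrs u)(10 := (arrs u 10)(nat (regs u 31) := y)), regs := ((regs u)(32 := y))(31 := regs u 31+1)\<rparr>"

text \<open>Effect of the sampling loop once its draws are fixed to \<open>ys\<close>. It separates
  the randomness from the state transformation.\<close>

fun srun :: "state => int list => state" where
 "srun u [] = u"
| "srun u (y # ys) = srun (sstep u y) ys"

lemma srun_props:
 assumes "regs u 31 = int a"
 shows "same {31, 32} {10} u (srun u ys) & (\<forall>i<length ys. arrs (srun u ys) 10 (a+i) = ys ! i) &
   (\<forall>i<a. arrs (srun u ys) 10 i = arrs u 10 i)"
 using assms
proof (induction ys arbitrary: u a)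
 case (Cons y ys)
 have r: "regs (sstep u y) 31 = int (Suc a)" using Cons.prems by (simp add: sstep_def)
 note IH = Cons.IH[OF r]
 have s1: "same {31, 32} {10} u (sstep u y)" by (simp add: sstep_def same_def)
 have a1: "arrs (sstep u y) 10 = (arrs u 10)(a := y)" using Cons.prems by (simp add: sstep_def)
 have "arrs (srun u (y # ys)) 10 (a+i) = (y # ys) ! i" if "i < length (y # ys)" for i
 proof (cases i)
  case 0
  have "arrs (srun (sstep u y) ys) 10 a = arrs (sstep u y) 10 a" using IH by blast
  then show ?thesis using 0 a1 by simp
 next
  case (Suc i')
  then have "arrs (srun (sstep u y) ys) 10 (Suc a+i') = ys ! i'" using IH that by simp
  then show ?thesis using Suc by simp
 qed
 moreover have "arrs (srun u (y # ys)) 10 i = arrs u 10 i" if "i < a" for i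
 proof -
  have "arrs (srun (sstep u y) ys) 10 i = arrs (sstep u y) 10 i" using IH that less_SucI by blast
  then show ?thesis using a1 that by simp
 qed
 moreover have "same {31, 32} {10} u (srun u (y # ys))" by (simp, rule same_trans[OF s1 conjunct1[OF IH]]) auto
 ultimately show ?case by blast
qed simp

lemma sstep_bnd:
 assumes "bnd B u" "\<bar>y\<bar> <= B" "\<bar>regs u 31+1\<bar> <= B" shows "bnd B (sstep u y)"
 using assms by (auto simp: sstep_def bnd_def)

abbreviation swhile :: com where
 "swhile \<equiv> While (Less (R 31) (R 3\<boxtimes>(N 4\<boxtimes>R 2))) ((Rand 32 (R 1) ;; Store 10 (R 31) (R 32)) ;; Assign 31 (R 31\<boxplus>N 1))"

lemma BW1: "B <= W"
proof -
 have "B^1 <= B^16" using B2 by (intro power_increasing) auto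
 then show ?thesis using BW by simp
qed

text \<open>\<open>bs\<close> has no rule for \<open>Rand\<close>, so this loop is unfolded in
  \<open>exec\<close> directly: six steps per draw and one for the last test. The number of steps is
  the same for all draws, so the remaining budget is a constant and the draws can be pulled out as
  one distribution.\<close>

lemma exec_swhile:
 assumes "bnd B u" "regs u 1 = int NN" "regs u 3 = 2^e0" "regs u 2 = int LG" "regs u 31 = int a" "a + k = 2^e0*(4*LG)"
  and mB: "int (2^e0*(4*LG))+1 <= B"
 shows "exec W (6 * k+1+r) (swhile # cs) u =
  bind_pmf (replicate_pmf k (pmf_of_set {0..<int NN})) (%ys. exec W r cs (srun u ys)) &
  (\<forall>ys\<in>set_pmf (replicate_pmf k (pmf_of_set {0..<int NN})). bnd B (srun u ys))"
 using assms(1-6)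
proof (induction k arbitrary: u a)
 case 0
 have "bok B u (Less (R 31) (R 3\<boxtimes>(N 4\<boxtimes>R 2)))" using B_facts by simp
 then have "bval W u (Less (R 31) (R 3\<boxtimes>(N 4\<boxtimes>R 2))) = Some (bv u (Less (R 31) (R 3\<boxtimes>(N 4\<boxtimes>R 2))))"
  by (rule bval_bnd[OF 0(1) B2 BW])
 moreover have "\<not> bv u (Less (R 31) (R 3\<boxtimes>(N 4\<boxtimes>R 2)))" using 0 by (simp add: mult_ac)
 ultimately have b: "bval W u (Less (R 31) (R 3\<boxtimes>(N 4\<boxtimes>R 2))) = Some False" by simp
 have "bs W swhile u u 1" by (rule bs_WhileF[OF b])
 from exec_bs[OF this, of r cs] show ?case using 0(1) by (simp add: bind_return_pmf)
next
 case (Suc k)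
 let ?P = "pmf_of_set {0..<int NN}"
 let ?bd = "Less (R 31) (R 3\<boxtimes>(N 4\<boxtimes>R 2))"
 have "bok B u ?bd" using B_facts by simp
 then have "bval W u ?bd = Some (bv u ?bd)" by (rule bval_bnd[OF Suc.prems(1) B2 BW])
 moreover have "bv u ?bd"
 proof -
  have "a < 2^e0*(4*LG)" using Suc.prems(6) by linarith
  then have "int a < int (2^e0*(4*LG))" by (simp only: of_nat_less_iff)
  then show ?thesis using Suc.prems(3,4,5) by (simp add: mult_ac)
 qed
 ultimately have b: "bval W u ?bd = Some True" by simp
 have WB: "int NN <= W" "1 <= W" using B_facts BW1 by linarith+
 have aW: "int a+1 <= B" "int a <= B"
 proof -
  have "int a+1 <= int (2^e0*(4*LG))+1" using Suc.prems(6) by linarith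
  then show "int a+1 <= B" using mB by linarith
  then show "int a <= B" by linarith
 qed
 have aW': "int a+1 <= W" "int a <= W" using aW BW1 by linarith+
 have set: "set_pmf ?P = {0..<int NN}" using NN0 by (intro set_pmf_of_set) auto
 have one: "exec W (Suc (Suc (Suc (Suc (Suc (Suc T)))))) (swhile # cs) u = bind_pmf ?P (%y. exec W T (swhile # cs) (sstep u y))" for T
 proof -
  have "exec W (Suc (Suc (Suc (Suc (Suc (Suc T)))))) (swhile # cs) u =
   bind_pmf ?P (%y. exec W (Suc (Suc T)) (Store 10 (R 31) (R 32) # Assign 31 (R 31\<boxplus>N 1) # swhile # cs) (setr u 32 y))"
   using b Suc.prems(2) WB NN0 by (simp add: bind_return_pmf bind_map_pmf word_def del: bval.simps)
  also have "\<dots> = bind_pmf ?P (%y. exec W T (swhile # cs) (sstep u y))"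
  proof (rule bind_pmf_cong[OF refl])
   fix y assume "y \<in> set_pmf ?P"
   then have y: "\<bar>y\<bar> <= W" using set WB by auto
   then show "exec W (Suc (Suc T)) (Store 10 (R 31) (R 32) # Assign 31 (R 31\<boxplus>N 1) # swhile # cs) (setr u 32 y) =
    exec W T (swhile # cs) (sstep u y)"
    using Suc.prems(5) aW' WB by (simp add: bind_return_pmf word_def sstep_def add.commute)
  qed
  finally show ?thesis .
 qed
 have st: "bnd B (sstep u y)" "regs (sstep u y) 1 = int NN" "regs (sstep u y) 3 = 2^e0" "regs (sstep u y) 2 = int LG" "regs (sstep u y) 31 = int (Suc a)"
  if "y \<in> set_pmf ?P" for y
 proof -
  have "\<bar>y\<bar> <= B" using that set B_facts by auto
  then show "bnd B (sstep u y)" using Suc.prems(1,5) aW by (intro sstep_bnd) auto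
 qed (use Suc.prems in \<open>simp_all add: sstep_def\<close>)
 have IH: "exec W (6 * k+1+r) (swhile # cs) (sstep u y) = bind_pmf (replicate_pmf k ?P) (%ys. exec W r cs (srun (sstep u y) ys)) &
  (\<forall>ys\<in>set_pmf (replicate_pmf k ?P). bnd B (srun (sstep u y) ys))" if "y \<in> set_pmf ?P" for y
  by (rule Suc.IH[OF st[OF that]]) (use Suc.prems(6) in simp)
 have "6*Suc k+1+r = Suc (Suc (Suc (Suc (Suc (Suc (6 * k+1+r))))))" by simp
 then have "exec W (6*Suc k+1+r) (swhile # cs) u = exec W (Suc (Suc (Suc (Suc (Suc (Suc (6 * k+1+r))))))) (swhile # cs) u"
  by (simp only:)
 also have "\<dots> = bind_pmf ?P (%y. exec W (6 * k+1+r) (swhile # cs) (sstep u y))" by (rule one)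
 also have "\<dots> = bind_pmf ?P (%y. bind_pmf (replicate_pmf k ?P) (%ys. exec W r cs (srun (sstep u y) ys)))"
  by (rule bind_pmf_cong[OF refl]) (use IH in blast)
 also have "\<dots> = bind_pmf (replicate_pmf (Suc k) ?P) (%ys. exec W r cs (srun u ys))"
  by (simp add: bind_assoc_pmf bind_return_pmf)
 finally have eq: "exec W (6*Suc k+1+r) (swhile # cs) u = bind_pmf (replicate_pmf (Suc k) ?P) (%ys. exec W r cs (srun u ys))" .
 have "bnd B (srun u ys)" if "ys \<in> set_pmf (replicate_pmf (Suc k) ?P)" for ys
 proof -
  obtain y zs where "ys = y # zs" "y \<in> set_pmf ?P" "zs \<in> set_pmf (replicate_pmf k ?P)" using \<open>ys \<in> _\<close> by auto
  then show ?thesis using IH[of y] by simp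
 qed
 then show ?case using eq by blast
qed

end

section \<open>Success probability and running time\<close>

text \<open>Stated for a prefix because at radius \<open>2^e\<close> just the first
  \<open>2^e * LP\<close> samples count, while all samples are drawn together.\<close>

lemma emeasure_replicate_prefix:
 fixes p :: "'a pmf"
 shows "m' <= m ==> emeasure (measure_pmf (replicate_pmf m p)) {xs. \<forall>a<m'. xs ! a \<in> X} = emeasure (measure_pmf p) X^m'"
proof (induction m arbitrary: m')
 case (Suc m)
 show ?case
 proof (cases m')
  case 0
  then show ?thesis by simp
 next
  case (Suc k)
  have e: "emeasure (measure_pmf (map_pmf ((#) x) (replicate_pmf m p))) {xs. \<forall>a<Suc k. xs ! a \<in> X} =
    indicator X x*emeasure (measure_pmf p) X ^ k" for x
  proof -
   have v: "(#) x -` {xs. \<forall>a<Suc k. xs ! a \<in> X} = (if x \<in> X then {xs. \<forall>a<k. xs ! a \<in> X} else {})"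
    by (auto simp: less_Suc_eq_0_disj)
   show ?thesis unfolding emeasure_map_pmf v using Suc.IH[of k] Suc.prems \<open>m' = Suc k\<close> by simp
  qed
  have "replicate_pmf (Suc m) p = bind_pmf p (%x. map_pmf ((#) x) (replicate_pmf m p))" by (simp add: map_pmf_def)
  then have "emeasure (measure_pmf (replicate_pmf (Suc m) p)) {xs. \<forall>a<Suc k. xs ! a \<in> X} =
    (\<integral>\<^sup>+ x. indicator X x*emeasure (measure_pmf p) X ^ k \<partial>measure_pmf p)"
   by (simp only: emeasure_bind_pmf e)
  also have "\<dots> = emeasure (measure_pmf p) X*emeasure (measure_pmf p) X ^ k" by (simp add: nn_integral_multc)
  finally show ?thesis using \<open>m' = Suc k\<close> by simp
 qed
qed simp

lemma prob_replicate_prefix: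
 "m' <= m ==> measure_pmf.prob (replicate_pmf m p) {xs. \<forall>a<m'. xs ! a \<in> X} = measure_pmf.prob p X^m'"
 using emeasure_replicate_prefix[of m' m p X]
 by (simp add: measure_pmf.emeasure_eq_measure ennreal_power)

text \<open>One query in the amortised accounting, with \<open>c\<close> the cost per refreshed
  column. Everything is multiplied by \<open>X\<close>, which will be \<open>NN\<close>, because the
  number \<open>m\<close> of refreshes is controlled only through \<open>m * X\<close>; this avoids
  rounding in a division.\<close>

lemma budget_step:
 fixes X :: nat
 assumes X: "0 < X" and a: "m*X+nu * vp <= nu * vp'" and b: "t0+5*p <= CQ+5*p' + c*m"
  and t: "Suc l*CQ*X+5*X*PM + c*nu*V <= t*X+5*X*p + c*nu * vp"
  and d: "p' <= PM" "vp' <= V"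
 shows "t0 <= t" "l*CQ*X+5*X*PM + c*nu*V <= (t - t0)*X+5*X*p' + c*nu * vp'"
proof -
 have a': "c*m*X + c*nu * vp <= c*nu * vp'" using mult_le_mono2[OF a, of c] by (simp add: algebra_simps)
 have b': "t0*X+5*X*p <= CQ*X+5*X*p' + c*m*X" using mult_le_mono1[OF b, of X] by (simp add: algebra_simps)
 have t': "CQ*X+l*CQ*X+5*X*PM + c*nu*V <= t*X+5*X*p + c*nu * vp" using t by (simp add: algebra_simps)
 have d': "5*X*p' <= 5*X*PM" "c*nu * vp' <= c*nu*V" using d by auto
 have s: "t0*X+l*CQ*X+5*X*PM + c*nu*V <= t*X+5*X*p' + c*nu * vp'"
  using a' b' t' by linarith
 then have "t0*X <= t*X" using d' by linarith
 then show "t0 <= t" using X by simp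
 then have "(t - t0)*X = t*X - t0*X" "t0*X <= t*X" by (auto simp: diff_mult_distrib)
 then show "l*CQ*X+5*X*PM + c*nu*V <= (t - t0)*X+5*X*p' + c*nu * vp'" using s by linarith
qed

section \<open>Amortised budget of a whole run\<close>

context full
begin

text \<open>\<open>NN^2 * LP * nu\<close> occurs twice: it bounds the summand
  \<open>NN^3 * LP div 2^e\<close> of \<open>pot\<close> and also a counter within that budget.
  \<open>3 * LP * tA\<close> bounds the counter at radius 1, which has at most \<open>3 * LP\<close>
  active copies and no budget; \<open>e0 * tA\<close> stands for the halvings.\<close>

definition potmax :: nat where
 "potmax = 2*(NN^2*LP*nu)+3*LP*tA+e0*tA"

lemma pot_le:
 assumes s: "ist r 0 s e cnt" and r: "r <= Suc n"
 shows "pot e cnt <= potmax"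
proof -
 have e: "e <= e0" "cnt <= spent (2^e) (%i. r)" "1 <= e --> cnt*2^e <= NN^3*LP" "Dok (2^e)" using s by (auto simp: ist_def)
 have "NN^3*LP = NN^2*LP*NN" by (simp add: power2_eq_square power3_eq_cube mult_ac)
 also have "\<dots> <= NN^2*LP*(nu*2^e)" using nu[OF e(1,4)] by (rule mult_le_mono2)
 finally have le: "NN^3*LP <= NN^2*LP*nu*2^e" by (simp only: mult.assoc)
 have d: "NN^3*LP div 2^e <= NN^2*LP*nu"
 proof -
  have "NN^3*LP div 2^e <= NN^2*LP*nu*2^e div 2^e" using le by (rule div_le_mono)
  then show ?thesis by simp
 qed
 have c: "cnt <= NN^2*LP*nu+3*LP*tA"
 proof (cases e)
  case 0
  have "cnt <= 1*LP*(2*1+1)*tA" using e(2) spent_le(1)[of "%i. r" 1] r 0 by simp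
  then show ?thesis by (simp add: mult_ac)
 next
  case (Suc e')
  then have "cnt*2^e <= NN^2*LP*nu*2^e" using e(3) le by linarith
  then have "cnt <= NN^2*LP*nu" by (simp only: mult_le_cancel2) simp
  then show ?thesis by linarith
 qed
 have "(e0 - e)*tA <= e0*tA" by (rule mult_le_mono1) simp
 then show ?thesis unfolding pot_def potmax_def using c d by linarith
qed

lemma vpot_le:
 assumes "stale s j" "j <= n" shows "vpot s <= 3*NN*NN"
proof -
 have "nat (arrs s 9 k+2*int NN) <= 3*NN" if k: "k < NN" for k
 proof -
  have "arrs s 9 k = - 2*int NN \<or> (\<exists>j'<j. arrs s 9 k = vh j' k)" using assms(1) k unfolding stale_def by blast
  then have "arrs s 9 k <= int NN"
  proof
   assume "\<exists>j'<j. arrs s 9 k = vh j' k"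
   then obtain j' where j': "j' < j" "arrs s 9 k = vh j' k" by blast
   then have "arrs s 9 k <= int n" using vr[of j' k] k assms(2) by simp
   then show ?thesis using n_le_NN by linarith
  qed simp
  then show ?thesis by linarith
 qed
 then have "vpot s <= (\<Sum>k<NN. 3*NN)" unfolding vpot_def by (intro sum_mono) simp
 then show ?thesis by (simp add: mult_ac)
qed

text \<open>After sampling the run is deterministic, so for every sample the outcome is a point
  distribution, without fault or exhausted budget. Only the values of the answers need
  \<open>good\<close>.\<close>

lemma serve_spec:
 assumes "length vs+j = n" "\<forall>i<length vs. \<forall>k<n. vs ! i $ k = vh (j+i) k"
  and "stat s" "trees s" "stale s j" "ist (Suc j) 0 s e cnt" "bnd B s"
  and "length vs*CQ*NN+5*NN*potmax+n*(7*LG+8)*nu*(3*NN*NN) <=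
   t*NN+5*NN*pot e cnt+n*(7*LG+8)*nu * vpot s"
 shows "\<exists>as. serve W (query_prog qA) n t s vs = return_pmf (Some as) &
  (good --> as = map (%q. vec n (%i. Min (vl (j+q) i ` {..<NN}))) [0..<length vs])"
 using assms
proof (induction vs arbitrary: j s e cnt t)
 case Nil
 then show ?case by simp
next
 case (Cons v vs)
 have j: "j < n" using Cons.prems(1) by simp
 have v: "v $ k = vh j k" if "k < n" for k using Cons.prems(2) that by force
 let ?s = "put_query n v s"
 have sm: "same {} {1} s ?s" by (simp add: put_query_def same_def)
 have a: "arrs ?s x = arrs s x" if "x \<noteq> 1" for x using that by (simp add: put_query_def)
 have rg: "regs ?s = regs s" by (simp add: put_query_def)
 have st: "stat ?s" by (rule stat_cong[OF Cons.prems(3)]) (use a rg in simp_all)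
 have te: "trees ?s" by (rule trees_cong[OF Cons.prems(4)]) (use a in simp)
 have sl: "stale ?s j" by (rule stale_cong[OF Cons.prems(5)]) (use a in \<open>simp_all add: tr_def\<close>)
 have it: "ist (Suc j) 0 ?s e cnt" by (rule ist_cong[OF Cons.prems(6)]) (use a rg in simp_all)
 have vp: "vpot ?s = vpot s" unfolding vpot_def using a by simp
 have a1: "arrs ?s 1 k = vh j k" if "k < n" for k using v that by (simp add: put_query_def)
 have b: "bnd B ?s"
 proof -
  have "\<bar>vh j k\<bar> <= B" if "k < n" for k using vr[OF j, of k] that n_le_NN B_facts by simp
  then show ?thesis using Cons.prems(7) v by (auto simp: bnd_def put_query_def)
 qed
 obtain s' t0 where bs: "bs W (query_prog qA) ?s s' t0" and b': "bnd B s'" and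
  Q: "\<exists>e' cnt' m. stat s' & trees s' & stale s' (Suc j) & ist (Suc (Suc j)) 0 s' e' cnt' &
   m*NN+nu * vpot ?s <= nu * vpot s' & t0+5*pot e cnt <= CQ+5*pot e' cnt'+n*(7*LG+8)*m &
   (good --> (\<forall>i<n. arrs s' 2 i = Min (vl j i ` {..<NN})))"
  using query_spec[OF j st te sl it a1] b unfolding T_def by blast
 then obtain e' cnt' m where I: "stat s'" "trees s'" "stale s' (Suc j)" "ist (Suc (Suc j)) 0 s' e' cnt'"
   and m: "m*NN+nu * vpot s <= nu * vpot s'" and t0: "t0+5*pot e cnt <= CQ+5*pot e' cnt'+n*(7*LG+8)*m"
   and g: "good ==> \<forall>i<n. arrs s' 2 i = Min (vl j i ` {..<NN})" unfolding vp by blast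
 have pl: "pot e' cnt' <= potmax" by (rule pot_le[OF I(4)]) (use j in simp)
 have vl': "vpot s' <= 3*NN*NN" by (rule vpot_le[OF I(3)]) (use j in simp)
 have bud: "Suc (length vs)*CQ*NN+5*NN*potmax+n*(7*LG+8)*nu*(3*NN*NN) <=
   t*NN+5*NN*pot e cnt+n*(7*LG+8)*nu * vpot s" using Cons.prems(8) by simp
 note B = budget_step[OF NN0 m t0 bud pl vl']
 have "\<exists>as. serve W (query_prog qA) n (t - t0) s' vs = return_pmf (Some as) &
  (good --> as = map (%q. vec n (%i. Min (vl (Suc j+q) i ` {..<NN}))) [0..<length vs])"
 proof (rule Cons.IH[OF _ _ I b' B(2)])
  show "length vs+Suc j = n" using Cons.prems(1) by simp
  show "\<forall>i<length vs. \<forall>k<n. vs ! i $ k = vh (Suc j+i) k"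
  proof (intro allI impI)
   fix i k assume "i < length vs" "k < n"
   then have "(v # vs) ! Suc i $ k = vh (j+Suc i) k" using Cons.prems(2) by (metis Suc_less_eq length_Cons)
   then show "vs ! i $ k = vh (Suc j+i) k" by simp
  qed
 qed
 then obtain as where as: "serve W (query_prog qA) n (t - t0) s' vs = return_pmf (Some as)"
  "good --> as = map (%q. vec n (%i. Min (vl (Suc j+q) i ` {..<NN}))) [0..<length vs]" by blast
 have "serve W (query_prog qA) n t s (v # vs) = return_pmf (Some (get_answer n s' # as))"
  using exec_bs_le[OF bs B(1), of "[]"] as(1) by (simp add: bind_return_pmf)
 moreover have "get_answer n s' # as = map (%q. vec n (%i. Min (vl (j+q) i ` {..<NN}))) [0..<length (v # vs)]" if good
 proof -
  have "get_answer n s' = vec n (%i. Min (vl (j+0) i ` {..<NN}))"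
   unfolding get_answer_def by (rule eq_vecI) (use g[OF that] in auto)
  moreover have "[0..<length (v # vs)] = 0 # map Suc [0..<length vs]" by (simp add: upt_conv_Cons map_Suc_upt del: upt_Suc)
  ultimately show ?thesis using as(2) that by simp
 qed
 ultimately show ?case by (intro exI[of _ "get_answer n s' # as"] conjI impI)
qed

definition TT :: nat where
 "TT = CP+n*CQ+5*potmax+n*(7*LG+8)*nu*(3*NN)"

lemma prep_serve:
 assumes s: "iregs s e0 0" and A: "\<And>q. q < n*n ==> arrs s 0 q = Mh (q div n) (q mod n)"
  and x: "\<And>a. a < length xs ==> arrs s 10 a = int (xs ! a)" and z: "arrs s 5 = (%_. 0)" "\<And>a. 12 <= a ==> arrs s a = (%_. 0)"
  and b: "bnd B s" and vs: "length vs = n" "\<And>j k. j < n ==> k < n ==> vs ! j $ k = vh j k" and t: "TT <= t"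
 shows "\<exists>as. bind_pmf (exec W t [prep_b pA] s) (%r. case r of None => return_pmf None
    | Some (s, t') => serve W (query_prog qA) n t' s vs) = return_pmf (Some as) &
  (good --> as = map (%j. vec n (%i. Min (vl j i ` {..<NN}))) [0..<n])"
proof -
 obtain s' t0 e cnt where bs: "bs W (prep_b pA) s s' t0" and b': "bnd B s'" and
  I: "stat s'" "trees s'" "stale s' 0" "ist (Suc 0) 0 s' e cnt" and t0: "t0+5*pot e0 0 <= CP+5*pot e cnt"
  using prep_b_spec[OF s A x z] b unfolding T_def by blast
 have pm: "pot e cnt <= potmax" by (rule pot_le[OF I(4)]) simp
 have t0t: "t0 <= t" using t t0 pm unfolding TT_def by linarith
 have "n*CQ+5*potmax+n*(7*LG+8)*nu*(3*NN) <= (t - t0)+5*pot e cnt"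
  using t t0 t0t unfolding TT_def by linarith
 from mult_le_mono1[OF this, of NN]
 have bud: "length vs*CQ*NN+5*NN*potmax+n*(7*LG+8)*nu*(3*NN*NN) <=
   (t - t0)*NN+5*NN*pot e cnt+n*(7*LG+8)*nu * vpot s'"
  unfolding vs(1) by (simp add: algebra_simps)
 have "\<exists>as. serve W (query_prog qA) n (t - t0) s' vs = return_pmf (Some as) &
  (good --> as = map (%q. vec n (%i. Min (vl (0+q) i ` {..<NN}))) [0..<length vs])"
  by (rule serve_spec[OF _ _ I b' bud]) (use vs in auto)
 then show ?thesis using exec_bs_le[OF bs t0t, of "[]"] vs(1) by (simp add: bind_return_pmf)
qed

end

definition reduction :: "com => com => online_alg" where
 "reduction p q = \<lparr>prep = params ;; sample ;; prep_b p, query = query_prog q\<rparr>"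

context par
begin

text \<open>The outcome is the image of the sample distribution under a function \<open>ans\<close>,
  so the success probability becomes a statement about samples alone.\<close>

lemma reduction_run:
 assumes F: "\<And>xs. length xs = 2^e0*(4*LG) ==> set xs \<subseteq> {..<NN} ==> full W B n L e0 tA Mh vh pA qA WA SC TC xs nu"
  and M: "\<And>i k. i < n ==> k < n ==> M $$ (i, k) = Mh i k"
  and vs: "length vs = n" "\<And>j k. j < n ==> k < n ==> vs ! j $ k = vh j k"
  and t: "4*L+2*e0+40+6*(2^e0*(4*LG))+full.TT n L e0 tA nu <= t"
 shows "\<exists>ans. run_online W (reduction pA qA) n t M vs =
   map_pmf (%ys. Some (ans ys)) (replicate_pmf (2^e0*(4*LG)) (pmf_of_set {0..<int NN})) &
  (\<forall>ys\<in>set_pmf (replicate_pmf (2^e0*(4*LG)) (pmf_of_set {0..<int NN})).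
   red.good n L e0 Mh vh (map nat ys) --> ans ys = map (%j. vec n (%i. Min ((%k. Mh i k + vh j k) ` {..<NN}))) [0..<n])"
proof -
 define m where "m = 2^e0*(4*LG)"
 define P where "P = replicate_pmf m (pmf_of_set {0..<int NN})"
 \<comment> \<open>An arbitrary sample, used to obtain the facts of the locale that do not mention
   samples.\<close>
 interpret F0: full W B n L e0 tA Mh vh pA qA WA SC TC "replicate m 0" nu
  by (rule F) (use NN0 in \<open>auto simp: m_def\<close>)
 have KB: "int (2^e0*(4*LG)*(2*2^e0+1)*Suc tA) <= B" by (rule F0.KB)
 have K1: "int (2^e0*(4*LG)*(2*2^e0+1)) <= B" and mB: "int (2^e0*(4*LG))+1 <= B"
 proof -
  let ?x = "2^e0*(4*LG)"
  have p: "0 < ?x" by (simp add: LG_def)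
  have "?x*(2*2^e0+1)*1 <= ?x*(2*2^e0+1)*Suc tA" by (intro mult_le_mono2) simp
  then have "int (?x*(2*2^e0+1)) <= int (?x*(2*2^e0+1)*Suc tA)" by (simp only: of_nat_le_iff mult_1_right)
  then show 1: "int (?x*(2*2^e0+1)) <= B" using KB by linarith
  have "?x*2 <= ?x*(2*2^e0+1)" by (intro mult_le_mono2) simp
  then have "?x+1 <= ?x*(2*2^e0+1)" using p by linarith
  then have "int (?x+1) <= int (?x*(2*2^e0+1))" by (simp only: of_nat_le_iff)
  then show "int ?x+1 <= B" using 1 by linarith
 qed
 let ?s0 = "init_state n M"
 have M0: "arrs ?s0 0 q = Mh (q div n) (q mod n)" if "q < n*n" for q
 proof -
  have "q div n < n" "q mod n < n" using that n0 by (auto simp: less_mult_imp_div_less)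
  then show ?thesis using that M by (simp add: init_state_def)
 qed
 have b0: "bnd B ?s0"
 proof -
  have "\<bar>M $$ (q div n, q mod n)\<bar> <= B" if "q < n*n" for q
  proof -
   have "q div n < n" "q mod n < n" using that n0 by (auto simp: less_mult_imp_div_less)
   moreover from this have "q mod n < NN" using n_le_NN by linarith
   ultimately have "1 <= M $$ (q div n, q mod n) & M $$ (q div n, q mod n) <= int n" using M F0.Mr[of "q div n" "q mod n"] by simp
   then show ?thesis using B_facts by linarith
  qed
  then show ?thesis using B_facts by (auto simp: bnd_def init_state_def)
 qed
 obtain s1 t1 where bs1: "bs W params ?s0 s1 t1" and b1: "bnd B s1" and t1: "t1 <= 4*L+2*e0+20"
  and r1: "regs s1 1 = int NN" "regs s1 2 = int LG" "regs s1 3 = 2^e0"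
   "regs s1 5 = int (2^e0*(4*LG)*(2*2^e0+1))" "regs s1 7 = int (2*2^e0+1)" and m1: "same {1, 2, 3, 5, 7} {} ?s0 s1"
  proof -
  have "regs ?s0 0 = int n" by (simp add: init_state_def)
  from params_spec[OF this F0.D0_le F0.D0_gt K1] b0 show ?thesis using that unfolding T_def by blast
 qed
 let ?u = "setr s1 31 0"
 have bu: "bnd B ?u" using bnd_assign[OF b1, of 0 31] B2 by simp
 \<comment> \<open>The 5 consists of three sequencing steps, the initialisation of the sampling loop
   and its final test.\<close>
 define r where "r = t - (t1+5+6*m)"
 have tr: "t = Suc (t1+Suc (Suc (Suc (6*m+1+r))))" unfolding r_def using t t1 by (simp add: m_def)
 have rT: "F0.TT <= r" unfolding r_def using t t1 by (simp add: m_def)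
 note EX = exec_swhile[OF bu, of e0 0 m r "[prep_b pA]", folded P_def]
 have ex: "exec W (6*m+1+r) (swhile # [prep_b pA]) ?u = bind_pmf P (%ys. exec W r [prep_b pA] (srun ?u ys))"
  and bys: "\<And>ys. ys \<in> set_pmf P ==> bnd B (srun ?u ys)"
  using EX r1 mB by (auto simp: m_def)
 have z1: "word W 0 = Some 0" using BW1 B2 by (simp add: word_def)
 have "exec W t [params ;; sample ;; prep_b pA] ?s0 = exec W (t1+Suc (Suc (Suc (6*m+1+r)))) [params, sample ;; prep_b pA] ?s0"
  unfolding tr by (simp add: bind_return_pmf)
 also have "\<dots> = exec W (Suc (Suc (Suc (6*m+1+r)))) [sample ;; prep_b pA] s1" by (rule exec_bs[OF bs1])
 also have "\<dots> = exec W (6*m+1+r) (swhile # [prep_b pA]) ?u"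
  unfolding sample_def for_loop_def by (simp add: bind_return_pmf z1 del: bval.simps)
 also note ex
 finally have E: "exec W t [params ;; sample ;; prep_b pA] ?s0 = bind_pmf P (%ys. exec W r [prep_b pA] (srun ?u ys))" .
 define G where "G ys = bind_pmf (exec W r [prep_b pA] (srun ?u ys)) (%r. case r of None => return_pmf None
    | Some (s, t') => serve W (query_prog qA) n t' s vs)" for ys
 have G: "\<exists>as. G ys = return_pmf (Some as) &
  (red.good n L e0 Mh vh (map nat ys) --> as = map (%j. vec n (%i. Min ((%k. Mh i k + vh j k) ` {..<NN}))) [0..<n])"
  if ys: "ys \<in> set_pmf P" for ys
 proof -
  have "set_pmf (pmf_of_set {0..<int NN}) = {0..<int NN}" using NN0 by (intro set_pmf_of_set) auto
  then have y: "length ys = m" "set ys \<subseteq> {0..<int NN}" using ys unfolding P_def set_replicate_pmf by auto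
  have "set (map nat ys) \<subseteq> {..<NN}" using y(2) by (auto simp: subset_iff nat_less_iff)
  then interpret F1: full W B n L e0 tA Mh vh pA qA WA SC TC "map nat ys" nu
   by (intro F) (use y(1) in \<open>simp_all add: m_def\<close>)
  have sp: "same {31, 32} {10} ?u (srun ?u ys)" "\<And>i. i < length ys ==> arrs (srun ?u ys) 10 (0+i) = ys ! i"
   using srun_props[of ?u 0 ys] by auto
  have rs: "regs (srun ?u ys) x = regs s1 x" if "x \<noteq> 31" "x \<noteq> 32" for x using same_regs[OF sp(1), of x] that by simp
  have as: "arrs (srun ?u ys) x = arrs ?s0 x" if "x \<noteq> 10" for x using same_arrs[OF sp(1), of x] same_arrs[OF m1, of x] that by simp
  have r40: "regs s1 4 = 0" "regs s1 0 = int n" using same_regs[OF m1, of 4] same_regs[OF m1, of 0] by (auto simp: init_state_def)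
  show ?thesis unfolding G_def
  proof (rule F1.prep_serve)
   show "F1.iregs (srun ?u ys) e0 0" unfolding F1.iregs_def F1.KI_eq F1.ZZ_def using rs r1 r40 by simp
   show "arrs (srun ?u ys) 0 q = Mh (q div n) (q mod n)" if "q < n*n" for q using as[of 0] M0[OF that] by simp
   show "arrs (srun ?u ys) 10 a = int (map nat ys ! a)" if "a < length (map nat ys)" for a
   proof -
    have "ys ! a \<in> {0..<int NN}" using y(2) that by (metis length_map nth_mem subsetD)
    then show ?thesis using sp(2)[of a] that by simp
   qed
   show "arrs (srun ?u ys) 5 = (%_. 0)" using as[of 5] by (simp add: init_state_def)
   show "arrs (srun ?u ys) a = (%_. 0)" if "12 <= a" for a using as[of a] that by (simp add: init_state_def)
   show "bnd B (srun ?u ys)" by (rule bys[OF ys])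
  qed (use vs rT in auto)
 qed
 define ans where "ans ys = (SOME as. G ys = return_pmf (Some as) &
  (red.good n L e0 Mh vh (map nat ys) --> as = map (%j. vec n (%i. Min ((%k. Mh i k + vh j k) ` {..<NN}))) [0..<n]))" for ys
 have ans: "G ys = return_pmf (Some (ans ys)) &
  (red.good n L e0 Mh vh (map nat ys) --> ans ys = map (%j. vec n (%i. Min ((%k. Mh i k + vh j k) ` {..<NN}))) [0..<n])"
  if "ys \<in> set_pmf P" for ys unfolding ans_def by (rule someI_ex[OF G[OF that]])
 have "run_online W (reduction pA qA) n t M vs = bind_pmf P G"
  unfolding run_online_def reduction_def G_def by (simp add: E bind_assoc_pmf)
 also have "\<dots> = bind_pmf P (%ys. return_pmf (Some (ans ys)))" by (rule bind_pmf_cong[OF refl]) (use ans in blast)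
 also have "\<dots> = map_pmf (%ys. Some (ans ys)) P" by (simp add: map_pmf_def)
 finally show ?thesis using ans unfolding P_def m_def by blast
qed

end

section \<open>Runs of the equality algorithm under a common word bound\<close>

lemma aval_mono: "aval W s e = Some v ==> W <= W' ==> aval W' s e = Some v"
 by (induction e arbitrary: v) (auto simp: word_def split: option.splits if_splits)

lemma bval_mono: "bval W s b = Some v ==> W <= W' ==> bval W' s b = Some v"
proof (induction b arbitrary: v)
 case (Less e1 e2)
 then obtain x y where "aval W s e1 = Some x" "aval W s e2 = Some y" "v = (x < y)" by (auto split: option.splits)
 then show ?case using aval_mono[of W s e1 x W'] aval_mono[of W s e2 y W'] Less.prems(2) by simp
next
 case (Equal e1 e2)
 then obtain x y where "aval W s e1 = Some x" "aval W s e2 = Some y" "v = (x = y)" by (auto split: option.splits)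
 then show ?case using aval_mono[of W s e1 x W'] aval_mono[of W s e2 y W'] Equal.prems(2) by simp
next
 case (Neg b)
 then show ?case by (auto simp: map_option_eq_Some)
next
 case (Conj b1 b2)
 then show ?case by (auto split: option.splits)
qed

text \<open>A larger word bound only removes faults. The instances given to the copies may have
  different largest entries and thus different word bounds, but all copies run under one
  \<open>WA\<close>.\<close>

lemma bs_mono: "bs W c s s' t ==> W <= W' ==> bs W' c s s' t"
proof (induction rule: bs.induct)
qed (blast intro: bs.intros aval_mono bval_mono)+

lemma finite_entries: "finite {f i k | i k. i < (m::nat) & k < (n::nat)}"
proof -
 have "{f i k | i k. i < m & k < n} = (%(i, k). f i k) ` ({..<m} \<times> {..<n})" by auto
 then show ?thesis by simp
qed

lemma word_bound_le:
 assumes "int n <= K" "\<And>i k. i < n ==> k < n ==> \<bar>M $$ (i, k)\<bar> <= K" "\<And>j k. j < length vs ==> k < n ==> \<bar>vs ! j $ k\<bar> <= K"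
 shows "word_bound c n M vs <= (K+2) ^ c"
proof -
 let ?S = "{int n} \<union> {\<bar>M $$ (i, k)\<bar> | i k. i < n & k < n} \<union> {\<bar>vs ! j $ k\<bar> | j k. j < length vs & k < n}"
 have f: "finite ?S" using finite_entries[of "%i k. \<bar>M $$ (i, k)\<bar>" n n] finite_entries[of "%j k. \<bar>vs ! j $ k\<bar>" "length vs" n] by simp
 have "Max ?S <= K" using f assms by (subst Max_le_iff) auto
 moreover have "int n <= Max ?S" using f by (intro Max_ge) auto
 ultimately show ?thesis unfolding word_bound_def by (intro power_mono) linarith+
qed

lemma word_bound_ge: "(int n+2) ^ c <= word_bound c n M vs"
proof -
 let ?S = "{int n} \<union> {\<bar>M $$ (i, k)\<bar> | i k. i < n & k < n} \<union> {\<bar>vs ! j $ k\<bar> | j k. j < length vs & k < n}"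
 have f: "finite ?S" using finite_entries[of "%i k. \<bar>M $$ (i, k)\<bar>" n n] finite_entries[of "%j k. \<bar>vs ! j $ k\<bar>" "length vs" n] by simp
 have "int n <= Max ?S" using f by (intro Max_ge) auto
 then show ?thesis unfolding word_bound_def by (intro power_mono) linarith+
qed

definition solves_equality :: "online_alg => nat => (nat => nat) => bool" where
 "solves_equality A c t \<longleftrightarrow> deterministic (prep A) & deterministic (query A) &
   (\<forall>n>0. \<forall>M vs. omv_instance n M vs --> run_online (word_bound c n M vs) A n (t n) M vs =
    return_pmf (Some (map (%v. vec n (%i. if \<exists>k<n. M $$ (i, k) = v $ k then 1 else 0)) vs)))"

lemma equality_trace:
 assumes A: "solves_equality A c t" and n: "0 < n" and i: "omv_instance n M vs" and W: "word_bound c n M vs <= W"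
 shows "\<exists>st \<tau>. bs W (prep A) (init_state n M) (st 0) (\<tau> 0) &
  (\<forall>j<n. bs W (query A) (put_query n (vs ! j) (st j)) (st (Suc j)) (\<tau> (Suc j))) &
  (\<forall>j<n. \<forall>i<n. arrs (st (Suc j)) 2 i = (if \<exists>k<n. M $$ (i, k) = vs ! j $ k then 1 else 0)) & (\<Sum>r\<le>n. \<tau> r) <= t n"
proof -
 let ?as = "map (%v. vec n (%i. if \<exists>k<n. M $$ (i, k) = v $ k then 1 else 0)) vs"
 have l: "length vs = n" using i by (simp add: omv_instance_def)
 have d: "deterministic (prep A)" "deterministic (query A)"
  and run: "run_online (word_bound c n M vs) A n (t n) M vs = return_pmf (Some ?as)"
  using A n i unfolding solves_equality_def by blast+
 obtain st \<tau> \<tau>0 where tr: "bs (word_bound c n M vs) (prep A) (init_state n M) (st 0) \<tau>0"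
  "\<forall>j<length vs. bs (word_bound c n M vs) (query A) (put_query n (vs ! j) (st j)) (st (Suc j)) (\<tau> j) & get_answer n (st (Suc j)) = ?as ! j"
  "\<tau>0+(\<Sum>j<length vs. \<tau> j) <= t n"
  using run_online_trace[OF d run] by blast
 have ans: "arrs (st (Suc j)) 2 i = (if \<exists>k<n. M $$ (i, k) = vs ! j $ k then 1 else 0)" if "j < n" "i < n" for j i
 proof -
  have "get_answer n (st (Suc j)) $ i = ?as ! j $ i" using tr(2) that l by simp
  then show ?thesis using that l by (simp add: get_answer_def)
 qed
 show ?thesis
 proof (rule exI[of _ st], rule exI[of _ "case_nat \<tau>0 \<tau>"], intro conjI allI impI)
  show "(\<Sum>r\<le>n. case_nat \<tau>0 \<tau> r) <= t n"
   using tr(3) l by (simp only: lessThan_Suc_atMost[symmetric] sum.lessThan_Suc_shift) simp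
 qed (use tr l ans bs_mono[OF _ W] in auto)
qed

text \<open>Alternating the all-zero and the all-one answer forces all \<open>n\<close> output cells to be rewritten for each query.\<close>

lemma equality_time_lower_bound:
 assumes A: "solves_equality A c t" and n: "0 < n"
 shows "n*(n - 1) <= t n"
proof -
 let ?M = "mat n n (%_. 0 :: int)" and ?vs = "map (%j. vec n (%_. int (j mod 2))) [0..<n]"
 have i: "omv_instance n ?M ?vs" by (auto simp: omv_instance_def)
 obtain st \<tau> where tr: "\<forall>j<n. bs (word_bound c n ?M ?vs) (query A) (put_query n (?vs ! j) (st j)) (st (Suc j)) (\<tau> (Suc j))"
  "\<forall>j<n. \<forall>i<n. arrs (st (Suc j)) 2 i = (if \<exists>k<n. ?M $$ (i, k) = ?vs ! j $ k then 1 else 0)" "(\<Sum>r\<le>n. \<tau> r) <= t n"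
  using equality_trace[OF A n i order_refl] by blast
 have out: "arrs (st (Suc j)) 2 i = (if even j then 1 else 0)" if "j < n" "i < n" for j i
 proof -
  have "(\<exists>k<n. ?M $$ (i, k) = ?vs ! j $ k) \<longleftrightarrow> even j" using that n by auto
  then show ?thesis using tr(2) that by simp
 qed
 have "n <= \<tau> (Suc (Suc j))" if j: "Suc j < n" for j
 proof -
  let ?s = "put_query n (?vs ! Suc j) (st (Suc j))" and ?s' = "st (Suc (Suc j))"
  have b: "bs (word_bound c n ?M ?vs) (query A) ?s ?s' (\<tau> (Suc (Suc j)))" using tr(1) j by blast
  have "{..<n} \<subseteq> {p. arrs ?s' 2 p \<noteq> arrs ?s 2 p}"
  proof
   fix p assume "p \<in> {..<n}"
   then have p: "p < n" by simp
   have "arrs ?s 2 p = arrs (st (Suc j)) 2 p" by (simp add: put_query_def)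
   then show "p \<in> {p. arrs ?s' 2 p \<noteq> arrs ?s 2 p}" using out[OF _ p, of j] out[OF j p] j by simp
  qed
  then have "card {..<n} <= card {p. arrs ?s' 2 p \<noteq> arrs ?s 2 p}" using card_changed_cells[OF b, of 2] by (intro card_mono) auto
  then show ?thesis using card_changed_cells[OF b, of 2] by simp
 qed
 then have "(\<Sum>j<n - 1. n) <= (\<Sum>j<n - 1. \<tau> (Suc (Suc j)))" by (intro sum_mono) simp
 also have "\<dots> <= (\<Sum>r\<le>n. \<tau> r)"
 proof -
  have "(\<Sum>j<n - 1. \<tau> (Suc (Suc j))) = (\<Sum>r\<in>(%j. Suc (Suc j)) ` {..<n - 1}. \<tau> r)" by (subst sum.reindex) (auto simp: inj_on_def)
  also have "\<dots> <= (\<Sum>r\<le>n. \<tau> r)" by (rule sum_mono2) auto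
  finally show ?thesis .
 qed
 finally show ?thesis using tr(3) by (simp add: mult.commute)
qed

text \<open>With \<open>\<epsilon> > 1\<close> the lower bound \<open>n * (n - 1)\<close> would make
  \<open>n^2 - n\<close> little-o of itself, hence eventually zero.\<close>

lemma exponent_le_1:
 assumes A: "solves_equality A c t" and O: "(%n. real (t n)) \<in> O(%n. real n powr (3 - \<epsilon>))"
 shows "\<epsilon> <= 1"
proof (rule ccontr)
 assume e: "\<not> \<epsilon> <= 1"
 have "(%n. real n^2 - real n) \<in> O(%n. real (t n))"
 proof (rule bigoI[of _ 1], rule eventually_mono[OF eventually_gt_at_top[of 0]])
  fix n :: nat assume n: "0 < n"
  have "real (n*(n - 1)) <= real (t n)" using equality_time_lower_bound[OF A n] by (simp only: of_nat_le_iff)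
  moreover have "real (n*(n - 1)) = real n^2 - real n" using n by (simp add: of_nat_diff power2_eq_square algebra_simps)
  moreover have "0 <= real (n*(n - 1))" by simp
  ultimately show "norm (real n^2 - real n) <= 1*norm (real (t n))" by simp
 qed
 then have "(%n. real n^2 - real n) \<in> O(%n. real n powr (3 - \<epsilon>))" using O by (rule landau_o.big_trans)
 moreover have "(%n. real n powr (3 - \<epsilon>)) \<in> o(%n. real n^2 - real n)"
  using e by real_asymp
 ultimately have "(%n. real n^2 - real n) \<in> o(%n. real n^2 - real n)" by (rule landau_o.big_small_trans)
 then have "eventually (%n. real n^2 - real n = 0) sequentially" by (rule landau_o.small_refl_iff[THEN iffD1])
 moreover have "eventually (%n. real n^2 - real n \<noteq> 0) sequentially"
 proof (rule eventually_mono[OF eventually_gt_at_top[of 1]])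
  fix n :: nat assume "1 < n"
  then show "real n^2 - real n \<noteq> 0" by (simp add: power2_eq_square)
 qed
 ultimately have "eventually (%n::nat. False) sequentially" by eventually_elim simp
 then show False by simp
qed

section \<open>Union bound for the sampling\<close>

context par
begin

text \<open>For fixed query, row and radius with more than \<open>NN / 2^e\<close> near-optimal
  columns, all \<open>2^e * (4 * LG)\<close> draws miss them with probability at most
  \<open>(1 - 1 / 2^e) ^ (2^e * (4 * LG))\<close>, which is at most \<open>exp (- 4 * LG)\<close>
  and hence at most \<open>1 / (2 * NN)^4\<close>. This is where the factor 4 in the number of
  samples comes from: each such event has probability at most \<open>1 / (16 * n^4)\<close>, and
  there are at most \<open>2 * n^3\<close> of them.\<close>

lemma good_prob:
 assumes e0: "e0 <= L"
  and good: "\<And>xs. good xs \<longleftrightarrow> (\<forall>j<n. \<forall>i<n. \<forall>e\<le>e0. NN div 2^e < card {k. k < NN & f j i k <= g j i e} -->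
   (\<exists>a<2^e*(4*LG). f j i (xs ! a) <= (g j i e :: int)))"
 shows "1 - 1 / real n <= measure_pmf.prob (replicate_pmf (2^e0*(4*LG)) (pmf_of_set {0..<int NN})) {ys. good (map nat ys)}"
proof -
 define p where "p = pmf_of_set {0..<int NN}"
 define m where "m = 2^e0*(4*LG)"
 define P where "P = replicate_pmf m p"
 define X where "X j i e = {y. \<not> f j i (nat y) <= g j i e}" for j i e
 define Bd where "Bd q = (case q of (j, i, e) => if NN div 2^e < card {k. k < NN & f j i k <= g j i e} then
   {ys. \<forall>a<2^e*(4*LG). ys ! a \<in> X j i e} else {})" for q
 define Q where "Q = {..<n} \<times> {..<n} \<times> {..e0}"
 have mle: "2^e*(4*LG) <= m" if "e <= e0" for e unfolding m_def using that by (intro mult_le_mono1 power_increasing) auto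
 have sub: "- {ys. good (map nat ys)} \<inter> set_pmf P \<subseteq> (\<Union>q\<in>Q. Bd q)"
 proof
  fix ys assume "ys \<in> - {ys. good (map nat ys)} \<inter> set_pmf P"
  then have ng: "\<not> good (map nat ys)" and l: "length ys = m" unfolding P_def set_replicate_pmf by auto
  then obtain j i e where q: "j < n" "i < n" "e <= e0" "NN div 2^e < card {k. k < NN & f j i k <= g j i e}"
   "\<And>a. a < 2^e*(4*LG) ==> \<not> f j i (map nat ys ! a) <= g j i e" unfolding good by blast
  have "ys ! a \<in> X j i e" if "a < 2^e*(4*LG)" for a
   using q(5)[OF that] that mle[OF q(3)] l unfolding X_def by simp
  then have "ys \<in> Bd (j, i, e)" unfolding Bd_def using q(4) by simp
  then show "ys \<in> (\<Union>q\<in>Q. Bd q)" using q(1-3) unfolding Q_def by blast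
 qed
 have NNr: "real NN = 2^L" by (simp add: NN_def)
 have one: "measure_pmf.prob P (Bd q) <= 1 / (16*real n^4)" if q: "q \<in> Q" for q
 proof -
  obtain j i e where qe: "q = (j, i, e)" by (cases q) auto
  have e: "e <= e0" using q unfolding Q_def qe by simp
  show ?thesis
  proof (cases "NN div 2^e < card {k. k < NN & f j i k <= g j i e}")
   case False
   then show ?thesis unfolding Bd_def qe by simp
  next
   case True
   let ?T = "{k. k < NN & f j i k <= g j i e}"
   have B: "Bd q = {ys. \<forall>a<2^e*(4*LG). ys ! a \<in> X j i e}" unfolding Bd_def qe using True by simp
   \<comment> \<open>\<open>2^e\<close> divides \<open>NN\<close>, so the integer quotient is the
     real one.\<close>
   have cT: "real NN / 2^e <= real (card ?T)"
   proof -
    have "NN = NN div 2^e*2^e" using e e0 le_imp_power_dvd[of e L "2::nat"] unfolding NN_def by simp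
    then have "real NN = real (NN div 2^e)*2^e" by (metis of_nat_mult of_nat_numeral of_nat_power)
    then have "real NN / 2^e = real (NN div 2^e)" by simp
    then show ?thesis using True by linarith
   qed
   have "{0..<int NN} \<inter> - X j i e = int ` ?T"
   proof
    show "{0..<int NN} \<inter> - X j i e \<subseteq> int ` ?T"
    proof
     fix y assume "y \<in> {0..<int NN} \<inter> - X j i e"
     then show "y \<in> int ` ?T" unfolding X_def by (intro image_eqI[of _ _ "nat y"]) auto
    qed
   qed (auto simp: X_def)
   then have "measure_pmf.prob p (- X j i e) = real (card ?T) / real NN"
    unfolding p_def using NN0 by (subst measure_pmf_of_set) (auto simp: card_image)
   moreover have "1 / 2^e <= real (card ?T) / real NN" using cT NN0 by (simp add: field_simps)
   moreover have "measure_pmf.prob p (X j i e) = 1 - measure_pmf.prob p (- X j i e)"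
    using measure_pmf.prob_compl[of "- X j i e" p] by (simp add: Compl_eq_Diff_UNIV[symmetric])
   ultimately have "measure_pmf.prob p (X j i e) <= 1 - 1 / 2^e" by simp
   also have "\<dots> <= exp (- (1 / 2^e))" using exp_ge_add_one_self[of "- (1 / 2^e)"] by simp
   finally have pX: "measure_pmf.prob p (X j i e) <= exp (- (1 / 2^e))" .
   have "measure_pmf.prob P (Bd q) = measure_pmf.prob p (X j i e)^(2^e*(4*LG))"
    unfolding B P_def by (rule prob_replicate_prefix[OF mle[OF e]])
   also have "\<dots> <= exp (- (1 / 2^e))^(2^e*(4*LG))" using pX by (intro power_mono) auto
   also have "\<dots> = exp (- 1)^(4*LG)"
    by (simp add: exp_of_nat_mult[symmetric] power_mult)
   also have "\<dots> <= (1 / 2)^(4*LG)"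
   proof (rule power_mono)
    have "2 <= exp (1::real)" using exp_ge_add_one_self[of 1] by simp
    then show "exp (- 1) <= 1 / (2::real)" by (simp add: exp_minus field_simps)
   qed simp
   also have "\<dots> = 1 / (2*real NN)^4"
   proof -
    have "(2*real NN)^4 = 2^(4*LG)" unfolding NNr LG_def by (simp add: power_mult[symmetric] mult.commute[of 4] flip: power_Suc)
    then show ?thesis by (simp add: power_one_over)
   qed
   also have "\<dots> <= 1 / (16*real n^4)"
   proof -
    have "real n^4 <= real NN^4" using n_le_NN by (intro power_mono) auto
    then have "16*real n^4 <= (2*real NN)^4" by (simp add: power_mult_distrib)
    then show ?thesis using n0 by (intro divide_left_mono) auto
   qed
   finally show ?thesis .
  qed
 qed
 have "measure_pmf.prob P (- {ys. good (map nat ys)}) = measure_pmf.prob P (- {ys. good (map nat ys)} \<inter> set_pmf P)"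
  by (simp add: measure_Int_set_pmf)
 also have "\<dots> <= measure_pmf.prob P (\<Union>q\<in>Q. Bd q)" using sub by (intro measure_pmf.finite_measure_mono) auto
 also have "\<dots> <= (\<Sum>q\<in>Q. measure_pmf.prob P (Bd q))" by (rule measure_UNION_le) (auto simp: Q_def)
 also have "\<dots> <= (\<Sum>q\<in>Q. 1 / (16*real n^4))" by (intro sum_mono one)
 also have "\<dots> = real n*real n*real (Suc e0) / (16*real n^4)" by (simp add: Q_def algebra_simps add_divide_distrib)
 also have "\<dots> <= 1 / real n"
 proof -
  have "real (Suc e0) <= 2*real n" using e0 L_le n0 by linarith
  then have "real n*real n*real (Suc e0)*real n <= real n*real n*(2*real n)*real n" by (intro mult_right_mono mult_left_mono) auto
  also have "\<dots> <= 16*real n^4" by (simp add: eval_nat_numeral)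
  finally show ?thesis using n0 by (simp add: divide_simps mult_ac)
 qed
 finally have "measure_pmf.prob P (- {ys. good (map nat ys)}) <= 1 / real n" .
 moreover have "measure_pmf.prob P (- {ys. good (map nat ys)}) = 1 - measure_pmf.prob P {ys. good (map nat ys)}"
  using measure_pmf.prob_compl[of "{ys. good (map nat ys)}" P] by (simp add: Compl_eq_Diff_UNIV[symmetric])
 ultimately show ?thesis unfolding P_def m_def p_def by simp
qed

end

section \<open>Total running time and instantiation of the reduction\<close>

lemma ex_log:
 assumes "0 < (n::nat)"
 shows "\<exists>L. n <= 2^L & 2^L < 2*n"
proof -
 define L where "L = (LEAST L. n <= 2^L)"
 have "n <= 2^n" using less_exp[of n] by simp
 then have L: "n <= 2^L" unfolding L_def by (rule LeastI)
 have "2^L < 2*n"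
 proof (cases L)
  case 0
  then show ?thesis using assms by simp
 next
  case (Suc l)
  then have "\<not> n <= 2^l" using not_less_Least[of l "%L. n <= 2^L"] unfolding L_def by simp
  then show ?thesis using Suc by simp
 qed
 then show ?thesis using L by blast
qed

lemma ex_radius:
 assumes "0 < (n::nat)"
 shows "\<exists>e. (2^e)^3 <= n & n < 8*(2^e)^3"
proof -
 define e where "e = (LEAST e. n < 8*(2^e)^3)"
 have "n < 8*(2^n)^3"
 proof -
  have "(2::nat)^n*1 <= 2^n*(2^n*2^n)" by (intro mult_le_mono) simp_all
  then have "(2::nat)^n <= (2^n)^3" by (simp only: power3_eq_cube mult.assoc mult_1_right)
  then show ?thesis using less_exp[of n] by linarith
 qed
 then have e: "n < 8*(2^e)^3" unfolding e_def by (rule LeastI)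
 have "(2^e)^3 <= n"
 proof (cases e)
  case 0
  then show ?thesis using assms by simp
 next
  case (Suc l)
  then have "\<not> n < 8*(2^l)^3" using not_less_Least[of l "%e. n < 8*(2^e)^3"] unfolding e_def by simp
  then show ?thesis using Suc by (simp add: power_mult_distrib)
 qed
 then show ?thesis using e by blast
qed

definition log_of :: "nat => nat" where "log_of n = (SOME L. n <= 2^L & 2^L < 2*n)"
definition rad_of :: "nat => nat" where "rad_of n = (SOME e. (2^e)^3 <= n & n < 8*(2^e)^3)"

lemma log_of: "0 < n ==> n <= 2^log_of n & 2^log_of n < 2*n"
 unfolding log_of_def by (rule someI_ex[OF ex_log])

lemma rad_of: "0 < n ==> (2^rad_of n)^3 <= n & n < 8*(2^rad_of n)^3"
 unfolding rad_of_def by (rule someI_ex[OF ex_radius])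

lemma cube_ge: "(2::nat)^e <= (2^e)^3"
proof -
 have "(2::nat)^e*1 <= 2^e*(2^e*2^e)" by (intro mult_le_mono) simp_all
 then show ?thesis by (simp only: power3_eq_cube mult.assoc mult_1_right)
qed

lemma rad_le_log: "0 < n ==> rad_of n <= log_of n"
proof -
 assume "0 < n"
 then have "(2::nat)^rad_of n <= 2^log_of n" using rad_of[of n] log_of[of n] cube_ge[of "rad_of n"] by linarith
 then show ?thesis by simp
qed

definition total_time :: "nat => nat => nat => nat => nat => nat" where
 "total_time n L e tA nu = 4*L+2*e+40+6*(2^e*(4*Suc L))+full.TT n L e tA nu"

context full
begin

text \<open>Every summand is at most a constant times \<open>LG * n^2 * nu\<close>. For the overhead
  of the \<open>KI\<close> copies, whose number is quadratic in the starting radius, this uses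
  \<open>(2^e0)^2 <= nu\<close>; \<open>C\<close> enters only through \<open>potmax\<close>, where
  whole runs of length \<open>tA\<close> are paid for.\<close>

lemma total_bound:
 assumes D: "2^e0*2^e0 <= nu" and t: "tA <= C*(n*n*nu)" and nu1: "1 <= nu"
 shows "total_time n L e0 tA nu <= (3000+65*C)*(LG*(n*n*nu))"
proof -
 define Z where "Z = LG*(n*n*nu)"
 define D where "D = (2::nat)^e0"
 have LG1: "1 <= LG" and n1: "1 <= n" and D1: "1 <= D" using n0 by (auto simp: LG_def D_def)
 have NNn: "NN <= 2*n" using NN_less by simp
 have Dn: "D <= n" using D0_n by (simp add: D_def)
 have e0L': "Suc e0 <= LG" using e0L by (simp add: LG_def)
 have m1: "a*b * c*d <= Z" if "a <= LG" "b <= n" "c <= n" "d <= nu" for a b c d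
  unfolding Z_def using that mult_le_mono[of a LG "b*(c*d)" "n*(n*nu)"] mult_le_mono[of b n "c*d" "n*nu"] mult_le_mono[of c n d nu]
  by (simp only: mult.assoc)
 have z1: "1 <= Z" using m1[of 1 1 1 1] LG1 n1 nu1 by simp
 have z2: "LG <= Z" using m1[of LG 1 1 1] n1 nu1 by simp
 have z3: "n <= Z" using m1[of 1 n 1 1] LG1 n1 nu1 by simp
 have z4: "LG*n <= Z" using m1[of LG n 1 1] n1 nu1 by simp
 have z5: "n*n <= Z" using m1[of 1 n n 1] LG1 nu1 by simp
 have z6: "LG*n*n <= Z" using m1[of LG n n 1] nu1 by simp
 have z7: "n*n*nu <= Z" using m1[of 1 n n nu] LG1 by simp
 have z8: "LG*n*n*nu <= Z" using m1[of LG n n nu] by simp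
 have z9: "LG*nu*n <= Z" using m1[of LG n 1 nu] n1 by (simp add: mult_ac)
 have z10: "LG*nu <= Z" using m1[of LG 1 1 nu] n1 by simp
 have nn: "n*NN <= 2*(n*n)" using mult_le_mono2[OF NNn, of n] by simp
 have KI: "KI <= 12*(LG*nu)"
 proof -
  have "2*D+1 <= 3*D" using D1 by simp
  then have "D*(4*LG)*(2*D+1) <= D*(4*LG)*(3*D)" by (rule mult_le_mono2)
  also have "\<dots> = 12*(LG*(D*D))" by simp
  also have "\<dots> <= 12*(LG*nu)" using assms(1) by (intro mult_le_mono2) (simp add: D_def)
  finally show ?thesis unfolding KI_eq D_def .
 qed
 have KIZ: "KI*(n*n) <= 12*Z" "KI*n <= 12*Z" "KI <= 12*Z"
 proof -
  have "KI*(n*n) <= 12*(LG*nu)*(n*n)" using KI by (rule mult_le_mono1)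
  also have "\<dots> = 12*(LG*n*n*nu)" by (simp add: mult_ac)
  finally show "KI*(n*n) <= 12*Z" using z8 by linarith
  have "KI*n <= 12*(LG*nu)*n" using KI by (rule mult_le_mono1)
  also have "\<dots> = 12*(LG*nu*n)" by (simp add: mult_ac)
  finally show "KI*n <= 12*Z" using z9 by linarith
  show "KI <= 12*Z" using KI z10 by linarith
 qed
 have nnL: "n*NN*LG <= 2*Z" "n*NN*LG*nu <= 2*Z" "n*NN*nu <= 2*Z" "n*NN <= 2*Z"
 proof -
  have "2*(n*n)*LG = 2*(LG*n*n)" by (simp add: mult_ac)
  then show "n*NN*LG <= 2*Z" using mult_le_mono1[OF nn, of LG] z6 by linarith
  have "2*(n*n)*(LG*nu) = 2*(LG*n*n*nu)" "n*NN*(LG*nu) = n*NN*LG*nu" by (simp_all add: mult_ac)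
  then show "n*NN*LG*nu <= 2*Z" using mult_le_mono1[OF nn, of "LG*nu"] z8 by linarith
  have "2*(n*n)*nu = 2*(n*n*nu)" by (simp add: mult_ac)
  then show "n*NN*nu <= 2*Z" using mult_le_mono1[OF nn, of nu] z7 by linarith
  show "n*NN <= 2*Z" using nn z5 by linarith
 qed
 have P0: "4*L+2*e0+40+6*(2^e0*(4*Suc L)) <= 100*Z"
 proof -
  have "L <= LG" "e0 <= LG" using e0L' by (auto simp: LG_def)
  moreover have "LG*D <= Z" using mult_le_mono2[OF Dn, of LG] z4 by linarith
  moreover have "2^e0*(4*Suc L) = 4*(LG*D)" unfolding D_def LG_def by (simp only: mult_ac)
  ultimately show ?thesis using z1 z2 by linarith
 qed
 have P1: "CP <= 900*Z"
 proof -
  have "n*NN*(14*LG+38) = 14*(n*NN*LG)+38*(n*NN)" by (simp add: algebra_simps)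
  moreover have "Suc e0*(n*NN*18+8) <= LG*(n*NN*18+8)" using e0L' by (rule mult_le_mono1)
  moreover have "LG*(n*NN*18+8) = 18*(n*NN*LG)+8*LG" by (simp add: algebra_simps)
  moreover have "KI*(4*n*n+32) = 4*(KI*(n*n))+32*KI" by (simp add: algebra_simps)
  ultimately show ?thesis unfolding CP_def using KIZ nnL z1 z2 z3 NNn by linarith
 qed
 have P2: "n*CQ <= 1400*Z"
 proof -
  have "n*CQ = 14*(n*NN*LG)+32*(n*NN)+13*(KI*(n*n))+30*(KI*n)+14*(n*NN*LG*nu)+16*(n*NN*nu) +
    88*(LG*n*n*nu)+97*(n*n)+10*(n*NN)+100*n"
   unfolding CQ_def by (simp add: algebra_simps)
  then show ?thesis using KIZ nnL z3 z5 z8 by linarith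
 qed
 have P3: "5*potmax <= 160*Z+65*C*Z"
 proof -
  have "NN*NN <= 2*n*(2*n)" using NNn by (intro mult_le_mono)
  then have "NN*NN*(LG*nu) <= 2*n*(2*n)*(LG*nu)" by (rule mult_le_mono1)
  moreover have "2*n*(2*n)*(LG*nu) = 4*(LG*n*n*nu)" by (simp add: mult_ac)
  moreover have "NN^2*LP*nu = 4*(NN*NN*(LG*nu))" unfolding LP_def power2_eq_square by (simp add: mult_ac)
  ultimately have a: "NN^2*LP*nu <= 16*Z" using z8 by linarith
  have "LG*tA <= LG*(C*(n*n*nu))" using t by (rule mult_le_mono2)
  then have b: "LG*tA <= C*Z" unfolding Z_def by (simp add: mult_ac)
  have "e0*tA <= LG*tA" using e0L' by (intro mult_le_mono1) simp
  moreover have "3*LP*tA = 12*(LG*tA)" unfolding LP_def by simp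
  ultimately have "potmax <= 32*Z+13*(C*Z)" unfolding potmax_def using a b by linarith
  then show ?thesis by simp
 qed
 have P4: "n*(7*LG+8)*nu*(3*NN) <= 90*Z"
 proof -
  have "n*(7*LG+8)*nu*(3*NN) = 21*(n*NN*LG*nu)+24*(n*NN*nu)" by (simp add: algebra_simps)
  then show ?thesis using nnL by linarith
 qed
 have "total_time n L e0 tA nu <= 3000*Z+65*C*Z" unfolding total_time_def TT_def using P0 P1 P2 P3 P4 by linarith
 then show ?thesis unfolding Z_def by (simp add: distrib_right)
qed

end

text \<open>Constants of the fixed algorithm are absorbed into an exponent; the base
  \<open>n + 2\<close> is at least 2 even for small \<open>n\<close>.\<close>

lemma pow_ge_const: "m <= b ==> m <= (n+2)^b" for m b n :: nat
proof -
 assume "m <= b"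
 then have "m < 2^b" using less_exp[of b] by linarith
 also have "\<dots> <= (n+2)^b" by (intro power_mono) auto
 finally show ?thesis by simp
qed

text \<open>The runs of the equality algorithm are chosen here for all columns and offsets, before
  any sample is mentioned. The exponent \<open>b\<close> covers the word bound
  \<open>(3 n + 2)^c <= (n + 2)^(2 c)\<close>, the step counter, at most
  \<open>8 (C + 1) (n + 2)^6\<close>, and the register numbers of the algorithm.\<close>

lemma reduction_full:
 fixes W :: int
 assumes A: "solves_equality A c t" and n: "0 < n" and inst: "bounded_monotone_instance n M vs"
  and t: "t n <= C*n^3" and b: "C+20+2 * c + cmax (prep A) + cmax (query A) <= b"
  and W: "(int n+2)^(16*b) <= W"
  and nu: "\<And>D. 0 < D ==> n < 8*D^3 \<or> (2^log_of n)^3 < 24*D^3*t n ==> 2^log_of n <= nu*D"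
 defines "L \<equiv> log_of n" and "e0 \<equiv> rad_of n" and "Mh \<equiv> %i k. M $$ (i, min k (n - 1))" and "vh \<equiv> %j k. vs ! j $ min k (n - 1)"
  and "B \<equiv> (int n+2)^b"
 shows "par W B n L & (\<exists>SC TC. \<forall>xs. length xs = 2^e0*(4*Suc L) --> set xs \<subseteq> {..<2^L} -->
   full W B n L e0 (t n) Mh vh (prep A) (query A) ((3*int n+2) ^ c) SC TC xs nu)"
proof -
 let ?N = "n+2"
 have Bn: "B = int (?N^b)" unfolding B_def by (simp add: add.commute)
 have powB: "int m <= B" if "m <= ?N^a" "a <= b" for m a
 proof -
  have "?N^a <= ?N^b" using that(2) by (intro power_increasing) auto
  then have "int m <= int (?N^b)" using that(1) by linarith
  then show ?thesis unfolding Bn .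
 qed
 have P: "par W B n L"
 proof
  show "2 <= B" using powB[of 2 1] b by simp
  show "B^16 <= W" using W unfolding B_def by (simp add: power_mult[symmetric] mult.commute)
  show "0 < n" by (rule n)
  show "n <= 2^L" "2^L < 2*n" using log_of[OF n] by (auto simp: L_def)
  have "1000*?N^4 <= ?N^10*?N^4"
  proof (rule mult_le_mono1)
   have "(2::nat)^10 <= ?N^10" by (intro power_mono) auto
   then show "1000 <= ?N^10" by simp
  qed
  then have "1000*?N^4 <= ?N^14" by (simp add: power_add[symmetric])
  then show "int (1000*(n+2)^4) <= B" by (rule powB) (use b in simp)
 qed
 interpret par W B n L by (rule P)
 have e0: "(2^e0)^3 <= n" "n < 8*(2^e0)^3" "e0 <= L" using rad_of[OF n] rad_le_log[OF n] by (auto simp: e0_def L_def)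
 have Dn: "2^e0 <= n" using e0(1) cube_ge[of e0] by linarith
 have om: "omv_instance n M vs" and Me: "\<And>i k. i < n ==> k < n ==> 1 <= M $$ (i, k) & M $$ (i, k) <= int n"
  and ve: "\<And>j k. j < n ==> k < n ==> 1 <= vs ! j $ k & vs ! j $ k <= int n"
  and mo: "rows_nondecreasing n M \<or> cols_nondecreasing n M \<or> queries_nondecreasing n vs \<or> queries_nondecreasing_in_time n vs"
  using inst unfolding bounded_monotone_instance_def by auto
 have mn: "min k (n - 1) < n" for k using n by simp
 have Mr: "1 <= Mh i k & Mh i k <= int n" if "i < n" for i k using Me[OF that mn] by (simp add: Mh_def)
 have vr: "1 <= vh j k & vh j k <= int n" if "j < n" for j k using ve[OF that mn] by (simp add: vh_def)
 \<comment> \<open>Differences of entries contribute less than \<open>n\<close> and offsets at most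
   \<open>2 n\<close>, so all numbers of these instances are at most \<open>3 n\<close> in absolute
   value.\<close>
 let ?WA = "(3*int n+2) ^ c"
 define EM where "EM cc = mat n n (%(i, k). Mh i k - Mh i cc)" for cc
 define EV where "EV cc d = map (%j. vec n (%k. vh j cc - vh j k - int d)) [0..<n]" for cc d
 \<comment> \<open>Pairs of column and offset are related to pairs of state and step sequences, so
   that one application of choice yields both \<open>SC\<close> and \<open>TC\<close>.\<close>
 define Rel where "Rel p q \<longleftrightarrow> (snd p <= 2*2^e0 -->
   bs ?WA (prep A) (init_state n (EM (fst p))) (fst q 0) (snd q 0) &
  (\<forall>j<n. bs ?WA (query A) (put_query n (EV (fst p) (snd p) ! j) (fst q j)) (fst q (Suc j)) (snd q (Suc j))) &
  (\<forall>j<n. \<forall>i<n. arrs (fst q (Suc j)) 2 i = (if \<exists>k<n. EM (fst p) $$ (i, k) = EV (fst p) (snd p) ! j $ k then 1 else 0)) &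
  (\<Sum>r\<le>n. snd q r) <= t n)" for p :: "nat \<times> nat" and q :: "(nat => state) \<times> (nat => nat)"
 have "\<exists>q. Rel p q" for p
 proof (cases "snd p <= 2*2^e0")
  case True
  have o: "omv_instance n (EM (fst p)) (EV (fst p) (snd p))" by (auto simp: omv_instance_def EM_def EV_def)
  have w: "word_bound c n (EM (fst p)) (EV (fst p) (snd p)) <= ?WA"
  proof (rule word_bound_le)
   fix i k assume "i < n" "k < n"
   then have "EM (fst p) $$ (i, k) = Mh i k - Mh i (fst p)" by (simp add: EM_def)
   then show "\<bar>EM (fst p) $$ (i, k)\<bar> <= 3*int n" using Mr[OF \<open>i < n\<close>, of k] Mr[OF \<open>i < n\<close>, of "fst p"] by linarith
  next
   fix j k assume jk: "j < length (EV (fst p) (snd p))" "k < n"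
   then have j: "j < n" by (simp add: EV_def)
   have "int (snd p) <= 2*int n" using True Dn by linarith
   moreover have "EV (fst p) (snd p) ! j $ k = vh j (fst p) - vh j k - int (snd p)" using j jk by (simp add: EV_def)
   ultimately show "\<bar>EV (fst p) (snd p) ! j $ k\<bar> <= 3*int n" using vr[OF j, of k] vr[OF j, of "fst p"] by linarith
  qed simp
  obtain st \<tau> where "bs ?WA (prep A) (init_state n (EM (fst p))) (st 0) (\<tau> 0) &
   (\<forall>j<n. bs ?WA (query A) (put_query n (EV (fst p) (snd p) ! j) (st j)) (st (Suc j)) (\<tau> (Suc j))) &
   (\<forall>j<n. \<forall>i<n. arrs (st (Suc j)) 2 i = (if \<exists>k<n. EM (fst p) $$ (i, k) = EV (fst p) (snd p) ! j $ k then 1 else 0)) & (\<Sum>r\<le>n. \<tau> r) <= t n"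
   using equality_trace[OF A n o w] by blast
  then have "Rel p (st, \<tau>)" unfolding Rel_def by simp
  then show ?thesis by blast
 next
  case False
  then show ?thesis unfolding Rel_def by blast
 qed
 then have "\<forall>p. \<exists>q. Rel p q" by blast
 then obtain F where F: "\<And>p. Rel p (F p)" using choice[of Rel] by blast
 define SC where "SC cc d = fst (F (cc, d))" for cc d
 define TC where "TC cc d = snd (F (cc, d))" for cc d
 have RR: "bs ?WA (prep A) (init_state n (EM cc)) (SC cc d 0) (TC cc d 0) &
  (\<forall>j<n. bs ?WA (query A) (put_query n (EV cc d ! j) (SC cc d j)) (SC cc d (Suc j)) (TC cc d (Suc j))) &
  (\<forall>j<n. \<forall>i<n. arrs (SC cc d (Suc j)) 2 i = (if \<exists>k<n. EM cc $$ (i, k) = EV cc d ! j $ k then 1 else 0)) &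
  (\<Sum>r\<le>n. TC cc d r) <= t n" if "d <= 2*2^e0" for cc d
  using F[of "(cc, d)", unfolded Rel_def fst_conv snd_conv, THEN mp, OF that] unfolding SC_def TC_def .
 note R = RR[THEN conjunct1] RR[THEN conjunct2, THEN conjunct1, rule_format] RR[THEN conjunct2, THEN conjunct2, THEN conjunct1, rule_format]
  RR[THEN conjunct2, THEN conjunct2, THEN conjunct2]
 have KB: "int (2^e0*(4*LG)*(2*2^e0+1)*Suc (t n)) <= B"
 proof (rule powB)
  have l: "4*LG <= 4*?N" using L_le by (simp add: LG_def)
  have d: "2*2^e0+1 <= 2*?N" using Dn by simp
  have tt: "Suc (t n) <= (C+1)*?N^3"
  proof -
   have "n^3 <= ?N^3" "1 <= ?N^3" by (auto intro: power_mono)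
   then have "C*n^3 <= C*?N^3" by simp
   moreover have "(C+1)*?N^3 = C*?N^3+?N^3" by (simp only: add_mult_distrib mult_1)
   ultimately show ?thesis using t \<open>1 <= ?N ^ 3\<close> by linarith
  qed
  have "2^e0*(4*LG)*(2*2^e0+1)*Suc (t n) <= ?N*(4*?N)*(2*?N)*((C+1)*?N^3)"
   using Dn by (intro mult_le_mono l d tt) simp
  also have "\<dots> = 8*(C+1)*?N^6"
  proof -
   have "x*(4*x)*(2*x)*(y*x^3) = 8*y*x^6" for x y :: nat
    using power_add[of x 3 3] by (simp add: power3_eq_cube mult_ac)
   then show ?thesis .
  qed
  also have "\<dots> <= ?N^3*?N^(C+1)*?N^6"
  proof (intro mult_le_mono1 mult_le_mono)
   have "(2::nat)^3 <= ?N^3" by (intro power_mono) auto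
   then show "8 <= ?N^3" by simp
   show "C+1 <= ?N^(C+1)" by (rule pow_ge_const) simp
  qed
  also have "\<dots> = ?N^(C+10)" by (simp only: power_add[symmetric]) (simp add: add.commute)
  finally show "2^e0*(4*LG)*(2*2^e0+1)*Suc (t n) <= ?N^(C+10)" .
 qed (use b in simp)
 have WAB: "?WA <= B"
 proof -
  have "3*n+2 <= ?N^2" by (simp add: power2_eq_square algebra_simps)
  then have "(3*n+2) ^ c <= (?N^2) ^ c" by (intro power_mono) auto
  then have "(3*n+2) ^ c <= ?N^(2 * c)" by (simp add: power_mult)
  then have "int ((3*n+2) ^ c) <= B" by (rule powB) (use b in simp)
  then show ?thesis by (simp add: add.commute)
 qed
 have cB: "int (cmax (prep A)) <= B" "int (cmax (query A)) <= B"
  using powB[OF pow_ge_const[OF order_refl], of "cmax (prep A)"] powB[OF pow_ge_const[OF order_refl], of "cmax (query A)"] b by simp_all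
 have ful: "full W B n L e0 (t n) Mh vh (prep A) (query A) ?WA SC TC xs nu"
  if xs: "length xs = 2^e0*(4*Suc L)" "set xs \<subseteq> {..<2^L}" for xs
 proof -
  interpret red W B n L e0 "t n" Mh vh "prep A" "query A" ?WA SC TC xs
  proof
   fix cc d :: nat assume d: "d <= 2*2^e0"
   show "bs ?WA (prep A) (init_state n (mat n n (%(i, k). Mh i k - Mh i cc))) (SC cc d 0) (TC cc d 0)"
    using R(1)[OF d] by (simp add: EM_def)
   show "(\<Sum>r\<le>n. TC cc d r) <= t n" by (rule R(4)[OF d])
   fix j assume j: "j < n"
   show "bs ?WA (query A) (put_query n (vec n (%k. vh j cc - vh j k - int d)) (SC cc d j)) (SC cc d (Suc j)) (TC cc d (Suc j))"
    using R(2)[OF d j] j by (simp add: EV_def)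
   fix i assume i: "i < n"
   have "(\<exists>k<n. EM cc $$ (i, k) = EV cc d ! j $ k) \<longleftrightarrow> (\<exists>k<n. Mh i k - Mh i cc = vh j cc - vh j k - int d)"
    using i j by (auto simp: EM_def EV_def)
   then show "arrs (SC cc d (Suc j)) 2 i = (if \<exists>k<n. Mh i k - Mh i cc = vh j cc - vh j k - int d then 1 else 0)"
    using R(3)[OF d j i] by simp
  next
   show "deterministic (prep A)" "deterministic (query A)" using A by (auto simp: solves_equality_def)
   show "Mh i k = Mh i (min k (n - 1))" "vh i k = vh i (min k (n - 1))" for i k by (simp_all add: Mh_def vh_def)
  qed (use e0 KB WAB cB Mr vr xs in \<open>auto simp: NN_def LG_def\<close>)
  show ?thesis
  proof
   fix e assume "Dok (2^e)"
   then show "NN <= nu*2^e" using nu[of "2^e", folded L_def] unfolding Dok_def NN_def by simp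
  next
   have le: "min k (n - 1) = min (k+1) (n - 1) \<or> min k (n - 1)+1 < n & min (k+1) (n - 1) = min k (n - 1)+1" for k using n by auto
   \<comment> \<open>Repeating the last column preserves monotonicity: from \<open>n - 1\<close> on,
     both sides are equal.\<close>
   have step: "f (min k (n - 1)) <= f (min (k+1) (n - 1))" if f: "\<forall>k. k+1 < n --> f k <= f (k+1)" for f :: "nat => int" and k
   proof (cases "min (k+1) (n - 1) = min k (n - 1)")
    case True
    show ?thesis unfolding True by simp
   next
    case False
    then have a: "min k (n - 1)+1 < n" "min (k+1) (n - 1) = min k (n - 1)+1" using le[of k] by auto
    show ?thesis unfolding a(2) using f a(1) by blast
   qed
   from mo show "rowsM \<or> colsM \<or> (\<forall>j<n. vmono j) \<or> timeM"
   proof (elim disjE)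
    assume r: "rows_nondecreasing n M"
    have rowsM unfolding rowsM_def
    proof (intro allI impI)
     fix i k assume "i < n"
     then have "\<forall>k. k+1 < n --> M $$ (i, k) <= M $$ (i, k+1)" using r unfolding rows_nondecreasing_def by blast
     then show "Mh i k <= Mh i (k+1)" unfolding Mh_def by (rule step)
    qed
    then show ?thesis by blast
   next
    assume r: "cols_nondecreasing n M"
    have colsM unfolding colsM_def
    proof (intro allI impI)
     fix i k assume "i+1 < n"
     then show "Mh i k <= Mh (i+1) k" using r[unfolded cols_nondecreasing_def, rule_format, OF mn[of k], of i] by (simp add: Mh_def)
    qed
    then show ?thesis by blast
   next
    assume r: "queries_nondecreasing n vs"
    have "vmono j" if "j < n" for j unfolding vmono_def
    proof (intro allI impI)
     fix k
     have "\<forall>k. k+1 < n --> vs ! j $ k <= vs ! j $ (k+1)" using r that unfolding queries_nondecreasing_def by blast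
     then show "vh j k <= vh j (k+1)" unfolding vh_def by (rule step)
    qed
    then show ?thesis by blast
   next
    assume r: "queries_nondecreasing_in_time n vs"
    have timeM unfolding timeM_def
    proof (intro allI impI)
     fix j k assume "j+1 < n"
     then show "vh j k <= vh (j+1) k" using r[unfolded queries_nondecreasing_in_time_def, rule_format, OF mn[of k], of j] by (simp add: vh_def)
    qed
    then show ?thesis by blast
   qed
  qed
 qed
 show ?thesis using P ful by blast
qed

lemma reduction_correct:
 assumes A: "solves_equality A c t" and n: "0 < n" and inst: "bounded_monotone_instance n M vs"
  and t: "t n <= C*n^3" and b: "C+20+2 * c + cmax (prep A) + cmax (query A) <= b"
  and nu: "\<And>D. 0 < D ==> n < 8*D^3 \<or> (2^log_of n)^3 < 24*D^3*t n ==> 2^log_of n <= nu*D"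
 defines "D \<equiv> run_online (word_bound (16*b) n M vs) (reduction (prep A) (query A)) n (total_time n (log_of n) (rad_of n) (t n) nu) M vs"
 shows "None \<notin> set_pmf D & 1 - 1 / real n <= measure_pmf.prob D {Some (map (answer bounded_monotone_min_plus_OMv n M) vs)}"
proof -
 let ?W = "word_bound (16*b) n M vs" and ?L = "log_of n" and ?e = "rad_of n" and ?B = "(int n+2)^b"
 define Mh where "Mh = (%i k. M $$ (i, min k (n - 1)))"
 define vh where "vh = (%j k. vs ! j $ min k (n - 1))"
 note RF = reduction_full[OF A n inst t b word_bound_ge[of n "16*b" M vs] nu, folded Mh_def vh_def]
 interpret par ?W ?B n ?L using RF by blast
 obtain SC TC where F: "\<And>xs. length xs = 2^?e*(4*LG) ==> set xs \<subseteq> {..<NN} ==>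
   full ?W ?B n ?L ?e (t n) Mh vh (prep A) (query A) ((3*int n+2) ^ c) SC TC xs nu"
  using RF unfolding NN_def LG_def by blast
 have lv: "length vs = n" using inst by (simp add: bounded_monotone_instance_def omv_instance_def)
 define P where "P = replicate_pmf (2^?e*(4*LG)) (pmf_of_set {0..<int NN})"
 let ?corr = "map (%j. vec n (%i. Min ((%k. Mh i k + vh j k) ` {..<NN}))) [0..<n]"
 have "\<exists>ans. D = map_pmf (%ys. Some (ans ys)) P & (\<forall>ys\<in>set_pmf P. red.good n ?L ?e Mh vh (map nat ys) --> ans ys = ?corr)"
  unfolding D_def P_def
  by (rule reduction_run[OF F]) (use lv in \<open>auto simp: Mh_def vh_def min_absorb1 total_time_def LG_def\<close>)
 then obtain ans where D: "D = map_pmf (%ys. Some (ans ys)) P"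
  and ans: "\<And>ys. ys \<in> set_pmf P ==> red.good n ?L ?e Mh vh (map nat ys) ==> ans ys = ?corr" by blast
 \<comment> \<open>\<open>good\<close> as a predicate on arbitrary lists, in the form that
   \<open>good_prob\<close> expects.\<close>
 define gd where "gd xs \<longleftrightarrow> (\<forall>j<n. \<forall>i<n. \<forall>e\<le>?e. NN div 2^e < card {k. k < NN & (Mh i k + vh j k) <= Min ((%k. Mh i k + vh j k) ` {..<NN})+2*2^e} -->
   (\<exists>a<2^e*(4*LG). Mh i (xs ! a) + vh j (xs ! a) <= Min ((%k. Mh i k + vh j k) ` {..<NN})+2*2^e))" for xs
 have corr: "?corr = map (answer bounded_monotone_min_plus_OMv n M) vs"
 proof (rule nth_equalityI)
  fix j assume "j < length ?corr"
  then have j: "j < n" by simp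
  have "(%k. Mh i k + vh j k) ` {..<NN} = {M $$ (i, k) + vs ! j $ k | k. k < n}" for i
  proof
   show "(%k. Mh i k + vh j k) ` {..<NN} \<subseteq> {M $$ (i, k) + vs ! j $ k | k. k < n}"
   proof
    fix x assume "x \<in> (%k. Mh i k + vh j k) ` {..<NN}"
    then obtain k where "x = M $$ (i, min k (n - 1)) + vs ! j $ min k (n - 1)" by (auto simp: Mh_def vh_def)
    moreover have "min k (n - 1) < n" using n by simp
    ultimately show "x \<in> {M $$ (i, k) + vs ! j $ k | k. k < n}" by blast
   qed
   show "{M $$ (i, k) + vs ! j $ k | k. k < n} \<subseteq> (%k. Mh i k + vh j k) ` {..<NN}"
   proof
    fix x assume "x \<in> {M $$ (i, k) + vs ! j $ k | k. k < n}"
    then obtain k where k: "k < n" "x = M $$ (i, k) + vs ! j $ k" by blast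
    then have "x = Mh i k + vh j k" "k < NN" using n_le_NN by (auto simp: Mh_def vh_def min_absorb1)
    then show "x \<in> (%k. Mh i k + vh j k) ` {..<NN}" by blast
   qed
  qed
  then show "?corr ! j = map (answer bounded_monotone_min_plus_OMv n M) vs ! j"
   using j lv by (simp add: bounded_monotone_min_plus_OMv_def)
 qed (simp add: lv)
 have sub: "{ys. gd (map nat ys)} \<inter> set_pmf P \<subseteq> (%ys. Some (ans ys)) -` {Some (map (answer bounded_monotone_min_plus_OMv n M) vs)}"
 proof
  fix ys assume "ys \<in> {ys. gd (map nat ys)} \<inter> set_pmf P"
  then have g: "gd (map nat ys)" and ys: "ys \<in> set_pmf P" by auto
  have "set_pmf (pmf_of_set {0..<int NN}) = {0..<int NN}" using NN0 by (intro set_pmf_of_set) auto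
  then have y: "length ys = 2^?e*(4*LG)" "set ys \<subseteq> {0..<int NN}" using ys unfolding P_def set_replicate_pmf by auto
  have "set (map nat ys) \<subseteq> {..<NN}" using y(2) by (auto simp: subset_iff nat_less_iff)
  then interpret F1: full ?W ?B n ?L ?e "t n" Mh vh "prep A" "query A" "(3*int n+2) ^ c" SC TC "map nat ys" nu
   by (intro F) (use y(1) in simp_all)
  have "F1.good" using g unfolding F1.good_def gd_def F1.LP_def .
  then show "ys \<in> (%ys. Some (ans ys)) -` {Some (map (answer bounded_monotone_min_plus_OMv n M) vs)}"
   using ans[OF ys] corr by simp
 qed
 have "1 - 1 / real n <= measure_pmf.prob P {ys. gd (map nat ys)}"
  unfolding P_def by (rule good_prob[OF rad_le_log[OF n]]) (simp only: gd_def)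
 also have "\<dots> = measure_pmf.prob P ({ys. gd (map nat ys)} \<inter> set_pmf P)" by (simp add: measure_Int_set_pmf)
 also have "\<dots> <= measure_pmf.prob P ((%ys. Some (ans ys)) -` {Some (map (answer bounded_monotone_min_plus_OMv n M) vs)})"
  using sub by (intro measure_pmf.finite_measure_mono) auto
 also have "\<dots> = measure_pmf.prob D {Some (map (answer bounded_monotone_min_plus_OMv n M) vs)}" unfolding D by simp
 finally show ?thesis unfolding D by auto
qed

text \<open>\<open>total_time\<close> depends on the parameters alone, but its bound is proved
  inside \<open>full\<close>, which needs an instance. The all-ones matrix and queries provide one
  for every \<open>n\<close>.\<close>

lemma reduction_time:
 assumes A: "solves_equality A c t" and n: "0 < n" and t: "t n <= C*n^3"
  and nu: "\<And>D. 0 < D ==> n < 8*D^3 \<or> (2^log_of n)^3 < 24*D^3*t n ==> 2^log_of n <= nu*D"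
  and D: "2^rad_of n*2^rad_of n <= nu" and tA: "t n <= C*(n*n*nu)" and nu1: "1 <= nu"
 shows "total_time n (log_of n) (rad_of n) (t n) nu <= (3000+65*C)*(Suc (log_of n)*(n*n*nu))"
proof -
 let ?M = "mat n n (%_. 1 :: int)" and ?vs = "replicate n (vec n (%_. 1 :: int))"
 define b where "b = C+20+2 * c + cmax (prep A) + cmax (query A)"
 have i: "bounded_monotone_instance n ?M ?vs"
  using n by (auto simp: bounded_monotone_instance_def omv_instance_def rows_nondecreasing_def)
 let ?W = "word_bound (16*b) n ?M ?vs" and ?B = "(int n+2)^b"
 have bb: "C+20+2 * c + cmax (prep A) + cmax (query A) <= b" by (simp add: b_def)
 note RF = reduction_full[OF A n i t bb word_bound_ge[of n "16*b" ?M ?vs] nu]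
 define Mh where "Mh = (%i k. ?M $$ (i, min k (n - 1)))"
 define vh where "vh = (%j k. ?vs ! j $ min k (n - 1))"
 define xs where "xs = replicate (2^rad_of n*(4*Suc (log_of n))) (0::nat)"
 have "length xs = 2^rad_of n*(4*Suc (log_of n))" "set xs \<subseteq> {..<2^log_of n}" by (auto simp: xs_def)
 then obtain SC TC where F: "full ?W ?B n (log_of n) (rad_of n) (t n) Mh vh (prep A) (query A) ((3*int n+2) ^ c) SC TC xs nu"
  using RF unfolding Mh_def vh_def by blast
 interpret full ?W ?B n "log_of n" "rad_of n" "t n" Mh vh "prep A" "query A" "(3*int n+2) ^ c" SC TC xs nu by (rule F)
 show ?thesis using total_bound[OF D tA nu1] unfolding LG_def .
qed

section \<open>The cutoff \<open>n^(1 - \<epsilon>/3)\<close> and the final estimate\<close>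

lemma bigo_everywhere:
 assumes "(%n. real (t n)) \<in> O(%n. real n powr a)" and a: "0 <= a"
 shows "\<exists>C\<ge>1. \<forall>n>0. real (t n) <= C*real n powr a"
proof -
 obtain c where "eventually (%n. norm (real (t n)) <= c*norm (real n powr a)) sequentially" using landau_o.bigE[OF assms(1)] by blast
 then obtain n0 where n0: "\<And>n. n0 <= n ==> real (t n) <= c*real n powr a" unfolding eventually_sequentially by auto
 \<comment> \<open>The finitely many exceptional values are bounded by their sum, and
   \<open>n powr a >= 1\<close>. A bound for all \<open>n > 0\<close> is wanted because the counters
   of the simulation must fit into words for every \<open>n\<close>.\<close>
 define C where "C = max 1 (max c (real (\<Sum>n<n0. t n)))"
 have "real (t n) <= C*real n powr a" if n: "0 < n" for n
 proof (cases "n0 <= n")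
  case True
  have "c*real n powr a <= C*real n powr a" unfolding C_def by (intro mult_right_mono) auto
  then show ?thesis using n0[OF True] by linarith
 next
  case False
  then have "t n <= (\<Sum>n<n0. t n)" by (intro member_le_sum) auto
  then have "real (t n) <= C" unfolding C_def by linarith
  moreover have "C*1 <= C*real n powr a" using n a by (intro mult_left_mono ge_one_powr_ge_zero) (auto simp: C_def)
  ultimately show ?thesis by linarith
 qed
 moreover have "1 <= C" by (simp add: C_def)
 ultimately show ?thesis by blast
qed

lemma cube_root_cube: "0 < y ==> (y^3) powr (1 / 3) = (y::real)"
proof -
 assume y: "0 < y"
 then have "y^3 = y powr 3" using powr_realpow[OF y, of 3] by simp
 then have "(y^3) powr (1 / 3) = y powr (3*(1 / 3))" by (simp only: powr_powr)
 then show ?thesis using y by simp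
qed

text \<open>The value used for \<open>nu\<close>, of order \<open>n^(1 - \<epsilon>/3)\<close>, that
  is, \<open>n / D\<close> at the balanced radius. The constant 4 serves the first alternative of
  \<open>Dok\<close>, the summand \<open>24 * C\<close> the second.\<close>

definition cutoff :: "real => real => nat => nat" where
 "cutoff C \<epsilon> n = nat \<lceil>(4+24*C)*real n powr (1 - \<epsilon> / 3)\<rceil>"

context
 fixes C \<epsilon> :: real and n tn :: nat
 assumes C: "1 <= C" and eps: "0 < \<epsilon>" "\<epsilon> <= 1" and n: "0 < n" and tn: "real tn <= C*real n powr (3 - \<epsilon>)"
begin

private definition "x = real n powr (1 - \<epsilon> / 3)"

private lemma x1: "1 <= x"
 unfolding x_def using n eps by (intro ge_one_powr_ge_zero) auto

lemma cutoff_ge: "(4+24*C)*x <= real (cutoff C \<epsilon> n)"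
 unfolding cutoff_def x_def by (rule of_nat_ceiling)

lemma cutoff_le: "real (cutoff C \<epsilon> n) <= (5+24*C)*x"
proof -
 have "0 <= (4+24*C)*x" using C x1 by simp
 then have "real (cutoff C \<epsilon> n) <= (4+24*C)*x+1" unfolding cutoff_def x_def by linarith
 then show ?thesis using x1 by (simp add: algebra_simps)
qed

lemma cutoff_ge_x: "x <= real (cutoff C \<epsilon> n)"
proof -
 have "1*x <= (4+24*C)*x" using C x1 by (intro mult_right_mono) auto
 then show ?thesis using cutoff_ge by simp
qed

lemma cutoff_ge_1: "1 <= cutoff C \<epsilon> n"
 using cutoff_ge_x x1 by linarith

lemma third: "real n powr (1 / 3)*real n powr (2 / 3) = real n" "real n powr (2 / 3) <= x"
 using n eps unfolding x_def by (auto simp: powr_add[symmetric] intro!: powr_mono)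

lemma x_cube: "x^3 = real n powr (3 - \<epsilon>)"
proof -
 have "x^3 = x powr real 3" using x1 by (intro powr_realpow[symmetric]) simp
 then have "x^3 = real n powr ((1 - \<epsilon> / 3)*3)" unfolding x_def powr_powr by simp
 then show ?thesis by (simp add: algebra_simps)
qed

lemma x_square: "real n^2*x = real n powr (3 - \<epsilon> / 3)"
proof -
 have "real n^2 = real n powr 2" using n by (simp add: powr_numeral)
 then have "real n^2*x = real n powr 2*real n powr (1 - \<epsilon> / 3)" by (simp only: x_def)
 also have "\<dots> = real n powr (2+(1 - \<epsilon> / 3))" by (rule powr_add[symmetric])
 finally show ?thesis by simp
qed

lemma cube_root_le: "real n <= y^3 ==> 0 < y ==> real n powr (1 / 3) <= y"
proof -
 assume a: "real n <= y^3" "0 < y"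
 have "real n powr (1 / 3) <= (y^3) powr (1 / 3)" using a(1) by (intro powr_mono2) auto
 also have "\<dots> = y" using a(2) by (rule cube_root_cube)
 finally show ?thesis .
qed

lemma cube_root_ge: "y^3 <= real n ==> 0 < y ==> y <= real n powr (1 / 3)"
proof -
 assume a: "y^3 <= real n" "0 < y"
 have "y = (y^3) powr (1 / 3)" using a(2) by (rule cube_root_cube[symmetric])
 also have "\<dots> <= real n powr (1 / 3)" using a by (intro powr_mono2) auto
 finally show ?thesis .
qed

text \<open>In the first case \<open>n^(1/3) <= 2 D\<close> and \<open>n^(2/3) <= x\<close>, by
  \<open>\<epsilon> <= 1\<close>, give \<open>2^log_of n < 2 n <= 4 D x\<close>. In the second
  \<open>tn <= C * x^3\<close>, so \<open>2^log_of n\<close> is below \<open>D x\<close> times the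
  cube root of \<open>24 C\<close>.\<close>

lemma cutoff_ok:
 assumes D: "0 < D" and d: "n < 8*D^3 \<or> (2^log_of n)^3 < 24*D^3*tn"
 shows "2^log_of n <= cutoff C \<epsilon> n*D"
proof -
 let ?N = "real (2^log_of n)" and ?D = "real D"
 have D0: "0 < ?D" using D by simp
 have "?N <= (4+24*C)*x*?D"
  using d
 proof
  assume "n < 8*D^3"
  then have "real n <= real (8*D^3)" by linarith
  then have "real n <= (2*?D)^3" by (simp add: power_mult_distrib)
  then have "real n powr (1 / 3) <= 2*?D" by (rule cube_root_le) (use D0 in simp)
  then have "real n powr (1 / 3)*real n powr (2 / 3) <= 2*?D*x" using third(2) D0 by (intro mult_mono) auto
  then have nD: "real n <= 2*?D*x" unfolding third(1) .
  have "real (2^log_of n) <= real (2*n)" using less_imp_le[OF conjunct2[OF log_of[OF n]]] by (simp only: of_nat_le_iff)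
  moreover have "2*(2*?D*x) = 4*(x*?D)" "real (2*n) = 2*real n" by simp_all
  ultimately have "?N <= 4*(x*?D)" using nD by linarith
  also have "\<dots> <= (4+24*C)*(x*?D)" using C x1 D0 by (intro mult_right_mono) auto
  finally show ?thesis by (simp only: mult.assoc)
 next
  assume a: "(2^log_of n)^3 < 24*D^3*tn"
  show ?thesis
  proof (rule ccontr)
   assume "\<not> ?thesis"
   then have "((4+24*C)*x*?D)^3 <= ?N^3" using C x1 D0 by (intro power_mono) auto
   also have "\<dots> = real ((2^log_of n)^3)" by simp
   also have "\<dots> < real (24*D^3*tn)" using a by (simp only: of_nat_less_iff)
   also have "\<dots> = 24*?D^3*real tn" by simp
   also have "\<dots> <= 24*?D^3*(C*x^3)" unfolding x_cube using tn by (intro mult_left_mono) auto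
   finally have "(4+24*C)^3*(x^3*?D^3) < 24*C*(x^3*?D^3)" by (simp add: power_mult_distrib mult_ac)
   then have "(4+24*C)^3 < 24*C" using x1 D0 by (subst (asm) mult_less_cancel_right_pos) auto
   moreover have "(4+24*C)^1 <= (4+24*C)^3" using C by (intro power_increasing) auto
   ultimately show False by simp
  qed
 qed
 also have "\<dots> <= real (cutoff C \<epsilon> n)*?D" using cutoff_ge D0 by (intro mult_right_mono) auto
 finally have "real (2^log_of n) <= real (cutoff C \<epsilon> n*D)" by simp
 then show ?thesis by (simp only: of_nat_le_iff)
qed

text \<open>Here \<open>\<epsilon> <= 1\<close> is essential: the square of the starting radius is
  at most \<open>n^(2/3)\<close>, which has to stay below
  \<open>n^(1 - \<epsilon>/3)\<close>.\<close>

lemma cutoff_radius: "2^rad_of n*2^rad_of n <= cutoff C \<epsilon> n"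
proof -
 let ?D = "real (2^rad_of n)"
 have "real ((2^rad_of n)^3) <= real n" using rad_of[OF n] by (simp only: of_nat_le_iff)
 then have "?D <= real n powr (1 / 3)" by (intro cube_root_ge) auto
 then have "?D*?D <= real n powr (1 / 3)*real n powr (1 / 3)" by (intro mult_mono) auto
 also have "\<dots> = real n powr (2 / 3)" by (simp add: powr_add[symmetric])
 also have "\<dots> <= real (cutoff C \<epsilon> n)" using third(2) cutoff_ge_x by linarith
 finally have "real (2^rad_of n*2^rad_of n) <= real (cutoff C \<epsilon> n)" by simp
 then show ?thesis by (simp only: of_nat_le_iff)
qed

lemma tn_le_cutoff: "tn <= nat \<lceil>C\<rceil> * (n*n * cutoff C \<epsilon> n)"
proof -
 have "real n powr (3 - \<epsilon>) <= real n powr (3 - \<epsilon> / 3)" using n eps by (intro powr_mono) auto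
 also have "\<dots> = real n^2*x" by (rule x_square[symmetric])
 also have "\<dots> <= real n^2*real (cutoff C \<epsilon> n)" using cutoff_ge_x by (intro mult_left_mono) auto
 finally have "C*real n powr (3 - \<epsilon>) <= real (nat \<lceil>C\<rceil>)*(real n^2*real (cutoff C \<epsilon> n))"
  using C by (intro mult_mono) (linarith | simp)+
 then have "real tn <= real (nat \<lceil>C\<rceil> * (n*n * cutoff C \<epsilon> n))" using tn by (simp add: power2_eq_square)
 then show ?thesis by (simp only: of_nat_le_iff)
qed

lemma tn_cubic: "tn <= nat \<lceil>C\<rceil> * n^3"
proof -
 have "real n powr (3 - \<epsilon>) <= real n powr 3" using n eps by (intro powr_mono) auto
 also have "\<dots> = real n^3" using n by (simp add: powr_numeral)
 finally have "C*real n powr (3 - \<epsilon>) <= real (nat \<lceil>C\<rceil>)*real n^3" using C by (intro mult_mono) (linarith | simp)+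
 then have "real tn <= real (nat \<lceil>C\<rceil> * n^3)" using tn by simp
 then show ?thesis by (simp only: of_nat_le_iff)
qed

text \<open>For \<open>n >= 3\<close> the natural logarithm is at least 1 and absorbs the additive
  constants; \<open>ln 2 >= 2/3\<close> handles the change of base.\<close>

lemma log_of_le: "3 <= n ==> real (Suc (log_of n)) <= 4*ln (real n)"
proof -
 assume n3: "3 <= n"
 have "exp 1 <= (3::real)" by (rule exp_le)
 then have "exp 1 <= real n" using n3 by linarith
 then have l1: "1 <= ln (real n)" using n by (simp add: ln_ge_iff)
 have "real (2^log_of n) <= real (2*n)" using less_imp_le[OF conjunct2[OF log_of[OF n]]] by (simp only: of_nat_le_iff)
 then have "ln (2^log_of n) <= ln (2*real n)" using n by (subst ln_le_cancel_iff) auto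
 then have "real (log_of n)*ln 2 <= ln 2+ln (real n)" using n by (simp add: ln_realpow ln_mult)
 moreover have "2 / 3 <= ln (2::real)" by (rule ln2_ge_two_thirds)
 ultimately have "(real (log_of n) - 1)*ln 2 <= ln (real n)" by (simp add: algebra_simps)
 moreover have "(real (log_of n) - 1)*(2 / 3) <= (real (log_of n) - 1)*ln 2" if "1 <= log_of n"
  by (rule mult_left_mono[OF \<open>2 / 3 <= ln 2\<close>]) (use that in simp)
 ultimately show ?thesis using l1 by (cases "1 <= log_of n") auto
qed

lemma time_bound:
 assumes n3: "3 <= n" and le: "T <= K*(Suc (log_of n)*(n*n * cutoff C \<epsilon> n))"
 shows "real T <= real K*(20+96*C)*(real n powr (3 - \<epsilon> / 3)*ln (real n))"
proof -
 have "real (n*n * cutoff C \<epsilon> n) <= real n^2*((5+24*C)*x)" using cutoff_le by (simp add: power2_eq_square mult_left_mono)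
 also have "\<dots> = (5+24*C)*real n powr (3 - \<epsilon> / 3)" unfolding x_square[symmetric] by (simp add: mult_ac)
 finally have a: "real (n*n * cutoff C \<epsilon> n) <= (5+24*C)*real n powr (3 - \<epsilon> / 3)" .
 have "real T <= real K*(real (Suc (log_of n))*real (n*n * cutoff C \<epsilon> n))"
  unfolding of_nat_mult[symmetric] using le by (simp only: of_nat_le_iff)
 also have "\<dots> <= real K*(4*ln (real n)*((5+24*C)*real n powr (3 - \<epsilon> / 3)))"
  using a log_of_le[OF n3] n C by (intro mult_left_mono mult_mono) auto
 also have "\<dots> = real K*(20+96*C)*(real n powr (3 - \<epsilon> / 3)*ln (real n))" by (simp add: algebra_simps)
 finally show ?thesis .
qed

end

theorem theorem5p1:
  fixes \<epsilon> :: real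
  assumes "\<epsilon> > 0"
    and "solvable_in_time ex_equality_OMv (\<lambda>n. real n powr (3 - \<epsilon>))"
  shows "solvable_in_time_with_prob bounded_monotone_min_plus_OMv
           (\<lambda>n. real n powr (3 - \<epsilon> / 3) * ln (real n)) (\<lambda>n. 1 - 1 / real n)"
proof -
  obtain A c t where A: "solves_equality A c t" and tO: "(\<lambda>n. real (t n)) \<in> O(\<lambda>n. real n powr (3 - \<epsilon>))"
  proof -
    have I: "instances ex_equality_OMv = omv_instance"
      "answer ex_equality_OMv = (\<lambda>n M v. vec n (\<lambda>i. if \<exists>k<n. M $$ (i, k) = v $ k then 1 else 0))" by (simp_all add: ex_equality_OMv_def)
    show ?thesis using assms(2) unfolding solvable_in_time_def I
    proof (elim exE conjE)
      fix A c t
      assume a: "deterministic (prep A)" "deterministic (query A)" "(\<lambda>n. real (t n)) \<in> O(\<lambda>n. real n powr (3 - \<epsilon>))"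
        "\<forall>n>0. \<forall>M vs. omv_instance n M vs \<longrightarrow> run_online (word_bound c n M vs) A n (t n) M vs =
          return_pmf (Some (map ((\<lambda>n M v. vec n (\<lambda>i. if \<exists>k<n. M $$ (i, k) = v $ k then 1 else 0)) n M) vs))"
      show ?thesis by (rule that[of A c t, OF _ a(3)], unfold solves_equality_def) (intro conjI a)
    qed
  qed
  have e1: "\<epsilon> \<le> 1" by (rule exponent_le_1[OF A tO])
  obtain C where C: "1 \<le> C" and tC: "\<And>n. 0 < n \<Longrightarrow> real (t n) \<le> C*real n powr (3 - \<epsilon>)"
    using bigo_everywhere[OF tO] e1 by auto
  define nu where "nu = cutoff C \<epsilon>"
  \<comment> \<open>Depends on the equality algorithm alone, so words keep logarithmic length; the
    factor 16 used with it is the room for intermediate values of expressions.\<close>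
  define b where "b = nat \<lceil>C\<rceil> + 20+2 * c + cmax (prep A) + cmax (query A)"
  define T where "T n = total_time n (log_of n) (rad_of n) (t n) (nu n)" for n
  note ctx = C assms(1) e1
  have nu: "2^log_of n \<le> nu n*D" if "0 < n" "0 < D" "n < 8*D^3 \<or> (2^log_of n)^3 < 24*D^3*t n" for n D
    unfolding nu_def by (rule cutoff_ok[OF ctx that(1) tC[OF that(1)] that(2,3)])
  have t3: "t n \<le> nat \<lceil>C\<rceil> * n^3" if "0 < n" for n by (rule tn_cubic[OF ctx that tC[OF that]])
  have TO: "(\<lambda>n. real (T n)) \<in> O(\<lambda>n. real n powr (3 - \<epsilon> / 3)*ln (real n))"
  proof (rule bigoI, rule eventually_mono[OF eventually_ge_at_top[of 3]])
    fix n :: nat assume n3: "3 \<le> n"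
    then have n: "0 < n" by simp
    have "T n \<le> (3000+65*nat \<lceil>C\<rceil>)*(Suc (log_of n)*(n*n*nu n))"
      unfolding T_def
    proof (rule reduction_time[OF A n t3[OF n] nu[OF n]])
      show "2^rad_of n*2^rad_of n \<le> nu n" unfolding nu_def by (rule cutoff_radius[OF ctx n tC[OF n]])
      show "t n \<le> nat \<lceil>C\<rceil> * (n*n*nu n)" unfolding nu_def by (rule tn_le_cutoff[OF ctx n tC[OF n]])
      show "1 \<le> nu n" unfolding nu_def by (rule cutoff_ge_1[OF ctx n tC[OF n]])
    qed
    from time_bound[OF ctx n tC[OF n] n3 this[unfolded nu_def]]
    show "norm (real (T n)) \<le> real (3000+65*nat \<lceil>C\<rceil>)*(20+96*C)*norm (real n powr (3 - \<epsilon> / 3)*ln (real n))"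
      using n3 by simp
  qed
  have run: "let D = run_online (word_bound (16*b) n M vs) (reduction (prep A) (query A)) n (T n) M vs
      in None \<notin> set_pmf D \<and> 1 - 1 / real n \<le> measure_pmf.prob D {Some (map (answer bounded_monotone_min_plus_OMv n M) vs)}"
    if n: "0 < n" and i: "bounded_monotone_instance n M vs" for n M vs
    unfolding Let_def T_def by (rule reduction_correct[OF A n i t3[OF n] _ nu[OF n]]) (simp add: b_def)
  have I: "instances bounded_monotone_min_plus_OMv = bounded_monotone_instance" by (simp add: bounded_monotone_min_plus_OMv_def)
  show ?thesis unfolding solvable_in_time_with_prob_def I
    by (rule exI[of _ "reduction (prep A) (query A)"], rule exI[of _ "16*b"], rule exI[of _ T]) (intro conjI allI impI TO run)
qed

end
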